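(* Let $\mathbb{M}=\mathbb{T}$ or $\mathbb{M}=\mathbb{R}$. Let $\rho>1/2$ and $\gamma>1/2$, and let $w\in C([0,\infty);\mathbb{R})$ be $(\rho,\gamma)$-irregular on $[0,T]$ for every $T>0$. Let $\alpha\ge 0$ and $H^\alpha=H^\alpha(\mathbb{M})$. Then for every initial condition $\phi\in H^\alpha$ the modulated cubic NLS equation $$\varphi_t = U^w_t\phi + U^w_t\int_0^t (U^w_s)^{-1}\mathcal{N}(\varphi_s)\,ds,\qquad t\ge 0,\qquad \mathcal{N}(\varphi)=i|\varphi|^2\varphi ,$$ has a global solution in $H^\alpha$, which belongs to the subspace $\mathcal{D}^w(H^\alpha)\subset C([0,\infty);H^\alpha)$. Uniqueness holds in $\mathcal{D}^w(H^\alpha)$: two global solutions in $\mathcal{D}^w(H^\alpha)$ with the same initial condition coincide. Moreover the flow is locally Lipschitz continuous in $\mathcal{D}^w(H^\alpha)$: for every $T>0$ the map sending $\phi\in H^\alpha$ to the restriction to $[0,T]$ of the corresponding solution in $\mathcal{D}^w(H^\alpha)$ is locally Lipschitz from $H^\alpha$ to $\mathcal{D}^w_T(H^\alpha)$.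
   Context: $\mathbb{T}=[0,2\pi)$ with periodic boundary conditions. $H^\alpha$ is the Sobolev space of complex-valued functions (distributions) with norm $\|\phi\|_{H^\alpha}=\|\langle\xi\rangle^\alpha\hat\phi(\xi)\|_{L^2}$ (respectively $\ell^2(\mathbb{Z})$ in the periodic case), $\langle\xi\rangle=(1+|\xi|^2)^{1/2}$. Irregularity: for a continuous $w$, $\Phi^w_t(a)=\int_0^t e^{iaw_r}\,dr$ and $$\|\Phi^w\|_{\mathcal{W}^{\rho,\gamma}_T}=\sup_{a\in\mathbb{R}}\ \sup_{0\le s<t\le T}(1+|a|)^\rho\,\frac{|\Phi^w_t(a)-\Phi^w_s(a)|}{|t-s|^\gamma}.$$ $w$ is $(\rho,\gamma)$-irregular on $[0,T]$ if this quantity is finite. $U^w_t=e^{w_t\, i\partial_x^2}$, i.e. the Fourier multiplier by $e^{-iw_t\xi^2}$. Notion of solution: let $\Pi_N$ be the Fourier projector on modes $|\xi|\le N$ and $\mathcal{N}_N(\phi)=\Pi_N\mathcal{N}(\Pi_N\phi)$. For $\varphi\in C([0,T);H^\alpha)$, $T\in(0,+\infty]$, the symbol $\int_0^t(U^w_s)^{-1}\mathcal{N}(\varphi_s)\,ds$ denotes $\lim_{N\to\infty}\int_0^t(U^w_s)^{-1}\mathcal{N}_N(\varphi_s)\,ds$ whenever this limit exists in $C([0,T);H^\alpha)$ (uniformly on compact subintervals). $\varphi$ is a solution in $H^\alpha$ with initial condition $\phi$ if this limit exists and the displayed equation holds in $C([0,T);H^\alpha)$; it is global if $T=+\infty$.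 Controlled paths: for $T<\infty$, $\mathcal{D}^w_T(V)$ is the set of $\varphi\in C([0,T],V)$ such that $\varphi^w_t=(U^w_t)^{-1}\varphi_t$ belongs to $C^{1/2}([0,T],V)$ ($1/2$-Hölder functions), with norm $\sup_{t\le T}\|\varphi^w_t\|_V+\sup_{s<t\le T}\|\varphi^w_t-\varphi^w_s\|_V/|t-s|^{1/2}$. $\mathcal{D}^w(V)$ is the set of $\varphi\in C([0,\infty);V)$ whose restriction to $[0,T]$ is in $\mathcal{D}^w_T(V)$ for every $T>0$. *)

theory Defs
  imports "HOL-Analysis.Analysis"
begin

text \<open>
  Elements of \<open>L\<^sup>2\<close> and \<open>H\<^sup>\<alpha>\<close> are represented by functions \<open>real \<Rightarrow> complex\<close>; two functions that
  agree almost everywhere represent the same element. The torus is \<open>[0, 2\<pi>)\<close> with Lebesgue measure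
  (values outside this interval are irrelevant); its dual is \<open>\<int>\<close> with counting measure.
\<close>

datatype domain = Torus | Line

fun phys :: "domain \<Rightarrow> real measure" where
  "phys Torus = restrict_space lborel {0..<2 * pi}"
| "phys Line = lborel"

fun freq :: "domain \<Rightarrow> real measure" where
  "freq Torus = count_space \<int>"
| "freq Line = lborel"

definition L2 :: "real measure \<Rightarrow> (real \<Rightarrow> complex) set" where
  "L2 \<mu> = {f \<in> borel_measurable \<mu>. integrable \<mu> (\<lambda>x. (cmod (f x))\<^sup>2)}"

text \<open>
  Unitary normalisation. On the line the transform of \<open>f \<in> L\<^sup>2\<close> is the \<open>L\<^sup>2\<close>-limit of
  the truncated Fourier integrals (Plancherel); it is chosen up to null sets.
\<close>

fun fourier :: "domain \<Rightarrow> (real \<Rightarrow> complex) \<Rightarrow> real \<Rightarrow> complex" where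
  "fourier Torus f =
     (\<lambda>\<xi>. complex_of_real (1 / sqrt (2 * pi)) * (LINT x|phys Torus. f x * cis (- (x * \<xi>))))"
| "fourier Line f =
     (SOME g. g \<in> L2 lborel \<and>
       ((\<lambda>R. \<integral>\<^sup>+\<xi>. ennreal ((cmod (complex_of_real (1 / sqrt (2 * pi)) *
                 (LINT x:{-R..R}|lborel. f x * cis (- (x * \<xi>))) - g \<xi>))\<^sup>2) \<partial>lborel)
          \<longlongrightarrow> 0) at_top)"

definition fourier_mult :: "domain \<Rightarrow> (real \<Rightarrow> complex) \<Rightarrow> (real \<Rightarrow> complex) \<Rightarrow> real \<Rightarrow> complex" where
  "fourier_mult M m f =
     (SOME g. g \<in> L2 (phys M) \<and> (AE \<xi> in freq M. fourier M g \<xi> = m \<xi> * fourier M f \<xi>))"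

definition jap :: "real \<Rightarrow> real" where
  "jap \<xi> = sqrt (1 + \<bar>\<xi>\<bar>\<^sup>2)"

text \<open>Only used for \<open>\<alpha> \<ge> 0\<close>, where every element of \<open>H\<^sup>\<alpha>\<close> is an \<open>L\<^sup>2\<close> function.\<close>

definition sobolev :: "domain \<Rightarrow> real \<Rightarrow> (real \<Rightarrow> complex) set" where
  "sobolev M \<alpha> =
     {f \<in> L2 (phys M). (\<lambda>\<xi>. complex_of_real (jap \<xi> powr \<alpha>) * fourier M f \<xi>) \<in> L2 (freq M)}"

definition sobolev_norm :: "domain \<Rightarrow> real \<Rightarrow> (real \<Rightarrow> complex) \<Rightarrow> real" where
  "sobolev_norm M \<alpha> f = sqrt (LINT \<xi>|freq M. (jap \<xi> powr \<alpha> * cmod (fourier M f \<xi>))\<^sup>2)"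

definition continuous_path ::
  "domain \<Rightarrow> real \<Rightarrow> real set \<Rightarrow> (real \<Rightarrow> real \<Rightarrow> complex) \<Rightarrow> bool" where
  "continuous_path M \<alpha> I \<phi> \<longleftrightarrow>
     (\<forall>t\<in>I. \<phi> t \<in> sobolev M \<alpha>) \<and>
     (\<forall>t\<in>I. ((\<lambda>s. sobolev_norm M \<alpha> (\<lambda>x. \<phi> s x - \<phi> t x)) \<longlongrightarrow> 0) (at t within I))"

text \<open>
  Integral over \<open>[0,t]\<close> of an \<open>H\<^sup>\<alpha>\<close>-valued function: the library's definition of
  \<open>has_integral\<close> on a compact interval, with the norm replaced by the \<open>H\<^sup>\<alpha>\<close> norm. It is only
  applied to continuous integrands, for which it is the Riemann integral.
\<close>

definition has_sobolev_integral ::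
  "domain \<Rightarrow> real \<Rightarrow> (real \<Rightarrow> real \<Rightarrow> complex) \<Rightarrow> (real \<Rightarrow> complex) \<Rightarrow> real \<Rightarrow> bool" where
  "has_sobolev_integral M \<alpha> g y t \<longleftrightarrow>
     y \<in> sobolev M \<alpha> \<and>
     (\<forall>e>0. \<exists>d. gauge d \<and>
        (\<forall>\<D>. \<D> tagged_division_of {0..t} \<and> d fine \<D> \<longrightarrow>
           sobolev_norm M \<alpha> (\<lambda>x. (\<Sum>(s, K)\<in>\<D>. measure lborel K *\<^sub>R g s x) - y x) < e))"

definition Phi :: "(real \<Rightarrow> real) \<Rightarrow> real \<Rightarrow> real \<Rightarrow> complex" where
  "Phi w t a = integral {0..t} (\<lambda>r. exp (\<i> * complex_of_real (a * w r)))"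

definition irregularity_norm :: "real \<Rightarrow> real \<Rightarrow> real \<Rightarrow> (real \<Rightarrow> real) \<Rightarrow> ennreal" where
  "irregularity_norm \<rho> \<gamma> T w =
     (SUP a. SUP (s, t)\<in>{(s, t). 0 \<le> s \<and> s < t \<and> t \<le> T}.
        ennreal ((1 + \<bar>a\<bar>) powr \<rho> * (cmod (Phi w t a - Phi w s a) / \<bar>t - s\<bar> powr \<gamma>)))"

definition irregular :: "real \<Rightarrow> real \<Rightarrow> real \<Rightarrow> (real \<Rightarrow> real) \<Rightarrow> bool" where
  "irregular \<rho> \<gamma> T w \<longleftrightarrow> irregularity_norm \<rho> \<gamma> T w < \<infinity>"

text \<open>\<open>schroedinger M \<tau>\<close> is \<open>exp(\<tau> i \<partial>\<^sub>x\<^sup>2)\<close>.\<close>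

definition schroedinger :: "domain \<Rightarrow> real \<Rightarrow> (real \<Rightarrow> complex) \<Rightarrow> real \<Rightarrow> complex" where
  "schroedinger M \<tau> = fourier_mult M (\<lambda>\<xi>. exp (- (\<i> * complex_of_real (\<tau> * \<xi>\<^sup>2))))"

definition U :: "domain \<Rightarrow> (real \<Rightarrow> real) \<Rightarrow> real \<Rightarrow> (real \<Rightarrow> complex) \<Rightarrow> real \<Rightarrow> complex" where
  "U M w t = schroedinger M (w t)"

definition U_inv :: "domain \<Rightarrow> (real \<Rightarrow> real) \<Rightarrow> real \<Rightarrow> (real \<Rightarrow> complex) \<Rightarrow> real \<Rightarrow> complex" where
  "U_inv M w t = schroedinger M (- w t)"

definition Pi_proj :: "domain \<Rightarrow> nat \<Rightarrow> (real \<Rightarrow> complex) \<Rightarrow> real \<Rightarrow> complex" where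
  "Pi_proj M N = fourier_mult M (indicator {\<xi>. \<bar>\<xi>\<bar> \<le> real N})"

definition cubic :: "(real \<Rightarrow> complex) \<Rightarrow> real \<Rightarrow> complex" where
  "cubic \<phi> = (\<lambda>x. \<i> * complex_of_real ((cmod (\<phi> x))\<^sup>2) * \<phi> x)"

definition cubic_trunc :: "domain \<Rightarrow> nat \<Rightarrow> (real \<Rightarrow> complex) \<Rightarrow> real \<Rightarrow> complex" where
  "cubic_trunc M N \<phi> = Pi_proj M N (cubic (Pi_proj M N \<phi>))"

text \<open>
  \<open>is_duhamel_integral M \<alpha> w T \<phi> J\<close>: the regularised integrals converge in \<open>C([0,T); H\<^sup>\<alpha>)\<close>,
  and \<open>J\<close> is their limit, i.e. what the symbol \<open>\<integral>\<^sub>0\<^sup>t (U\<^sub>s)\<^sup>-\<^sup>1 \<N>(\<phi>\<^sub>s) ds\<close> denotes.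
\<close>

definition is_duhamel_integral ::
  "domain \<Rightarrow> real \<Rightarrow> (real \<Rightarrow> real) \<Rightarrow> ereal \<Rightarrow> (real \<Rightarrow> real \<Rightarrow> complex) \<Rightarrow>
   (real \<Rightarrow> real \<Rightarrow> complex) \<Rightarrow> bool" where
  "is_duhamel_integral M \<alpha> w T \<phi> J \<longleftrightarrow>
     continuous_path M \<alpha> {t. 0 \<le> t \<and> ereal t < T} J \<and>
     (\<exists>JN. (\<forall>N. continuous_path M \<alpha> {t. 0 \<le> t \<and> ereal t < T} (JN N)) \<and>
           (\<forall>N t. 0 \<le> t \<longrightarrow> ereal t < T \<longrightarrow>
              has_sobolev_integral M \<alpha> (\<lambda>s. U_inv M w s (cubic_trunc M N (\<phi> s))) (JN N t) t) \<and>
           (\<forall>S. 0 \<le> S \<longrightarrow> ereal S < T \<longrightarrow>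
              uniform_limit {0..S} (\<lambda>N t. sobolev_norm M \<alpha> (\<lambda>x. JN N t x - J t x)) (\<lambda>_. 0)
                sequentially))"

definition is_solution ::
  "domain \<Rightarrow> real \<Rightarrow> (real \<Rightarrow> real) \<Rightarrow> ereal \<Rightarrow> (real \<Rightarrow> complex) \<Rightarrow>
   (real \<Rightarrow> real \<Rightarrow> complex) \<Rightarrow> bool" where
  "is_solution M \<alpha> w T \<phi>0 \<phi> \<longleftrightarrow>
     continuous_path M \<alpha> {t. 0 \<le> t \<and> ereal t < T} \<phi> \<and>
     (\<exists>J. is_duhamel_integral M \<alpha> w T \<phi> J \<and>
          (\<forall>t. 0 \<le> t \<longrightarrow> ereal t < T \<longrightarrow>
             (AE x in phys M. \<phi> t x = U M w t \<phi>0 x + U M w t (J t) x)))"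

abbreviation is_global_solution ::
  "domain \<Rightarrow> real \<Rightarrow> (real \<Rightarrow> real) \<Rightarrow> (real \<Rightarrow> complex) \<Rightarrow>
   (real \<Rightarrow> real \<Rightarrow> complex) \<Rightarrow> bool" where
  "is_global_solution M \<alpha> w \<equiv> is_solution M \<alpha> w \<infinity>"

text \<open>
  Controlled paths. A function on \<open>[0,\<infinity>)\<close> is its own restriction to \<open>[0,T]\<close>: the two notions
  indexed by \<open>T\<close> only look at times in \<open>[0,T]\<close>.
\<close>

definition controlled_upto ::
  "domain \<Rightarrow> real \<Rightarrow> (real \<Rightarrow> real) \<Rightarrow> real \<Rightarrow> (real \<Rightarrow> real \<Rightarrow> complex) set" where
  "controlled_upto M \<alpha> w T =
     {\<phi>. continuous_path M \<alpha> {0..T} \<phi> \<and>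
         (\<exists>C. \<forall>s t. 0 \<le> s \<longrightarrow> s < t \<longrightarrow> t \<le> T \<longrightarrow>
            sobolev_norm M \<alpha> (\<lambda>x. U_inv M w t (\<phi> t) x - U_inv M w s (\<phi> s) x)
              \<le> C * \<bar>t - s\<bar> powr (1/2))}"

definition controlled_norm ::
  "domain \<Rightarrow> real \<Rightarrow> (real \<Rightarrow> real) \<Rightarrow> real \<Rightarrow> (real \<Rightarrow> real \<Rightarrow> complex) \<Rightarrow> ennreal" where
  "controlled_norm M \<alpha> w T \<phi> =
     (SUP t\<in>{0..T}. ennreal (sobolev_norm M \<alpha> (U_inv M w t (\<phi> t)))) +
     (SUP (s, t)\<in>{(s, t). 0 \<le> s \<and> s < t \<and> t \<le> T}.
        ennreal (sobolev_norm M \<alpha> (\<lambda>x. U_inv M w t (\<phi> t) x - U_inv M w s (\<phi> s) x)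
                   / \<bar>t - s\<bar> powr (1/2)))"

definition controlled ::
  "domain \<Rightarrow> real \<Rightarrow> (real \<Rightarrow> real) \<Rightarrow> (real \<Rightarrow> real \<Rightarrow> complex) set" where
  "controlled M \<alpha> w =
     {\<phi>. continuous_path M \<alpha> {0..} \<phi> \<and> (\<forall>T>0. \<phi> \<in> controlled_upto M \<alpha> w T)}"

end

(*
In the interaction representation v_t = (U_t)^{-1} phi_t, and on the Fourier side with
xi = xi1 - xi2 + xi3, p = xi - xi1, q = xi - xi3, the equation becomes v' = N_t(v,v,v), where N_t is the
trilinear operator with kernel exp(2 i p q w_t), since xi^2 - xi1^2 + xi2^2 - xi3^2 = 2pq. Irregularity
of w says that the time increments of these operators have kernels bounded by
K |t-s|^gamma (1 + 2|pq|)^{-rho}. As rho > 1/2, this is bounded on L^2 by Cauchy-Schwarz after splitting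
into |p| < 1, |q| < 1 and |p|, |q| >= 1; as gamma > 1/2, the integral against 1/2-Hoelder paths exists as
a Young integral (sewing), uniformly in the frequency cutoff, and Picard iteration gives local solutions,
uniqueness and Lipschitz dependence. H^alpha is treated as L^2 with a weight W for which
W(xi) <= C W(xi1) W(xi2) W(xi3), which only changes the kernels by a bounded factor.

The L^2 norm is conserved, because the quartic form is real and increments of order
|t-s|^{gamma + 1/2} are negligible. For alpha > 0 the solution is global because the weights
1 + delta <xi>^alpha satisfy the bound above with a constant that does not depend on delta <= 1:
if the H^alpha norm is at most A, then for delta = 1/A the weighted norm is bounded by the conserved L^2
norm plus 1, so that the lifespan in this norm does not depend on A.
*)
theory Submission
 imports Defs "HOL-Probability.Probability"
begin


section \<open>Young integration\<close>

text \<open>A solution is defined by a limit of ordinary integrals with a frequency cutoff N, so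
  Young integration has to speak about these integrals and not only about their limit. For fixed N
  the truncated nonlinearity is bounded and continuous in time, but with constants that grow with N.
  They are used only qualitatively, to see that on short intervals the integral agrees with its
  frozen-argument approximation up to o(t - s). The sewing argument then replaces this by an
  estimate whose constants come from irregularity and the trilinear estimate and are free of N. An
  element of H^\<alpha> is represented by its transform multiplied by the weight, as a point of one
  fixed L^2 space. Every weight thus gives an equation in the same Banach space, and a change of
  weight is a multiplication operator that maps solutions to solutions. This is what allows \<delta>
  to change from one time step to the next. On the Fourier side, Plancherel's theorem on the line
  comes from Gaussian regularisation, and Parseval's identity on the torus is derived from
  it.\<close>

definition holder :: "real => real => real => (real => 'v::real_normed_vector) => bool" where
 "holder a b A f \<longleftrightarrow> (\<forall>s\<in>{a..b}. \<forall>t\<in>{a..b}. norm (f t - f s) <= A * sqrt \<bar>t - s\<bar>)"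

definition ctrl :: "real => real => real => (real => 'v::real_normed_vector) => bool" where
 "ctrl a b M f \<longleftrightarrow> (\<forall>t\<in>{a..b}. norm (f t) <= M) \<and> holder a b M f"

lemma holderI:
 assumes "\<And>s t. a <= s ==> s <= t ==> t <= b ==> norm (f t - f s) <= A * sqrt (t - s)"
 shows "holder a b A f"
 unfolding holder_def
proof (intro ballI)
 fix s t assume st: "s \<in> {a..b}" "t \<in> {a..b}"
 show "norm (f t - f s) <= A * sqrt \<bar>t - s\<bar>"
 proof (cases "s <= t")
  case True then show ?thesis using assms[of s t] st by auto
 next
  case False
  then have "norm (f s - f t) <= A * sqrt (s - t)" using assms[of t s] st by auto
  then show ?thesis using False by (simp add: norm_minus_commute abs_if)
 qed
qed

lemma holderD:
 assumes "holder a b A f" "a <= s" "s <= t" "t <= b"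
 shows "norm (f t - f s) <= A * sqrt (t - s)"
proof -
 have "s \<in> {a..b}" "t \<in> {a..b}" using assms by auto
 then have "norm (f t - f s) <= A * sqrt \<bar>t - s\<bar>" using assms(1) unfolding holder_def by blast
 then show ?thesis using assms by simp
qed

lemma holder_mono:
 assumes "holder a b A f" "A <= B" shows "holder a b B f"
 using assms unfolding holder_def
 by (meson mult_right_mono order_trans real_sqrt_ge_zero abs_ge_zero)

lemma holder_subset: "holder a b A f ==> a <= a' ==> b' <= b ==> holder a' b' A f"
 unfolding holder_def by auto

lemma ctrl_subset: "ctrl a b A f ==> a <= a' ==> b' <= b ==> ctrl a' b' A f"
 unfolding ctrl_def by (auto intro: holder_subset)

lemma ctrl_mono: "ctrl a b A f ==> A <= B ==> ctrl a b B f"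
 unfolding ctrl_def using holder_mono order_trans by blast

lemma ctrl_nonneg: "ctrl a b M f ==> a <= b ==> 0 <= M"
 unfolding ctrl_def by (metis atLeastAtMost_iff norm_ge_zero order_refl order_trans)

lemma ctrl_holder: "ctrl a b M f ==> holder a b M f"
 unfolding ctrl_def by simp

lemma ctrl_norm: "ctrl a b M f ==> a <= t ==> t <= b ==> norm (f t) <= M"
 unfolding ctrl_def by simp

text \<open>Across the junction each piece contributes up to a full square root of t - s, hence the
  sum of the two constants.\<close>

lemma holder_join:
 assumes 1: "holder a m A f" and 2: "holder m b B f" and "a <= m" "m <= b" "0 <= A" "0 <= B"
 shows "holder a b (A + B) f"
proof (rule holderI)
 fix s t assume st: "a <= s" "s <= t" "t <= b"
 consider "t <= m" | "m <= s" | "s <= m" "m <= t" by linarith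
 then show "norm (f t - f s) <= (A + B) * sqrt (t - s)"
 proof cases
  case 1
  have "norm (f t - f s) <= A * sqrt (t - s)" by (rule holderD[OF assms(1)]) (use st 1 in auto)
  also have "... <= (A + B) * sqrt (t - s)" using assms st by (intro mult_right_mono) auto
  finally show ?thesis .
 next
  case 2
  have "norm (f t - f s) <= B * sqrt (t - s)" by (rule holderD[OF assms(2)]) (use st 2 in auto)
  also have "... <= (A + B) * sqrt (t - s)" using assms st by (intro mult_right_mono) auto
  finally show ?thesis .
 next
  case 3
  have "norm (f t - f s) <= norm (f t - f m) + norm (f m - f s)"
   using norm_triangle_ineq[of "f t - f m" "f m - f s"] by simp
  also have "... <= B * sqrt (t - m) + A * sqrt (m - s)"
   by (intro add_mono holderD[OF assms(1)] holderD[OF assms(2)]) (use st 3 in auto)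
  also have "... <= B * sqrt (t - s) + A * sqrt (t - s)"
   using assms 3 by (intro add_mono mult_left_mono) auto
  finally show ?thesis by (simp add: algebra_simps)
 qed
qed

lemma continuous_onI_LIMSEQ:
 fixes f :: "'a::metric_space => 'b::topological_space"
 assumes "\<And>x y. \<forall>n. x n \<in> S ==> y \<in> S ==> x \<longlonglongrightarrow> y ==> (\<lambda>n. f (x n)) \<longlonglongrightarrow> f y"
 shows "continuous_on S f"
 using assms unfolding continuous_on_sequentially o_def by blast

lemma LIMSEQ_0_le:
 fixes f :: "nat => 'v::real_normed_vector"
 assumes "\<And>n. norm (f n) <= D n" "D \<longlonglongrightarrow> 0" shows "f \<longlonglongrightarrow> 0"
 using Lim_null_comparison[of f D sequentially] assms by simp

lemma holder_continuous:
 assumes "holder a b A f" shows "continuous_on {a..b} f"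
proof (rule continuous_onI_LIMSEQ)
 fix x y assume x: "\<forall>n. x n \<in> {a..b}" and y: "y \<in> {a..b}" and lim: "x \<longlonglongrightarrow> y"
 have "(\<lambda>n. A * sqrt \<bar>x n - y\<bar>) \<longlonglongrightarrow> A * sqrt \<bar>y - y\<bar>"
  by (intro tendsto_intros lim)
 then have "(\<lambda>n. A * sqrt \<bar>x n - y\<bar>) \<longlonglongrightarrow> 0" by simp
 moreover have "norm (f (x n) - f y) <= A * sqrt \<bar>x n - y\<bar>" for n
  using assms x y unfolding holder_def by blast
 ultimately have "(\<lambda>n. f (x n) - f y) \<longlonglongrightarrow> 0"
  by (rule LIMSEQ_0_le[rotated])
 then show "(\<lambda>n. f (x n)) \<longlonglongrightarrow> f y" by (simp add: LIM_zero_iff)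
qed

lemma holder_ctrl:
 assumes "holder a b A f" "a <= b" obtains M where "ctrl a b M f" "1 <= M"
proof -
 have "compact (f ` {a..b})" using holder_continuous[OF assms(1)] by (intro compact_continuous_image) auto
 then have "bounded (f ` {a..b})" by (rule compact_imp_bounded)
 then obtain B where B: "\<And>t. t \<in> {a..b} ==> norm (f t) <= B"
  unfolding bounded_iff by blast
 have "ctrl a b (max 1 (max A B)) f"
  unfolding ctrl_def using B holder_mono[OF assms(1)] by (fastforce simp: max_def)
 then show ?thesis by (rule that) simp
qed

section \<open>The sewing lemma\<close>

text \<open>Bisection from short intervals upwards. If both halves obey the bound C x^\<beta>, their
  sum is C q x^\<beta> with q = 2^(1 - \<beta>) < 1, and the midpoint defect adds c x^\<beta>; the
  constant C is the fixed point of C = C q + c, so the bound survives every doubling of the length.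
  The linear term e (t - s) is additive under bisection, starts the induction on intervals shorter
  than d, and disappears at the end by letting e tend to 0.\<close>

lemma sewing_bound:
 fixes E :: "real => real => 'v::real_normed_vector"
 assumes \<beta>: "\<beta> > 1" and c: "c >= 0"
  and mid: "\<And>s t. a <= s ==> s <= t ==> t <= b ==>
   norm (E s t - E s ((s + t) / 2) - E ((s + t) / 2) t) <= c * (t - s) powr \<beta>"
  and small: "\<And>e. e > 0 ==> \<exists>d>0. \<forall>s t. a <= s --> s <= t --> t <= b --> t - s < d -->
   norm (E s t) <= e * (t - s)"
  and st: "a <= s" "s <= t" "t <= b"
 shows "norm (E s t) <= c / (1 - 2 powr (1 - \<beta>)) * (t - s) powr \<beta>"
proof -
 define q where "q = 2 powr (1 - \<beta>)"
 have q: "q < 1" unfolding q_def using \<beta> powr_less_mono[of "1 - \<beta>" 0 2] by simp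
 define C where "C = c / (1 - q)"
 have Cq: "C * q + c = C" using q by (simp add: C_def field_simps)
 have half: "2 * (x / 2) powr \<beta> = q * x powr \<beta>" if "x >= 0" for x :: real
  using that by (simp add: q_def powr_divide powr_diff)
 have claim: "\<forall>s t. a <= s --> s <= t --> t <= b --> t - s < d * 2 ^ n -->
   norm (E s t) <= e * (t - s) + C * (t - s) powr \<beta>"
  if d: "d > 0" "\<forall>s t. a <= s --> s <= t --> t <= b --> t - s < d --> norm (E s t) <= e * (t - s)"
  for d e and n :: nat
 proof (induction n)
  case 0
  have "0 <= C" using q c by (simp add: C_def)
  then show ?case using d by (fastforce intro: add_increasing2)
 next
  case (Suc n)
  show ?case
  proof (intro allI impI)
   fix s t assume st: "a <= s" "s <= t" "t <= b" "t - s < d * 2 ^ Suc n"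
   define m where "m = (s + t) / 2"
   have m: "s <= m" "m <= t" "m - s = (t - s) / 2" "t - m = (t - s) / 2"
    using st by (auto simp: m_def field_simps)
   have "norm (E s t) <= norm (E s t - E s m - E m t) + norm (E s m) + norm (E m t)"
    using norm_triangle_ineq[of "E s t - E s m - E m t" "E s m + E m t"] norm_triangle_ineq[of "E s m" "E m t"]
    by simp
   also have "... <= c * (t - s) powr \<beta> + (e * ((t - s)/2) + C * ((t - s)/2) powr \<beta>)
     + (e * ((t - s)/2) + C * ((t - s)/2) powr \<beta>)"
    using mid[of s t] Suc.IH[rule_format, of s m] Suc.IH[rule_format, of m t] st m
    unfolding m_def[symmetric] by (intro add_mono) auto
   also have "... = e * (t - s) + (C * (2 * ((t - s)/2) powr \<beta>) + c * (t - s) powr \<beta>)"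
    by (simp add: algebra_simps)
   also have "... = e * (t - s) + (C * q + c) * (t - s) powr \<beta>"
    using half[of "t - s"] st by (simp add: algebra_simps)
   finally show "norm (E s t) <= e * (t - s) + C * (t - s) powr \<beta>" by (simp add: Cq)
  qed
 qed
 have "norm (E s t) <= e * (t - s) + C * (t - s) powr \<beta>" if e: "e > 0" for e
 proof -
  obtain d where d: "d > 0" "\<forall>s t. a <= s --> s <= t --> t <= b --> t - s < d --> norm (E s t) <= e * (t - s)"
   using small[OF e] by blast
  obtain n :: nat where "(t - s) / d < 2 ^ n"
   using real_arch_pow[of 2 "(t - s) / d"] by auto
  then have "t - s < d * 2 ^ n" using d by (simp add: field_simps)
  then show ?thesis using claim[OF d, of n] st by blast
 qed
 then have *: "norm (E s t) - C * (t - s) powr \<beta> <= e * (t - s)" if "e > 0" for e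
  using that by (simp add: algebra_simps)
 have "norm (E s t) - C * (t - s) powr \<beta> <= 0"
 proof (rule field_le_epsilon)
  fix e :: real assume e: "e > 0"
  \<comment> \<open>The summand 1 keeps the denominator positive when s = t.\<close>
  have "norm (E s t) - C * (t - s) powr \<beta> <= e / (t - s + 1) * (t - s)"
   using e st by (intro *) auto
  also have "... = e * ((t - s) / (t - s + 1))" by simp
  also have "... <= e * 1" using e st by (intro mult_left_mono) auto
  finally show "norm (E s t) - C * (t - s) powr \<beta> <= 0 + e" by simp
 qed
 then show ?thesis unfolding C_def q_def by simp
qed

lemma trilinear_diff:
 fixes B :: "'v::ab_group_add => 'v => 'v => 'w::ab_group_add"
 assumes "\<And>f f' g h. B (f + f') g h = B f g h + B f' g h"
  and "\<And>f g g' h. B f (g + g') h = B f g h + B f g' h"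
  and "\<And>f g h h'. B f g (h + h') = B f g h + B f g h'"
 shows "B f g h - B f' g' h' = B (f - f') g h + B f' (g - g') h + B f' g' (h - h')"
 using assms(1)[of "f - f'" f' g h] assms(2)[of f' "g - g'" g' h] assms(3)[of f' g' "h - h'" h'] by simp

text \<open>Picard iteration contracts on intervals of length at most \<open>(t-s)\<close> with
  \<open>3 * young_const K \<gamma> T * (t-s) powr (\<gamma> - 1/2) * M^3 \<le> 1/2\<close>; nothing but \<open>K\<close>, \<open>\<gamma>\<close>, \<open>T\<close> and the
  size \<open>M\<close> of the paths enters.\<close>

definition young_const :: "real => real => real => real" where
 "young_const K \<gamma> T = K * (1 + 3 / (1 - 2 powr (1/2 - \<gamma>)) * sqrt T)"

definition short_time :: "real => real => real => real => real => bool" where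
 "short_time K \<gamma> T M l \<longleftrightarrow> l <= 1 \<and> 3 * young_const K \<gamma> T * l powr (\<gamma> - 1/2) * M ^ 3 <= 1/2"

lemma young_const_nonneg: "K >= 0 ==> \<gamma> > 1/2 ==> T >= 0 ==> young_const K \<gamma> T >= 0"
proof -
 assume a: "K >= 0" "\<gamma> > 1/2" "T >= 0"
 have "2 powr (1/2 - \<gamma>) < (1::real)" using a powr_less_mono[of "1/2 - \<gamma>" 0 2] by simp
 then show ?thesis unfolding young_const_def using a
  by (intro mult_nonneg_nonneg add_nonneg_nonneg divide_nonneg_nonneg) auto
qed

lemma ex_short_time:
 assumes "\<gamma> > 1/2" "K >= 0" "T >= 0" "M >= 0" shows "\<exists>\<tau>>0. short_time K \<gamma> T M \<tau>"
proof -
 define B where "B = 3 * young_const K \<gamma> T * M ^ 3"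
 have B: "B >= 0" unfolding B_def using young_const_nonneg assms by simp
 define \<tau> where "\<tau> = min 1 ((1 / (2 * (B + 1))) powr (1 / (\<gamma> - 1/2)))"
 have \<tau>: "\<tau> > 0" "\<tau> <= 1" using B by (auto simp: \<tau>_def)
 have "\<tau> powr (\<gamma> - 1/2) <= ((1 / (2 * (B + 1))) powr (1 / (\<gamma> - 1/2))) powr (\<gamma> - 1/2)"
  using \<tau> assms by (intro powr_mono2) (auto simp: \<tau>_def)
 also have "... = 1 / (2 * (B + 1))" using assms B by (simp add: powr_powr)
 finally have "B * \<tau> powr (\<gamma> - 1/2) <= B * (1 / (2 * (B + 1)))" using B by (intro mult_left_mono) auto
 also have "... <= 1/2" using B by (simp add: field_simps)
 finally show ?thesis using \<tau> unfolding short_time_def B_def by (intro exI[of _ \<tau>]) (simp add: mult_ac)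
qed

lemma short_time_mono:
 assumes "short_time K \<gamma> T M l" "\<gamma> > 1/2" "K >= 0" "T >= 0" "0 <= M'" "M' <= M" "0 <= l'" "l' <= l"
 shows "short_time K \<gamma> T M' l'"
proof -
 have "3 * young_const K \<gamma> T * l' powr (\<gamma> - 1/2) * M' ^ 3 <= 3 * young_const K \<gamma> T * l powr (\<gamma> - 1/2) * M ^ 3"
  using assms young_const_nonneg[of K \<gamma> T] by (intro mult_mono powr_mono2 power_mono mult_nonneg_nonneg) auto
 then show ?thesis using assms unfolding short_time_def by linarith
qed

section \<open>The Young integral of a cubic nonlinearity as a limit in the cutoff\<close>

text \<open>\<open>F N r\<close> stands for the truncated nonlinearity at time r and
  \<open>X N s t\<close> for its time integral over [s,t] with frozen arguments. The constant
  \<open>K\<close> is common to all N, while \<open>C N\<close> and the rate in \<open>X_F\<close>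
  may get worse with N. Trilinearity is expressed by additivity in each slot, which the conjugation
  in the middle slot of the cubic term respects.\<close>

locale young =
 fixes X :: "nat => real => real => 'v::banach => 'v => 'v => 'v"
  and XX :: "real => real => 'v => 'v => 'v => 'v"
  and F :: "nat => real => 'v => 'v => 'v => 'v"
  and C :: "nat => real" and K \<gamma> T :: real
 assumes K_nonneg: "K >= 0" and \<gamma>_gt: "\<gamma> > 1/2" and T_nonneg: "T >= 0"
  and X_add: "\<And>N s t f f' g h. X N s t (f + f') g h = X N s t f g h + X N s t f' g h"
   "\<And>N s t f g g' h. X N s t f (g + g') h = X N s t f g h + X N s t f g' h"
   "\<And>N s t f g h h'. X N s t f g (h + h') = X N s t f g h + X N s t f g h'"
  and F_add: "\<And>N r f f' g h. F N r (f + f') g h = F N r f g h + F N r f' g h"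
   "\<And>N r f g g' h. F N r f (g + g') h = F N r f g h + F N r f g' h"
   "\<And>N r f g h h'. F N r f g (h + h') = F N r f g h + F N r f g h'"
  and X_bound: "\<And>N s t f g h. 0 <= s ==> s <= t ==> t <= T ==>
   norm (X N s t f g h) <= K * (t - s) powr \<gamma> * (norm f * norm g * norm h)"
  and F_bound: "\<And>N r f g h. 0 <= r ==> r <= T ==> norm (F N r f g h) <= C N * (norm f * norm g * norm h)"
  and F_cont: "\<And>N f g h. continuous_on {0..T} (\<lambda>r. F N r f g h)"
  and X_time: "\<And>N s t u f g h. 0 <= s ==> s <= t ==> t <= u ==> u <= T ==>
   X N s u f g h = X N s t f g h + X N t u f g h"
  and X_F: "\<And>N e. e > 0 ==> \<exists>d>0. \<forall>s t f g h. 0 <= s --> s <= t --> t <= T --> t - s < d -->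
   norm (X N s t f g h - (t - s) *\<^sub>R F N s f g h) <= e * (t - s) * (norm f * norm g * norm h)"
  and X_lim: "\<And>s t f g h. 0 <= s ==> s <= t ==> t <= T ==> (\<lambda>N. X N s t f g h) \<longlonglongrightarrow> XX s t f g h"
begin

lemma F_diff: "F N r f g h - F N r f' g' h' = F N r (f - f') g h + F N r f' (g - g') h + F N r f' g' (h - h')"
 by (rule trilinear_diff) (rule F_add)+

lemma X_diff: "X N s t f g h - X N s t f' g' h'
  = X N s t (f - f') g h + X N s t f' (g - g') h + X N s t f' g' (h - h')"
 by (rule trilinear_diff) (rule X_add)+

text \<open>The three paths are kept apart so that the difference of two cubic expressions can be
  expanded one slot at a time.\<close>

definition J :: "nat => real => real => (real => 'v) => (real => 'v) => (real => 'v) => 'v" where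
 "J N s t f g h = integral {s..t} (\<lambda>r. F N r (f r) (g r) (h r))"

lemma F_path_continuous:
 assumes "continuous_on {a..b} f" "continuous_on {a..b} g" "continuous_on {a..b} h" "0 <= a" "b <= T"
 shows "continuous_on {a..b} (\<lambda>r. F N r (f r) (g r) (h r))"
proof (rule continuous_onI_LIMSEQ)
 fix x y assume x: "\<forall>n. x n \<in> {a..b}" and y: "y \<in> {a..b}" and lim: "x \<longlonglongrightarrow> y"
 have lf: "(\<lambda>n. f (x n)) \<longlonglongrightarrow> f y" and lg: "(\<lambda>n. g (x n)) \<longlonglongrightarrow> g y" and lh: "(\<lambda>n. h (x n)) \<longlonglongrightarrow> h y"
  using assms(1-3) x y lim by (auto simp: continuous_on_sequentially o_def)
 have xT: "0 <= x n" "x n <= T" for n using x assms by (auto intro: order_trans)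
 define D where "D n = C N * (norm (f (x n) - f y) * norm (g (x n)) * norm (h (x n)))
  + C N * (norm (f y) * norm (g (x n) - g y) * norm (h (x n)))
  + C N * (norm (f y) * norm (g y) * norm (h (x n) - h y))" for n
 have DD: "norm (F N (x n) (f (x n)) (g (x n)) (h (x n)) - F N (x n) (f y) (g y) (h y)) <= D n" for n
  unfolding F_diff[of N "x n" "f (x n)"] D_def
  by (intro order_trans[OF norm_triangle_ineq] add_mono F_bound xT)
 have "D \<longlonglongrightarrow> C N * (norm (f y - f y) * norm (g y) * norm (h y))
  + C N * (norm (f y) * norm (g y - g y) * norm (h y))
  + C N * (norm (f y) * norm (g y) * norm (h y - h y))"
  unfolding D_def by (intro tendsto_intros lf lg lh)
 then have "D \<longlonglongrightarrow> 0" by simp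
 from LIMSEQ_0_le[OF DD this]
 have 1: "(\<lambda>n. F N (x n) (f (x n)) (g (x n)) (h (x n)) - F N (x n) (f y) (g y) (h y)) \<longlonglongrightarrow> 0"
  .
 have 2: "(\<lambda>n. F N (x n) (f y) (g y) (h y)) \<longlonglongrightarrow> F N y (f y) (g y) (h y)"
  using F_cont[of N "f y" "g y" "h y"] xT y lim assms by (auto simp: continuous_on_sequentially o_def)
 show "(\<lambda>n. F N (x n) (f (x n)) (g (x n)) (h (x n))) \<longlonglongrightarrow> F N y (f y) (g y) (h y)"
  using tendsto_add[OF 1 2] by simp
qed

lemma F_path_integrable:
 assumes "continuous_on {a..b} f" "continuous_on {a..b} g" "continuous_on {a..b} h" "0 <= a" "b <= T"
 shows "(\<lambda>r. F N r (f r) (g r) (h r)) integrable_on {a..b}"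
 using F_path_continuous[OF assms] by (rule integrable_continuous_interval)

lemma J_time:
 assumes "continuous_on {a..b} f" "continuous_on {a..b} g" "continuous_on {a..b} h"
  and "0 <= a" "b <= T" "a <= s" "s <= m" "m <= t" "t <= b"
 shows "J N s t f g h = J N s m f g h + J N m t f g h"
 unfolding J_def
 by (subst Henstock_Kurzweil_Integration.integral_combine[symmetric, of s m t])
  (use assms in "auto intro!: F_path_integrable intro: continuous_on_subset")

text \<open>Both \<open>J\<close> and \<open>X\<close> agree to first order with (t - s) times the
  nonlinearity frozen at time s: the former by uniform continuity of the integrand, the latter by
  \<open>X_F\<close>. The threshold d depends on N, which is enough, because sewing only needs some
  d for each N and returns a bound in which d has disappeared.\<close>

lemma J_approx:
 assumes c: "continuous_on {a..b} f" "continuous_on {a..b} g" "continuous_on {a..b} h"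
  and ab: "0 <= a" "b <= T" and e: "e > 0"
 shows "\<exists>d>0. \<forall>s t. a <= s --> s <= t --> t <= b --> t - s < d -->
   norm (J N s t f g h - X N s t (f s) (g s) (h s)) <= e * (t - s)"
proof -
 define G where "G r = F N r (f r) (g r) (h r)" for r
 have Gc: "continuous_on {a..b} G" unfolding G_def by (rule F_path_continuous[OF c ab])
 have "compact ((\<lambda>r. norm (f r) * norm (g r) * norm (h r)) ` {a..b})"
  by (intro compact_continuous_image continuous_intros c) auto
 then have "bdd_above ((\<lambda>r. norm (f r) * norm (g r) * norm (h r)) ` {a..b})"
  by (intro bounded_imp_bdd_above compact_imp_bounded)
 then obtain B where B: "\<And>r. r \<in> {a..b} ==> norm (f r) * norm (g r) * norm (h r) <= B"
  unfolding bdd_above_def by blast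
 define B' where "B' = max B 0 + 1"
 have B': "B' > 0" "\<And>r. r \<in> {a..b} ==> norm (f r) * norm (g r) * norm (h r) <= B'"
  using B unfolding B'_def by (force, force)
 obtain d1 where d1: "d1 > 0" "\<And>s t f g h. 0 <= s ==> s <= t ==> t <= T ==> t - s < d1 ==>
   norm (X N s t f g h - (t - s) *\<^sub>R F N s f g h) <= e / (2 * B') * (t - s) * (norm f * norm g * norm h)"
 proof -
  have "e / (2 * B') > 0" using e B' by simp
  from X_F[OF this, of N] show ?thesis using that by blast
 qed
 have "uniformly_continuous_on {a..b} G" using Gc by (intro compact_uniformly_continuous) auto
 then obtain d2 where d2: "d2 > 0" "\<And>r s. r \<in> {a..b} ==> s \<in> {a..b} ==> dist s r < d2 ==> dist (G s) (G r) < e / 2"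
  unfolding uniformly_continuous_on_def using e by (meson half_gt_zero)
 show ?thesis
 proof (intro exI[of _ "min d1 d2"] conjI allI impI)
  fix s t assume st: "a <= s" "s <= t" "t <= b" "t - s < min d1 d2"
  have int: "G integrable_on {s..t}"
   using Gc st by (intro integrable_continuous_interval) (auto intro: continuous_on_subset)
  have "J N s t f g h - (t - s) *\<^sub>R G s = integral {s..t} (\<lambda>r. G r - G s)"
   unfolding J_def G_def[symmetric] using int st by (subst Henstock_Kurzweil_Integration.integral_diff) auto
  also have "norm ... <= (e / 2) * (t - s)"
  proof (rule integral_bound)
   show "continuous_on {s..t} (\<lambda>r. G r - G s)"
    using Gc st by (intro continuous_intros) (auto intro: continuous_on_subset)
   show "norm (G r - G s) <= e / 2" if "r \<in> {s..t}" for r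
    using d2(2)[of s r] that st by (auto simp: dist_norm)
  qed (use st in auto)
  finally have 1: "norm (J N s t f g h - (t - s) *\<^sub>R G s) <= e / 2 * (t - s)" .
  have "norm (X N s t (f s) (g s) (h s) - (t - s) *\<^sub>R G s)
    <= e / (2 * B') * (t - s) * (norm (f s) * norm (g s) * norm (h s))"
   unfolding G_def using d1(2)[of s t "f s" "g s" "h s"] st ab by auto
  also have "... <= e / (2 * B') * (t - s) * B'"
   using B' st e by (intro mult_left_mono B'(2)) auto
  also have "... = e / 2 * (t - s)" using B' by simp
  finally have "norm (X N s t (f s) (g s) (h s) - (t - s) *\<^sub>R G s) <= e / 2 * (t - s)" .
  then show "norm (J N s t f g h - X N s t (f s) (g s) (h s)) <= e * (t - s)"
   using 1 norm_triangle_ineq4[of "J N s t f g h - (t - s) *\<^sub>R G s" "X N s t (f s) (g s) (h s) - (t - s) *\<^sub>R G s"]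
   by simp
 qed (use d1 d2 in auto)
qed

text \<open>The sewing constant for \<beta> = \<gamma> + 1/2, where 2^(1 - \<beta>) = 2^(1/2 -
  \<gamma>); the factor 3 counts the slots in which the arguments change.\<close>

definition sc :: real where "sc = 3 * K / (1 - 2 powr (1/2 - \<gamma>))"

lemma sc_nonneg: "sc >= 0"
proof -
 have "2 powr (1/2 - \<gamma>) < (1::real)" using \<gamma>_gt powr_less_mono[of "1/2 - \<gamma>" 0 2] by simp
 then show ?thesis unfolding sc_def using K_nonneg by simp
qed

text \<open>Since \<open>J\<close> and \<open>X\<close> are both additive in time, the midpoint
  defect of their difference is \<open>X\<close> over the second half, with its arguments moved from
  time m back to time s. Slot by slot, the operator bound contributes the power \<gamma> and the
  Hoelder increment the power 1/2, together more than 1. All constants are independent of N.\<close>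

lemma J_sewing:
 assumes f: "ctrl a b Mf f" and g: "ctrl a b Mg g" and h: "ctrl a b Mh h"
  and ab: "0 <= a" "b <= T" and st: "a <= s" "s <= t" "t <= b"
 shows "norm (J N s t f g h - X N s t (f s) (g s) (h s)) <= sc * (Mf * Mg * Mh) * (t - s) powr (\<gamma> + 1/2)"
proof -
 have c: "continuous_on {a..b} f" "continuous_on {a..b} g" "continuous_on {a..b} h"
  using f g h by (auto intro: holder_continuous ctrl_holder)
 have nn: "0 <= Mf" "0 <= Mg" "0 <= Mh" using ctrl_nonneg f g h st by (meson order_trans)+
 define E where "E s t = J N s t f g h - X N s t (f s) (g s) (h s)" for s t
 have "norm (E s t) <= 3 * K * (Mf * Mg * Mh) / (1 - 2 powr (1 - (\<gamma> + 1/2))) * (t - s) powr (\<gamma> + 1/2)"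
 proof (rule sewing_bound[where a = a and b = b])
  fix s t assume st: "a <= s" "s <= t" "t <= b"
  define m where "m = (s + t) / 2"
  have m: "s <= m" "m <= t" "m - s <= t - s" "t - m <= t - s" using st by (auto simp: m_def)
  have "E s t - E s m - E m t = X N m t (f m) (g m) (h m) - X N m t (f s) (g s) (h s)"
   unfolding E_def using J_time[OF c ab, of s m t] X_time[of s m t] st m ab by simp
  also have "... = X N m t (f m - f s) (g m) (h m) + X N m t (f s) (g m - g s) (h m) + X N m t (f s) (g s) (h m - h s)"
   by (rule X_diff)
  also have "norm ... <= K * (t - m) powr \<gamma> * (norm (f m - f s) * norm (g m) * norm (h m))
   + K * (t - m) powr \<gamma> * (norm (f s) * norm (g m - g s) * norm (h m))
   + K * (t - m) powr \<gamma> * (norm (f s) * norm (g s) * norm (h m - h s))"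
   using m st ab by (intro order_trans[OF norm_triangle_ineq] add_mono X_bound) auto
  also have "... <= K * (t - m) powr \<gamma> * ((Mf * sqrt (m - s)) * Mg * Mh)
   + K * (t - m) powr \<gamma> * (Mf * (Mg * sqrt (m - s)) * Mh)
   + K * (t - m) powr \<gamma> * (Mf * Mg * (Mh * sqrt (m - s)))"
   using m st K_nonneg nn
   by (intro add_mono mult_left_mono mult_mono ctrl_norm[OF f] ctrl_norm[OF g] ctrl_norm[OF h]
     holderD[OF ctrl_holder[OF f]] holderD[OF ctrl_holder[OF g]] holderD[OF ctrl_holder[OF h]]) auto
  also have "... = 3 * K * (Mf * Mg * Mh) * ((t - m) powr \<gamma> * sqrt (m - s))" by (simp add: algebra_simps)
  also have "... <= 3 * K * (Mf * Mg * Mh) * ((t - s) powr \<gamma> * sqrt (t - s))"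
   using m st K_nonneg nn \<gamma>_gt by (intro mult_left_mono mult_mono powr_mono2) auto
  also have "(t - s) powr \<gamma> * sqrt (t - s) = (t - s) powr (\<gamma> + 1/2)"
   using st by (simp add: powr_add powr_half_sqrt)
  finally show "norm (E s t - E s ((s + t) / 2) - E ((s + t) / 2) t) <= 3 * K * (Mf * Mg * Mh) * (t - s) powr (\<gamma> + 1/2)"
   unfolding m_def .
 next
  fix e :: real assume "e > 0"
  then show "\<exists>d>0. \<forall>s t. a <= s --> s <= t --> t <= b --> t - s < d --> norm (E s t) <= e * (t - s)"
   unfolding E_def by (rule J_approx[OF c ab])
 qed (use st \<gamma>_gt K_nonneg nn in auto)
 then show ?thesis unfolding E_def sc_def by (simp add: algebra_simps)
qed

abbreviation kk :: real where "kk \<equiv> young_const K \<gamma> T"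

lemma kk_nonneg: "kk >= 0" using young_const_nonneg K_nonneg \<gamma>_gt T_nonneg by simp

lemma kk_eq: "kk = K + sc * sqrt T" by (simp add: young_const_def sc_def algebra_simps)

lemma J_bound:
 assumes f: "ctrl a b Mf f" and g: "ctrl a b Mg g" and h: "ctrl a b Mh h"
  and ab: "0 <= a" "b <= T" and st: "a <= s" "s <= t" "t <= b"
 shows "norm (J N s t f g h) <= kk * (Mf * Mg * Mh) * (t - s) powr \<gamma>"
proof -
 have nn: "0 <= Mf" "0 <= Mg" "0 <= Mh" using ctrl_nonneg f g h st by (meson order_trans)+
 have "norm (X N s t (f s) (g s) (h s)) <= K * (t - s) powr \<gamma> * (norm (f s) * norm (g s) * norm (h s))"
  using X_bound st ab by auto
 also have "... <= K * (t - s) powr \<gamma> * (Mf * Mg * Mh)"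
  using st K_nonneg nn by (intro mult_left_mono mult_mono ctrl_norm[OF f] ctrl_norm[OF g] ctrl_norm[OF h]) auto
 finally have 1: "norm (X N s t (f s) (g s) (h s)) <= K * (t - s) powr \<gamma> * (Mf * Mg * Mh)" .
 have "sc * (Mf * Mg * Mh) * (t - s) powr (\<gamma> + 1/2) = sc * (Mf * Mg * Mh) * (t - s) powr \<gamma> * sqrt (t - s)"
  using st by (simp add: powr_add powr_half_sqrt)
 also have "... <= sc * (Mf * Mg * Mh) * (t - s) powr \<gamma> * sqrt T"
  using st ab sc_nonneg nn by (intro mult_left_mono) auto
 finally have 2: "sc * (Mf * Mg * Mh) * (t - s) powr (\<gamma> + 1/2) <= sc * (Mf * Mg * Mh) * (t - s) powr \<gamma> * sqrt T" .
 have "norm (J N s t f g h) <= norm (J N s t f g h - X N s t (f s) (g s) (h s)) + norm (X N s t (f s) (g s) (h s))"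
  using norm_triangle_ineq[of "J N s t f g h - X N s t (f s) (g s) (h s)" "X N s t (f s) (g s) (h s)"] by simp
 also have "... <= sc * (Mf * Mg * Mh) * (t - s) powr \<gamma> * sqrt T + K * (t - s) powr \<gamma> * (Mf * Mg * Mh)"
  using J_sewing[OF f g h ab st, of N] 1 2 by linarith
 also have "... = kk * (Mf * Mg * Mh) * (t - s) powr \<gamma>" unfolding kk_eq by (simp add: algebra_simps)
 finally show ?thesis .
qed

text \<open>Only the approximations \<open>X N\<close> are known to converge. On one interval
  \<open>J N\<close> and \<open>J N'\<close> differ by \<open>X N - X N'\<close> and two sewing
  errors of size (t - s)^(\<gamma> + 1/2). After n bisections the 2^n small intervals contribute in
  total only q^n times this error, because the exponent exceeds 1; so n is fixed first to make the
  errors small, and then the finitely many \<open>X N\<close> are close for large N. The allowance e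
  is halved along with the interval.\<close>

lemma J_Cauchy:
 assumes f: "ctrl a b Mf f" and g: "ctrl a b Mg g" and h: "ctrl a b Mh h"
  and ab: "0 <= a" "b <= T" and st: "a <= s" "s <= t" "t <= b"
 shows "Cauchy (\<lambda>N. J N s t f g h)"
proof -
 have c: "continuous_on {a..b} f" "continuous_on {a..b} g" "continuous_on {a..b} h"
  using f g h by (auto intro: holder_continuous ctrl_holder)
 have nn: "0 <= Mf" "0 <= Mg" "0 <= Mh" using ctrl_nonneg f g h st by (meson order_trans)+
 define B where "B = 2 * (sc * (Mf * Mg * Mh))"
 define q where "q = 2 powr (1/2 - \<gamma>)"
 have q: "q < 1" "0 < q" using \<gamma>_gt powr_less_mono[of "1/2 - \<gamma>" 0 2] by (auto simp: q_def)
 have half: "2 * (x / 2) powr (\<gamma> + 1/2) = q * x powr (\<gamma> + 1/2)" if "x >= 0" for x :: real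
 proof -
  have "2 powr (\<gamma> + 1/2) * q = 2" unfolding q_def by (simp add: powr_add[symmetric])
  then show ?thesis using that by (simp add: powr_divide field_simps)
 qed
 have claim: "\<exists>n0. \<forall>N\<ge>n0. \<forall>N'\<ge>n0. norm (J N s t f g h - J N' s t f g h) <= B * (t - s) powr (\<gamma> + 1/2) * q ^ n + e"
  if "a <= s" "s <= t" "t <= b" "e > 0" for n s t e
  using that
 proof (induction n arbitrary: s t e)
  case 0
  have "Cauchy (\<lambda>N. X N s t (f s) (g s) (h s))"
   by (rule LIMSEQ_imp_Cauchy[OF X_lim]) (use 0 ab in auto)
  then obtain n0 where n0: "\<And>N N'. N >= n0 ==> N' >= n0 ==>
    norm (X N s t (f s) (g s) (h s) - X N' s t (f s) (g s) (h s)) < e"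
   using 0 unfolding Cauchy_def dist_norm by meson
  show ?case
  proof (intro exI[of _ n0] allI impI)
   fix N N' assume N: "N >= n0" "N' >= n0"
   have tri: "norm (x - y) <= norm (x - x') + norm (y - y') + norm (x' - y')" for x y x' y' :: 'v
    using norm_triangle_ineq[of "(x - x') - (y - y')" "x' - y'"] norm_triangle_ineq4[of "x - x'" "y - y'"]
    by simp
   show "norm (J N s t f g h - J N' s t f g h) <= B * (t - s) powr (\<gamma> + 1/2) * q ^ 0 + e"
    using tri[of "J N s t f g h" "J N' s t f g h" "X N s t (f s) (g s) (h s)" "X N' s t (f s) (g s) (h s)"]
     J_sewing[OF f g h ab, of s t N] J_sewing[OF f g h ab, of s t N'] n0[OF N] 0
    unfolding B_def by simp
  qed
 next
  case (Suc n)
  define m where "m = (s + t) / 2"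
  have m: "a <= m" "s <= m" "m <= t" "m <= b" "m - s = (t - s) / 2" "t - m = (t - s) / 2"
   using Suc.prems by (auto simp: m_def field_simps)
  obtain n1 where n1: "\<And>N N'. N >= n1 ==> N' >= n1 ==>
    norm (J N s m f g h - J N' s m f g h) <= B * ((t - s)/2) powr (\<gamma> + 1/2) * q ^ n + e/2"
   using Suc.IH[of s m "e/2"] Suc.prems m by (metis half_gt_zero)
  obtain n2 where n2: "\<And>N N'. N >= n2 ==> N' >= n2 ==>
    norm (J N m t f g h - J N' m t f g h) <= B * ((t - s)/2) powr (\<gamma> + 1/2) * q ^ n + e/2"
   using Suc.IH[of m t "e/2"] Suc.prems m by (metis half_gt_zero)
  show ?case
  proof (intro exI[of _ "max n1 n2"] allI impI)
   fix N N' assume N: "N >= max n1 n2" "N' >= max n1 n2"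
   have "J N s t f g h - J N' s t f g h = (J N s m f g h - J N' s m f g h) + (J N m t f g h - J N' m t f g h)"
    using J_time[OF c ab, of s m t] Suc.prems m by simp
   also have "norm ... <= (B * ((t - s)/2) powr (\<gamma> + 1/2) * q ^ n + e/2) + (B * ((t - s)/2) powr (\<gamma> + 1/2) * q ^ n + e/2)"
    using N by (intro order_trans[OF norm_triangle_ineq] add_mono n1 n2) auto
   also have "... = B * (2 * ((t - s)/2) powr (\<gamma> + 1/2)) * q ^ n + e" by simp
   also have "... = B * (q * (t - s) powr (\<gamma> + 1/2)) * q ^ n + e"
    using half[of "t - s"] Suc.prems by simp
   finally show "norm (J N s t f g h - J N' s t f g h) <= B * (t - s) powr (\<gamma> + 1/2) * q ^ Suc n + e"
    by (simp add: mult_ac)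
  qed
 qed
 show ?thesis unfolding Cauchy_def dist_norm
 proof (intro allI impI)
  fix e :: real assume e: "e > 0"
  have "(\<lambda>n. B * (t - s) powr (\<gamma> + 1/2) * q ^ n) \<longlonglongrightarrow> B * (t - s) powr (\<gamma> + 1/2) * 0"
   using q by (intro tendsto_intros LIMSEQ_realpow_zero) auto
  then have "\<forall>\<^sub>F n in sequentially. B * (t - s) powr (\<gamma> + 1/2) * q ^ n < e/2"
   using e by (intro order_tendstoD(2)) auto
  then obtain n where n: "B * (t - s) powr (\<gamma> + 1/2) * q ^ n < e/2"
   using eventually_happens'[OF sequentially_bot] by blast
  obtain n0 where "\<forall>N\<ge>n0. \<forall>N'\<ge>n0. norm (J N s t f g h - J N' s t f g h) <= B * (t - s) powr (\<gamma> + 1/2) * q ^ n + e/2"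
   using claim[OF st, of "e/2" n] e by auto
  then show "\<exists>n0. \<forall>N\<ge>n0. \<forall>N'\<ge>n0. norm (J N s t f g h - J N' s t f g h) < e"
   using n by (intro exI[of _ n0]) force
 qed
qed

text \<open>The Young integral, obtained as the limit in the cutoff and not from Riemann
  sums.\<close>

definition JJ :: "real => real => (real => 'v) => (real => 'v) => (real => 'v) => 'v" where
 "JJ s t f g h = lim (\<lambda>N. J N s t f g h)"

lemma J_tendsto:
 assumes "ctrl a b Mf f" "ctrl a b Mg g" "ctrl a b Mh h" "0 <= a" "b <= T" "a <= s" "s <= t" "t <= b"
 shows "(\<lambda>N. J N s t f g h) \<longlonglongrightarrow> JJ s t f g h"
 using J_Cauchy[OF assms] unfolding JJ_def by (simp add: Cauchy_convergent_iff convergent_LIMSEQ_iff)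

lemma JJ_bound:
 assumes "ctrl a b Mf f" "ctrl a b Mg g" "ctrl a b Mh h" "0 <= a" "b <= T" "a <= s" "s <= t" "t <= b"
 shows "norm (JJ s t f g h) <= kk * (Mf * Mg * Mh) * (t - s) powr \<gamma>"
 using J_tendsto[OF assms] J_bound[OF assms] by (intro LIMSEQ_le_const2[OF tendsto_norm]) auto

lemma JJ_time:
 assumes f: "ctrl a b Mf f" and g: "ctrl a b Mg g" and h: "ctrl a b Mh h"
  and ab: "0 <= a" "b <= T" and st: "a <= s" "s <= m" "m <= t" "t <= b"
 shows "JJ s t f g h = JJ s m f g h + JJ m t f g h"
proof (rule LIMSEQ_unique)
 show "(\<lambda>N. J N s t f g h) \<longlonglongrightarrow> JJ s t f g h"
  using st by (intro J_tendsto[OF f g h ab]) auto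
 have c: "continuous_on {a..b} f" "continuous_on {a..b} g" "continuous_on {a..b} h"
  using f g h by (auto intro: holder_continuous ctrl_holder)
 have "(\<lambda>N. J N s m f g h + J N m t f g h) \<longlonglongrightarrow> JJ s m f g h + JJ m t f g h"
  using st by (intro tendsto_add J_tendsto[OF f g h ab]) auto
 then show "(\<lambda>N. J N s t f g h) \<longlonglongrightarrow> JJ s m f g h + JJ m t f g h"
  using J_time[OF c ab st] by simp
qed

lemma JJ_sewing:
 assumes "ctrl a b Mf f" "ctrl a b Mg g" "ctrl a b Mh h"
  and "0 <= a" "b <= T" and "a <= s" "s <= t" "t <= b"
 shows "norm (JJ s t f g h - XX s t (f s) (g s) (h s)) <= sc * (Mf * Mg * Mh) * (t - s) powr (\<gamma> + 1/2)"
 using J_tendsto[OF assms] X_lim[of s t "f s" "g s" "h s"] J_sewing[OF assms] assms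
 by (intro LIMSEQ_le_const2[OF tendsto_norm[OF tendsto_diff]]) auto

text \<open>The bound of \<open>J_bound\<close> makes the paths t \<mapsto> \<open>J N a t\<close>
  \<gamma>-Hoelder with one constant for all N, and the limit inherits it. Pointwise convergence at
  the finitely many points of a grid therefore controls all times.\<close>

lemma J_uniform_limit:
 assumes f: "ctrl a b Mf f" and g: "ctrl a b Mg g" and h: "ctrl a b Mh h"
  and ab: "0 <= a" "b <= T"
 shows "uniform_limit {a..b} (\<lambda>N t. J N a t f g h) (\<lambda>t. JJ a t f g h) sequentially"
proof (cases "a <= b")
 case True
 define B where "B = kk * (Mf * Mg * Mh)"
 have nn: "0 <= Mf" "0 <= Mg" "0 <= Mh" using ctrl_nonneg f g h True by blast+
 have B: "0 <= B" unfolding B_def using nn kk_nonneg by simp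
 have c: "continuous_on {a..b} f" "continuous_on {a..b} g" "continuous_on {a..b} h"
  using f g h by (auto intro: holder_continuous ctrl_holder)
 show ?thesis
 proof (rule uniform_limitI)
  fix e :: real assume e: "e > 0"
  \<comment> \<open>The mesh of the grid: over one cell the increments of \<open>J N\<close>, for
    every N, and of the limit are at most e/4.\<close>
  define d where "d = (e / (4 * (B + 1))) powr (1 / \<gamma>)"
  have d: "d > 0" using e B by (simp add: d_def)
  have dd: "B * x powr \<gamma> <= e / 4" if "0 <= x" "x <= d" for x
  proof -
   have "x powr \<gamma> <= d powr \<gamma>" using that \<gamma>_gt by (intro powr_mono2) auto
   also have "... = e / (4 * (B + 1))" using e B \<gamma>_gt by (simp add: d_def powr_powr)
   finally have "B * x powr \<gamma> <= B * (e / (4 * (B + 1)))" using B by (intro mult_left_mono) auto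
   also have "... <= e / 4" using B e by (simp add: field_simps)
   finally show ?thesis .
  qed
  define p where "p i = a + real i * d" for i :: nat
  obtain n :: nat where n: "(b - a) / d < n" using reals_Archimedean2 by blast
  have "\<forall>\<^sub>F N in sequentially. \<forall>i\<in>{i. i <= n \<and> p i <= b}. dist (J N a (p i) f g h) (JJ a (p i) f g h) < e / 4"
  proof (rule eventually_ball_finite, simp, intro ballI)
   fix i assume "i \<in> {i. i <= n \<and> p i <= b}"
   then show "\<forall>\<^sub>F N in sequentially. dist (J N a (p i) f g h) (JJ a (p i) f g h) < e / 4"
    using e d by (intro tendstoD J_tendsto[OF f g h ab]) (auto simp: p_def)
  qed
  then show "\<forall>\<^sub>F N in sequentially. \<forall>t\<in>{a..b}. dist (J N a t f g h) (JJ a t f g h) < e"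
  proof eventually_elim
   case (elim N)
   show ?case
   proof
    fix t assume t: "t \<in> {a..b}"
    define i where "i = nat \<lfloor>(t - a) / d\<rfloor>"
    have fl: "real i <= (t - a) / d" "(t - a) / d < real i + 1"
     using t d unfolding i_def by (auto simp: of_nat_nat)
    have "(t - a) / d <= (b - a) / d" using t d by (intro divide_right_mono) auto
    then have "i <= n" using fl n by linarith
    have pi: "p i <= t" "t - p i <= d" "a <= p i"
     using fl d by (auto simp: p_def field_simps)
    have 1: "dist (J N a (p i) f g h) (JJ a (p i) f g h) < e / 4"
     using elim \<open>i <= n\<close> pi t by auto
    have "norm (J N (p i) t f g h) <= e / 4"
     using J_bound[OF f g h ab, of "p i" t N] dd[of "t - p i"] pi t unfolding B_def by auto
    moreover have "norm (JJ (p i) t f g h) <= e / 4"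
     using JJ_bound[OF f g h ab, of "p i" t] dd[of "t - p i"] pi t unfolding B_def by auto
    moreover have "J N a t f g h = J N a (p i) f g h + J N (p i) t f g h"
     using J_time[OF c ab, of a "p i" t] pi t by auto
    moreover have "JJ a t f g h = JJ a (p i) f g h + JJ (p i) t f g h"
     using JJ_time[OF f g h ab, of a "p i" t] pi t by auto
    ultimately have "J N a t f g h - JJ a t f g h = (J N a (p i) f g h - JJ a (p i) f g h) + (J N (p i) t f g h - JJ (p i) t f g h)"
     and "norm (J N (p i) t f g h - JJ (p i) t f g h) <= e / 4 + e / 4"
     using norm_triangle_ineq4[of "J N (p i) t f g h" "JJ (p i) t f g h"] by simp_all
    then have "norm (J N a t f g h - JJ a t f g h) <= norm (J N a (p i) f g h - JJ a (p i) f g h) + (e/4 + e/4)"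
     using norm_triangle_ineq[of "J N a (p i) f g h - JJ a (p i) f g h" "J N (p i) t f g h - JJ (p i) t f g h"] by simp
    then show "dist (J N a t f g h) (JJ a t f g h) < e" using 1 e unfolding dist_norm by linarith
   qed
  qed
 qed
qed (auto simp: uniform_limit_iff)

end

text \<open>The difference of squared norms is exactly additive over intervals, so its midpoint
  defect is 0. It splits into the square of the increment and twice an inner product, both of order
  larger than t - s; the sewing bound with c = 0 then forces it to vanish.\<close>

lemma norm_conserved:
 fixes v :: "real => 'v::real_inner"
 assumes \<beta>: "\<beta> > 1" and A: "A >= 0"
  and incr: "\<And>s t. a <= s ==> s <= t ==> t <= b ==> (norm (v t - v s))\<^sup>2 <= A * (t - s) powr \<beta>"
  and orth: "\<And>s t. a <= s ==> s <= t ==> t <= b ==> \<bar>inner (v s) (v t - v s)\<bar> <= A * (t - s) powr \<beta>"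
  and t: "a <= t" "t <= b"
 shows "norm (v t) = norm (v a)"
proof -
 define E where "E s t = (norm (v t))^2 - (norm (v s))\<^sup>2" for s t
 have "norm (E a t) <= 0 / (1 - 2 powr (1 - \<beta>)) * (t - a) powr \<beta>"
 proof (rule sewing_bound[where a = a and b = b])
  fix e :: real assume e: "e > 0"
  \<comment> \<open>Makes 3 A d^(\<beta> - 1) at most e; the factor 3 is one square plus twice the
    inner product.\<close>
  define d where "d = (e / (3 * A + 1)) powr (1 / (\<beta> - 1))"
  have d: "d > 0" using e A by (simp add: d_def)
  show "\<exists>d>0. \<forall>s t. a <= s --> s <= t --> t <= b --> t - s < d --> norm (E s t) <= e * (t - s)"
  proof (intro exI[of _ d] conjI allI impI d)
   fix s t assume st: "a <= s" "s <= t" "t <= b" "t - s < d"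
   have "E s t = (norm (v t - v s))^2 + 2 * inner (v s) (v t - v s)"
    unfolding E_def power2_norm_eq_inner by (simp add: inner_diff inner_commute)
   then have "\<bar>E s t\<bar> <= A * (t - s) powr \<beta> + 2 * (A * (t - s) powr \<beta>)"
    using incr[of s t] orth[of s t] st by (smt (verit) zero_le_power2)
   also have "... = 3 * A * ((t - s) powr (\<beta> - 1) * (t - s))"
    using st by (cases "s = t") (auto simp: powr_diff)
   also have "... <= 3 * A * (d powr (\<beta> - 1) * (t - s))"
    using st A \<beta> by (intro mult_left_mono mult_right_mono powr_mono2) auto
   also have "d powr (\<beta> - 1) = e / (3 * A + 1)" using e A \<beta> by (simp add: d_def powr_powr)
   also have "3 * A * (e / (3 * A + 1) * (t - s)) = (3 * A / (3 * A + 1)) * (e * (t - s))" by simp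
   also have "... <= 1 * (e * (t - s))" using A e st by (intro mult_right_mono) auto
   finally show "norm (E s t) <= e * (t - s)" by simp
  qed
 qed (use \<beta> t in "auto simp: E_def")
 then show ?thesis by (simp add: E_def)
qed

section \<open>Solutions of the Young equation: gluing, Picard iteration, stability\<close>

context young
begin

text \<open>Existence of the limit of the truncated integrals is part of the notion, as in the
  definition of the symbol for the Duhamel integral. Only \<open>F\<close> enters, so the notion
  does not change with the horizon \<open>T\<close> or the constant \<open>K\<close>, and solutions
  obtained on different horizons can be compared.\<close>

definition sol :: "real => real => (real => 'v) => bool" where
 "sol a b v \<longleftrightarrow> (\<exists>A. holder a b A v) \<and> (\<forall>t\<in>{a..b}. (\<lambda>N. J N a t v v v) \<longlonglongrightarrow> v t - v a)"

lemma sol_ctrl: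
 assumes "sol a b v" "a <= b" obtains M where "ctrl a b M v" "1 <= M"
 using assms holder_ctrl unfolding sol_def by blast

lemma sol_JJ:
 assumes v: "sol a b v" and ab: "0 <= a" "b <= T" and st: "a <= s" "s <= t" "t <= b"
 shows "v t - v s = JJ s t v v v"
proof -
 obtain M where M: "ctrl a b M v" using sol_ctrl v st by (meson order_trans)
 have *: "v t - v a = JJ a t v v v" if "a <= t" "t <= b" for t
 proof (rule LIMSEQ_unique)
  show "(\<lambda>N. J N a t v v v) \<longlonglongrightarrow> v t - v a" using v that unfolding sol_def by simp
  show "(\<lambda>N. J N a t v v v) \<longlonglongrightarrow> JJ a t v v v"
   by (rule J_tendsto[OF M M M ab]) (use that in auto)
 qed
 have "JJ a t v v v = JJ a s v v v + JJ s t v v v"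
  by (rule JJ_time[OF M M M ab]) (use st in auto)
 then show ?thesis using *[of s] *[of t] st by (simp add: algebra_simps)
qed

lemma solI:
 assumes M: "ctrl a b M v" and ab: "0 <= a" "b <= T"
  and eq: "\<And>t. a <= t ==> t <= b ==> v t - v a = JJ a t v v v"
 shows "sol a b v"
 unfolding sol_def
proof (intro conjI ballI)
 show "\<exists>A. holder a b A v" using M ctrl_holder by blast
 fix t assume "t \<in> {a..b}"
 then show "(\<lambda>N. J N a t v v v) \<longlonglongrightarrow> v t - v a"
  using eq[of t] J_tendsto[OF M M M ab, of a t] by simp
qed

lemma sol_subinterval:
 assumes v: "sol a b v" and ab: "0 <= a" "b <= T" and st: "a <= a'" "a' <= b'" "b' <= b"
 shows "sol a' b' v"
proof -
 obtain M where M: "ctrl a b M v" using sol_ctrl v st by (meson order_trans)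
 show ?thesis
 proof (rule solI)
  show "ctrl a' b' M v" by (rule ctrl_subset[OF M]) (use st in auto)
 qed (use sol_JJ[OF v ab] ab st in auto)
qed

lemma sol_join:
 assumes 1: "sol a m v" and 2: "sol m b v" and ab: "0 <= a" "b <= T" "a <= m" "m <= b"
 shows "sol a b v"
proof -
 obtain A B where AB: "ctrl a m A v" "1 <= A" "ctrl m b B v" "1 <= B" using sol_ctrl 1 2 ab by metis
 have h: "holder a b (A + B) v"
  by (rule holder_join[OF ctrl_holder[OF AB(1)] ctrl_holder[OF AB(3)]]) (use AB ab in auto)
 obtain M where M: "ctrl a b M v" using holder_ctrl[OF h] ab by force
 show ?thesis
 proof (rule solI[OF M ab(1,2)])
  fix t assume t: "a <= t" "t <= b"
  show "v t - v a = JJ a t v v v"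
  proof (cases "t <= m")
   case True
   then show ?thesis using sol_JJ[OF 1, of a t] t ab by auto
  next
   case False
   then have "v t - v m = JJ m t v v v" "v m - v a = JJ a m v v v"
    using sol_JJ[OF 2, of m t] sol_JJ[OF 1, of a m] t ab by auto
   moreover have "JJ a t v v v = JJ a m v v v + JJ m t v v v"
    by (rule JJ_time[OF M M M ab(1,2)]) (use t ab False in auto)
   ultimately show ?thesis by (simp add: algebra_simps)
  qed
 qed
qed

lemma sol_cong:
 assumes v: "sol a b v" and eq: "\<And>t. a <= t ==> t <= b ==> v t = v' t"
 shows "sol a b v'"
proof -
 have J: "J N a t v v v = J N a t v' v' v'" if "t <= b" for N t
  unfolding J_def by (rule integral_cong) (use eq that in auto)
 have hv: "holder a b A v = holder a b A v'" for A
  unfolding holder_def by (auto simp: eq)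
 have "(\<lambda>N. J N a t v' v' v') \<longlonglongrightarrow> v' t - v' a" if "t \<in> {a..b}" for t
 proof -
  have "(\<lambda>N. J N a t v v v) \<longlonglongrightarrow> v t - v a" using v that unfolding sol_def by blast
  then show ?thesis using that J[of t] eq[of t] eq[of a] by simp
 qed
 then show ?thesis using v hv unfolding sol_def by simp
qed

text \<open>The two expansions behind conservation of the norm: increments squared have order 2
  \<gamma> > 1, and up to order \<gamma> + 1/2 > 1 the increment is the value of \<open>XX\<close>
  at the initial point.\<close>

lemma sol_increments:
 assumes v: "sol a b v" and ab: "0 <= a" "b <= T" "a <= b"
 obtains A where "A >= 0"
  "\<And>s t. a <= s ==> s <= t ==> t <= b ==> norm (v t - v s) <= A * (t - s) powr \<gamma>"
  "\<And>s t. a <= s ==> s <= t ==> t <= b ==> norm (v t - v s - XX s t (v s) (v s) (v s)) <= A * (t - s) powr (\<gamma> + 1/2)"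
proof -
 obtain M where M: "ctrl a b M v" "1 <= M" using sol_ctrl v ab by metis
 define A where "A = max (kk * (M * M * M)) (sc * (M * M * M))"
 show ?thesis
 proof (rule that)
  show "A >= 0" using kk_nonneg M by (auto simp: A_def le_max_iff_disj)
  fix s t assume st: "a <= s" "s <= t" "t <= b"
  have "norm (v t - v s) <= kk * (M * M * M) * (t - s) powr \<gamma>"
   using sol_JJ[OF v ab(1,2) st] JJ_bound[OF M(1) M(1) M(1) ab(1,2) st] by simp
  also have "... <= A * (t - s) powr \<gamma>" by (intro mult_right_mono) (auto simp: A_def)
  finally show "norm (v t - v s) <= A * (t - s) powr \<gamma>" .
  have "norm (v t - v s - XX s t (v s) (v s) (v s)) <= sc * (M * M * M) * (t - s) powr (\<gamma> + 1/2)"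
   using sol_JJ[OF v ab(1,2) st] JJ_sewing[OF M(1) M(1) M(1) ab(1,2) st] by simp
  also have "... <= A * (t - s) powr (\<gamma> + 1/2)" by (intro mult_right_mono) (auto simp: A_def)
  finally show "norm (v t - v s - XX s t (v s) (v s) (v s)) <= A * (t - s) powr (\<gamma> + 1/2)" .
 qed
qed

lemma powr_gamma_le:
 assumes "s <= t" "t - s <= l" shows "(t - s) powr \<gamma> <= l powr (\<gamma> - 1/2) * sqrt (t - s)"
proof -
 have "(t - s) powr \<gamma> = (t - s) powr (\<gamma> - 1/2 + 1/2)" by simp
 also have "... = (t - s) powr (\<gamma> - 1/2) * sqrt (t - s)"
  unfolding powr_add using assms by (simp add: powr_half_sqrt)
 also have "... <= l powr (\<gamma> - 1/2) * sqrt (t - s)"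
  using assms \<gamma>_gt by (intro mult_right_mono powr_mono2) auto
 finally show ?thesis .
qed

text \<open>Expanding slot by slot leaves three integrals, each with D = f - f' in one slot. The
  initial value and the Hoelder constant of D together bound D in \<open>ctrl\<close>, since the
  interval has length at most 1. One factor (t - s)^(1/2) is kept for the Hoelder bound; the surplus
  power \<gamma> - 1/2 of the length is what makes the factor 1/2 possible.\<close>

lemma JJ_contract:
 assumes f: "ctrl a b M f" and f': "ctrl a b M f'" and M: "1 <= M"
  and d: "holder a b d (\<lambda>t. f t - f' t)" "0 <= d"
  and \<delta>: "norm (f a - f' a) <= \<delta>"
  and short: "short_time K \<gamma> T M (b - a)"
  and ab: "0 <= a" "b <= T" and st: "a <= s" "s <= t" "t <= b"
 shows "norm (JJ s t f f f - JJ s t f' f' f') <= (\<delta> + d) / 2 * sqrt (t - s)"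
proof -
 define D where "D t = f t - f' t" for t
 have \<delta>0: "0 <= \<delta>" using \<delta> norm_ge_zero order_trans by blast
 have Dc: "ctrl a b (\<delta> + d) D"
  unfolding ctrl_def
 proof
  show "holder a b (\<delta> + d) D" using holder_mono[OF d(1), of "\<delta> + d"] \<delta>0 unfolding D_def[abs_def] by simp
  show "\<forall>t\<in>{a..b}. norm (D t) <= \<delta> + d"
  proof
   fix t assume t: "t \<in> {a..b}"
   have "norm (D t) <= norm (D a) + norm (D t - D a)" using norm_triangle_ineq[of "D a" "D t - D a"] by simp
   also have "... <= \<delta> + d * sqrt (t - a)"
    using holderD[OF d(1), of a t] \<delta> t by (intro add_mono) (auto simp: D_def)
   also have "... <= \<delta> + d * 1"
    using d(2) t short unfolding short_time_def by (intro add_left_mono mult_left_mono) auto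
   finally show "norm (D t) <= \<delta> + d" by simp
  qed
 qed
 have c: "continuous_on {a..b} f" "continuous_on {a..b} f'" "continuous_on {a..b} D"
  using f f' Dc by (auto intro: holder_continuous ctrl_holder)
 have Jeq: "J N s t f f f - J N s t f' f' f' = J N s t D f f + J N s t f' D f + J N s t f' f' D" for N
 proof -
  have c': "continuous_on {s..t} f" "continuous_on {s..t} f'" "continuous_on {s..t} D"
   using c st by (auto intro: continuous_on_subset)
  have st': "0 <= s" "t <= T" using st ab by auto
  note int = F_path_integrable[OF _ _ _ st']
  have "J N s t f f f - J N s t f' f' f' = integral {s..t} (\<lambda>r. F N r (f r) (f r) (f r) - F N r (f' r) (f' r) (f' r))"
   unfolding J_def by (rule Henstock_Kurzweil_Integration.integral_diff[symmetric]) (intro int c')+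
  also have "... = integral {s..t} (\<lambda>r. F N r (D r) (f r) (f r) + F N r (f' r) (D r) (f r) + F N r (f' r) (f' r) (D r))"
   unfolding D_def F_diff[of N _ "f _" "f _" "f _"] ..
  also have "... = J N s t D f f + J N s t f' D f + J N s t f' f' D"
   unfolding J_def
   by (subst Henstock_Kurzweil_Integration.integral_add,
     intro integrable_add int c', intro int c',
     subst Henstock_Kurzweil_Integration.integral_add, intro int c', intro int c', rule refl)
  finally show ?thesis .
 qed
 have nn: "0 <= \<delta> + d" "0 <= M" using d \<delta>0 M by auto
 have bnd: "norm (J N s t f f f - J N s t f' f' f') <= (\<delta> + d) / 2 * sqrt (t - s)" for N
 proof -
  have "norm (J N s t f f f - J N s t f' f' f')
    <= kk * ((\<delta> + d) * M * M) * (t - s) powr \<gamma> + kk * (M * (\<delta> + d) * M) * (t - s) powr \<gamma>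
     + kk * (M * M * (\<delta> + d)) * (t - s) powr \<gamma>"
   unfolding Jeq
   by (intro order_trans[OF norm_triangle_ineq] add_mono J_bound[OF Dc f f ab st]
     J_bound[OF f' Dc f ab st] J_bound[OF f' f' Dc ab st])
  also have "... = 3 * kk * (\<delta> + d) * M\<^sup>2 * (t - s) powr \<gamma>" by (simp add: algebra_simps power2_eq_square)
  \<comment> \<open>The square is enlarged to the cube, using 1 <= M, to fit the single smallness
    condition \<open>short_time\<close>.\<close>
  also have "... <= 3 * kk * (\<delta> + d) * M^3 * ((b - a) powr (\<gamma> - 1/2) * sqrt (t - s))"
   using kk_nonneg nn M st by (intro mult_mono powr_gamma_le power_increasing) auto
  also have "... = (3 * kk * (b - a) powr (\<gamma> - 1/2) * M^3) * ((\<delta> + d) * sqrt (t - s))" by simp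
  also have "... <= 1/2 * ((\<delta> + d) * sqrt (t - s))"
   using short nn st unfolding short_time_def by (intro mult_right_mono) auto
  finally show ?thesis by simp
 qed
 show ?thesis
  by (rule LIMSEQ_le_const2[OF tendsto_norm[OF tendsto_diff[OF J_tendsto[OF f f f ab st] J_tendsto[OF f' f' f' ab st]]]])
   (use bnd in auto)
qed

lemma JJ_self_bound:
 assumes f: "ctrl a b M f" and M: "1 <= M" and short: "short_time K \<gamma> T M (b - a)"
  and ab: "0 <= a" "b <= T" and st: "a <= s" "s <= t" "t <= b"
 shows "norm (JJ s t f f f) <= sqrt (t - s)"
proof -
 have "norm (JJ s t f f f) <= kk * (M * M * M) * (t - s) powr \<gamma>" by (rule JJ_bound[OF f f f ab st])
 also have "... <= kk * (M * M * M) * ((b - a) powr (\<gamma> - 1/2) * sqrt (t - s))"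
  using kk_nonneg M st by (intro mult_left_mono powr_gamma_le) auto
 also have "... = (3 * kk * (b - a) powr (\<gamma> - 1/2) * M^3) * (sqrt (t - s) / 3)"
  by (simp add: power3_eq_cube)
 also have "... <= 1/2 * (sqrt (t - s) / 3)"
  using short st unfolding short_time_def by (intro mult_right_mono) auto
 also have "... <= sqrt (t - s)" using st by simp
 finally show ?thesis .
qed

primrec picard :: "real => 'v => nat => real => 'v" where
 "picard a va 0 = (\<lambda>t. va)"
| "picard a va (Suc k) = (\<lambda>t. va + JJ a t (picard a va k) (picard a va k) (picard a va k))"

lemma holder_1_ctrl:
 assumes "holder a b 1 v" "norm (v a) <= R" "b - a <= 1" shows "ctrl a b (R + 1) v"
 unfolding ctrl_def
proof
 have "0 <= R" using assms(2) norm_ge_zero order_trans by blast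
 then show "holder a b (R + 1) v" using holder_mono[OF assms(1)] by simp
 show "\<forall>t\<in>{a..b}. norm (v t) <= R + 1"
 proof
  fix t assume t: "t \<in> {a..b}"
  have "norm (v t) <= norm (v a) + norm (v t - v a)" using norm_triangle_ineq[of "v a" "v t - v a"] by simp
  also have "... <= R + 1 * sqrt (t - a)" using holderD[OF assms(1), of a t] assms(2) t by (intro add_mono) auto
  also have "... <= R + 1" using t assms(3) by simp
  finally show "norm (v t) <= R + 1" .
 qed
qed

text \<open>The iteration preserves the initial value va and Hoelder constant 1, hence the bound R +
  1 on an interval of length at most 1. As all iterates start at va, the contraction applies with
  \<delta> = 0 and successive differences halve in the Hoelder seminorm.\<close>

lemma local_solution:
 assumes ab: "0 <= a" "a <= b" "b <= T" and va: "norm va <= R"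
  and short: "short_time K \<gamma> T (R + 1) (b - a)"
 obtains v where "v a = va" "sol a b v"  "holder a b 1 v"
proof -
 define v where "v = picard a va"
 have R: "0 <= R" using va norm_ge_zero order_trans by blast
 have l1: "b - a <= 1" using short unfolding short_time_def by simp
 have M: "1 <= R + 1" using R by simp
 have ab': "0 <= a" "b <= T" using ab by auto
 have v_Suc: "v (Suc k) t = va + JJ a t (v k) (v k) (v k)" for k t by (simp add: v_def)
 have base: "JJ a a f f f = 0" for f by (simp add: JJ_def J_def)
 have va': "v k a = va" for k by (cases k) (auto simp: v_def base)
 have h: "holder a b 1 (v k)" for k
 proof (induction k)
  case 0 show ?case by (rule holderI) (simp add: v_def)
 next
  case (Suc k)
  have c: "ctrl a b (R + 1) (v k)" using Suc va' va l1 by (intro holder_1_ctrl) auto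
  show ?case
  proof (rule holderI)
   fix s t assume st: "a <= s" "s <= t" "t <= b"
   have "v (Suc k) t - v (Suc k) s = JJ s t (v k) (v k) (v k)"
    using JJ_time[OF c c c ab', of a s t] st by (simp add: v_Suc)
   then show "norm (v (Suc k) t - v (Suc k) s) <= 1 * sqrt (t - s)"
    using JJ_self_bound[OF c M short ab' st] by simp
  qed
 qed
 have c: "ctrl a b (R + 1) (v k)" for k using h va' va l1 by (intro holder_1_ctrl) auto
 have diff: "holder a b (2 / 2 ^ k) (\<lambda>t. v (Suc k) t - v k t)" for k
 proof (induction k)
  case 0
  show ?case
  proof (rule holderI)
   fix s t assume st: "a <= s" "s <= t" "t <= b"
   have "norm (v (Suc 0) t - v 0 t - (v (Suc 0) s - v 0 s)) = norm (v (Suc 0) t - v (Suc 0) s)"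
    by (simp add: v_def)
   also have "... <= 1 * sqrt (t - s)" by (rule holderD[OF h st])
   also have "... <= 2 / 2 ^ 0 * sqrt (t - s)" using st by simp
   finally show "norm (v (Suc 0) t - v 0 t - (v (Suc 0) s - v 0 s)) <= 2 / 2 ^ 0 * sqrt (t - s)" .
  qed
 next
  case (Suc k)
  show ?case
  proof (rule holderI)
   fix s t assume st: "a <= s" "s <= t" "t <= b"
   have "v (Suc (Suc k)) t - v (Suc k) t - (v (Suc (Suc k)) s - v (Suc k) s)
     = JJ s t (v (Suc k)) (v (Suc k)) (v (Suc k)) - JJ s t (v k) (v k) (v k)"
    using JJ_time[OF c c c ab', of a s t "Suc k" "Suc k" "Suc k"] JJ_time[OF c c c ab', of a s t k k k] st
    by (simp add: v_Suc)
   also have "norm ... <= (0 + 2 / 2 ^ k) / 2 * sqrt (t - s)"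
    using va' by (intro JJ_contract[OF c c M Suc _ _ short ab' st]) auto
   finally show "norm (v (Suc (Suc k)) t - v (Suc k) t - (v (Suc (Suc k)) s - v (Suc k) s))
     <= 2 / 2 ^ Suc k * sqrt (t - s)" by simp
  qed
 qed
 have diff_j: "holder a b (4 / 2 ^ k) (\<lambda>t. v (k + j) t - v k t)" for k j
 proof -
  \<comment> \<open>The exact partial sum of the geometric series of the successive differences, so
    that the induction on j closes without loss.\<close>
  have "holder a b (4 / 2 ^ k - 4 / 2 ^ (k + j)) (\<lambda>t. v (k + j) t - v k t)"
  proof (induction j)
   case 0 show ?case by (rule holderI) simp
  next
   case (Suc j)
   show ?case
   proof (rule holderI)
    fix s t assume st: "a <= s" "s <= t" "t <= b"
    have "norm (v (k + Suc j) t - v k t - (v (k + Suc j) s - v k s))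
      <= norm (v (Suc (k + j)) t - v (k + j) t - (v (Suc (k + j)) s - v (k + j) s))
       + norm (v (k + j) t - v k t - (v (k + j) s - v k s))"
     using norm_triangle_ineq[of "v (Suc (k + j)) t - v (k + j) t - (v (Suc (k + j)) s - v (k + j) s)"
       "v (k + j) t - v k t - (v (k + j) s - v k s)"] by (simp add: algebra_simps)
    also have "... <= 2 / 2 ^ (k + j) * sqrt (t - s) + (4 / 2 ^ k - 4 / 2 ^ (k + j)) * sqrt (t - s)"
     by (intro add_mono holderD[OF diff st] holderD[OF Suc st])
    also have "... = (4 / 2 ^ k - 4 / 2 ^ (k + Suc j)) * sqrt (t - s)" by (simp add: algebra_simps)
    finally show "norm (v (k + Suc j) t - v k t - (v (k + Suc j) s - v k s))
      <= (4 / 2 ^ k - 4 / 2 ^ (k + Suc j)) * sqrt (t - s)" .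
   qed
  qed
  then show ?thesis by (rule holder_mono) simp
 qed
 have p0: "(\<lambda>k. 4 / 2 ^ k :: real) \<longlonglongrightarrow> 0"
  using tendsto_mult[OF tendsto_const[of 4] LIMSEQ_realpow_zero[of "1/2 :: real"]]
  by (simp add: power_divide)
 have sup_j: "norm (v (k + j) t - v k t) <= 4 / 2 ^ k" if "a <= t" "t <= b" for k j t
 proof -
  have "norm (v (k + j) t - v k t) <= 4 / 2 ^ k * sqrt (t - a)"
   using holderD[OF diff_j, of a t k j] va' that by simp
  also have "... <= 4 / 2 ^ k * 1" using that l1 by (intro mult_left_mono) auto
  finally show ?thesis by simp
 qed
 have conv: "convergent (\<lambda>k. v k t)" if t: "a <= t" "t <= b" for t
 proof -
  have "Cauchy (\<lambda>k. v k t)"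
  proof (rule CauchyI)
   fix e :: real assume e: "e > 0"
   obtain n where n: "4 / 2 ^ n < e / 2"
    using order_tendstoD(2)[OF p0, of "e / 2"] e eventually_happens'[OF sequentially_bot] by (metis half_gt_zero)
   show "\<exists>n. \<forall>i\<ge>n. \<forall>j\<ge>n. norm (v i t - v j t) < e"
   proof (intro exI[of _ n] allI impI)
    fix i j assume ij: "n <= i" "n <= j"
    have "norm (v i t - v j t) <= norm (v i t - v n t) + norm (v j t - v n t)"
     using norm_triangle_ineq4[of "v i t - v n t" "v j t - v n t"] by simp
    also have "... <= 4 / 2 ^ n + 4 / 2 ^ n"
     using sup_j[OF t, of n "i - n"] sup_j[OF t, of n "j - n"] ij by simp
    finally show "norm (v i t - v j t) < e" using n by simp
   qed
  qed
  then show ?thesis by (simp add: Cauchy_convergent_iff)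
 qed
 define u where "u t = lim (\<lambda>k. v k t)" for t
 have lim: "(\<lambda>k. v k t) \<longlonglongrightarrow> u t" if "a <= t" "t <= b" for t
  using conv[OF that] unfolding u_def by (simp add: convergent_LIMSEQ_iff)
 have ua: "u a = va" using lim[of a] ab va' LIMSEQ_unique[OF _ tendsto_const] by simp
 have uh: "holder a b 1 u"
 proof (rule holderI)
  fix s t assume st: "a <= s" "s <= t" "t <= b"
  show "norm (u t - u s) <= 1 * sqrt (t - s)"
   by (rule LIMSEQ_le_const2[OF tendsto_norm[OF tendsto_diff[OF lim lim]]])
    (use st holderD[OF h st] in auto)
 qed
 have uc: "ctrl a b (R + 1) u" using uh ua va l1 by (intro holder_1_ctrl) auto
 have ud: "holder a b (4 / 2 ^ k) (\<lambda>t. u t - v k t)" for k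
 proof (rule holderI)
  fix s t assume st: "a <= s" "s <= t" "t <= b"
  have "(\<lambda>j. v (k + j) t - v k t - (v (k + j) s - v k s)) \<longlonglongrightarrow> u t - v k t - (u s - v k s)"
   using st LIMSEQ_ignore_initial_segment[OF lim, of _ k] by (intro tendsto_intros) (auto simp: add.commute)
  then show "norm (u t - v k t - (u s - v k s)) <= 4 / 2 ^ k * sqrt (t - s)"
   by (rule LIMSEQ_le_const2[OF tendsto_norm]) (use holderD[OF diff_j st] in auto)
 qed
 have "sol a b u"
 proof (rule solI[OF uc ab'])
  fix t assume t: "a <= t" "t <= b"
  have bnd: "norm (JJ a t u u u - JJ a t (v k) (v k) (v k)) <= 4 / 2 ^ k" for k
  proof -
   have "norm (JJ a t u u u - JJ a t (v k) (v k) (v k)) <= (0 + 4 / 2 ^ k) / 2 * sqrt (t - a)"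
    by (rule JJ_contract[OF uc c M ud _ _ short ab']) (use ua va' t in auto)
   also have "... <= (0 + 4 / 2 ^ k) / 2 * 1" using t l1 by (intro mult_left_mono) auto
   also have "... <= 4 / 2 ^ k" by (simp add: field_simps)
   finally show ?thesis .
  qed
  have "(\<lambda>k. JJ a t u u u - JJ a t (v k) (v k) (v k)) \<longlonglongrightarrow> 0"
   by (rule LIMSEQ_0_le[OF bnd p0])
  then have "(\<lambda>k. JJ a t u u u - (v (Suc k) t - va)) \<longlonglongrightarrow> 0" by (simp add: v_Suc)
  moreover have "(\<lambda>k. JJ a t u u u - (v (Suc k) t - va)) \<longlonglongrightarrow> JJ a t u u u - (u t - va)"
   using LIMSEQ_Suc[OF lim[OF t]] by (intro tendsto_intros)
  ultimately have "JJ a t u u u - (u t - va) = 0" using LIMSEQ_unique by blast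
  then show "u t - u a = JJ a t u u u" by (simp add: ua)
 qed
 then show ?thesis using that ua uh by blast
qed

text \<open>If the difference has Hoelder constant \<delta> + x, where \<delta> is its initial size,
  the contraction improves this to (\<delta> + (\<delta> + x)) / 2 = \<delta> + x/2. Starting from
  the trivial constant 2 M and iterating leaves \<delta> alone.\<close>

lemma sol_diff_holder:
 assumes u: "sol a b u" and v: "sol a b v" and uM: "ctrl a b M u" and vM: "ctrl a b M v" and M: "1 <= M"
  and ab: "0 <= a" "b <= T" and short: "short_time K \<gamma> T M (b - a)"
 shows "holder a b (norm (u a - v a)) (\<lambda>t. u t - v t)"
proof -
 define \<delta> where "\<delta> = norm (u a - v a)"
 have *: "holder a b (\<delta> + 2 * M / 2 ^ n) (\<lambda>t. u t - v t)" for n :: nat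
 proof (induction n)
  case 0
  have "holder a b (2 * M) (\<lambda>t. u t - v t)"
  proof (rule holderI)
   fix s t assume st: "a <= s" "s <= t" "t <= b"
   have "norm (u t - v t - (u s - v s)) <= norm (u t - u s) + norm (v t - v s)"
    using norm_triangle_ineq4[of "u t - u s" "v t - v s"] by (simp add: algebra_simps)
   also have "... <= M * sqrt (t - s) + M * sqrt (t - s)"
    by (intro add_mono holderD[OF ctrl_holder[OF uM] st] holderD[OF ctrl_holder[OF vM] st])
   finally show "norm (u t - v t - (u s - v s)) <= 2 * M * sqrt (t - s)" by simp
  qed
  then show ?case by (rule holder_mono) (simp add: \<delta>_def)
 next
  case (Suc n)
  show ?case
  proof (rule holderI)
   fix s t assume st: "a <= s" "s <= t" "t <= b"
   have "u t - v t - (u s - v s) = JJ s t u u u - JJ s t v v v"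
    using sol_JJ[OF u ab st] sol_JJ[OF v ab st] by (simp add: algebra_simps)
   also have "norm ... <= (\<delta> + (\<delta> + 2 * M / 2 ^ n)) / 2 * sqrt (t - s)"
    by (rule JJ_contract[OF uM vM M Suc _ _ short ab st]) (use M in "auto simp: \<delta>_def")
   also have "(\<delta> + (\<delta> + 2 * M / 2 ^ n)) / 2 = \<delta> + 2 * M / 2 ^ Suc n" by (simp add: field_simps)
   finally show "norm (u t - v t - (u s - v s)) <= (\<delta> + 2 * M / 2 ^ Suc n) * sqrt (t - s)" .
  qed
 qed
 have lim: "(\<lambda>n. (\<delta> + 2 * M / 2 ^ n) * x) \<longlonglongrightarrow> \<delta> * x" for x :: real
 proof -
  have "(\<lambda>n. (\<delta> + 2 * M * (1/2) ^ n) * x) \<longlonglongrightarrow> (\<delta> + 2 * M * 0) * x"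
   by (intro tendsto_intros LIMSEQ_realpow_zero) auto
  then show ?thesis by (simp add: power_divide)
 qed
 have "holder a b \<delta> (\<lambda>t. u t - v t)"
  by (rule holderI, rule LIMSEQ_le_const[OF lim]) (use holderD[OF *] in blast)
 then show ?thesis by (simp add: \<delta>_def)
qed

text \<open>Each solution has some bound on [a,b], not known in advance; a common bound M fixes a
  step length \<tau>. On every step the difference has a Hoelder constant equal to its initial size,
  which is 0, and finitely many steps cover the interval.\<close>

lemma sol_unique:
 assumes u: "sol a b u" and v: "sol a b v" and eq: "u a = v a" and ab: "0 <= a" "b <= T"
  and t: "a <= t" "t <= b"
 shows "u t = v t"
proof -
 obtain Mu Mv where Mu: "ctrl a b Mu u" "1 <= Mu" and Mv: "ctrl a b Mv v" "1 <= Mv"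
  using sol_ctrl u v t by (metis order_trans)
 define M where "M = max Mu Mv"
 have M: "ctrl a b M u" "ctrl a b M v" "1 <= M"
  using Mu Mv by (auto simp: M_def intro: ctrl_mono)
 obtain \<tau> where \<tau>: "\<tau> > 0" "short_time K \<gamma> T M \<tau>"
  using ex_short_time[OF \<gamma>_gt K_nonneg T_nonneg, of M] M by auto
 have *: "\<forall>t. a <= t --> t <= b --> t <= a + real n * \<tau> --> u t = v t" for n
 proof (induction n)
  case 0 then show ?case using eq by force
 next
  case (Suc n)
  show ?case
  proof (intro allI impI)
   fix t assume t: "a <= t" "t <= b" "t <= a + real (Suc n) * \<tau>"
   define m where "m = min t (a + real n * \<tau>)"
   have m: "a <= m" "m <= t" "t - m <= \<tau>" using t \<tau> by (auto simp: m_def algebra_simps)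
   have um: "u m = v m" using Suc m t by (auto simp: m_def)
   have "holder m t (norm (u m - v m)) (\<lambda>t. u t - v t)"
   proof (rule sol_diff_holder)
    show "sol m t u" "sol m t v" using sol_subinterval u v ab m t by auto
    show "ctrl m t M u" "ctrl m t M v" using ctrl_subset M m t by auto
    show "short_time K \<gamma> T M (t - m)"
     by (rule short_time_mono[OF \<tau>(2) \<gamma>_gt K_nonneg T_nonneg]) (use M m in auto)
   qed (use M ab m t in auto)
   from holderD[OF this, of m t] show "u t = v t" using um m by simp
  qed
 qed
 obtain n :: nat where "(t - a) / \<tau> < n" using reals_Archimedean2 by blast
 then have "t <= a + real n * \<tau>" using \<tau> by (simp add: field_simps)
 then show ?thesis using * t by blast
qed

text \<open>Turns the unspecified Hoelder constant of a solution into one governed by the datum: the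
  solution constructed by Picard iteration has constant 1, and uniqueness identifies it with
  u.\<close>

lemma sol_short_bound:
 assumes u: "sol a b u" and ab: "0 <= a" "a <= b" "b <= T" and R: "norm (u a) <= R"
  and short: "short_time K \<gamma> T (R + 1) (b - a)"
 shows "holder a b 1 u" "ctrl a b (R + 1) u"
proof -
 obtain v where v: "v a = u a" "sol a b v" "holder a b 1 v" using local_solution[OF ab R short] by blast
 have "u t = v t" if "a <= t" "t <= b" for t
  by (rule sol_unique[OF u v(2)]) (use v ab that in auto)
 then show "holder a b 1 u" using v(3) unfolding holder_def by simp
 then show "ctrl a b (R + 1) u" using R short unfolding short_time_def by (intro holder_1_ctrl) auto
qed

text \<open>On a step of length \<tau> the difference has a Hoelder constant equal to its size at
  the start of the step, so joining steps at most doubles both its size and its Hoelder constant.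
  The number of steps is read off from the horizon T, which gives one L for all pairs of solutions
  bounded by M.\<close>

lemma sol_lipschitz:
 assumes M: "1 <= M"
 shows "\<exists>L\<ge>0. \<forall>b u v. 0 <= b --> b <= T --> sol 0 b u --> sol 0 b v --> ctrl 0 b M u --> ctrl 0 b M v -->
  ctrl 0 b (L * norm (u 0 - v 0)) (\<lambda>t. u t - v t)"
proof -
 obtain \<tau> where \<tau>: "\<tau> > 0" "short_time K \<gamma> T M \<tau>"
  using ex_short_time[OF \<gamma>_gt K_nonneg T_nonneg, of M] M by auto
 have *: "\<forall>b u v. 0 <= b --> b <= T --> b <= real n * \<tau> --> sol 0 b u --> sol 0 b v --> ctrl 0 b M u --> ctrl 0 b M v -->
  ctrl 0 b (2 ^ n * norm (u 0 - v 0)) (\<lambda>t. u t - v t)" for n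
 proof (induction n)
  case 0
  show ?case by (auto simp: ctrl_def holder_def)
 next
  case (Suc n)
  show ?case
  proof (intro allI impI)
   fix b u v
   assume b: "0 <= b" "b <= T" "b <= real (Suc n) * \<tau>" and u: "sol 0 b u" and v: "sol 0 b v"
    and uM: "ctrl 0 b M u" and vM: "ctrl 0 b M v"
   define m where "m = min b (real n * \<tau>)"
   define \<delta> where "\<delta> = 2 ^ n * norm (u 0 - v 0)"
   have \<delta>0: "0 <= \<delta>" by (simp add: \<delta>_def)
   have m: "0 <= m" "m <= b" "b - m <= \<tau>" "m <= real n * \<tau>" using b \<tau> by (auto simp: m_def algebra_simps)
   have c1: "ctrl 0 m \<delta> (\<lambda>t. u t - v t)"
    using Suc m b sol_subinterval[OF u, of 0 m] sol_subinterval[OF v, of 0 m]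
     ctrl_subset[OF uM, of 0 m] ctrl_subset[OF vM, of 0 m] unfolding \<delta>_def by simp
   have "holder m b (norm (u m - v m)) (\<lambda>t. u t - v t)"
   proof (rule sol_diff_holder)
    show "sol m b u" "sol m b v" using sol_subinterval u v m b by auto
    show "ctrl m b M u" "ctrl m b M v" using ctrl_subset[OF uM, of m b] ctrl_subset[OF vM, of m b] m by auto
    show "short_time K \<gamma> T M (b - m)"
     by (rule short_time_mono[OF \<tau>(2) \<gamma>_gt K_nonneg T_nonneg]) (use M m in auto)
   qed (use M m b in auto)
   then have h2: "holder m b \<delta> (\<lambda>t. u t - v t)"
    using ctrl_norm[OF c1, of m] m by (auto intro: holder_mono)
   have "holder 0 b (\<delta> + \<delta>) (\<lambda>t. u t - v t)"
    by (rule holder_join[OF ctrl_holder[OF c1] h2]) (use m \<delta>0 in auto)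
   moreover have "norm (u t - v t) <= \<delta> + \<delta>" if "0 <= t" "t <= b" for t
   proof (cases "t <= m")
    case True then show ?thesis using ctrl_norm[OF c1, of t] that \<delta>0 by simp
   next
    case False
    have l1: "b - m <= 1" using \<tau> m unfolding short_time_def by simp
    have "norm (u t - v t) <= norm (u m - v m) + norm (u t - v t - (u m - v m))"
     using norm_triangle_ineq[of "u m - v m" "u t - v t - (u m - v m)"] by simp
    also have "... <= \<delta> + \<delta> * sqrt (t - m)"
     using holderD[OF h2, of m t] ctrl_norm[OF c1, of m] False that m by (intro add_mono) auto
    also have "... <= \<delta> + \<delta> * 1" using l1 that \<delta>0 by (intro add_left_mono mult_left_mono) auto
    finally show ?thesis by simp
   qed
   ultimately show "ctrl 0 b (2 ^ Suc n * norm (u 0 - v 0)) (\<lambda>t. u t - v t)"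
    unfolding ctrl_def by (simp add: \<delta>_def mult.assoc)
  qed
 qed
 obtain n :: nat where "T / \<tau> < n" using reals_Archimedean2 by blast
 then have "T <= real n * \<tau>" using \<tau> by (simp add: field_simps)
 then show ?thesis using *[of n] by (intro exI[of _ "2 ^ n"]) auto
qed

end

section \<open>The space of square integrable functions\<close>

lemmas LINT_cong = Bochner_Integration.integral_cong[OF refl]
lemmas LINT_cmult = Bochner_Integration.integral_mult_right_zero
lemmas LINT_multc = Bochner_Integration.integral_mult_left_zero
lemmas LINT_cnj = Bochner_Integration.integral_cnj
lemmas integrable_cmult = Bochner_Integration.integrable_mult_right
lemmas integrable_multc = Bochner_Integration.integrable_mult_left

abbreviation fmeas :: "domain => (real => 'a::topological_space) set" where
 "fmeas M \<equiv> borel_measurable (freq M)"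

abbreviation freq_sq :: "domain => (real \<times> real) measure" where
 "freq_sq M \<equiv> freq M \<Otimes>\<^sub>M freq M"

text \<open>Valued in \<open>ennreal\<close>, so that identities such as Plancherel's carry
  finiteness with them and limits can be taken before square integrability is known.\<close>

definition sqn :: "real measure => (real => complex) => ennreal" where
 "sqn \<mu> f = (\<integral>\<^sup>+x. ennreal ((cmod (f x))^2) \<partial>\<mu>)"

lemma L2_iff: "f \<in> L2 \<mu> \<longleftrightarrow> f \<in> borel_measurable \<mu> \<and> sqn \<mu> f < \<infinity>"
 unfolding L2_def sqn_def by (auto simp: integrable_iff_bounded)

lemma L2_measurable [measurable_dest]: "f \<in> L2 \<mu> ==> f \<in> borel_measurable \<mu>"
 by (simp add: L2_def)

lemma L2_sqn_finite: "f \<in> L2 \<mu> ==> sqn \<mu> f < \<infinity>"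
 by (simp add: L2_iff)

lemma L2_integrable_square: "f \<in> L2 \<mu> ==> integrable \<mu> (\<lambda>x. (cmod (f x))^2)"
 by (simp add: L2_def)

lemma sqn_eq_integral: "f \<in> L2 \<mu> ==> sqn \<mu> f = ennreal (LINT x|\<mu>. (cmod (f x))^2)"
 unfolding sqn_def by (rule nn_integral_eq_integral) (auto simp: L2_def)

lemma sqn_cong_AE: "AE x in \<mu>. f x = g x ==> sqn \<mu> f = sqn \<mu> g"
 unfolding sqn_def by (rule nn_integral_cong_AE) auto

lemma sqn_mono:
 assumes "AE x in \<mu>. cmod (f x) <= cmod (g x)" shows "sqn \<mu> f <= sqn \<mu> g"
 unfolding sqn_def using assms by (intro nn_integral_mono_AE) (auto simp: power_mono)

lemma sqn_scale:
 assumes "f \<in> borel_measurable \<mu>" shows "sqn \<mu> (\<lambda>x. c * f x) = ennreal ((cmod c)^2) * sqn \<mu> f"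
 unfolding sqn_def using assms
 by (subst nn_integral_cmult[symmetric]) (auto simp: norm_mult power_mult_distrib ennreal_mult)

lemma sqn_add_le:
 assumes [measurable]: "f \<in> borel_measurable \<mu>" "g \<in> borel_measurable \<mu>"
 shows "sqn \<mu> (\<lambda>x. f x + g x) <= 2 * (sqn \<mu> f + sqn \<mu> g)"
proof -
 have "(cmod (f x + g x))^2 <= 2 * ((cmod (f x))^2 + (cmod (g x))^2)" for x
 proof -
  have "(cmod (f x + g x))^2 <= (cmod (f x) + cmod (g x))^2"
   by (intro power_mono norm_triangle_ineq) auto
  also have "... <= 2 * ((cmod (f x))^2 + (cmod (g x))^2)"
   using sum_squares_bound[of "cmod (f x)" "cmod (g x)"] by (simp add: power2_sum)
  finally show ?thesis .
 qed
 then have "sqn \<mu> (\<lambda>x. f x + g x) <= (\<integral>\<^sup>+x. 2 * (ennreal ((cmod (f x))^2) + ennreal ((cmod (g x))^2)) \<partial>\<mu>)"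
  unfolding sqn_def
  by (intro nn_integral_mono) (simp add: ennreal_plus[symmetric] ennreal_mult[symmetric] del: ennreal_plus
    flip: ennreal_numeral)
 also have "... = 2 * (sqn \<mu> f + sqn \<mu> g)"
  unfolding sqn_def by (simp add: nn_integral_cmult nn_integral_add)
 finally show ?thesis .
qed

lemma sqn_diff_commute: "sqn \<mu> (\<lambda>x. f x - g x) = sqn \<mu> (\<lambda>x. g x - f x)"
 by (simp add: sqn_def norm_minus_commute)

lemma sqn_zero_iff: "f \<in> borel_measurable \<mu> ==> sqn \<mu> f = 0 \<longleftrightarrow> (AE x in \<mu>. f x = 0)"
 unfolding sqn_def by (subst nn_integral_0_iff_AE) auto

lemma L2_add: "f \<in> L2 \<mu> ==> g \<in> L2 \<mu> ==> (\<lambda>x. f x + g x) \<in> L2 \<mu>"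
 unfolding L2_iff using sqn_add_le[of f \<mu> g]
 by (auto intro!: le_less_trans[OF sqn_add_le] simp: ennreal_mult_less_top)

lemma L2_scale: "f \<in> L2 \<mu> ==> (\<lambda>x. c * f x) \<in> L2 \<mu>"
 unfolding L2_iff by (auto simp: sqn_scale ennreal_mult_less_top)

lemma L2_diff: "f \<in> L2 \<mu> ==> g \<in> L2 \<mu> ==> (\<lambda>x. f x - g x) \<in> L2 \<mu>"
 using L2_add[of f \<mu> "\<lambda>x. -1 * g x"] L2_scale[of g \<mu> "-1"] by simp

lemma L2_zero: "(\<lambda>x. 0) \<in> L2 \<mu>"
 by (simp add: L2_iff sqn_def)

lemma L2_bound:
 assumes "g \<in> L2 \<mu>" "f \<in> borel_measurable \<mu>" "AE x in \<mu>. cmod (f x) <= cmod (g x)"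
 shows "f \<in> L2 \<mu>"
 using sqn_mono[OF assms(3)] assms by (auto simp: L2_iff intro: le_less_trans)

lemma L2_mult_bounded:
 assumes "f \<in> L2 \<mu>" "b \<in> borel_measurable \<mu>" "\<And>x. x \<in> space \<mu> ==> cmod (b x) <= B"
 shows "(\<lambda>x. b x * f x) \<in> L2 \<mu>"
proof (rule L2_bound[OF L2_scale[OF assms(1), of "of_real \<bar>B\<bar>"]])
 show "(\<lambda>x. b x * f x) \<in> borel_measurable \<mu>" using assms by measurable
 show "AE x in \<mu>. cmod (b x * f x) <= cmod (of_real \<bar>B\<bar> * f x)"
  using assms(3) by (intro AE_I2) (force simp: norm_mult intro!: mult_right_mono)
qed

lemma borel_measurable_cnj [measurable (raw)]:
 "f \<in> borel_measurable M ==> (\<lambda>x. cnj (f x)) \<in> borel_measurable M"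
 by (rule borel_measurable_continuous_on[OF continuous_on_cnj[OF continuous_on_id]])

lemma L2_cong_AE: "f \<in> L2 \<mu> ==> g \<in> borel_measurable \<mu> ==> AE x in \<mu>. f x = g x ==> g \<in> L2 \<mu>"
 by (rule L2_bound) auto

lemma L2_inner_integrable:
 assumes "f \<in> L2 \<mu>" "g \<in> L2 \<mu>" shows "integrable \<mu> (\<lambda>x. f x * cnj (g x))"
proof (rule Bochner_Integration.integrable_bound)
 show "integrable \<mu> (\<lambda>x. (cmod (f x))^2 + (cmod (g x))^2)"
  using assms by (simp add: L2_integrable_square)
 show "(\<lambda>x. f x * cnj (g x)) \<in> borel_measurable \<mu>" using assms by measurable
 have "cmod (f x) * cmod (g x) <= (cmod (f x))^2 + (cmod (g x))^2" for x
 proof -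
  have "2 * (cmod (f x) * cmod (g x)) <= (cmod (f x))^2 + (cmod (g x))^2"
   using sum_squares_bound[of "cmod (f x)" "cmod (g x)"] by (simp add: mult.assoc)
  moreover have "0 <= cmod (f x) * cmod (g x)" by simp
  ultimately show ?thesis by linarith
 qed
 then show "AE x in \<mu>. norm (f x * cnj (g x)) <= norm ((cmod (f x))^2 + (cmod (g x))^2)"
  by (intro AE_I2) (simp add: norm_mult)
qed

lemma ennreal_tendsto_zero_D:
 assumes "(\<lambda>n. f n :: ennreal) \<longlonglongrightarrow> 0" "e > 0" shows "\<exists>n0. \<forall>n\<ge>n0. f n < e"
 using order_tendstoD(2)[OF assms] by (simp add: eventually_sequentially)

lemma ennreal_tendsto_zeroI:
 assumes "\<And>e. e > 0 ==> \<exists>n0. \<forall>n\<ge>n0. f n <= ennreal e" shows "f \<longlonglongrightarrow> (0::ennreal)"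
proof (rule tendsto_0_if_Limsup_eq_0_ennreal, rule antisym)
 show "limsup f <= 0"
 proof (rule ennreal_le_epsilon)
  fix e :: real assume "0 < e"
  then have "\<forall>\<^sub>F n in sequentially. f n <= ennreal e"
   using assms by (simp add: eventually_sequentially)
  then show "limsup f <= 0 + ennreal e" by (simp add: Limsup_bounded)
 qed
qed simp

text \<open>Riesz-Fischer. Along a subsequence whose increments have square norm at most 8^(-k), the
  sum of 4^k |increment|^2 has finite integral; hence almost everywhere the increments are O(2^(-k))
  and the subsequence converges. Fatou's lemma then estimates the distance of every f n to the
  pointwise limit.\<close>

lemma L2_complete:
 assumes f: "\<And>n. f n \<in> L2 \<mu>"
  and C: "\<And>e. e > 0 ==> \<exists>n0. \<forall>m\<ge>n0. \<forall>n\<ge>n0. sqn \<mu> (\<lambda>x. f m x - f n x) <= ennreal e"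
 obtains g where "g \<in> L2 \<mu>" "(\<lambda>n. sqn \<mu> (\<lambda>x. f n x - g x)) \<longlonglongrightarrow> 0"
proof -
 have [measurable]: "f n \<in> borel_measurable \<mu>" for n using f by measurable
 have "\<exists>n0. \<forall>m\<ge>n0. \<forall>n\<ge>n0. sqn \<mu> (\<lambda>x. f m x - f n x) <= ennreal ((1/8) ^ k)" for k
  by (rule C) simp
 then obtain N where N: "\<And>k m n. N k <= m ==> N k <= n ==> sqn \<mu> (\<lambda>x. f m x - f n x) <= ennreal ((1/8) ^ k)"
  by metis
 \<comment> \<open>Summing the thresholds makes r monotone, and the summand k makes it unbounded
   even when the thresholds are not.\<close>
 define r where "r k = k + (\<Sum>i\<le>k. N i)" for k
 have rN: "N k <= r k" for k
  unfolding r_def using member_le_sum[of k "{..k}" N] by simp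
 have rSuc: "r k <= r (Suc k)" for k by (simp add: r_def)
 have rk: "k <= r k" for k by (simp add: r_def)
 define D where "D k x = ennreal ((cmod (f (r (Suc k)) x - f (r k) x))^2)" for k x
 have Dint: "(\<integral>\<^sup>+x. D k x \<partial>\<mu>) <= ennreal ((1/8) ^ k)" for k
  using N[of k "r (Suc k)" "r k"] rN[of k] rSuc[of k] unfolding D_def sqn_def by simp
 have "(\<integral>\<^sup>+x. (\<Sum>k. ennreal (4 ^ k) * D k x) \<partial>\<mu>) = (\<Sum>k. ennreal (4 ^ k) * (\<integral>\<^sup>+x. D k x \<partial>\<mu>))"
  unfolding D_def by (subst nn_integral_suminf) (auto simp: nn_integral_cmult)
 also have "... <= (\<Sum>k. ennreal ((1/2) ^ k))"
 proof (intro suminf_le summableI)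
  fix k
  have "ennreal (4 ^ k) * (\<integral>\<^sup>+x. D k x \<partial>\<mu>) <= ennreal (4 ^ k) * ennreal ((1/8) ^ k)"
   by (intro mult_left_mono Dint) auto
  also have "... = ennreal ((1/2) ^ k)"
   by (subst ennreal_mult[symmetric]) (auto simp: power_mult_distrib[symmetric])
  finally show "ennreal (4 ^ k) * (\<integral>\<^sup>+x. D k x \<partial>\<mu>) <= ennreal ((1/2) ^ k)" .
 qed
 also have "... < \<infinity>"
  by (subst suminf_ennreal_eq[OF _ geometric_sums]) auto
 finally have fin: "(\<integral>\<^sup>+x. (\<Sum>k. ennreal (4 ^ k) * D k x) \<partial>\<mu>) < \<infinity>" .
 have ae: "AE x in \<mu>. (\<Sum>k. ennreal (4 ^ k) * D k x) \<noteq> \<infinity>"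
  by (rule nn_integral_PInf_AE) (use fin in "auto simp: D_def")
 have conv: "AE x in \<mu>. convergent (\<lambda>k. f (r k) x)"
  using ae
 proof eventually_elim
  case (elim x)
  define G where "G = (\<Sum>k. ennreal (4 ^ k) * D k x)"
  obtain B where B: "G = ennreal B" "0 <= B" using elim unfolding G_def by (cases G) (auto simp: G_def)
  have le: "cmod (f (r (Suc k)) x - f (r k) x) <= sqrt B * (1/2) ^ k" for k
  proof -
   have "ennreal (4 ^ k) * D k x <= G"
    unfolding G_def using sum_le_suminf[OF summableI, of "{k}" "\<lambda>k. ennreal (4 ^ k) * D k x"] by simp
   then have "ennreal (4 ^ k * (cmod (f (r (Suc k)) x - f (r k) x))^2) <= ennreal B"
    unfolding D_def B by (subst ennreal_mult) auto
   then have "4 ^ k * (cmod (f (r (Suc k)) x - f (r k) x))^2 <= B" using B by simp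
   then have "(cmod (f (r (Suc k)) x - f (r k) x))^2 <= B * (1/4) ^ k"
    by (simp add: field_simps power_divide)
   then have "cmod (f (r (Suc k)) x - f (r k) x) <= sqrt (B * (1/4) ^ k)"
    by (rule real_le_rsqrt)
   also have "(1/4 :: real) ^ k = ((1/2) ^ k)^2" by (simp add: power2_eq_square power_mult_distrib[symmetric])
   finally show ?thesis by (simp add: real_sqrt_mult)
  qed
  have "summable (\<lambda>k. f (r (Suc k)) x - f (r k) x)"
   by (rule summable_comparison_test'[of "\<lambda>k. sqrt B * (1/2) ^ k" 0])
    (use le in "auto intro!: summable_mult summable_geometric")
  then have "convergent (\<lambda>n. \<Sum>k<n. f (r (Suc k)) x - f (r k) x)" by (simp add: summable_iff_convergent)
  then have "convergent (\<lambda>n. f (r n) x - f (r 0) x)"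
   using sum_lessThan_telescope[of "\<lambda>k. f (r k) x"] by simp
  then show ?case using convergent_add[OF _ convergent_const[of "f (r 0) x"]] by fastforce
 qed
 define g where "g x = lim (\<lambda>k. f (r k) x)" for x
 have [measurable]: "g \<in> borel_measurable \<mu>" unfolding g_def by measurable
 have Fatou: "sqn \<mu> (\<lambda>x. f n x - g x) <= ennreal e"
  if n: "n >= n0" "\<And>m n. m >= n0 ==> n >= n0 ==> sqn \<mu> (\<lambda>x. f m x - f n x) <= ennreal e" for n n0 e
 proof -
  have "sqn \<mu> (\<lambda>x. f n x - g x) = (\<integral>\<^sup>+x. liminf (\<lambda>k. ennreal ((cmod (f n x - f (r k) x))^2)) \<partial>\<mu>)"
   unfolding sqn_def
  proof (rule nn_integral_cong_AE, use conv in eventually_elim)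
   case (elim x)
   then have "(\<lambda>k. f (r k) x) \<longlonglongrightarrow> g x" unfolding g_def by (simp add: convergent_LIMSEQ_iff)
   then have "(\<lambda>k. ennreal ((cmod (f n x - f (r k) x))^2)) \<longlonglongrightarrow> ennreal ((cmod (f n x - g x))^2)"
    by (intro tendsto_intros tendsto_ennrealI)
   then show ?case by (rule lim_imp_Liminf[OF sequentially_bot, symmetric])
  qed
  also have "... <= liminf (\<lambda>k. sqn \<mu> (\<lambda>x. f n x - f (r k) x))"
   unfolding sqn_def by (rule nn_integral_liminf) measurable
  also have "... <= limsup (\<lambda>k. sqn \<mu> (\<lambda>x. f n x - f (r k) x))" by (rule Liminf_le_Limsup) simp
  also have "... <= ennreal e"
  proof (rule Limsup_bounded)
   show "\<forall>\<^sub>F k in sequentially. sqn \<mu> (\<lambda>x. f n x - f (r k) x) <= ennreal e"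
    using eventually_ge_at_top[of n0]
   proof eventually_elim
    case (elim k)
    then show ?case using n(2)[OF n(1), of "r k"] rk[of k] by simp
   qed
  qed
  finally show ?thesis .
 qed
 have lim: "(\<lambda>n. sqn \<mu> (\<lambda>x. f n x - g x)) \<longlonglongrightarrow> 0"
 proof (rule ennreal_tendsto_zeroI)
  fix e :: real assume "e > 0"
  then obtain n0 where "\<forall>m\<ge>n0. \<forall>n\<ge>n0. sqn \<mu> (\<lambda>x. f m x - f n x) <= ennreal e" using C by blast
  then show "\<exists>n0. \<forall>n\<ge>n0. sqn \<mu> (\<lambda>x. f n x - g x) <= ennreal e" using Fatou by blast
 qed
 obtain n where n: "sqn \<mu> (\<lambda>x. f n x - g x) < 1"
  using ennreal_tendsto_zero_D[OF lim, of 1] by auto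
 have "(\<lambda>x. f n x - g x) \<in> L2 \<mu>" using n by (auto simp: L2_iff intro: less_trans)
 from L2_diff[OF f[of n] this] have "g \<in> L2 \<mu>" by simp
 then show ?thesis using lim that by blast
qed

text \<open>A type parameter selects the domain, so that the square integrable functions on its dual form a
  type of class \<open>banach\<close>.\<close>

class l2dom = fixes dom_of :: "'a itself => domain"

abbreviation mu :: "'m::l2dom itself => real measure" where "mu a \<equiv> freq (dom_of a)"

typedef (overloaded) ('m::l2dom) l2 =
 "(\<lambda>f. {g \<in> L2 (mu TYPE('m)). AE x in mu TYPE('m). g x = f x}) ` L2 (mu TYPE('m))"
 using L2_zero by blast

definition toL2 :: "(real => complex) => 'm::l2dom l2" where
 "toL2 f = Abs_l2 {g \<in> L2 (mu TYPE('m)). AE x in mu TYPE('m). g x = f x}"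

definition fn :: "'m::l2dom l2 => real => complex" where
 "fn u = (SOME g. g \<in> Rep_l2 u)"

lemma Rep_toL2:
 assumes "f \<in> L2 (mu TYPE('m::l2dom))"
 shows "Rep_l2 (toL2 f :: 'm l2) = {g \<in> L2 (mu TYPE('m)). AE x in mu TYPE('m). g x = f x}"
 unfolding toL2_def using assms by (intro Abs_l2_inverse) auto

lemma fn_Rep: "fn (u::'m::l2dom l2) \<in> Rep_l2 u"
proof -
 obtain f where "f \<in> L2 (mu TYPE('m))" "Rep_l2 u = {g \<in> L2 (mu TYPE('m)). AE x in mu TYPE('m). g x = f x}"
  using Rep_l2[of u] by auto
 then have "f \<in> Rep_l2 u" by auto
 then show ?thesis unfolding fn_def using someI[of "\<lambda>g. g \<in> Rep_l2 u" f] by simp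
qed

lemma fn_L2 [simp, intro]: "fn (u::'m::l2dom l2) \<in> L2 (mu TYPE('m))"
 using Rep_l2[of u] fn_Rep[of u] by auto

lemma fn_measurable [measurable]: "fn (u::'m::l2dom l2) \<in> borel_measurable (mu TYPE('m))"
 using fn_L2[of u] by measurable

lemma fn_toL2:
 assumes "f \<in> L2 (mu TYPE('m::l2dom))" shows "AE x in mu TYPE('m). fn (toL2 f :: 'm l2) x = f x"
 using fn_Rep[of "toL2 f :: 'm l2"] Rep_toL2[OF assms] by auto

lemma toL2_eq_iff:
 assumes f: "f \<in> L2 (mu TYPE('m::l2dom))" and g: "g \<in> L2 (mu TYPE('m))"
 shows "(toL2 f :: 'm l2) = toL2 g \<longleftrightarrow> (AE x in mu TYPE('m). f x = g x)"
proof
 assume "(toL2 f :: 'm l2) = toL2 g"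
 with fn_toL2[OF f] fn_toL2[OF g] show "AE x in mu TYPE('m). f x = g x" by auto
next
 assume "AE x in mu TYPE('m). f x = g x"
 then have "{h \<in> L2 (mu TYPE('m)). AE x in mu TYPE('m). h x = f x} = {h \<in> L2 (mu TYPE('m)). AE x in mu TYPE('m). h x = g x}"
  by (auto elim: AE_mp)
 then show "(toL2 f :: 'm l2) = toL2 g" by (simp add: toL2_def)
qed

lemma toL2_cong:
 assumes "f \<in> L2 (mu TYPE('m::l2dom))" "g \<in> L2 (mu TYPE('m))" "AE x in mu TYPE('m). f x = g x"
 shows "(toL2 f :: 'm l2) = toL2 g"
 using toL2_eq_iff assms by blast

lemma toL2_fn: "toL2 (fn u) = (u::'m::l2dom l2)"
proof -
 obtain f where f: "f \<in> L2 (mu TYPE('m))" "Rep_l2 u = {g \<in> L2 (mu TYPE('m)). AE x in mu TYPE('m). g x = f x}"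
  using Rep_l2[of u] by auto
 have u: "u = toL2 f" unfolding toL2_def using f(2) by (metis Rep_l2_inverse)
 have "AE x in mu TYPE('m). fn u x = f x" using fn_Rep[of u] f by auto
 then have "toL2 (fn u) = (toL2 f :: 'm l2)" using f by (intro toL2_cong) auto
 then show ?thesis using u by simp
qed

lemma l2_eq_iff: "(u::'m::l2dom l2) = v \<longleftrightarrow> (AE x in mu TYPE('m). fn u x = fn v x)"
 using toL2_eq_iff[OF fn_L2 fn_L2, of u v] by (simp add: toL2_fn)

text \<open>The structure is real: the cubic nonlinearity is conjugate linear in its middle
  argument, and conservation of the norm concerns the real part of the pairing.\<close>

instantiation l2 :: (l2dom) real_inner
begin
definition "0 = toL2 (\<lambda>x. 0)"
definition "u + v = toL2 (\<lambda>x. fn u x + fn v x)"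
definition "u - v = toL2 (\<lambda>x. fn u x - fn v x)"
definition "- u = toL2 (\<lambda>x. - fn u x)"
definition "c *\<^sub>R u = toL2 (\<lambda>x. of_real c * fn u x)"
definition "inner (u::'a l2) v = Re (LINT x|mu TYPE('a). fn u x * cnj (fn v x))"
definition "norm (u::'a l2) = sqrt (inner u u)"
definition "dist (u::'a l2) v = norm (u - v)"
definition "sgn (u::'a l2) = toL2 (\<lambda>x. of_real (inverse (norm u)) * fn u x)"
definition "uniformity = (INF e\<in>{0<..}. principal {(x::'a l2, y). dist x y < e})"
definition "open (S::'a l2 set) \<longleftrightarrow> (\<forall>x\<in>S. \<forall>\<^sub>F (x', y) in uniformity. x' = x --> y \<in> S)"

lemma fn_zero: "AE x in mu TYPE('a). fn (0::'a l2) x = 0"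
 unfolding zero_l2_def by (rule fn_toL2[OF L2_zero])
lemma fn_add: "AE x in mu TYPE('a). fn (u + v :: 'a l2) x = fn u x + fn v x"
 unfolding plus_l2_def by (rule fn_toL2) (intro L2_add fn_L2)
lemma fn_diff: "AE x in mu TYPE('a). fn (u - v :: 'a l2) x = fn u x - fn v x"
 unfolding minus_l2_def by (rule fn_toL2) (intro L2_diff fn_L2)
lemma fn_uminus: "AE x in mu TYPE('a). fn (- u :: 'a l2) x = - fn u x"
 unfolding uminus_l2_def using L2_scale[of "fn u" _ "-1"] by (intro fn_toL2) simp
lemma fn_scaleR: "AE x in mu TYPE('a). fn (c *\<^sub>R u :: 'a l2) x = of_real c * fn u x"
 unfolding scaleR_l2_def by (rule fn_toL2) (intro L2_scale fn_L2)

instance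
proof
 fix u v w :: "'a l2" and a b c :: real and S :: "'a l2 set"
 show "u + v + w = u + (v + w)" unfolding l2_eq_iff
  using fn_add[of "u + v" w] fn_add[of u v] fn_add[of u "v + w"] fn_add[of v w] by eventually_elim simp
 show "u + v = v + u" unfolding l2_eq_iff using fn_add[of u v] fn_add[of v u] by eventually_elim simp
 show "0 + u = u" unfolding l2_eq_iff using fn_add[of 0 u] fn_zero by eventually_elim simp
 show "- u + u = 0" unfolding l2_eq_iff using fn_add[of "- u" u] fn_zero fn_uminus[of u] by eventually_elim simp
 show "u - v = u + - v" unfolding l2_eq_iff using fn_add[of u "- v"] fn_uminus[of v] fn_diff[of u v] by eventually_elim simp
 show "a *\<^sub>R (u + v) = a *\<^sub>R u + a *\<^sub>R v" unfolding l2_eq_iff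
  using fn_scaleR[of a "u + v"] fn_add[of u v] fn_add[of "a *\<^sub>R u" "a *\<^sub>R v"] fn_scaleR[of a u] fn_scaleR[of a v]
  by eventually_elim (simp add: algebra_simps)
 show "(a + b) *\<^sub>R u = a *\<^sub>R u + b *\<^sub>R u" unfolding l2_eq_iff
  using fn_scaleR[of "a + b" u] fn_add[of "a *\<^sub>R u" "b *\<^sub>R u"] fn_scaleR[of a u] fn_scaleR[of b u]
  by eventually_elim (simp add: algebra_simps)
 show "a *\<^sub>R b *\<^sub>R u = (a * b) *\<^sub>R u" unfolding l2_eq_iff
  using fn_scaleR[of a "b *\<^sub>R u"] fn_scaleR[of b u] fn_scaleR[of "a * b" u]
  by eventually_elim (simp add: algebra_simps)
 show "1 *\<^sub>R u = u" unfolding l2_eq_iff using fn_scaleR[of 1 u] by eventually_elim simp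
 show "dist u v = norm (u - v)" by (simp add: dist_l2_def)
 show "sgn u = inverse (norm u) *\<^sub>R u" by (simp add: sgn_l2_def scaleR_l2_def)
 show "uniformity = (INF e\<in>{0<..}. principal {(x::'a l2, y). dist x y < e})" by (simp add: uniformity_l2_def)
 show "open S \<longleftrightarrow> (\<forall>x\<in>S. \<forall>\<^sub>F (x', y) in uniformity. x' = x --> y \<in> S)" by (simp add: open_l2_def)
 show "norm u = sqrt (inner u u)" by (simp add: norm_l2_def)
 note int = L2_inner_integrable[OF fn_L2 fn_L2]
 have "cnj (LINT x|mu TYPE('a). fn u x * cnj (fn v x)) = (LINT x|mu TYPE('a). fn v x * cnj (fn u x))"
  unfolding LINT_cnj[symmetric] by (simp add: mult.commute)
 then show "inner u v = inner v u" unfolding inner_l2_def by (metis cnj.simps(1))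
 have "(LINT x|mu TYPE('a). fn (u + v) x * cnj (fn w x))
   = (LINT x|mu TYPE('a). fn u x * cnj (fn w x) + fn v x * cnj (fn w x))"
  by (rule integral_cong_AE, measurable) (use fn_add[of u v] in eventually_elim, simp add: algebra_simps)
 also have "... = (LINT x|mu TYPE('a). fn u x * cnj (fn w x)) + (LINT x|mu TYPE('a). fn v x * cnj (fn w x))"
  by (rule Bochner_Integration.integral_add) (rule int)+
 finally show "inner (u + v) w = inner u w + inner v w" by (simp add: inner_l2_def)
 have "(LINT x|mu TYPE('a). fn (a *\<^sub>R u) x * cnj (fn v x)) = (LINT x|mu TYPE('a). of_real a * (fn u x * cnj (fn v x)))"
  by (rule integral_cong_AE, measurable) (use fn_scaleR[of a u] in eventually_elim, simp)
 then show "inner (a *\<^sub>R u) v = a * inner u v" by (simp add: inner_l2_def)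
 have sq: "inner u u = (LINT x|mu TYPE('a). (cmod (fn u x))^2)"
  unfolding inner_l2_def complex_norm_square[symmetric] by (simp flip: of_real_power)
 show "0 <= inner u u" unfolding sq by simp
 have "inner u u = 0 \<longleftrightarrow> (AE x in mu TYPE('a). (cmod (fn u x))^2 = 0)"
  unfolding sq by (rule integral_nonneg_eq_0_iff_AE) (auto simp: L2_integrable_square)
 also have "... \<longleftrightarrow> u = 0" unfolding l2_eq_iff
 proof
  assume "AE x in mu TYPE('a). (cmod (fn u x))^2 = 0"
  with fn_zero show "AE x in mu TYPE('a). fn u x = fn 0 x" by eventually_elim simp
 next
  assume "AE x in mu TYPE('a). fn u x = fn 0 x"
  with fn_zero show "AE x in mu TYPE('a). (cmod (fn u x))^2 = 0" by eventually_elim simp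
 qed
 finally show "inner u u = 0 \<longleftrightarrow> u = 0" .
qed
end

lemma norm_l2_sq: "(norm (u::'m::l2dom l2))^2 = (LINT x|mu TYPE('m). (cmod (fn u x))^2)"
 unfolding power2_norm_eq_inner inner_l2_def complex_norm_square[symmetric] by (simp flip: of_real_power)

lemma sqn_fn: "sqn (mu TYPE('m)) (fn u) = ennreal ((norm (u::'m::l2dom l2))^2)"
 unfolding norm_l2_sq by (rule sqn_eq_integral) simp

lemma sqn_fn_diff: "sqn (mu TYPE('m)) (\<lambda>x. fn u x - fn v x) = ennreal ((norm (u - v::'m::l2dom l2))^2)"
 unfolding sqn_fn[symmetric] by (rule sqn_cong_AE) (use fn_diff[of u v] in auto)

lemma norm_toL2_sq:
 assumes "f \<in> L2 (mu TYPE('m::l2dom))"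
 shows "(norm (toL2 f :: 'm l2))^2 = (LINT x|mu TYPE('m). (cmod (f x))^2)"
 unfolding norm_l2_sq
 by (rule integral_cong_AE) (use fn_toL2[OF assms] assms in "auto intro: borel_measurable_power")

lemma sqn_toL2:
 assumes "f \<in> L2 (mu TYPE('m::l2dom))"
 shows "ennreal ((norm (toL2 f :: 'm l2))^2) = sqn (mu TYPE('m)) f"
 unfolding norm_toL2_sq[OF assms] by (rule sqn_eq_integral[OF assms, symmetric])

lemma toL2_add:
 assumes "f \<in> L2 (mu TYPE('m::l2dom))" "g \<in> L2 (mu TYPE('m))"
 shows "(toL2 (\<lambda>x. f x + g x) :: 'm l2) = toL2 f + toL2 g"
 unfolding plus_l2_def using fn_toL2[OF assms(1)] fn_toL2[OF assms(2)] assms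
 by (intro toL2_cong L2_add) auto

lemma toL2_diff:
 assumes "f \<in> L2 (mu TYPE('m::l2dom))" "g \<in> L2 (mu TYPE('m))"
 shows "(toL2 (\<lambda>x. f x - g x) :: 'm l2) = toL2 f - toL2 g"
 unfolding minus_l2_def using fn_toL2[OF assms(1)] fn_toL2[OF assms(2)] assms
 by (intro toL2_cong L2_diff) auto

lemma toL2_scaleR:
 assumes f: "f \<in> L2 (mu TYPE('m::l2dom))"
 shows "(toL2 (\<lambda>x. of_real c * f x) :: 'm l2) = c *\<^sub>R toL2 f"
proof -
 have "AE x in mu TYPE('m). complex_of_real c * f x = of_real c * fn (toL2 f :: 'm l2) x"
  using fn_toL2[OF f] by eventually_elim simp
 then show ?thesis unfolding scaleR_l2_def by (intro toL2_cong L2_scale f fn_L2)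
qed

instance l2 :: (l2dom) banach
proof
 fix X :: "nat => 'a l2" assume X: "Cauchy X"
 obtain g where g: "g \<in> L2 (mu TYPE('a))" "(\<lambda>n. sqn (mu TYPE('a)) (\<lambda>x. fn (X n) x - g x)) \<longlonglongrightarrow> 0"
 proof (rule L2_complete[of "\<lambda>n. fn (X n)" "mu TYPE('a)"])
  fix e :: real assume e: "e > 0"
  then obtain n0 where n0: "\<And>m n. m >= n0 ==> n >= n0 ==> norm (X m - X n) < sqrt e"
   using X unfolding Cauchy_def dist_norm by (meson real_sqrt_gt_zero)
  show "\<exists>n0. \<forall>m\<ge>n0. \<forall>n\<ge>n0. sqn (mu TYPE('a)) (\<lambda>x. fn (X m) x - fn (X n) x) <= ennreal e"
   unfolding sqn_fn_diff
  proof (intro exI[of _ n0] allI impI ennreal_leI)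
   fix m n assume "n0 <= m" "n0 <= n"
   then have "(norm (X m - X n))^2 <= (sqrt e)^2" by (intro power_mono less_imp_le[OF n0]) auto
   then show "(norm (X m - X n))^2 <= e" using e by simp
  qed
 qed auto
 have "sqn (mu TYPE('a)) (\<lambda>x. fn (X n) x - g x) = ennreal ((norm (X n - toL2 g))^2)" for n
  using sqn_toL2[where 'm = 'a, of "\<lambda>x. fn (X n) x - g x"] toL2_diff[where 'm = 'a, of "fn (X n)" g] g(1)
  by (simp add: toL2_fn L2_diff)
 then have "(\<lambda>n. ennreal ((norm (X n - toL2 g))^2)) \<longlonglongrightarrow> ennreal 0" using g(2) by simp
 then have "(\<lambda>n. (norm (X n - toL2 g))^2) \<longlonglongrightarrow> 0" by (subst (asm) tendsto_ennreal_iff) auto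
 then have "(\<lambda>n. sqrt ((norm (X n - toL2 g))^2)) \<longlonglongrightarrow> sqrt 0" by (rule tendsto_real_sqrt)
 then have "(\<lambda>n. X n - toL2 g) \<longlonglongrightarrow> 0" by (simp add: tendsto_norm_zero_iff)
 then have "X \<longlonglongrightarrow> toL2 g" by (simp add: LIM_zero_iff)
 then show "convergent X" by (rule convergentI)
qed

subsection \<open>Multiplication operators\<close>

definition mult :: "(real => complex) => 'm::l2dom l2 => 'm l2" where
 "mult b u = toL2 (\<lambda>x. b x * fn u x)"

definition bmult :: "'m::l2dom itself => real => (real => complex) => bool" where
 "bmult a B b \<longleftrightarrow> b \<in> borel_measurable (mu a) \<and> (\<forall>x. cmod (b x) <= B)"

lemma bmult_L2: "bmult TYPE('m::l2dom) B b ==> f \<in> L2 (mu TYPE('m)) ==> (\<lambda>x. b x * f x) \<in> L2 (mu TYPE('m))"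
 unfolding bmult_def by (auto intro: L2_mult_bounded)

lemma fn_mult:
 fixes u :: "'m::l2dom l2"
 assumes "bmult TYPE('m) B b" shows "AE x in mu TYPE('m). fn (mult b u) x = b x * fn u x"
 unfolding mult_def by (rule fn_toL2) (rule bmult_L2[OF assms fn_L2])

lemma mult_toL2:
 assumes "bmult TYPE('m::l2dom) B b" "f \<in> L2 (mu TYPE('m))"
 shows "mult b (toL2 f :: 'm l2) = toL2 (\<lambda>x. b x * f x)"
 unfolding mult_def using fn_toL2[OF assms(2)] assms by (intro toL2_cong bmult_L2) auto

lemma mult_add:
 fixes u v :: "'m::l2dom l2"
 assumes "bmult TYPE('m) B b" shows "mult b (u + v) = mult b u + mult b v"
 unfolding l2_eq_iff
 using fn_mult[OF assms, of "u + v"] fn_mult[OF assms, of u] fn_mult[OF assms, of v] fn_add[of u v]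
  fn_add[of "mult b u" "mult b v"]
 by eventually_elim (simp add: algebra_simps)

lemma mult_diff:
 fixes u v :: "'m::l2dom l2"
 assumes "bmult TYPE('m) B b" shows "mult b (u - v) = mult b u - mult b v"
 using mult_add[OF assms, of "u - v" v] by simp

lemma mult_scaleR:
 fixes u :: "'m::l2dom l2"
 assumes "bmult TYPE('m) B b" shows "mult b (c *\<^sub>R u) = c *\<^sub>R mult b u"
 unfolding l2_eq_iff
 using fn_mult[OF assms, of "c *\<^sub>R u"] fn_mult[OF assms, of u] fn_scaleR[of c u] fn_scaleR[of c "mult b u"]
 by eventually_elim simp

lemma norm_mult_le:
 fixes u :: "'m::l2dom l2"
 assumes b: "bmult TYPE('m) B b" shows "norm (mult b u) <= B * norm u"
proof -
 have B: "0 <= B" using b unfolding bmult_def by (meson norm_ge_zero order_trans)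
 have "ennreal ((norm (mult b u))^2) = sqn (mu TYPE('m)) (\<lambda>x. b x * fn u x)"
  unfolding mult_def by (rule sqn_toL2[OF bmult_L2[OF b fn_L2]])
 also have "... <= sqn (mu TYPE('m)) (\<lambda>x. of_real B * fn u x)"
  using b B unfolding bmult_def by (intro sqn_mono AE_I2) (auto simp: norm_mult intro!: mult_right_mono)
 also have "... = ennreal ((B * norm u)^2)"
  using B by (simp add: sqn_scale sqn_fn power_mult_distrib ennreal_mult)
 finally have "(norm (mult b u))^2 <= (B * norm u)^2" by simp
 then show ?thesis using B by (simp add: power2_le_iff_abs_le)
qed

lemma bounded_linear_mult:
 assumes "bmult TYPE('m::l2dom) B b" shows "bounded_linear (mult b :: 'm l2 => 'm l2)"
 by (rule bounded_linear_intro[of _ B])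
  (use mult_add[OF assms] mult_scaleR[OF assms] norm_mult_le[OF assms] in "auto simp: mult.commute")

lemma mult_mult:
 fixes u :: "'m::l2dom l2"
 assumes "bmult TYPE('m) B b" "bmult TYPE('m) C c" shows "mult b (mult c u) = mult (\<lambda>x. b x * c x) u"
proof -
 have "bmult TYPE('m) (B * C) (\<lambda>x. b x * c x)"
  using assms unfolding bmult_def by (auto simp: norm_mult intro!: mult_mono intro: order_trans[OF norm_ge_zero])
 from fn_mult[OF this, of u] fn_mult[OF assms(1), of "mult c u"] fn_mult[OF assms(2), of u]
 show ?thesis unfolding l2_eq_iff by eventually_elim simp
qed

lemma mult_one:
 fixes u :: "'m::l2dom l2"
 assumes "bmult TYPE('m) B b" "\<And>x. x \<in> space (mu TYPE('m)) ==> b x = 1" shows "mult b u = u"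
 unfolding l2_eq_iff using fn_mult[OF assms(1), of u] AE_space by eventually_elim (simp add: assms)

text \<open>Strong convergence, by dominated convergence for each fixed u. It is the mode in which
  the cutoffs tend to the identity and in which the propagator depends continuously on time;
  convergence in operator norm would fail for both.\<close>

lemma mult_tendsto:
 fixes u :: "'m::l2dom l2"
 assumes b: "\<And>n. bmult TYPE('m) B (b n)" and c: "bmult TYPE('m) B c"
  and lim: "\<And>x. x \<in> space (mu TYPE('m)) ==> (\<lambda>n. b n x) \<longlonglongrightarrow> c x"
 shows "(\<lambda>n. mult (b n) u) \<longlonglongrightarrow> mult c u"
proof -
 have [measurable]: "b n \<in> borel_measurable (mu TYPE('m))" "c \<in> borel_measurable (mu TYPE('m))" for n
  using b c by (auto simp: bmult_def)
 have B: "0 <= B" using c unfolding bmult_def by (meson norm_ge_zero order_trans)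
 have "(\<lambda>n. LINT x|mu TYPE('m). (cmod ((b n x - c x) * fn u x))^2) \<longlonglongrightarrow> (LINT x|mu TYPE('m). 0)"
 proof (rule integral_dominated_convergence)
  show "integrable (mu TYPE('m)) (\<lambda>x. (2 * B)^2 * (cmod (fn u x))^2)"
   using L2_integrable_square[OF fn_L2[of u]] by simp
  show "AE x in mu TYPE('m). (\<lambda>n. (cmod ((b n x - c x) * fn u x))^2) \<longlonglongrightarrow> 0"
  proof (rule AE_I2)
   fix x assume "x \<in> space (mu TYPE('m))"
   then have "(\<lambda>n. (cmod ((b n x - c x) * fn u x))^2) \<longlonglongrightarrow> (cmod ((c x - c x) * fn u x))\<^sup>2"
    by (intro tendsto_intros lim)
   then show "(\<lambda>n. (cmod ((b n x - c x) * fn u x))^2) \<longlonglongrightarrow> 0" by simp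
  qed
  show "AE x in mu TYPE('m). norm ((cmod ((b n x - c x) * fn u x))^2) <= (2 * B)^2 * (cmod (fn u x))^2" for n
  proof (rule AE_I2)
   fix x
   have "cmod (b n x - c x) <= cmod (b n x) + cmod (c x)" by (rule norm_triangle_ineq4)
   also have "... <= 2 * B" using b[of n] c unfolding bmult_def by (metis add_mono mult_2)
   finally have "(cmod (b n x - c x))^2 <= (2 * B)^2" by (rule power_mono) simp
   then show "norm ((cmod ((b n x - c x) * fn u x))^2) <= (2 * B)^2 * (cmod (fn u x))^2"
    unfolding norm_mult power_mult_distrib by (simp add: mult_right_mono)
  qed
 qed measurable
 moreover have "(LINT x|mu TYPE('m). (cmod ((b n x - c x) * fn u x))^2) = (norm (mult (b n) u - mult c u))^2" for n
 proof -
  note L = bmult_L2[OF b[of n] fn_L2[of u]] bmult_L2[OF c fn_L2[of u]]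
  show ?thesis unfolding mult_def toL2_diff[OF L, symmetric] norm_toL2_sq[OF L2_diff[OF L]]
   by (simp add: left_diff_distrib)
 qed
 ultimately have "(\<lambda>n. (norm (mult (b n) u - mult c u))^2) \<longlonglongrightarrow> 0" by simp
 then have "(\<lambda>n. sqrt ((norm (mult (b n) u - mult c u))^2)) \<longlonglongrightarrow> sqrt 0" by (rule tendsto_real_sqrt)
 then have "(\<lambda>n. mult (b n) u - mult c u) \<longlonglongrightarrow> 0" by (simp add: tendsto_norm_zero_iff)
 then show ?thesis by (simp add: LIM_zero_iff)
qed

subsection \<open>Limits in the square mean\<close>

lemma Cauchy_Schwarz_L2:
 assumes "f \<in> L2 \<mu>" "g \<in> L2 \<mu>"
 shows "(ennreal (cmod (LINT x|\<mu>. f x * cnj (g x))))^2 <= sqn \<mu> f * sqn \<mu> g"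
proof -
 have [measurable]: "f \<in> borel_measurable \<mu>" "g \<in> borel_measurable \<mu>" using assms by measurable
 have "ennreal (cmod (LINT x|\<mu>. f x * cnj (g x))) <= (\<integral>\<^sup>+x. ennreal (cmod (f x * cnj (g x))) \<partial>\<mu>)"
  by (rule integral_norm_bound_ennreal[OF L2_inner_integrable[OF assms]])
 also have "... = (\<integral>\<^sup>+x. ennreal (cmod (f x)) * ennreal (cmod (g x)) \<partial>\<mu>)"
  by (simp add: norm_mult ennreal_mult)
 finally have "(ennreal (cmod (LINT x|\<mu>. f x * cnj (g x))))^2
   <= (\<integral>\<^sup>+x. ennreal (cmod (f x)) * ennreal (cmod (g x)) \<partial>\<mu>)^2"
  by (rule power_mono) simp
 also have "... <= (\<integral>\<^sup>+x. ennreal (cmod (f x)) ^ 2 \<partial>\<mu>) * (\<integral>\<^sup>+x. ennreal (cmod (g x)) ^ 2 \<partial>\<mu>)"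
  by (rule Cauchy_Schwarz_nn_integral) measurable
 also have "... = sqn \<mu> f * sqn \<mu> g" by (simp add: sqn_def ennreal_power)
 finally show ?thesis .
qed

lemma L2_inner_tendsto:
 assumes f: "\<And>n. f n \<in> L2 \<mu>" "g \<in> L2 \<mu>" and h: "h \<in> L2 \<mu>"
  and lim: "(\<lambda>n. sqn \<mu> (\<lambda>x. f n x - g x)) \<longlonglongrightarrow> 0"
 shows "(\<lambda>n. LINT x|\<mu>. f n x * cnj (h x)) \<longlonglongrightarrow> (LINT x|\<mu>. g x * cnj (h x))"
proof -
 define d where "d n = (LINT x|\<mu>. (f n x - g x) * cnj (h x))" for n
 have d: "(LINT x|\<mu>. f n x * cnj (h x)) - (LINT x|\<mu>. g x * cnj (h x)) = d n" for n
  unfolding d_def left_diff_distrib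
  by (rule Bochner_Integration.integral_diff[symmetric]) (intro L2_inner_integrable f h)+
 have "(\<lambda>n. sqn \<mu> (\<lambda>x. f n x - g x) * sqn \<mu> h) \<longlonglongrightarrow> 0 * sqn \<mu> h"
  using L2_sqn_finite[OF h] by (intro tendsto_mult_ennreal lim tendsto_const) auto
 then have lim': "(\<lambda>n. sqn \<mu> (\<lambda>x. f n x - g x) * sqn \<mu> h) \<longlonglongrightarrow> 0" by simp
 have le: "ennreal ((cmod (d n))^2) <= sqn \<mu> (\<lambda>x. f n x - g x) * sqn \<mu> h" for n
  using Cauchy_Schwarz_L2[OF L2_diff[OF f] h, of n] by (simp add: d_def ennreal_power)
 have "(\<lambda>n. ennreal ((cmod (d n))^2)) \<longlonglongrightarrow> 0"
  by (rule tendsto_sandwich[OF _ _ tendsto_const lim']) (use le in auto)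
 then have "(\<lambda>n. ennreal ((cmod (d n))^2)) \<longlonglongrightarrow> ennreal 0" by simp
 then have "(\<lambda>n. (cmod (d n))^2) \<longlonglongrightarrow> 0" by (subst (asm) tendsto_ennreal_iff) auto
 then have "(\<lambda>n. sqrt ((cmod (d n))^2)) \<longlonglongrightarrow> sqrt 0" by (rule tendsto_real_sqrt)
 then have "d \<longlonglongrightarrow> 0" by (simp add: tendsto_norm_zero_iff)
 then show ?thesis unfolding d[symmetric] by (simp add: LIM_zero_iff)
qed

lemma sqn_add_tendsto_0:
 assumes [measurable]: "\<And>n. f n \<in> borel_measurable \<mu>" "\<And>n. g n \<in> borel_measurable \<mu>"
  and lim: "((\<lambda>n. sqn \<mu> (f n)) \<longlongrightarrow> 0) F" "((\<lambda>n. sqn \<mu> (g n)) \<longlongrightarrow> 0) F"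
 shows "((\<lambda>n. sqn \<mu> (\<lambda>x. f n x + g n x)) \<longlongrightarrow> 0) F"
proof -
 have "((\<lambda>n. 2 * (sqn \<mu> (f n) + sqn \<mu> (g n))) \<longlongrightarrow> 2 * (0 + 0)) F"
  by (intro tendsto_mult_ennreal tendsto_const tendsto_add lim) auto
 then have "((\<lambda>n. 2 * (sqn \<mu> (f n) + sqn \<mu> (g n))) \<longlongrightarrow> 0) F" by simp
 note L = this
 show ?thesis
  by (rule tendsto_sandwich[OF always_eventually always_eventually tendsto_const L])
   (auto simp del: distrib_left_numeral intro!: sqn_add_le)
qed

lemma sqn_scale_tendsto_0:
 assumes [measurable]: "\<And>n. f n \<in> borel_measurable \<mu>" and lim: "((\<lambda>n. sqn \<mu> (f n)) \<longlongrightarrow> 0) F"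
 shows "((\<lambda>n. sqn \<mu> (\<lambda>x. c * f n x)) \<longlongrightarrow> 0) F"
proof -
 have "((\<lambda>n. ennreal ((cmod c)^2) * sqn \<mu> (f n)) \<longlongrightarrow> ennreal ((cmod c)^2) * 0) F"
  by (intro tendsto_mult_ennreal tendsto_const lim) auto
 then show ?thesis by (simp add: sqn_scale)
qed

lemma sqn_limit_unique:
 assumes [measurable]: "\<And>n. f n \<in> borel_measurable \<mu>" "g \<in> borel_measurable \<mu>" "h \<in> borel_measurable \<mu>"
  and lim: "((\<lambda>n. sqn \<mu> (\<lambda>x. f n x - g x)) \<longlongrightarrow> 0) F" "((\<lambda>n. sqn \<mu> (\<lambda>x. f n x - h x)) \<longlongrightarrow> 0) F"
  and F: "F \<noteq> bot"
 shows "AE x in \<mu>. g x = h x"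
proof -
 have "((\<lambda>n. sqn \<mu> (\<lambda>x. (f n x - g x) + (h x - f n x))) \<longlongrightarrow> 0) F"
  using lim by (intro sqn_add_tendsto_0) (auto simp: sqn_diff_commute[of _ h])
 then have "((\<lambda>n. sqn \<mu> (\<lambda>x. h x - g x)) \<longlongrightarrow> 0) F" by simp
 then have "sqn \<mu> (\<lambda>x. h x - g x) = 0" using F by (simp add: tendsto_const_iff)
 then show ?thesis by (subst (asm) sqn_zero_iff) auto
qed

lemma sqn_polarize:
 assumes "f \<in> L2 \<mu>" "g \<in> L2 \<mu>"
 shows "(LINT x|\<mu>. (cmod (f x - g x))^2) = (LINT x|\<mu>. (cmod (f x))^2)
  - 2 * Re (LINT x|\<mu>. f x * cnj (g x)) + (LINT x|\<mu>. (cmod (g x))^2)"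
proof -
 have eq: "(cmod (a - b))^2 = (cmod a)^2 - 2 * Re (a * cnj b) + (cmod b)^2" for a b
  unfolding cmod_power2 by (simp add: power2_eq_square algebra_simps)
 have int: "integrable \<mu> (\<lambda>x. Re (f x * cnj (g x)))"
  by (intro integrable_Re L2_inner_integrable assms)
 have "(LINT x|\<mu>. (cmod (f x - g x))^2)
   = (LINT x|\<mu>. (cmod (f x))^2 - 2 * Re (f x * cnj (g x)) + (cmod (g x))^2)"
  unfolding eq ..
 also have "... = (LINT x|\<mu>. (cmod (f x))^2) - (LINT x|\<mu>. 2 * Re (f x * cnj (g x))) + (LINT x|\<mu>. (cmod (g x))^2)"
  by (subst Bochner_Integration.integral_add,
    intro Bochner_Integration.integrable_diff L2_integrable_square assms integrable_cmult int,
    intro L2_integrable_square assms, subst Bochner_Integration.integral_diff,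
    intro L2_integrable_square assms, intro integrable_cmult int, rule refl)
 also have "(LINT x|\<mu>. 2 * Re (f x * cnj (g x))) = 2 * Re (LINT x|\<mu>. f x * cnj (g x))"
  unfolding LINT_cmult integral_Re[OF L2_inner_integrable[OF assms]] ..
 finally show ?thesis .
qed

text \<open>Polarisation expresses the norm of f n through the norm of f n - g and the inner product
  with g, and both converge.\<close>

lemma sqn_tendsto:
 assumes f: "\<And>n. f n \<in> L2 \<mu>" and g: "g \<in> L2 \<mu>"
  and lim: "(\<lambda>n. sqn \<mu> (\<lambda>x. f n x - g x)) \<longlonglongrightarrow> 0"
 shows "(\<lambda>n. sqn \<mu> (f n)) \<longlonglongrightarrow> sqn \<mu> g"
proof -
 define N where "N h = (LINT x|\<mu>. (cmod (h x))^2)" for h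
 have N: "sqn \<mu> h = ennreal (N h)" if "h \<in> L2 \<mu>" for h using sqn_eq_integral[OF that] by (simp add: N_def)
 have eq: "N (f n) = N (\<lambda>x. f n x - g x) + 2 * Re (LINT x|\<mu>. f n x * cnj (g x)) - N g" for n
  using sqn_polarize[OF f[of n] g] by (simp add: N_def)
 have "(\<lambda>n. ennreal (N (\<lambda>x. f n x - g x))) \<longlonglongrightarrow> ennreal 0" using lim N[OF L2_diff[OF f g]] by simp
 then have 1: "(\<lambda>n. N (\<lambda>x. f n x - g x)) \<longlonglongrightarrow> 0" by (subst (asm) tendsto_ennreal_iff) (auto simp: N_def)
 have "(\<lambda>n. N (f n)) \<longlonglongrightarrow> 0 + 2 * Re (LINT x|\<mu>. g x * cnj (g x)) - N g"
  unfolding eq by (intro tendsto_intros 1 L2_inner_tendsto[OF f g g lim])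
 also have "(LINT x|\<mu>. g x * cnj (g x)) = of_real (N g)"
  unfolding N_def complex_norm_square[symmetric] by (simp flip: of_real_power)
 finally have "(\<lambda>n. N (f n)) \<longlonglongrightarrow> N g" by simp
 then show ?thesis using N[OF f] N[OF g] by (simp add: tendsto_ennrealI)
qed

lemma sqn_dominated_tendsto:
 assumes f: "\<And>n. f n \<in> borel_measurable \<mu>" and g: "g \<in> L2 \<mu>"
  and le: "\<And>n x. cmod (f n x) <= cmod (g x)" and lim: "\<And>x. x \<in> space \<mu> ==> (\<lambda>n. f n x) \<longlonglongrightarrow> 0"
 shows "(\<lambda>n. sqn \<mu> (f n)) \<longlonglongrightarrow> 0"
proof -
 have fL: "f n \<in> L2 \<mu>" for n using le by (intro L2_bound[OF g f]) auto
 have [measurable]: "f n \<in> borel_measurable \<mu>" for n using f .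
 have "(\<lambda>n. LINT x|\<mu>. (cmod (f n x))^2) \<longlonglongrightarrow> (LINT x|\<mu>. 0)"
 proof (rule integral_dominated_convergence)
  show "integrable \<mu> (\<lambda>x. (cmod (g x))^2)" by (rule L2_integrable_square[OF g])
  show "AE x in \<mu>. (\<lambda>n. (cmod (f n x))^2) \<longlonglongrightarrow> 0"
  proof (rule AE_I2)
   fix x assume "x \<in> space \<mu>"
   then have "(\<lambda>n. (cmod (f n x))^2) \<longlonglongrightarrow> (cmod 0)\<^sup>2" by (intro tendsto_intros lim)
   then show "(\<lambda>n. (cmod (f n x))^2) \<longlonglongrightarrow> 0" by simp
  qed
  show "AE x in \<mu>. norm ((cmod (f n x))^2) <= (cmod (g x))^2" for n
   using le[of n] by (intro AE_I2) (simp add: power_mono)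
 qed measurable
 then have "(\<lambda>n. ennreal (LINT x|\<mu>. (cmod (f n x))^2)) \<longlonglongrightarrow> ennreal 0"
  by (intro tendsto_ennrealI) simp
 then show ?thesis using sqn_eq_integral[OF fL] by simp
qed

section \<open>Plancherel's theorem\<close>

subsection \<open>Continuity of translations in the square mean\<close>

lemma sqn_translate:
 assumes "f \<in> borel_measurable borel" shows "sqn lborel (\<lambda>x. f (x - z)) = sqn lborel f"
 unfolding sqn_def
 using nn_integral_real_affine[of "\<lambda>x. ennreal ((cmod (f x))^2)" 1 "- z"] assms by simp

lemma sqn_reflect:
 assumes "f \<in> borel_measurable borel" shows "sqn lborel (\<lambda>x. f (- x)) = sqn lborel f"
 unfolding sqn_def
 using nn_integral_real_affine[of "\<lambda>x. ennreal ((cmod (f x))^2)" "-1" 0] assms by simp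

text \<open>Continuity of translations at 0, in the sequential form in which it later yields
  continuity of the autocorrelation at 0.\<close>

definition transl_cont :: "(real => complex) => bool" where
 "transl_cont f \<longleftrightarrow> (\<forall>z. z \<longlonglongrightarrow> 0 --> (\<lambda>n::nat. sqn lborel (\<lambda>x. f (x - z n) - f x)) \<longlonglongrightarrow> 0)"

lemma transl_cont_add:
 assumes [measurable]: "f \<in> borel_measurable borel" "g \<in> borel_measurable borel"
  and "transl_cont f" "transl_cont g"
 shows "transl_cont (\<lambda>x. f x + g x)"
 unfolding transl_cont_def
proof (intro allI impI)
 fix z :: "nat => real" assume "z \<longlonglongrightarrow> 0"
 then have "(\<lambda>n. sqn lborel (\<lambda>x. (f (x - z n) - f x) + (g (x - z n) - g x))) \<longlonglongrightarrow> 0"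
  using assms by (intro sqn_add_tendsto_0) (auto simp: transl_cont_def)
 then show "(\<lambda>n. sqn lborel (\<lambda>x. f (x - z n) + g (x - z n) - (f x + g x))) \<longlonglongrightarrow> 0"
  by (simp add: algebra_simps)
qed

lemma transl_cont_scale:
 assumes [measurable]: "f \<in> borel_measurable borel" and "transl_cont f"
 shows "transl_cont (\<lambda>x. c * f x)"
 unfolding transl_cont_def
proof (intro allI impI)
 fix z :: "nat => real" assume "z \<longlonglongrightarrow> 0"
 then have "(\<lambda>n. sqn lborel (\<lambda>x. c * (f (x - z n) - f x))) \<longlonglongrightarrow> 0"
  using assms by (intro sqn_scale_tendsto_0) (auto simp: transl_cont_def)
 then show "(\<lambda>n. sqn lborel (\<lambda>x. c * f (x - z n) - c * f x)) \<longlonglongrightarrow> 0"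
  by (simp add: algebra_simps)
qed

lemma transl_cont_limit:
 assumes [measurable]: "\<And>k. f k \<in> borel_measurable borel" "g \<in> borel_measurable borel"
  and f: "\<And>k. transl_cont (f k)"
  and lim: "(\<lambda>k::nat. sqn lborel (\<lambda>x. f k x - g x)) \<longlonglongrightarrow> 0"
 shows "transl_cont g"
 unfolding transl_cont_def
proof (intro allI impI)
 fix z :: "nat => real" assume z: "z \<longlonglongrightarrow> 0"
 show "(\<lambda>n. sqn lborel (\<lambda>x. g (x - z n) - g x)) \<longlonglongrightarrow> 0"
 proof (rule ennreal_tendsto_zeroI)
  fix e :: real assume e: "e > 0"
  obtain k where k: "sqn lborel (\<lambda>x. f k x - g x) < ennreal (e/16)"
   using ennreal_tendsto_zero_D[OF lim, of "ennreal (e/16)"] e by auto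
  obtain n0 where n0: "\<And>n. n >= n0 ==> sqn lborel (\<lambda>x. f k (x - z n) - f k x) < ennreal (e/16)"
   using ennreal_tendsto_zero_D[of "\<lambda>n. sqn lborel (\<lambda>x. f k (x - z n) - f k x)" "ennreal (e/16)"]
    f[of k] z e unfolding transl_cont_def by auto
  show "\<exists>n0. \<forall>n\<ge>n0. sqn lborel (\<lambda>x. g (x - z n) - g x) <= ennreal e"
  proof (intro exI[of _ n0] allI impI)
   fix n assume n: "n0 <= n"
   have 1: "sqn lborel (\<lambda>x. g (x - z n) - f k (x - z n)) = sqn lborel (\<lambda>x. f k x - g x)"
    using sqn_translate[of "\<lambda>x. g x - f k x" "z n"] by (simp add: sqn_diff_commute[of _ g])
   have "sqn lborel (\<lambda>x. g (x - z n) - g x)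
    = sqn lborel (\<lambda>x. (g (x - z n) - f k (x - z n)) + ((f k (x - z n) - f k x) + (f k x - g x)))"
    by simp
   also have "... <= 2 * (sqn lborel (\<lambda>x. g (x - z n) - f k (x - z n))
     + sqn lborel (\<lambda>x. (f k (x - z n) - f k x) + (f k x - g x)))"
    by (rule sqn_add_le) measurable
   also have "... <= 2 * (ennreal (e/16) + 2 * (ennreal (e/16) + ennreal (e/16)))"
    unfolding 1 using k n0[OF n]
    by (intro mult_left_mono add_mono order_trans[OF sqn_add_le] less_imp_le) auto
   also have "... = ennreal (10 * (e/16))"
    using e by (simp add: ennreal_plus[symmetric] ennreal_mult[symmetric] del: ennreal_plus flip: ennreal_numeral)
   also have "... <= ennreal e" using e by (intro ennreal_leI) auto
   finally show "sqn lborel (\<lambda>x. g (x - z n) - g x) <= ennreal e" .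
  qed
 qed
qed

lemma sqn_indicator:
 assumes "A \<in> sets \<mu>" shows "sqn \<mu> (indicator A) = emeasure \<mu> A"
proof -
 have "sqn \<mu> (indicator A) = (\<integral>\<^sup>+x. indicator A x \<partial>\<mu>)"
  unfolding sqn_def by (intro nn_integral_cong) (auto simp: indicator_def)
 then show ?thesis using assms by simp
qed

text \<open>The squared difference of the two indicators integrates to 2 |V| minus twice the measure
  of the overlap of V with its translate. A point of an open V stays in V under small shifts, so the
  product of the indicators converges pointwise, and |V| < \<infinity> gives domination. Points
  outside V need no argument, which is why open sets come before Borel sets.\<close>

lemma transl_cont_open:
 assumes V: "open V" and fin: "emeasure lborel V < \<infinity>" shows "transl_cont (indicator V)"
 unfolding transl_cont_def
proof (intro allI impI)
 fix z :: "nat => real" assume z: "z \<longlonglongrightarrow> 0"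
 have [measurable]: "V \<in> sets borel" using V by auto
 have iU: "integrable lborel (indicator V :: real => real)" using fin by (simp add: integrable_indicator_iff)
 have iUz: "integrable lborel (\<lambda>x. indicator V (x - z n) :: real)" for n
  using lborel_integrable_real_affine[OF iU, of 1 "- z n"] by (simp add: algebra_simps)
 have iUU: "integrable lborel (\<lambda>x. indicator V (x - z n) * indicator V x :: real)" for n
  by (rule Bochner_Integration.integrable_bound[OF iU]) (auto simp: indicator_def)
 define m where "m = (LINT x|lborel. indicator V x :: real)"
 have mz: "(LINT x|lborel. indicator V (x - z n) :: real) = m" for n
  using lborel_integral_real_affine[of 1 "indicator V :: real => real" "- z n"] by (simp add: m_def)
 have "(\<lambda>n. LINT x|lborel. indicator V (x - z n) * indicator V x :: real) \<longlonglongrightarrow> m"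
  unfolding m_def
 proof (rule integral_dominated_convergence[where w = "indicator V"])
  show "integrable lborel (indicator V :: real => real)" by (rule iU)
  show "AE x in lborel. (\<lambda>n. indicator V (x - z n) * indicator V x) \<longlonglongrightarrow> (indicator V x :: real)"
  proof (rule AE_I2)
   fix x :: real
   show "(\<lambda>n. indicator V (x - z n) * indicator V x) \<longlonglongrightarrow> (indicator V x :: real)"
   proof (cases "x \<in> V")
    case True
    have "(\<lambda>n. x - z n) \<longlonglongrightarrow> x - 0" by (intro tendsto_intros z)
    then have "\<forall>\<^sub>F n in sequentially. x - z n \<in> V" using V True by (auto dest: topological_tendstoD)
    then have "\<forall>\<^sub>F n in sequentially. indicator V (x - z n) * indicator V x = (indicator V x :: real)"
     by eventually_elim (use True in simp)
    then show ?thesis by (rule tendsto_eventually)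
   qed simp
  qed
  show "AE x in lborel. norm (indicator V (x - z n) * indicator V x :: real) <= indicator V x" for n
   by (auto simp: indicator_def)
 qed measurable
 then have lim: "(\<lambda>n. m + m - 2 * (LINT x|lborel. indicator V (x - z n) * indicator V x :: real)) \<longlonglongrightarrow> m + m - 2 * m"
  by (intro tendsto_intros)
 have "sqn lborel (\<lambda>x. indicator V (x - z n) - indicator V x)
   = ennreal (m + m - 2 * (LINT x|lborel. indicator V (x - z n) * indicator V x))" for n
 proof -
  have "sqn lborel (\<lambda>x. indicator V (x - z n) - indicator V x)
   = (\<integral>\<^sup>+x. ennreal (indicator V (x - z n) + indicator V x - 2 * (indicator V (x - z n) * indicator V x)) \<partial>lborel)"
   unfolding sqn_def by (intro nn_integral_cong) (auto simp: indicator_def)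
  also have "... = ennreal (LINT x|lborel. indicator V (x - z n) + indicator V x - 2 * (indicator V (x - z n) * indicator V x))"
  proof (rule nn_integral_eq_integral)
   show "integrable lborel (\<lambda>x. indicator V (x - z n) + indicator V x - 2 * (indicator V (x - z n) * indicator V x) :: real)"
    by (intro Bochner_Integration.integrable_diff Bochner_Integration.integrable_add
      integrable_cmult iU iUz iUU)
  qed (auto simp: indicator_def)
  also have "(LINT x|lborel. indicator V (x - z n) + indicator V x - 2 * (indicator V (x - z n) * indicator V x))
   = m + m - 2 * (LINT x|lborel. indicator V (x - z n) * indicator V x)"
   using iU iUz[of n] iUU[of n] mz[of n] by (simp add: m_def)
  finally show ?thesis .
 qed
 then show "(\<lambda>n. sqn lborel (\<lambda>x. indicator V (x - z n) - indicator V x)) \<longlonglongrightarrow> 0"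
  using tendsto_ennrealI[OF lim] by simp
qed

lemma transl_cont_borel:
 assumes B: "B \<in> sets borel" and fin: "emeasure lborel B < \<infinity>" shows "transl_cont (indicator B)"
proof -
 have "\<exists>V. open V \<and> B \<subseteq> V \<and> emeasure lborel (V - B) < ennreal (1 / real (Suc k))" for k
  using outer_regular_lborel[OF B, of "1 / real (Suc k)"] by (metis of_nat_0_less_iff zero_less_Suc zero_less_divide_1_iff)
 then obtain V where V: "\<And>k. open (V k)" "\<And>k. B \<subseteq> V k"
   "\<And>k. emeasure lborel (V k - B) < ennreal (1 / real (Suc k))" by metis
 have [measurable]: "V k \<in> sets borel" "B \<in> sets borel" for k using V B by auto
 show ?thesis
 proof (rule transl_cont_limit[of "\<lambda>k. indicator (V k)"])
  fix k
  have "emeasure lborel (V k) <= emeasure lborel (V k - B) + emeasure lborel B"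
   using V(2)[of k] by (subst plus_emeasure) (auto intro!: emeasure_mono)
  also have "... < \<infinity>" using V(3)[of k] fin by (auto intro: less_trans)
  finally show "transl_cont (indicator (V k))" using V by (intro transl_cont_open) auto
 next
  have le: "sqn lborel (\<lambda>x. indicator (V k) x - indicator B x) <= ennreal (1 / real (Suc k))" for k
  proof -
   have "sqn lborel (\<lambda>x. indicator (V k) x - indicator B x) = sqn lborel (indicator (V k - B))"
    unfolding sqn_def using V(2)[of k] by (intro nn_integral_cong) (auto simp: indicator_def)
   then show ?thesis using V(3)[of k] by (simp add: sqn_indicator)
  qed
  have "(\<lambda>k. ennreal (1 / real (Suc k))) \<longlonglongrightarrow> ennreal 0"
   using LIMSEQ_Suc[OF lim_1_over_n[where 'a = real]] by (intro tendsto_ennrealI) simp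
  then have L: "(\<lambda>k. ennreal (1 / real (Suc k))) \<longlonglongrightarrow> 0" by simp
  show "(\<lambda>k. sqn lborel (\<lambda>x. indicator (V k) x - indicator B x)) \<longlonglongrightarrow> 0"
   by (rule tendsto_sandwich[OF always_eventually always_eventually tendsto_const L]) (use le in auto)
 qed auto
qed

lemma transl_cont_sum:
 assumes "finite I" "\<And>i. i \<in> I ==> f i \<in> borel_measurable borel" "\<And>i. i \<in> I ==> transl_cont (f i)"
 shows "transl_cont (\<lambda>x. \<Sum>i\<in>I. f i x)"
 using assms
proof (induction I rule: finite_induct)
 case empty show ?case by (simp add: transl_cont_def sqn_def)
next
 case (insert i I)
 have "transl_cont (\<lambda>x. f i x + (\<Sum>i\<in>I. f i x))"
  using insert by (intro transl_cont_add borel_measurable_sum) auto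
 then show ?case using insert by simp
qed

lemma transl_cont_L2:
 assumes f: "f \<in> L2 lborel" shows "transl_cont f"
proof -
 obtain s where s: "\<And>i. simple_function lborel (s i)" "\<And>x. (\<lambda>i. s i x) \<longlonglongrightarrow> f x"
   "\<And>i x. cmod (s i x) <= 2 * cmod (f x)"
  using borel_measurable_implies_sequence_metric[OF L2_measurable[OF f], of 0] by (auto simp: dist_norm)
 have sm: "s i \<in> borel_measurable borel" for i
  using borel_measurable_simple_function[OF s(1)] by simp
 have fm: "f \<in> borel_measurable borel" using L2_measurable[OF f] by simp
 have s_tc: "transl_cont (s i)" for i
 proof -
  have fin: "finite (range (s i))" using simple_functionD(1)[OF s(1)] by simp
  have eq: "s i = (\<lambda>x. \<Sum>y\<in>range (s i) - {0}. y * indicator (s i -` {y}) x)"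
  proof
   fix x
   have "(\<Sum>y\<in>range (s i) - {0}. y * indicator (s i -` {y}) x) = (\<Sum>y\<in>range (s i) - {0}. if y = s i x then y else 0)"
    by (intro sum.cong) (auto simp: indicator_def)
   also have "... = s i x" using fin by (subst sum.delta) auto
   finally show "s i x = (\<Sum>y\<in>range (s i) - {0}. y * indicator (s i -` {y}) x)" ..
  qed
  have "transl_cont (\<lambda>x. \<Sum>y\<in>range (s i) - {0}. y * indicator (s i -` {y}) x)"
  proof (rule transl_cont_sum)
   show "finite (range (s i) - {0})" using fin by simp
   fix y assume y: "y \<in> range (s i) - {0}"
   have S: "s i -` {y} \<in> sets borel" using measurable_sets[OF sm, of "{y}" i] by simp
   then show m: "(\<lambda>x. y * indicator (s i -` {y}) x) \<in> borel_measurable borel" by measurable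
   \<comment> \<open>A level set of a nonzero value y has finite measure, since y times its
     indicator is dominated by 2 f.\<close>
   have "(\<lambda>x. y * indicator (s i -` {y}) x) \<in> L2 lborel"
   proof (rule L2_bound[OF L2_scale[OF f, of 2]])
    show "(\<lambda>x. y * indicator (s i -` {y}) x) \<in> borel_measurable lborel" using m by simp
   qed (use s(3)[of i] in "auto simp: indicator_def norm_mult")
   then have "ennreal ((cmod y)^2) * emeasure lborel (s i -` {y}) < \<infinity>"
    using S by (simp add: L2_iff sqn_scale sqn_indicator)
   then have "emeasure lborel (s i -` {y}) < \<infinity>"
    using y by (auto simp: ennreal_mult_less_top)
   then show "transl_cont (\<lambda>x. y * indicator (s i -` {y}) x)"
    using S by (intro transl_cont_scale transl_cont_borel) auto
  qed
  then show ?thesis using eq by simp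
 qed
 show ?thesis
 proof (rule transl_cont_limit[OF sm fm s_tc])
  show "(\<lambda>k. sqn lborel (\<lambda>x. s k x - f x)) \<longlonglongrightarrow> 0"
  proof (rule sqn_dominated_tendsto)
   show "(\<lambda>x. 3 * f x) \<in> L2 lborel" by (rule L2_scale[OF f])
   show "(\<lambda>x. s n x - f x) \<in> borel_measurable lborel" for n using sm fm by measurable
   show "cmod (s n x - f x) <= cmod (3 * f x)" for n x
    using norm_triangle_ineq4[of "s n x" "f x"] s(3)[of n x] by (simp add: norm_mult)
   show "(\<lambda>n. s n x - f x) \<longlonglongrightarrow> 0" for x using s(2)[of x] by (simp add: LIM_zero_iff)
  qed
 qed
qed

subsection \<open>The Fourier integral\<close>

definition c2pi :: complex where "c2pi = complex_of_real (1 / sqrt (2 * pi))"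

lemma norm_c2pi: "(cmod c2pi)^2 = 1 / (2 * pi)"
 unfolding c2pi_def norm_of_real power2_abs by (simp add: power_divide)

lemma cnj_c2pi [simp]: "cnj c2pi = c2pi" by (simp add: c2pi_def)

text \<open>Pointwise defined for integrable f, whereas the transform on L^2 of the line is a limit
  chosen up to null sets.\<close>

definition FI :: "(real => complex) => real => complex" where
 "FI f \<xi> = c2pi * (LINT x|lborel. f x * cis (- (x * \<xi>)))"

lemma borel_measurable_cis [measurable (raw)]:
 "f \<in> borel_measurable M ==> (\<lambda>x. cis (f x)) \<in> borel_measurable M"
 unfolding cis_conv_exp by measurable

lemma integrable_cis:
 assumes "integrable M f" "g \<in> borel_measurable M" shows "integrable M (\<lambda>x. f x * cis (g x))"
 by (rule Bochner_Integration.integrable_bound[OF assms(1)]) (use assms in "auto simp: norm_mult")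

lemma FI_add_scale:
 assumes "integrable lborel f" "integrable lborel g"
 shows "FI (\<lambda>x. f x + c * g x) \<xi> = FI f \<xi> + c * FI g \<xi>"
proof -
 have "(LINT x|lborel. (f x + c * g x) * cis (- (x * \<xi>)))
   = (LINT x|lborel. f x * cis (- (x * \<xi>)) + c * (g x * cis (- (x * \<xi>))))"
  by (simp add: algebra_simps)
 also have "... = (LINT x|lborel. f x * cis (- (x * \<xi>))) + c * (LINT x|lborel. g x * cis (- (x * \<xi>)))"
  using integrable_cis[OF assms(1), of "\<lambda>x. - (x * \<xi>)"] integrable_cis[OF assms(2), of "\<lambda>x. - (x * \<xi>)"] by simp
 finally show ?thesis by (simp add: FI_def algebra_simps)
qed

lemma FI_diff:
 assumes "integrable lborel f" "integrable lborel g"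
 shows "FI (\<lambda>x. f x - g x) \<xi> = FI f \<xi> - FI g \<xi>"
 using FI_add_scale[OF assms, of "-1"] by simp

lemma FI_measurable [measurable]:
 assumes [measurable]: "f \<in> borel_measurable borel" shows "FI f \<in> borel_measurable borel"
proof -
 have "(\<lambda>\<xi>. LINT x|lborel. f x * cis (- (x * \<xi>))) \<in> borel_measurable borel"
  by (rule lborel.borel_measurable_lebesgue_integral) measurable
 then show ?thesis unfolding FI_def[abs_def] by measurable
qed

text \<open>After rescaling by e, this is the characteristic function of the standard normal
  distribution.\<close>

lemma gauss_fourier:
 assumes "e > 0"
 shows "integrable lborel (\<lambda>\<xi>. complex_of_real (exp (- (e * \<xi>)\<^sup>2 / 2)))"
  and "(LINT \<xi>|lborel. complex_of_real (exp (- (e * \<xi>)\<^sup>2 / 2)) * cis (- (z * \<xi>)))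
   = complex_of_real (2 * pi / e * std_normal_density (z / e))"
proof -
 have d: "integrable lborel std_normal_density" by (simp add: integrable_normal_density)
 have e: "exp (- (e * \<xi>)\<^sup>2 / 2) = sqrt (2 * pi) * std_normal_density (0 + e * \<xi>)" for \<xi>
  by (simp add: std_normal_density_def)
 show "integrable lborel (\<lambda>\<xi>. complex_of_real (exp (- (e * \<xi>)\<^sup>2 / 2)))"
  unfolding e using assms d
  by (intro integrable_of_real integrable_cmult lborel_integrable_real_affine) auto
 have "char std_normal_distribution t = (LINT s|lborel. std_normal_density s *\<^sub>R iexp (t * s))" for t
  unfolding char_def by (subst integral_density) (auto simp: normal_density_nonneg)
 then have ch: "(LINT s|lborel. std_normal_density s *\<^sub>R iexp (t * s)) = of_real (exp (- t\<^sup>2 / 2))" for t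
  by (simp add: char_std_normal_distribution)
 have pw: "complex_of_real (exp (- (e * \<xi>)\<^sup>2 / 2)) * cis (- (z * \<xi>))
  = complex_of_real (sqrt (2 * pi)) * (std_normal_density (0 + e * \<xi>) *\<^sub>R iexp (- z / e * (0 + e * \<xi>)))" for \<xi>
  using assms unfolding e by (simp add: cis_conv_exp scaleR_conv_of_real)
 have "(LINT \<xi>|lborel. complex_of_real (exp (- (e * \<xi>)\<^sup>2 / 2)) * cis (- (z * \<xi>)))
  = complex_of_real (sqrt (2 * pi)) * (LINT \<xi>|lborel. std_normal_density (0 + e * \<xi>) *\<^sub>R iexp (- z / e * (0 + e * \<xi>)))"
  unfolding pw by (rule LINT_cmult)
 also have "(LINT \<xi>|lborel. std_normal_density (0 + e * \<xi>) *\<^sub>R iexp (- z / e * (0 + e * \<xi>)))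
   = (1 / e) *\<^sub>R (LINT s|lborel. std_normal_density s *\<^sub>R iexp (- z / e * s))"
  using assms by (subst lborel_integral_real_affine[where c = e and t = 0, of "\<lambda>s. std_normal_density s *\<^sub>R iexp (- z / e * s)"]) auto
 also have "... = (1 / e) *\<^sub>R complex_of_real (exp (- (- z / e)\<^sup>2 / 2))" by (simp only: ch)
 also have "complex_of_real (sqrt (2 * pi)) * ((1 / e) *\<^sub>R complex_of_real (exp (- (- z / e)\<^sup>2 / 2)))
   = complex_of_real (2 * pi / e * std_normal_density (z / e))"
 proof -
  have "sqrt (2 * pi) * ((1 / e) * exp (- (- z / e)\<^sup>2 / 2)) = 2 * pi / e * std_normal_density (z / e)"
   using assms by (simp add: std_normal_density_def field_simps)
  then show ?thesis by (simp add: scaleR_conv_of_real flip: of_real_mult)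
 qed
 finally show "(LINT \<xi>|lborel. complex_of_real (exp (- (e * \<xi>)\<^sup>2 / 2)) * cis (- (z * \<xi>)))
   = complex_of_real (2 * pi / e * std_normal_density (z / e))" .
qed

subsection \<open>The Fourier transform on the line\<close>

declare fourier.simps(2) [simp del]

text \<open>The autocorrelation A z = \<integral> f(x) cnj(f(x - z)) dx has value |f|^2 at 0 and
  Fourier integral 2 \<pi> |\<open>FI f\<close>|^2. Damping the latter by the Gaussian exp(-(e
  \<xi>)^2/2) and integrating gives the mean of A(e s) over a standard normal s. As e tends to 0
  this mean tends to A 0, by continuity of translations in L^2, while the damped integrals increase
  to the full one.\<close>

theorem plancherel_FI:
 assumes f1: "integrable lborel f" and f2: "f \<in> L2 lborel"
 shows "sqn lborel (FI f) = sqn lborel f"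
proof -
 let ?q = "\<lambda>e \<xi>. exp (- (e * \<xi>)\<^sup>2 / 2) * (cmod (FI f \<xi>))^2"
 let ?P = "\<lambda>\<xi> x z. f x * cnj (f (x - z)) * cis (- (z * \<xi>))"
 define N where "N = (LINT x|lborel. (cmod (f x))^2)"
 define L where "L = (LINT x|lborel. cmod (f x))"
 define A where "A z = (LINT x|lborel. f x * cnj (f (x - z)))" for z
 have [measurable]: "f \<in> borel_measurable borel" using f1 by auto
 have N0: "0 <= N" by (simp add: N_def)
 have sqf: "sqn lborel f = ennreal N" unfolding N_def by (rule sqn_eq_integral[OF f2])
 have fz: "(\<lambda>x. f (x - z)) \<in> L2 lborel" for z using f2 sqn_translate[of f z] by (simp add: L2_iff)
 have A_meas [measurable]: "A \<in> borel_measurable borel"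
  unfolding A_def[abs_def] by (rule lborel.borel_measurable_lebesgue_integral) measurable
 have A_bound: "cmod (A z) <= N" for z
 proof -
  have "(ennreal (cmod (A z)))^2 <= ennreal N * ennreal N"
   using Cauchy_Schwarz_L2[OF f2 fz[of z]] sqn_translate[of f z] by (simp add: A_def sqf)
  then have "ennreal ((cmod (A z))^2) <= ennreal (N\<^sup>2)"
   using N0 by (simp add: ennreal_power power2_eq_square ennreal_mult)
  then have "(cmod (A z))^2 <= N\<^sup>2" by (subst (asm) ennreal_le_iff) auto
  then show ?thesis using N0 by (rule power2_le_imp_le)
 qed
 have A0: "A 0 = of_real N"
  unfolding A_def N_def by (simp add: complex_norm_square[symmetric] flip: of_real_power)
 have A_cont: "(\<lambda>n. A (z n)) \<longlonglongrightarrow> A 0" if "z \<longlonglongrightarrow> 0" for z :: "nat => real"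
 proof -
  have eq: "A t = cnj (LINT x|lborel. f (x - t) * cnj (f x))" for t
   unfolding A_def LINT_cnj[symmetric] by (simp add: mult.commute)
  have "(\<lambda>n. LINT x|lborel. f (x - z n) * cnj (f x)) \<longlonglongrightarrow> (LINT x|lborel. f x * cnj (f x))"
   by (rule L2_inner_tendsto[OF fz f2 f2]) (use transl_cont_L2[OF f2] that in "simp add: transl_cont_def")
  then have "(\<lambda>n. A (z n)) \<longlonglongrightarrow> cnj (LINT x|lborel. f x * cnj (f x))"
   unfolding eq by (rule tendsto_cnj)
  then show ?thesis unfolding eq[of 0] by simp
 qed
 have affine: "(LINT z|lborel. g (x - z)) = (LINT y|lborel. g y)" for g :: "real => 'a::{banach, second_countable_topology}" and x
  using lborel_integral_real_affine[of "-1" g x] by simp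
 have affine_int: "integrable lborel (\<lambda>z. g (x - z))" if "integrable lborel g"
  for g :: "real => 'a::{banach, second_countable_topology}" and x
  using lborel_integrable_real_affine[OF that, of "-1" x] by simp
 have P_int: "integrable (lborel \<Otimes>\<^sub>M lborel) (\<lambda>(x, z). ?P \<xi> x z)" for \<xi>
 proof (rule lborel_pair.Fubini_integrable)
  show "(\<lambda>(x, z). ?P \<xi> x z) \<in> borel_measurable (lborel \<Otimes>\<^sub>M lborel)" by measurable
  have "(LINT z|lborel. norm (case (x, z) of (x, z) => ?P \<xi> x z)) = cmod (f x) * L" for x
   using affine[of "\<lambda>y. cmod (f y)" x] by (simp add: norm_mult L_def)
  then show "integrable lborel (\<lambda>x. LINT z|lborel. norm (case (x, z) of (x, z) => ?P \<xi> x z))"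
   using f1 by simp
  have "integrable lborel (\<lambda>z. ?P \<xi> x z)" for x
   by (intro integrable_cis integrable_cmult integrable_cnj affine_int f1) measurable
  then show "AE x in lborel. integrable lborel (\<lambda>z. case (x, z) of (x, z) => ?P \<xi> x z)"
   by simp
 qed
 have F1: "(LINT z|lborel. A z * cis (- (z * \<xi>))) = of_real (2 * pi * (cmod (FI f \<xi>))^2)" for \<xi>
 proof -
  define h where "h y = f y * cis (- (y * \<xi>))" for y
  have "(LINT z|lborel. A z * cis (- (z * \<xi>))) = (LINT z|lborel. LINT x|lborel. ?P \<xi> x z)"
   unfolding A_def by simp
  also have "... = (LINT x|lborel. LINT z|lborel. ?P \<xi> x z)"
   by (rule lborel_pair.Fubini_integral[OF P_int])
  also have "... = (LINT x|lborel. h x * cnj (LINT y|lborel. h y))"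
  proof (rule LINT_cong)
   fix x
   have "?P \<xi> x z = h x * cnj (h (x - z))" for z
    by (simp add: h_def cis_cnj cis_mult algebra_simps)
   then have "(LINT z|lborel. ?P \<xi> x z) = h x * (LINT z|lborel. cnj (h (x - z)))"
    by simp
   also have "(LINT z|lborel. cnj (h (x - z))) = cnj (LINT y|lborel. h y)"
    unfolding affine[of "\<lambda>y. cnj (h y)" x] by simp
   finally show "(LINT z|lborel. ?P \<xi> x z) = h x * cnj (LINT y|lborel. h y)" .
  qed
  also have "... = (LINT y|lborel. h y) * cnj (LINT y|lborel. h y)" by simp
  also have "... = of_real ((cmod (LINT y|lborel. h y))^2)" by (simp add: complex_norm_square[symmetric])
  also have "(cmod (LINT y|lborel. h y))^2 = 2 * pi * (cmod (FI f \<xi>))^2"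
   by (simp add: FI_def h_def norm_mult power_mult_distrib norm_c2pi)
  finally show ?thesis .
 qed
 have A_int: "integrable lborel A"
  using lborel_pair.integrable_snd[OF P_int[of 0]] by (simp add: A_def[abs_def])
 \<comment> \<open>The Gaussian makes the double integral in z and \<xi> absolutely convergent; the
   factors 2 \<pi> from \<open>F1\<close> and from the Gaussian transform cancel.\<close>
 have nnq: "(\<integral>\<^sup>+\<xi>. ennreal (?q e \<xi>) \<partial>lborel)
   = ennreal (Re (LINT s|lborel. A (e * s) * of_real (std_normal_density s)))" if e: "e > 0" for e
 proof -
  define g where "g \<xi> = complex_of_real (exp (- (e * \<xi>)\<^sup>2 / 2))" for \<xi>
  have g_int: "integrable lborel g" unfolding g_def using gauss_fourier(1)[OF e] .
  have [measurable]: "g \<in> borel_measurable borel" unfolding g_def by measurable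
  have Q_int: "integrable (lborel \<Otimes>\<^sub>M lborel) (\<lambda>(z, \<xi>). A z * (g \<xi> * cis (- (z * \<xi>))))"
  proof (rule lborel_pair.Fubini_integrable)
   show "(\<lambda>(z, \<xi>). A z * (g \<xi> * cis (- (z * \<xi>)))) \<in> borel_measurable (lborel \<Otimes>\<^sub>M lborel)" by measurable
   have "(LINT \<xi>|lborel. norm (case (z, \<xi>) of (z, \<xi>) => A z * (g \<xi> * cis (- (z * \<xi>))))) = cmod (A z) * (LINT \<xi>|lborel. cmod (g \<xi>))" for z
    by (simp add: norm_mult)
   then show "integrable lborel (\<lambda>z. LINT \<xi>|lborel. norm (case (z, \<xi>) of (z, \<xi>) => A z * (g \<xi> * cis (- (z * \<xi>)))))"
    using A_int by simp
   have "integrable lborel (\<lambda>\<xi>. A z * (g \<xi> * cis (- (z * \<xi>))))" for z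
    by (intro integrable_cmult integrable_cis g_int) measurable
   then show "AE z in lborel. integrable lborel (\<lambda>\<xi>. case (z, \<xi>) of (z, \<xi>) => A z * (g \<xi> * cis (- (z * \<xi>))))"
    by simp
  qed
  have inner: "(LINT z|lborel. A z * (g \<xi> * cis (- (z * \<xi>)))) = of_real (2 * pi * (?q e \<xi>))" for \<xi>
  proof -
   have "(LINT z|lborel. A z * (g \<xi> * cis (- (z * \<xi>)))) = (LINT z|lborel. g \<xi> * (A z * cis (- (z * \<xi>))))"
    by (simp add: mult_ac)
   also have "... = g \<xi> * (LINT z|lborel. A z * cis (- (z * \<xi>)))" by simp
   finally show ?thesis unfolding F1 g_def by (simp add: mult_ac)
  qed
  have int: "integrable lborel (\<lambda>\<xi>. ?q e \<xi>)"
  proof -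
   have "integrable lborel (\<lambda>\<xi>. complex_of_real (2 * pi * (?q e \<xi>)))"
    using lborel_pair.integrable_snd[OF Q_int] by (simp add: inner)
   from integrable_Re[OF this] have "integrable lborel (\<lambda>\<xi>. 1 / (2 * pi) * (2 * pi * (?q e \<xi>)))"
    by (intro integrable_cmult) simp
   then show ?thesis by simp
  qed
  have "of_real (2 * pi * (LINT \<xi>|lborel. ?q e \<xi>))
   = (LINT \<xi>|lborel. LINT z|lborel. A z * (g \<xi> * cis (- (z * \<xi>))))"
   unfolding inner integral_complex_of_real LINT_cmult ..
  also have "... = (LINT z|lborel. LINT \<xi>|lborel. A z * (g \<xi> * cis (- (z * \<xi>))))"
   by (rule lborel_pair.Fubini_integral[OF Q_int])
  also have "... = (LINT z|lborel. A z * of_real (2 * pi / e * std_normal_density (z / e)))"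
   using gauss_fourier(2)[OF e] by (simp add: g_def)
  also have "... = \<bar>e\<bar> *\<^sub>R (LINT s|lborel. A (0 + e * s) * of_real (2 * pi / e * std_normal_density ((0 + e * s) / e)))"
   by (rule lborel_integral_real_affine) (use e in simp)
  also have "(\<lambda>s. A (0 + e * s) * of_real (2 * pi / e * std_normal_density ((0 + e * s) / e)))
    = (\<lambda>s. of_real (2 * pi / e) * (A (e * s) * of_real (std_normal_density s)))"
   using e by (simp add: mult_ac)
  also have "\<bar>e\<bar> *\<^sub>R (LINT s|lborel. of_real (2 * pi / e) * (A (e * s) * of_real (std_normal_density s)))
    = of_real (2 * pi) * (LINT s|lborel. A (e * s) * of_real (std_normal_density s))"
   using e unfolding LINT_cmult by (simp add: scaleR_conv_of_real)
  finally have "of_real (2 * pi) * of_real (LINT \<xi>|lborel. ?q e \<xi>)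
   = complex_of_real (2 * pi) * (LINT s|lborel. A (e * s) * of_real (std_normal_density s))"
   by (simp only: of_real_mult)
  then have eq: "complex_of_real (LINT \<xi>|lborel. ?q e \<xi>)
   = (LINT s|lborel. A (e * s) * of_real (std_normal_density s))"
   by (subst (asm) mult_left_cancel) auto
  have "(\<integral>\<^sup>+\<xi>. ennreal (?q e \<xi>) \<partial>lborel)
   = ennreal (LINT \<xi>|lborel. ?q e \<xi>)"
   by (rule nn_integral_eq_integral[OF int]) simp
  then show ?thesis unfolding eq[symmetric] by simp
 qed
 define en where "en n = 1 / real (Suc n)" for n
 have en: "en n > 0" for n by (simp add: en_def)
 have en0: "en \<longlonglongrightarrow> 0" unfolding en_def using LIMSEQ_Suc[OF lim_1_over_n[where 'a = real]] by simp
 \<comment> \<open>Monotone convergence, since \<open>FI f\<close> is not yet known to be square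
   integrable.\<close>
 have lhs: "(\<lambda>n. \<integral>\<^sup>+\<xi>. ennreal (?q (en n) \<xi>) \<partial>lborel)
   \<longlonglongrightarrow> (\<integral>\<^sup>+\<xi>. ennreal ((cmod (FI f \<xi>))^2) \<partial>lborel)"
 proof (rule nn_integral_LIMSEQ)
  show "incseq (\<lambda>n \<xi>. ennreal (?q (en n) \<xi>))"
  proof (intro incseq_SucI le_funI ennreal_leI mult_right_mono)
   fix n \<xi>
   have "(en (Suc n) * \<xi>)^2 <= (en n * \<xi>)^2"
    unfolding power_mult_distrib by (intro mult_right_mono power_mono) (auto simp: en_def field_simps)
   then show "exp (- (en n * \<xi>)\<^sup>2 / 2) <= exp (- (en (Suc n) * \<xi>)\<^sup>2 / 2)" by simp
  qed simp
  fix \<xi> :: real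
  have "(\<lambda>n. ennreal (?q (en n) \<xi>))
   \<longlonglongrightarrow> ennreal (?q 0 \<xi>)"
   by (intro tendsto_ennrealI tendsto_intros en0) simp
  then show "(\<lambda>n. ennreal (?q (en n) \<xi>)) \<longlonglongrightarrow> ennreal ((cmod (FI f \<xi>))^2)"
   by simp
 qed measurable
 have d: "integrable lborel std_normal_density" by (simp add: integrable_normal_density)
 have "(\<lambda>n. LINT s|lborel. A (en n * s) * of_real (std_normal_density s))
   \<longlonglongrightarrow> (LINT s|lborel. of_real N * complex_of_real (std_normal_density s))"
 proof (rule integral_dominated_convergence[where w = "\<lambda>s. N * std_normal_density s"])
  show "integrable lborel (\<lambda>s. N * std_normal_density s)" using d by simp
  show "AE s in lborel. (\<lambda>n. A (en n * s) * of_real (std_normal_density s)) \<longlonglongrightarrow> of_real N * complex_of_real (std_normal_density s)"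
  proof (rule AE_I2)
   fix s
   have "(\<lambda>n. en n * s) \<longlonglongrightarrow> 0 * s" by (intro tendsto_intros en0)
   then show "(\<lambda>n. A (en n * s) * of_real (std_normal_density s)) \<longlonglongrightarrow> of_real N * complex_of_real (std_normal_density s)"
    using A_cont[of "\<lambda>n. en n * s"] unfolding A0 by (intro tendsto_intros) simp
  qed
  show "AE s in lborel. norm (A (en n * s) * complex_of_real (std_normal_density s)) <= N * std_normal_density s" for n
   using A_bound by (intro AE_I2) (simp add: norm_mult normal_density_nonneg mult_right_mono)
 qed measurable
 also have "(LINT s|lborel. of_real N * complex_of_real (std_normal_density s)) = of_real N"
  by simp
 finally have "(\<lambda>n. ennreal (Re (LINT s|lborel. A (en n * s) * of_real (std_normal_density s)))) \<longlonglongrightarrow> ennreal (Re (of_real N))"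
  by (intro tendsto_ennrealI tendsto_Re)
 then have "(\<lambda>n. \<integral>\<^sup>+\<xi>. ennreal (?q (en n) \<xi>) \<partial>lborel) \<longlonglongrightarrow> ennreal N"
  unfolding nnq[OF en] by simp
 from LIMSEQ_unique[OF lhs this] show ?thesis by (simp add: sqn_def[of _ "FI f"] sqf)
qed

lemma FI_L2:
 assumes "integrable lborel f" "f \<in> L2 lborel" shows "FI f \<in> L2 lborel"
proof -
 have [measurable]: "f \<in> borel_measurable borel" using assms by auto
 show ?thesis using plancherel_FI[OF assms] assms(2) by (simp add: L2_iff)
qed

text \<open>Fubini, with the integrable majorant |f(x)| |h(\<xi>)|. Two arbitrary sigma-finite
  measures are allowed, so that the pairs line-line and torus-integers are treated at once.\<close>

lemma fourier_duality:
 assumes \<mu>: "sigma_finite_measure \<mu>" and \<nu>: "sigma_finite_measure \<nu>"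
  and f: "integrable \<mu> f" and h: "integrable \<nu> h"
  and [measurable]: "(\<lambda>x. x) \<in> borel_measurable \<mu>" "(\<lambda>x. x) \<in> borel_measurable \<nu>"
 shows "(LINT \<xi>|\<nu>. (LINT x|\<mu>. f x * cis (- (x * \<xi>))) * cnj (h \<xi>))
  = (LINT x|\<mu>. f x * cnj (LINT \<xi>|\<nu>. h \<xi> * cis (x * \<xi>)))"
proof -
 interpret \<mu>: sigma_finite_measure \<mu> by fact
 interpret \<nu>: sigma_finite_measure \<nu> by fact
 interpret pair_sigma_finite \<mu> \<nu> ..
 have [measurable]: "f \<in> borel_measurable \<mu>" "h \<in> borel_measurable \<nu>" using f h by auto
 have id1 [measurable]: "fst \<in> borel_measurable (\<mu> \<Otimes>\<^sub>M \<nu>)" "snd \<in> borel_measurable (\<mu> \<Otimes>\<^sub>M \<nu>)"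
  using measurable_compose[OF measurable_fst[of \<mu> \<nu>], of "\<lambda>x. x" borel]
   measurable_compose[OF measurable_snd[of \<mu> \<nu>], of "\<lambda>x. x" borel] by auto
 have P: "integrable (\<mu> \<Otimes>\<^sub>M \<nu>) (\<lambda>(x, \<xi>). f x * cis (- (x * \<xi>)) * cnj (h \<xi>))"
 proof (rule Fubini_integrable)
  show "(\<lambda>(x, \<xi>). f x * cis (- (x * \<xi>)) * cnj (h \<xi>)) \<in> borel_measurable (\<mu> \<Otimes>\<^sub>M \<nu>)"
   unfolding split_beta' by measurable
  have "(LINT \<xi>|\<nu>. norm (case (x, \<xi>) of (x, \<xi>) => f x * cis (- (x * \<xi>)) * cnj (h \<xi>))) = cmod (f x) * (LINT \<xi>|\<nu>. cmod (h \<xi>))" for x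
   by (simp add: norm_mult)
  then show "integrable \<mu> (\<lambda>x. LINT \<xi>|\<nu>. norm (case (x, \<xi>) of (x, \<xi>) => f x * cis (- (x * \<xi>)) * cnj (h \<xi>)))"
   using f by simp
  have "integrable \<nu> (\<lambda>\<xi>. f x * (cnj (h \<xi>) * cis (- (x * \<xi>))))" for x
   by (intro integrable_cmult integrable_cis integrable_cnj h) measurable
  then show "AE x in \<mu>. integrable \<nu> (\<lambda>\<xi>. case (x, \<xi>) of (x, \<xi>) => f x * cis (- (x * \<xi>)) * cnj (h \<xi>))"
   by (simp add: mult_ac)
 qed
 have "(LINT \<xi>|\<nu>. (LINT x|\<mu>. f x * cis (- (x * \<xi>))) * cnj (h \<xi>))
   = (LINT \<xi>|\<nu>. LINT x|\<mu>. f x * cis (- (x * \<xi>)) * cnj (h \<xi>))"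
  unfolding LINT_multc ..
 also have "... = (LINT x|\<mu>. LINT \<xi>|\<nu>. f x * cis (- (x * \<xi>)) * cnj (h \<xi>))"
  by (rule Fubini_integral[OF P])
 also have "... = (LINT x|\<mu>. f x * cnj (LINT \<xi>|\<nu>. h \<xi> * cis (x * \<xi>)))"
  unfolding LINT_cnj[symmetric]
  by (simp add: cis_cnj mult_ac flip: LINT_cmult)
 finally show ?thesis .
qed

definition trunc :: "real => (real => complex) => real => complex" where
 "trunc R f x = indicator {-R..R} x * f x"

lemma trunc_measurable [measurable (raw)]: "f \<in> borel_measurable borel ==> trunc R f \<in> borel_measurable borel"
 unfolding trunc_def[abs_def] by measurable

lemma trunc_L2: "f \<in> L2 lborel ==> trunc R f \<in> L2 lborel"
 by (rule L2_bound[of f]) (auto simp: trunc_def indicator_def dest!: L2_measurable)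

lemma trunc_integrable:
 assumes f: "f \<in> L2 lborel" shows "integrable lborel (trunc R f)"
proof (rule Bochner_Integration.integrable_bound)
 have "emeasure lborel {-R..R} < \<infinity>" by (simp add: emeasure_lborel_Icc_eq)
 then show "integrable lborel (\<lambda>x. indicator {-R..R} x + (cmod (f x))^2)"
  using L2_integrable_square[OF f] by (intro Bochner_Integration.integrable_add) auto
 show "trunc R f \<in> borel_measurable lborel" using L2_measurable[OF f] by simp
 have "cmod (trunc R f x) <= indicator {-R..R} x + (cmod (f x))^2" for x
 proof (cases "cmod (f x) <= 1")
  case False
  then have "cmod (f x) * 1 <= cmod (f x) * cmod (f x)" by (intro mult_left_mono) auto
  then show ?thesis by (simp add: trunc_def indicator_def power2_eq_square)
 qed (auto simp: trunc_def indicator_def intro: add_increasing2)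
 then show "AE x in lborel. norm (trunc R f x) <= norm (indicator {-R..R} x + (cmod (f x))^2)"
  by (intro AE_I2) (simp add: order_trans[OF _ abs_ge_self])
qed

lemma trunc_diff_le:
 assumes "c <= a" "c <= b" shows "cmod (trunc a f x - trunc b f x) <= cmod (f x - trunc c f x)"
 using assms by (auto simp: trunc_def indicator_def)

lemma trunc_tendsto:
 assumes f: "f \<in> L2 lborel" shows "(\<lambda>n. sqn lborel (\<lambda>x. f x - trunc (real n) f x)) \<longlonglongrightarrow> 0"
proof (rule sqn_dominated_tendsto[OF _ f])
 show "(\<lambda>x. f x - trunc (real n) f x) \<in> borel_measurable lborel" for n using L2_measurable[OF f] by simp
 show "cmod (f x - trunc (real n) f x) <= cmod (f x)" for n x by (auto simp: trunc_def indicator_def)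
 fix x :: real
 obtain n0 :: nat where n0: "\<bar>x\<bar> <= n0" using real_arch_simple[of "\<bar>x\<bar>"] by blast
 have "\<forall>\<^sub>F n in sequentially. f x - trunc (real n) f x = 0"
  using eventually_ge_at_top[of n0]
 proof eventually_elim
  case (elim n)
  then have "\<bar>x\<bar> <= real n" using n0 by linarith
  then have "x \<in> {- real n..real n}" by auto
  then show ?case by (simp add: trunc_def)
 qed
 then show "(\<lambda>n. f x - trunc (real n) f x) \<longlonglongrightarrow> 0" by (rule tendsto_eventually)
qed

lemma sqn_FI_diff:
 assumes "integrable lborel f" "f \<in> L2 lborel" "integrable lborel g" "g \<in> L2 lborel"
 shows "sqn lborel (\<lambda>\<xi>. FI f \<xi> - FI g \<xi>) = sqn lborel (\<lambda>x. f x - g x)"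
proof -
 have "FI (\<lambda>x. f x - g x) = (\<lambda>\<xi>. FI f \<xi> - FI g \<xi>)" using FI_diff assms by blast
 then show ?thesis using plancherel_FI[of "\<lambda>x. f x - g x"] assms by (simp add: L2_diff)
qed

text \<open>The transform is defined by a limit along real radii, whereas completeness speaks of
  sequences. The limit is therefore found along integer radii, and the Cauchy estimate
  \<open>small\<close>, valid for real radii, carries it over.\<close>

lemma fourier_line_exists:
 assumes f: "f \<in> L2 lborel"
 obtains g where "g \<in> L2 lborel" "((\<lambda>R. sqn lborel (\<lambda>\<xi>. FI (trunc R f) \<xi> - g \<xi>)) \<longlongrightarrow> 0) at_top"
proof -
 note T = trunc_integrable[OF f] trunc_L2[OF f]
 have small: "\<exists>n0::nat. \<forall>a\<ge>n0. \<forall>b\<ge>n0. sqn lborel (\<lambda>\<xi>. FI (trunc a f) \<xi> - FI (trunc b f) \<xi>) <= ennreal e"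
  if "e > 0" for e
 proof -
  obtain n0 where n0: "sqn lborel (\<lambda>x. f x - trunc (real n0) f x) < ennreal e"
  proof -
   have "\<exists>n0. \<forall>n\<ge>n0. sqn lborel (\<lambda>x. f x - trunc (real n) f x) < ennreal e"
    using ennreal_tendsto_zero_D[OF trunc_tendsto[OF f], of "ennreal e"] \<open>e > 0\<close> by simp
   then show ?thesis using that by blast
  qed
  show ?thesis
  proof (intro exI[of _ n0] allI impI)
   fix a b :: real assume ab: "real n0 <= a" "real n0 <= b"
   have "sqn lborel (\<lambda>x. trunc a f x - trunc b f x) <= sqn lborel (\<lambda>x. f x - trunc (real n0) f x)"
    using trunc_diff_le[OF ab] by (intro sqn_mono) auto
   then show "sqn lborel (\<lambda>\<xi>. FI (trunc a f) \<xi> - FI (trunc b f) \<xi>) <= ennreal e"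
    using n0 by (simp add: sqn_FI_diff[OF T T])
  qed
 qed
 obtain g where g: "g \<in> L2 lborel" "(\<lambda>n. sqn lborel (\<lambda>\<xi>. FI (trunc (real n) f) \<xi> - g \<xi>)) \<longlonglongrightarrow> 0"
 proof (rule L2_complete[of "\<lambda>n. FI (trunc (real n) f)" lborel])
  show "FI (trunc (real n) f) \<in> L2 lborel" for n by (rule FI_L2[OF T])
  fix e :: real assume "e > 0"
  from small[OF this] obtain n0 :: nat where n0: "\<And>a b. real n0 <= a ==> real n0 <= b ==>
    sqn lborel (\<lambda>\<xi>. FI (trunc a f) \<xi> - FI (trunc b f) \<xi>) <= ennreal e" by auto
  then show "\<exists>n0. \<forall>m\<ge>n0. \<forall>n\<ge>n0. sqn lborel (\<lambda>\<xi>. FI (trunc (real m) f) \<xi> - FI (trunc (real n) f) \<xi>) <= ennreal e"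
   by (intro exI[of _ n0]) auto
 qed
 have [measurable]: "f \<in> borel_measurable borel" "g \<in> borel_measurable borel"
  using L2_measurable[OF f] L2_measurable[OF g(1)] by auto
 have "((\<lambda>R. sqn lborel (\<lambda>\<xi>. FI (trunc R f) \<xi> - g \<xi>)) \<longlongrightarrow> 0) at_top"
 proof (rule tendsto_0_if_Limsup_eq_0_ennreal, rule antisym)
  show "Limsup at_top (\<lambda>R. sqn lborel (\<lambda>\<xi>. FI (trunc R f) \<xi> - g \<xi>)) <= 0"
  proof (rule ennreal_le_epsilon)
   fix e :: real assume e: "0 < e"
   obtain n0 :: nat where n0: "\<And>a b. real n0 <= a ==> real n0 <= b ==>
    sqn lborel (\<lambda>\<xi>. FI (trunc a f) \<xi> - FI (trunc b f) \<xi>) <= ennreal (e/4)" using small[of "e/4"] e by auto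
   obtain n1 where n1: "\<And>n. n >= n1 ==> sqn lborel (\<lambda>\<xi>. FI (trunc (real n) f) \<xi> - g \<xi>) < ennreal (e/4)"
    using ennreal_tendsto_zero_D[OF g(2), of "ennreal (e/4)"] e by auto
   define n where "n = max n0 n1"
   have "sqn lborel (\<lambda>\<xi>. FI (trunc R f) \<xi> - g \<xi>) <= ennreal e" if R: "R >= real n0" for R
   proof -
    have "sqn lborel (\<lambda>\<xi>. FI (trunc R f) \<xi> - g \<xi>)
      = sqn lborel (\<lambda>\<xi>. (FI (trunc R f) \<xi> - FI (trunc (real n) f) \<xi>) + (FI (trunc (real n) f) \<xi> - g \<xi>))" by simp
    also have "... <= 2 * (sqn lborel (\<lambda>\<xi>. FI (trunc R f) \<xi> - FI (trunc (real n) f) \<xi>)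
      + sqn lborel (\<lambda>\<xi>. FI (trunc (real n) f) \<xi> - g \<xi>))"
     by (rule sqn_add_le) measurable
    also have "... <= 2 * (ennreal (e/4) + ennreal (e/4))"
     using R by (intro mult_left_mono add_mono n0 less_imp_le[OF n1]) (auto simp: n_def)
    also have "... = ennreal e"
     using e by (simp add: ennreal_plus[symmetric] ennreal_mult[symmetric] del: ennreal_plus flip: ennreal_numeral)
    finally show ?thesis .
   qed
   then have "\<forall>\<^sub>F R in at_top. sqn lborel (\<lambda>\<xi>. FI (trunc R f) \<xi> - g \<xi>) <= ennreal e"
    by (rule eventually_mono[OF eventually_ge_at_top])
   then show "Limsup at_top (\<lambda>R. sqn lborel (\<lambda>\<xi>. FI (trunc R f) \<xi> - g \<xi>)) <= 0 + ennreal e"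
    by (simp add: Limsup_bounded)
  qed
 qed simp
 then show ?thesis using g(1) that by blast
qed

lemma fourier_line:
 assumes f: "f \<in> L2 lborel"
 shows "fourier Line f \<in> L2 lborel"
  and "((\<lambda>R. sqn lborel (\<lambda>\<xi>. FI (trunc R f) \<xi> - fourier Line f \<xi>)) \<longlongrightarrow> 0) at_top"
proof -
 have FI: "complex_of_real (1 / sqrt (2 * pi)) * (LINT x:{-R..R}|lborel. f x * cis (- (x * \<xi>))) = FI (trunc R f) \<xi>" for R \<xi>
  unfolding FI_def c2pi_def set_lebesgue_integral_def trunc_def
  by (intro arg_cong2[where f = times] Bochner_Integration.integral_cong refl) (simp add: indicator_def)
 have "\<exists>g. g \<in> L2 lborel \<and> ((\<lambda>R. sqn lborel (\<lambda>\<xi>. FI (trunc R f) \<xi> - g \<xi>)) \<longlongrightarrow> 0) at_top"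
  using fourier_line_exists[OF f] by blast
 from someI_ex[OF this[folded FI, unfolded sqn_def]]
 have "fourier Line f \<in> L2 lborel \<and> ((\<lambda>R. sqn lborel (\<lambda>\<xi>. FI (trunc R f) \<xi> - fourier Line f \<xi>)) \<longlongrightarrow> 0) at_top"
  unfolding FI[symmetric] sqn_def fourier.simps .
 then show "fourier Line f \<in> L2 lborel"
  and "((\<lambda>R. sqn lborel (\<lambda>\<xi>. FI (trunc R f) \<xi> - fourier Line f \<xi>)) \<longlongrightarrow> 0) at_top" by auto
qed

lemma fourier_line_nat:
 assumes "f \<in> L2 lborel"
 shows "(\<lambda>n. sqn lborel (\<lambda>\<xi>. FI (trunc (real n) f) \<xi> - fourier Line f \<xi>)) \<longlonglongrightarrow> 0"
 by (rule filterlim_compose[OF fourier_line(2)[OF assms] filterlim_real_sequentially])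

lemma fourier_line_plancherel:
 assumes f: "f \<in> L2 lborel" shows "sqn lborel (fourier Line f) = sqn lborel f"
proof (rule LIMSEQ_unique)
 note T = trunc_integrable[OF f] trunc_L2[OF f]
 show "(\<lambda>n. sqn lborel (FI (trunc (real n) f))) \<longlonglongrightarrow> sqn lborel (fourier Line f)"
  by (rule sqn_tendsto[OF FI_L2[OF T] fourier_line(1)[OF f] fourier_line_nat[OF f]])
 have "(\<lambda>n. sqn lborel (trunc (real n) f)) \<longlonglongrightarrow> sqn lborel f"
  by (rule sqn_tendsto[OF T(2) f]) (subst sqn_diff_commute, rule trunc_tendsto[OF f])
 then show "(\<lambda>n. sqn lborel (FI (trunc (real n) f))) \<longlonglongrightarrow> sqn lborel f"
  by (simp add: plancherel_FI[OF T])
qed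

lemma fourier_line_add_scale:
 assumes f: "f \<in> L2 lborel" and g: "g \<in> L2 lborel"
 shows "AE \<xi> in lborel. fourier Line (\<lambda>x. f x + c * g x) \<xi> = fourier Line f \<xi> + c * fourier Line g \<xi>"
proof (rule sqn_limit_unique)
 have h: "(\<lambda>x. f x + c * g x) \<in> L2 lborel" by (intro L2_add L2_scale f g)
 note fm [measurable] = L2_measurable[OF f, simplified] L2_measurable[OF g, simplified]
  L2_measurable[OF fourier_line(1)[OF f], simplified] L2_measurable[OF fourier_line(1)[OF g], simplified]
  L2_measurable[OF fourier_line(1)[OF h], simplified]
 show "(\<lambda>n. sqn lborel (\<lambda>\<xi>. FI (trunc (real n) (\<lambda>x. f x + c * g x)) \<xi> - fourier Line (\<lambda>x. f x + c * g x) \<xi>)) \<longlonglongrightarrow> 0"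
  by (rule fourier_line_nat[OF h])
 have "(\<lambda>n. sqn lborel (\<lambda>\<xi>. (FI (trunc (real n) f) \<xi> - fourier Line f \<xi>) + c * (FI (trunc (real n) g) \<xi> - fourier Line g \<xi>))) \<longlonglongrightarrow> 0"
  by (intro sqn_add_tendsto_0 sqn_scale_tendsto_0 fourier_line_nat f g) measurable
 moreover have "FI (trunc (real n) (\<lambda>x. f x + c * g x)) \<xi> = FI (trunc (real n) f) \<xi> + c * FI (trunc (real n) g) \<xi>" for n \<xi>
  using FI_add_scale[OF trunc_integrable[OF f, of n] trunc_integrable[OF g, of n], of c \<xi>]
  by (simp add: trunc_def[abs_def] algebra_simps)
 ultimately show "(\<lambda>n. sqn lborel (\<lambda>\<xi>. FI (trunc (real n) (\<lambda>x. f x + c * g x)) \<xi> - (fourier Line f \<xi> + c * fourier Line g \<xi>))) \<longlonglongrightarrow> 0"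
  by (simp add: algebra_simps)
 show "fourier Line (\<lambda>x. f x + c * g x) \<in> borel_measurable lborel" using fm by simp
 show "(\<lambda>\<xi>. fourier Line f \<xi> + c * fourier Line g \<xi>) \<in> borel_measurable lborel" by measurable
 show "FI (trunc (real n) (\<lambda>x. f x + c * g x)) \<in> borel_measurable lborel" for n by measurable
qed simp

lemma fourier_line_inner:
 assumes f: "f \<in> L2 lborel" and h1: "integrable lborel h" and h2: "h \<in> L2 lborel"
 shows "(LINT \<xi>|lborel. fourier Line f \<xi> * cnj (h \<xi>)) = (LINT x|lborel. f x * cnj (FI h (- x)))"
proof (rule LIMSEQ_unique)
 note T = trunc_integrable[OF f] trunc_L2[OF f]
 have [measurable]: "f \<in> borel_measurable borel" "h \<in> borel_measurable borel"
  using L2_measurable[OF f] L2_measurable[OF h2] by auto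
 have Eh: "(\<lambda>x. FI h (- x)) \<in> L2 lborel"
  using FI_L2[OF h1 h2] sqn_reflect[of "FI h"] by (simp add: L2_iff)
 show "(\<lambda>n. LINT \<xi>|lborel. FI (trunc (real n) f) \<xi> * cnj (h \<xi>)) \<longlonglongrightarrow> (LINT \<xi>|lborel. fourier Line f \<xi> * cnj (h \<xi>))"
  by (rule L2_inner_tendsto[OF FI_L2[OF T] fourier_line(1)[OF f] h2 fourier_line_nat[OF f]])
 have eq: "(LINT \<xi>|lborel. FI g \<xi> * cnj (h \<xi>)) = (LINT x|lborel. g x * cnj (FI h (- x)))" if g: "integrable lborel g" for g
 proof -
  have "(LINT \<xi>|lborel. FI g \<xi> * cnj (h \<xi>)) = c2pi * (LINT \<xi>|lborel. (LINT x|lborel. g x * cis (- (x * \<xi>))) * cnj (h \<xi>))"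
   unfolding FI_def mult.assoc by (rule LINT_cmult)
  also have "... = c2pi * (LINT x|lborel. g x * cnj (LINT \<xi>|lborel. h \<xi> * cis (x * \<xi>)))"
   by (subst fourier_duality[OF lborel.sigma_finite_measure_axioms lborel.sigma_finite_measure_axioms g h1]) auto
  also have "... = (LINT x|lborel. c2pi * (g x * cnj (LINT \<xi>|lborel. h \<xi> * cis (x * \<xi>))))"
   by (rule LINT_cmult[symmetric])
  also have "... = (LINT x|lborel. g x * cnj (c2pi * (LINT \<xi>|lborel. h \<xi> * cis (x * \<xi>))))"
   by (simp only: complex_cnj_mult cnj_c2pi mult.left_commute)
  also have "... = (LINT x|lborel. g x * cnj (FI h (- x)))"
   by (simp add: FI_def mult.commute)
  finally show ?thesis .
 qed
 have "(\<lambda>n. LINT x|lborel. trunc (real n) f x * cnj (FI h (- x))) \<longlonglongrightarrow> (LINT x|lborel. f x * cnj (FI h (- x)))"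
  by (rule L2_inner_tendsto[OF T(2) f Eh]) (subst sqn_diff_commute, rule trunc_tendsto[OF f])
 then show "(\<lambda>n. LINT \<xi>|lborel. FI (trunc (real n) f) \<xi> * cnj (h \<xi>)) \<longlonglongrightarrow> (LINT x|lborel. f x * cnj (FI h (- x)))"
  by (simp add: eq[OF T(1)])
qed

text \<open>Let f be the reflected Fourier integral of h. Plancherel gives f, its transform and h
  the same norm, and duality gives the transform of f and h an inner product equal to the square of
  this norm. By polarisation their distance is 0.\<close>

lemma fourier_line_inversion:
 assumes h1: "integrable lborel h" and h2: "h \<in> L2 lborel"
 shows "(\<lambda>x. FI h (- x)) \<in> L2 lborel" "AE \<xi> in lborel. fourier Line (\<lambda>x. FI h (- x)) \<xi> = h \<xi>"
proof -
 have [measurable]: "h \<in> borel_measurable borel" using L2_measurable[OF h2] by auto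
 define f where "f = (\<lambda>x. FI h (- x))"
 have sq: "sqn lborel f = sqn lborel h"
  unfolding f_def using sqn_reflect[of "FI h"] plancherel_FI[OF h1 h2] by simp
 show f: "(\<lambda>x. FI h (- x)) \<in> L2 lborel" using sq h2 unfolding f_def by (simp add: L2_iff)
 then have f': "f \<in> L2 lborel" by (simp add: f_def)
 note Ff = fourier_line(1)[OF f']
 have N: "(LINT x|lborel. (cmod (g x))^2) = enn2real (sqn lborel g)" if "g \<in> L2 lborel" for g
  by (simp add: sqn_eq_integral[OF that])
 have inner: "(LINT \<xi>|lborel. fourier Line f \<xi> * cnj (h \<xi>)) = of_real (LINT x|lborel. (cmod (f x))^2)"
  unfolding fourier_line_inner[OF f' h1 h2] unfolding f_def complex_norm_square[symmetric] by (simp flip: of_real_power)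
 have "(LINT \<xi>|lborel. (cmod (fourier Line f \<xi> - h \<xi>))^2) = 0"
  unfolding sqn_polarize[OF Ff h2] inner N[OF f'] N[OF Ff] N[OF h2] fourier_line_plancherel[OF f'] sq by simp
 then have "sqn lborel (\<lambda>\<xi>. fourier Line f \<xi> - h \<xi>) = 0"
  by (simp add: sqn_eq_integral[OF L2_diff[OF Ff h2]])
 then show "AE \<xi> in lborel. fourier Line (\<lambda>x. FI h (- x)) \<xi> = h \<xi>"
  using L2_measurable[OF L2_diff[OF Ff h2]] by (subst (asm) sqn_zero_iff) (auto simp: f_def)
qed

subsection \<open>The Fourier transform on the torus\<close>

lemma sigma_finite_phys: "sigma_finite_measure (phys M)"
 by (cases M) (auto intro: sigma_finite_measure_restrict_space lborel.sigma_finite_measure_axioms)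

lemma sigma_finite_freq: "sigma_finite_measure (freq M)"
 by (cases M) (auto intro: sigma_finite_measure_count_space_countable lborel.sigma_finite_measure_axioms
   simp: Ints_def)

lemma borel_measurable_freq [measurable (raw)]: "f \<in> borel_measurable borel ==> f \<in> fmeas M"
 by (cases M) auto

lemma borel_measurable_phys [measurable (raw)]: "f \<in> borel_measurable borel ==> f \<in> borel_measurable (phys M)"
 by (cases M) (auto intro: measurable_restrict_space1)

text \<open>Extension by zero moves a function from the torus to the line, where its Fourier
  coefficients are the values of \<open>FI\<close> at the integers.\<close>

definition ext :: "(real => complex) => real => complex" where
 "ext f x = indicator {0..<2 * pi} x * f x"

lemma ext_measurable_iff: "f \<in> borel_measurable (phys Torus) \<longleftrightarrow> ext f \<in> borel_measurable borel"
proof -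
 have "(\<lambda>x. indicator {0..<2 * pi} x *\<^sub>R f x) = ext f" by (auto simp: ext_def indicator_def)
 then show ?thesis using borel_measurable_restrict_space_iff[of "{0..<2 * pi}" lborel f] by simp
qed

lemma sqn_ext: "sqn (phys Torus) f = sqn lborel (ext f)"
proof -
 have "sqn (phys Torus) f = (\<integral>\<^sup>+x. ennreal ((cmod (f x))^2) * indicator {0..<2 * pi} x \<partial>lborel)"
  unfolding sqn_def phys.simps by (rule nn_integral_restrict_space) simp
 also have "... = sqn lborel (ext f)"
  unfolding sqn_def by (intro nn_integral_cong) (auto simp: ext_def indicator_def)
 finally show ?thesis .
qed

lemma ext_L2_iff: "f \<in> L2 (phys Torus) \<longleftrightarrow> ext f \<in> L2 lborel"
 unfolding L2_iff ext_measurable_iff sqn_ext by simp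

lemma ext_integrable: "f \<in> L2 (phys Torus) ==> integrable lborel (ext f)"
proof -
 assume "f \<in> L2 (phys Torus)"
 then have "ext f \<in> L2 lborel" using ext_L2_iff by blast
 then have "integrable lborel (trunc (2 * pi) (ext f))" by (rule trunc_integrable)
 moreover have "trunc (2 * pi) (ext f) = ext f" by (auto simp: trunc_def ext_def indicator_def)
 ultimately show ?thesis by simp
qed

lemma torus_integral:
 fixes f :: "real => complex"
 shows "(LINT x|phys Torus. f x) = (LINT x|lborel. indicator {0..<2 * pi} x *\<^sub>R f x)"
 unfolding phys.simps by (subst Bochner_Integration.integral_restrict_space) auto

lemma torus_integrable_iff: "integrable (phys Torus) f \<longleftrightarrow> integrable lborel (ext f)"
proof -
 have "(\<lambda>x. indicator {0..<2 * pi} x *\<^sub>R f x) = ext f" by (auto simp: ext_def indicator_def)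
 then show ?thesis unfolding phys.simps by (subst integrable_restrict_space) auto
qed

lemma fourier_torus: "fourier Torus f \<xi> = FI (ext f) \<xi>"
proof -
 have "(LINT x|phys Torus. f x * cis (- (x * \<xi>))) = (LINT x|lborel. ext f x * cis (- (x * \<xi>)))"
  unfolding torus_integral by (intro Bochner_Integration.integral_cong refl) (simp add: ext_def indicator_def)
 then show ?thesis by (simp add: FI_def c2pi_def)
qed

lemma torus_orthogonal:
 assumes "n \<in> \<int>" shows "(LINT x|phys Torus. cis (x * n)) = (if n = 0 then of_real (2 * pi) else 0)"
proof -
 have eq: "(LINT x|phys Torus. cis (x * n)) = (LINT x|lborel. indicator {0..2 * pi} x *\<^sub>R cis (x * n))"
  unfolding torus_integral
 proof (rule integral_cong_AE)
  have "AE x in lborel. x \<noteq> 2 * pi" by (rule AE_lborel_singleton)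
  then show "AE x in lborel. indicator {0..<2 * pi} x *\<^sub>R cis (x * n) = indicator {0..2 * pi} x *\<^sub>R cis (x * n)"
   by eventually_elim (auto simp: indicator_def)
 qed measurable
 show ?thesis
 proof (cases "n = 0")
  case True
  then have "(LINT x|lborel. indicator {0..2 * pi} x *\<^sub>R cis (x * n)) = (LINT x|lborel. indicator {0..2 * pi} x *\<^sub>R (1::complex))"
   by (simp add: cis_zero)
  also have "... = of_real (2 * pi)"
   by (simp add: measure_def scaleR_conv_of_real)
  finally show ?thesis using True eq by simp
 next
  case False
  have "has_bochner_integral lborel (\<lambda>x. indicator {0..2 * pi} x *\<^sub>R cis (x * n))
   (cis (2 * pi * n) / (\<i> * of_real n) - cis (0 * n) / (\<i> * of_real n))"
  proof (rule has_bochner_integral_FTC_Icc)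
   fix x :: real
   have "((\<lambda>z. exp (\<i> * of_real n * z) / (\<i> * of_real n)) has_field_derivative exp (\<i> * of_real n * of_real x)) (at (of_real x) within UNIV)"
    using False by (auto intro!: derivative_eq_intros)
   then have "((\<lambda>x. exp (\<i> * of_real n * of_real x) / (\<i> * of_real n)) has_vector_derivative exp (\<i> * of_real n * of_real x)) (at x within {0..2 * pi})"
    by (intro has_vector_derivative_real_field) auto
   moreover have "exp (\<i> * of_real n * of_real x) = cis (x * n)" for x by (simp add: cis_conv_exp mult_ac)
   ultimately show "((\<lambda>x. cis (x * n) / (\<i> * of_real n)) has_vector_derivative cis (x * n)) (at x within {0..2 * pi})"
    by simp
  next
   show "continuous_on {0..2 * pi} (\<lambda>x. cis (x * n))" unfolding cis_conv_exp by (intro continuous_intros)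
  qed simp
  then have "(LINT x|lborel. indicator {0..2 * pi} x *\<^sub>R cis (x * n)) = cis (2 * pi * n) / (\<i> * of_real n) - cis (0 * n) / (\<i> * of_real n)"
   by (rule has_bochner_integral_integral_eq)
  then show ?thesis using eq False assms by (simp add: cis_zero)
 qed
qed

text \<open>The inverse transform of an integrable h, as a trigonometric series on the torus and as
  an integral on the line.\<close>

definition Ei :: "domain => (real => complex) => real => complex" where
 "Ei M h x = c2pi * (LINT \<xi>|freq M. h \<xi> * cis (x * \<xi>))"

lemma torus_const_L2: "(\<lambda>x. c) \<in> L2 (phys Torus)"
proof -
 have "ext (\<lambda>x. c) = (\<lambda>x. c * indicator {0..<2 * pi} x)" by (auto simp: ext_def)
 moreover have "(indicator {0..<2 * pi} :: real => complex) \<in> L2 lborel" by (simp add: L2_iff sqn_indicator)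
 ultimately show ?thesis unfolding ext_L2_iff by (simp add: L2_scale)
qed

lemma Ei_measurable:
 assumes [measurable]: "h \<in> fmeas M" shows "Ei M h \<in> borel_measurable borel"
proof -
 interpret sigma_finite_measure "freq M" by (rule sigma_finite_freq)
 have [measurable]: "snd \<in> borel_measurable (borel \<Otimes>\<^sub>M freq M)"
  using measurable_compose[OF measurable_snd[of borel "freq M"] borel_measurable_freq[of "\<lambda>x. x"]] by simp
 have "(\<lambda>x. LINT \<xi>|freq M. h \<xi> * cis (x * \<xi>)) \<in> borel_measurable borel"
  by (rule borel_measurable_lebesgue_integral) (unfold split_beta', measurable)
 then show ?thesis unfolding Ei_def[abs_def] by measurable
qed

lemma Ei_torus_L2:
 assumes h: "integrable (freq Torus) h" shows "Ei Torus h \<in> L2 (phys Torus)"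
proof (rule L2_bound[OF torus_const_L2[of "of_real (cmod c2pi * (LINT \<xi>|freq Torus. cmod (h \<xi>)))"]])
 show "Ei Torus h \<in> borel_measurable (phys Torus)"
  using Ei_measurable[of h Torus] h by (intro borel_measurable_phys) auto
 show "AE x in phys Torus. cmod (Ei Torus h x) <= cmod (of_real (cmod c2pi * (LINT \<xi>|freq Torus. cmod (h \<xi>))))"
 proof (rule AE_I2)
  fix x
  have "cmod (LINT \<xi>|freq Torus. h \<xi> * cis (x * \<xi>)) <= (LINT \<xi>|freq Torus. cmod (h \<xi> * cis (x * \<xi>)))"
   by (rule integral_norm_bound)
  also have "... = (LINT \<xi>|freq Torus. cmod (h \<xi>))" by (simp add: norm_mult del: freq.simps)
  finally have "cmod c2pi * cmod (LINT \<xi>|freq Torus. h \<xi> * cis (x * \<xi>)) <= cmod c2pi * (LINT \<xi>|freq Torus. cmod (h \<xi>))"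
   by (rule mult_left_mono) simp
  then show "cmod (Ei Torus h x) <= cmod (of_real (cmod c2pi * (LINT \<xi>|freq Torus. cmod (h \<xi>))))"
   unfolding Ei_def norm_mult norm_of_real by (simp add: order_trans[OF _ abs_ge_self] abs_mult)
 qed
qed

lemma torus_duality:
 assumes f: "f \<in> L2 (phys Torus)" and h: "integrable (freq Torus) h"
 shows "(LINT \<xi>|freq Torus. fourier Torus f \<xi> * cnj (h \<xi>)) = (LINT x|phys Torus. f x * cnj (Ei Torus h x))"
proof -
 have fi: "integrable (phys Torus) f" using ext_integrable[OF f] torus_integrable_iff by simp
 have "(LINT \<xi>|freq Torus. fourier Torus f \<xi> * cnj (h \<xi>))
   = c2pi * (LINT \<xi>|freq Torus. (LINT x|phys Torus. f x * cis (- (x * \<xi>))) * cnj (h \<xi>))"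
  unfolding fourier.simps c2pi_def[symmetric] mult.assoc by (rule LINT_cmult)
 also have "... = c2pi * (LINT x|phys Torus. f x * cnj (LINT \<xi>|freq Torus. h \<xi> * cis (x * \<xi>)))"
  by (subst fourier_duality[OF sigma_finite_phys sigma_finite_freq fi h])
   (auto intro: borel_measurable_phys borel_measurable_freq simp del: phys.simps freq.simps)
 also have "... = (LINT x|phys Torus. c2pi * (f x * cnj (LINT \<xi>|freq Torus. h \<xi> * cis (x * \<xi>))))"
  by (rule LINT_cmult[symmetric])
 also have "... = (LINT x|phys Torus. f x * cnj (Ei Torus h x))"
  unfolding Ei_def by (simp only: complex_cnj_mult cnj_c2pi mult.left_commute)
 finally show ?thesis .
qed

lemma torus_count_integral:
 assumes "m \<in> \<int>" shows "(LINT n|freq Torus. (if n = m then g n else 0 :: complex)) = g m"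
proof -
 have "{a \<in> \<int>. (if a = m then g a else 0) \<noteq> 0} \<subseteq> {m}" by auto
 then have "finite {a \<in> \<int>. (if a = m then g a else 0) \<noteq> 0}" by (rule finite_subset) simp
 then have "(LINT n|freq Torus. (if n = m then g n else 0)) = (\<Sum>a | a \<in> \<int> \<and> (if a = m then g a else 0) \<noteq> 0. if a = m then g a else 0)"
  unfolding freq.simps by (rule lebesgue_integral_count_space_finite_support)
 also have "... = (\<Sum>a\<in>{m}. if a = m then g a else 0)"
  using assms by (intro sum.mono_neutral_left) auto
 finally show ?thesis by simp
qed

text \<open>Duality tested against the exponential of frequency m: its coefficients vanish except at
  m, so the pairing with h returns a multiple of h m, and no further exchange of sum and integral
  arises.\<close>

lemma fourier_torus_Ei:
 assumes h: "integrable (freq Torus) h" and m: "m \<in> \<int>" shows "fourier Torus (Ei Torus h) m = h m"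
proof -
 define f where "f x = cis (x * m)" for x
 have f: "f \<in> L2 (phys Torus)"
 proof (rule L2_bound[OF torus_const_L2[of 1]])
  show "f \<in> borel_measurable (phys Torus)" unfolding f_def by (intro borel_measurable_phys) measurable
 qed (simp add: f_def)
 have Ff: "fourier Torus f n = (if n = m then c2pi * of_real (2 * pi) else 0)" if "n \<in> \<int>" for n
 proof -
  have "(LINT x|phys Torus. f x * cis (- (x * n))) = (LINT x|phys Torus. cis (x * (m - n)))"
   by (simp only: f_def cis_mult) (simp add: right_diff_distrib del: phys.simps)
  then show ?thesis using torus_orthogonal[of "m - n"] m that by (simp add: c2pi_def del: phys.simps)
 qed
 have "fourier Torus (Ei Torus h) m = c2pi * cnj (LINT x|phys Torus. f x * cnj (Ei Torus h x))"
  unfolding fourier.simps c2pi_def[symmetric] LINT_cnj[symmetric]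
  by (simp add: f_def cis_cnj mult.commute del: phys.simps)
 also have "... = c2pi * cnj (LINT n|freq Torus. fourier Torus f n * cnj (h n))"
  by (simp only: torus_duality[OF f h])
 also have "(LINT n|freq Torus. fourier Torus f n * cnj (h n)) = (LINT n|freq Torus. (if n = m then c2pi * of_real (2 * pi) * cnj (h n) else 0))"
  by (rule LINT_cong) (use Ff in auto)
 also have "... = c2pi * of_real (2 * pi) * cnj (h m)" by (rule torus_count_integral[OF m])
 also have "c2pi * cnj (c2pi * of_real (2 * pi) * cnj (h m)) = (c2pi * c2pi) * of_real (2 * pi) * h m"
  by (simp add: mult_ac)
 also have "c2pi * c2pi = of_real (1 / (2 * pi))"
  using complex_norm_square[of c2pi] norm_c2pi by (metis cnj_c2pi of_real_power)
 finally show ?thesis by simp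
qed

lemma sqn_Ei_torus:
 assumes h1: "integrable (freq Torus) h" and h2: "h \<in> L2 (freq Torus)"
 shows "sqn (phys Torus) (Ei Torus h) = sqn (freq Torus) h"
proof -
 note E = Ei_torus_L2[OF h1]
 have "of_real (LINT x|phys Torus. (cmod (Ei Torus h x))^2) = (LINT x|phys Torus. Ei Torus h x * cnj (Ei Torus h x))"
  unfolding complex_norm_square[symmetric] by (simp del: phys.simps flip: of_real_power)
 also have "... = (LINT \<xi>|freq Torus. fourier Torus (Ei Torus h) \<xi> * cnj (h \<xi>))" by (rule torus_duality[OF E h1, symmetric])
 also have "... = (LINT \<xi>|freq Torus. h \<xi> * cnj (h \<xi>))"
  by (rule LINT_cong) (simp add: fourier_torus_Ei[OF h1] del: fourier.simps)
 also have "... = of_real (LINT \<xi>|freq Torus. (cmod (h \<xi>))^2)"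
  unfolding complex_norm_square[symmetric] by (simp del: freq.simps flip: of_real_power)
 finally show ?thesis using sqn_eq_integral[OF E] sqn_eq_integral[OF h2] by (simp only: of_real_eq_iff)
qed

definition tr :: "nat => (real => complex) => real => complex" where
 "tr N g \<xi> = indicator {\<xi>. \<bar>\<xi>\<bar> <= real N} \<xi> * g \<xi>"

lemma tr_measurable [measurable (raw)]: "g \<in> fmeas M ==> tr N g \<in> fmeas M"
proof -
 assume [measurable]: "g \<in> fmeas M"
 have [measurable]: "(indicator {\<xi>. \<bar>\<xi>\<bar> <= real N} :: real => complex) \<in> fmeas M"
  by (rule borel_measurable_freq) measurable
 show ?thesis unfolding tr_def[abs_def] by measurable
qed

lemma tr_L2: "g \<in> L2 (freq M) ==> tr N g \<in> L2 (freq M)"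
 by (rule L2_bound[of g]) (auto simp: tr_def indicator_def dest!: L2_measurable)

lemma finite_Ints_ball: "finite ({\<xi>. \<bar>\<xi>\<bar> <= real N} \<inter> \<int>)"
proof -
 have "{\<xi>. \<bar>\<xi>\<bar> <= real N} \<inter> \<int> \<subseteq> of_int ` {- int N..int N}"
 proof
  fix x assume x: "x \<in> {\<xi>. \<bar>\<xi>\<bar> <= real N} \<inter> \<int>"
  then obtain k where k: "x = of_int k" by (auto elim: Ints_cases)
  then have "- int N <= k" "k <= int N" using x by auto
  then show "x \<in> of_int ` {- int N..int N}" using k by auto
 qed
 then show ?thesis by (rule finite_subset) simp
qed

lemma emeasure_freq_ball: "emeasure (freq M) ({\<xi>. \<bar>\<xi>\<bar> <= real N} \<inter> space (freq M)) < \<infinity>"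
proof (cases M)
 case Torus
 then show ?thesis using finite_Ints_ball[of N] by (simp add: emeasure_count_space of_nat_less_top)
next
 case Line
 have "{\<xi>::real. \<bar>\<xi>\<bar> <= real N} = {- real N..real N}" by auto
 then show ?thesis using Line by (simp add: emeasure_lborel_Icc_eq)
qed

lemma tr_integrable:
 assumes g: "g \<in> L2 (freq M)" shows "integrable (freq M) (tr N g)"
proof (rule Bochner_Integration.integrable_bound)
 have "integrable (freq M) (indicator ({\<xi>. \<bar>\<xi>\<bar> <= real N} \<inter> space (freq M)) :: real => real)"
  using emeasure_freq_ball[of M N]
  by (intro integrable_real_indicator) (cases M, auto)
 then show "integrable (freq M) (\<lambda>x. indicator ({\<xi>. \<bar>\<xi>\<bar> <= real N} \<inter> space (freq M)) x + (cmod (g x))^2)"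
  using L2_integrable_square[OF g] by (intro Bochner_Integration.integrable_add)
 show "tr N g \<in> fmeas M" using L2_measurable[OF g] by measurable
 show "AE x in freq M. norm (tr N g x) <= norm (indicator ({\<xi>. \<bar>\<xi>\<bar> <= real N} \<inter> space (freq M)) x + (cmod (g x))^2)"
 proof (rule AE_I2)
  fix x assume x: "x \<in> space (freq M)"
  show "norm (tr N g x) <= norm (indicator ({\<xi>. \<bar>\<xi>\<bar> <= real N} \<inter> space (freq M)) x + (cmod (g x))^2)"
  proof (cases "cmod (g x) <= 1")
   case False
   then have "cmod (g x) * 1 <= cmod (g x) * cmod (g x)" by (intro mult_left_mono) auto
   then show ?thesis using x by (simp add: tr_def indicator_def power2_eq_square)
  qed (use x in "auto simp: tr_def indicator_def intro: add_increasing2")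
 qed
qed

lemma tr_tendsto:
 assumes g: "g \<in> L2 (freq M)" shows "(\<lambda>n. sqn (freq M) (\<lambda>x. tr n g x - g x)) \<longlonglongrightarrow> 0"
proof (rule sqn_dominated_tendsto[OF _ g])
 show "(\<lambda>x. tr n g x - g x) \<in> fmeas M" for n using L2_measurable[OF g] by measurable
 show "cmod (tr n g x - g x) <= cmod (g x)" for n x by (auto simp: tr_def indicator_def)
 fix x :: real
 obtain n0 :: nat where n0: "\<bar>x\<bar> <= real n0" using real_arch_simple[of "\<bar>x\<bar>"] by blast
 have "\<forall>\<^sub>F n in sequentially. tr n g x - g x = 0"
  using eventually_ge_at_top[of n0]
 proof eventually_elim
  case (elim n)
  then have "\<bar>x\<bar> <= real n" using n0 by linarith
  then show ?case by (simp add: tr_def)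
 qed
 then show "(\<lambda>n. tr n g x - g x) \<longlonglongrightarrow> 0" by (rule tendsto_eventually)
qed

lemma fourier_torus_measurable: "fourier Torus f \<in> fmeas Torus"
 by simp

text \<open>The distance of f to its N-th partial Fourier sum is the norm of f squared minus the sum
  of the first squared coefficients, hence the latter is bounded; the partial sums increase to the
  full one.\<close>

lemma torus_bessel:
 assumes f: "f \<in> L2 (phys Torus)" shows "sqn (freq Torus) (fourier Torus f) <= sqn (phys Torus) f"
proof -
 define a where "a = fourier Torus f"
 have aN: "sqn (freq Torus) (tr N a) <= sqn (phys Torus) f" for N
 proof -
  note fin = finite_Ints_ball[of N]
  have a1: "integrable (freq Torus) (tr N a)"
  proof (rule integrableI_bounded)
   have "(\<integral>\<^sup>+x. ennreal (norm (tr N a x)) \<partial>freq Torus) = (\<integral>\<^sup>+x. ennreal (norm (tr N a x)) \<partial>count_space ({\<xi>. \<bar>\<xi>\<bar> <= real N} \<inter> \<int>))"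
    unfolding freq.simps by (rule nn_integral_count_space_eq) (auto simp: tr_def)
   also have "... < \<infinity>" using fin by (subst nn_integral_count_space_finite) (auto simp: less_top[symmetric])
   finally show "(\<integral>\<^sup>+x. ennreal (norm (tr N a x)) \<partial>freq Torus) < \<infinity>" .
  qed simp
  have a2: "tr N a \<in> L2 (freq Torus)"
  proof -
   have "sqn (freq Torus) (tr N a) = (\<integral>\<^sup>+x. ennreal ((cmod (tr N a x))^2) \<partial>count_space ({\<xi>. \<bar>\<xi>\<bar> <= real N} \<inter> \<int>))"
    unfolding sqn_def freq.simps by (rule nn_integral_count_space_eq) (auto simp: tr_def)
   also have "... < \<infinity>" using fin by (subst nn_integral_count_space_finite) (auto simp: less_top[symmetric])
   finally show ?thesis by (simp add: L2_iff)
  qed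
  note E = Ei_torus_L2[OF a1]
  define S where "S = (LINT \<xi>|freq Torus. (cmod (tr N a \<xi>))^2)"
  have "(LINT x|phys Torus. f x * cnj (Ei Torus (tr N a) x)) = (LINT \<xi>|freq Torus. a \<xi> * cnj (tr N a \<xi>))"
   unfolding a_def by (rule torus_duality[OF f a1[unfolded a_def], symmetric])
  also have "... = (LINT \<xi>|freq Torus. of_real ((cmod (tr N a \<xi>))^2))"
   by (intro Bochner_Integration.integral_cong refl) (auto simp: tr_def indicator_def complex_norm_square simp del: of_real_power)
  also have "... = of_real S" unfolding S_def by (rule integral_complex_of_real)
  finally have i: "(LINT x|phys Torus. f x * cnj (Ei Torus (tr N a) x)) = of_real S" .
  have sqS: "sqn (freq Torus) (tr N a) = ennreal S" unfolding S_def by (rule sqn_eq_integral[OF a2])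
  have E2: "(LINT x|phys Torus. (cmod (Ei Torus (tr N a) x))^2) = S"
   using sqn_Ei_torus[OF a1 a2] sqn_eq_integral[OF E] sqn_eq_integral[OF a2]
   by (simp add: S_def del: freq.simps phys.simps)
  have "(LINT x|phys Torus. (cmod (f x - Ei Torus (tr N a) x))^2) = (LINT x|phys Torus. (cmod (f x))^2) - 2 * S + S"
   unfolding sqn_polarize[OF f E] i E2 by (simp del: phys.simps)
  moreover have "0 <= (LINT x|phys Torus. (cmod (f x - Ei Torus (tr N a) x))^2)" by (simp del: phys.simps)
  ultimately have "S <= (LINT x|phys Torus. (cmod (f x))^2)" by linarith
  then show ?thesis unfolding sqS sqn_eq_integral[OF f] by (rule ennreal_leI)
 qed
 have "(\<lambda>N. \<integral>\<^sup>+x. ennreal ((cmod (tr N a x))^2) \<partial>freq Torus) \<longlonglongrightarrow> (\<integral>\<^sup>+x. ennreal ((cmod (a x))^2) \<partial>freq Torus)"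
 proof (rule nn_integral_LIMSEQ)
  show "incseq (\<lambda>N x. ennreal ((cmod (tr N a x))^2))"
  proof (rule incseq_SucI, rule le_funI, rule ennreal_leI, rule power_mono)
   show "cmod (tr N a x) <= cmod (tr (Suc N) a x)" for N x
    by (simp add: tr_def indicator_def)
  qed simp
  fix x :: real
  obtain n0 :: nat where n0: "\<bar>x\<bar> <= real n0" using real_arch_simple[of "\<bar>x\<bar>"] by blast
  have "\<forall>\<^sub>F n in sequentially. ennreal ((cmod (tr n a x))^2) = ennreal ((cmod (a x))^2)"
   using eventually_ge_at_top[of n0]
  proof eventually_elim
   case (elim n)
   then have "\<bar>x\<bar> <= real n" using n0 by linarith
   then show ?case by (simp add: tr_def)
  qed
  then show "(\<lambda>n. ennreal ((cmod (tr n a x))^2)) \<longlonglongrightarrow> ennreal ((cmod (a x))^2)" by (rule tendsto_eventually)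
 qed simp
 then have "(\<lambda>N. sqn (freq Torus) (tr N a)) \<longlonglongrightarrow> sqn (freq Torus) (fourier Torus f)"
  unfolding sqn_def a_def .
 then show ?thesis by (rule LIMSEQ_le_const2) (use aN in blast)
qed

text \<open>Every real number is uniquely n + \<theta> with n an integer and 0 \<le> \<theta> < 1.
  This links sums over the integers to integrals over the line, both for Parseval's identity and for
  the summability of the resonance weight.\<close>

lemma nn_integral_periodize:
 assumes [measurable]: "G \<in> borel_measurable borel"
 shows "(\<integral>\<^sup>+\<theta>. indicator {0..<1} \<theta> * (\<integral>\<^sup>+n. G (n + \<theta>) \<partial>freq Torus) \<partial>lborel) = (\<integral>\<^sup>+y. G y \<partial>lborel)"
proof -
 interpret F: sigma_finite_measure "freq Torus" by (rule sigma_finite_freq)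
 interpret pair_sigma_finite lborel "freq Torus" ..
 have [measurable]: "snd \<in> borel_measurable (lborel \<Otimes>\<^sub>M freq Torus)"
  using measurable_compose[OF measurable_snd[of lborel "freq Torus"] borel_measurable_freq[of "\<lambda>x. x"]] by simp
 have "(\<integral>\<^sup>+\<theta>. indicator {0..<1} \<theta> * (\<integral>\<^sup>+n. G (n + \<theta>) \<partial>freq Torus) \<partial>lborel)
   = (\<integral>\<^sup>+\<theta>. \<integral>\<^sup>+n. indicator {0..<1} \<theta> * G (n + \<theta>) \<partial>freq Torus \<partial>lborel)"
  by (simp add: nn_integral_cmult)
 also have "... = (\<integral>\<^sup>+n. \<integral>\<^sup>+\<theta>. indicator {0..<1} \<theta> * G (n + \<theta>) \<partial>lborel \<partial>freq Torus)"
  by (rule Fubini'[symmetric]) (unfold split_beta', measurable)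
 also have "... = (\<integral>\<^sup>+n. \<integral>\<^sup>+y. indicator {0..<1} (y - n) * G y \<partial>lborel \<partial>freq Torus)"
 proof (rule nn_integral_cong)
  fix n :: real
  show "(\<integral>\<^sup>+\<theta>. indicator {0..<1} \<theta> * G (n + \<theta>) \<partial>lborel) = (\<integral>\<^sup>+y. indicator {0..<1} (y - n) * G y \<partial>lborel)"
   using nn_integral_real_affine[of "\<lambda>y. indicator {0..<1} (y - n) * G y" 1 n] by simp
 qed
 also have "... = (\<integral>\<^sup>+y. \<integral>\<^sup>+n. indicator {0..<1} (y - n) * G y \<partial>freq Torus \<partial>lborel)"
  by (rule Fubini') (unfold split_beta', measurable)
 also have "... = (\<integral>\<^sup>+y. G y \<partial>lborel)"
 proof (rule nn_integral_cong)
  fix y :: real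
  have "(\<integral>\<^sup>+n. indicator {0..<1} (y - n) * G y \<partial>freq Torus) = (\<integral>\<^sup>+n. G y * indicator {of_int \<lfloor>y\<rfloor>} n \<partial>freq Torus)"
  proof (rule nn_integral_cong)
   fix n :: real assume "n \<in> space (freq Torus)"
   then obtain k where k: "n = of_int k" by (auto elim: Ints_cases)
   have "(0 <= y - n \<and> y - n < 1) = (k = \<lfloor>y\<rfloor>)" unfolding k by linarith
   then show "indicator {0..<1} (y - n) * G y = G y * indicator {of_int \<lfloor>y\<rfloor>} n"
    by (auto simp: indicator_def k)
  qed
  also have "... = G y * emeasure (freq Torus) {of_int \<lfloor>y\<rfloor>}"
   by (subst nn_integral_cmult_indicator) auto
  also have "... = G y" by simp
  finally show "(\<integral>\<^sup>+n. indicator {0..<1} (y - n) * G y \<partial>freq Torus) = G y" .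
 qed
 finally show ?thesis .
qed

text \<open>The Bessel inequality for all the modulated functions \<open>exp (- \<i> x \<theta>) f\<close> cannot be strict for
  almost every \<open>\<theta>\<close>, since integrating over \<open>\<theta>\<close> gives Plancherel's identity on the line; by
  continuity in \<open>\<theta>\<close> equality then holds at \<open>\<theta> = 0\<close>.\<close>

lemma torus_parseval:
 assumes f: "f \<in> L2 (phys Torus)" shows "sqn (freq Torus) (fourier Torus f) = sqn (phys Torus) f"
proof -
 define F where "F = ext f"
 define f' where "f' \<theta> x = f x * cis (- (x * \<theta>))" for \<theta> x
 define N where "N = sqn (phys Torus) f"
 have Nfin: "N < \<infinity>" unfolding N_def by (rule L2_sqn_finite[OF f])
 have fm: "f \<in> borel_measurable (phys Torus)" by (rule L2_measurable[OF f])
 have cm: "(\<lambda>x. cis (- (x * \<theta>))) \<in> borel_measurable (phys Torus)" for \<theta>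
  by (rule borel_measurable_phys) measurable
 have f'm: "f' \<theta> \<in> borel_measurable (phys Torus)" for \<theta>
  unfolding f'_def[abs_def] using fm cm by (rule borel_measurable_times)
 have f'L: "f' \<theta> \<in> L2 (phys Torus)" for \<theta>
  by (rule L2_bound[OF f f'm]) (simp add: f'_def norm_mult)
 have sqf': "sqn (phys Torus) (f' \<theta>) = N" for \<theta>
  unfolding N_def sqn_def f'_def by (simp add: norm_mult del: phys.simps)
 have Ff': "fourier Torus (f' \<theta>) n = FI F (n + \<theta>)" for \<theta> n
 proof -
  have "cis (- (x * \<theta>)) * cis (- (x * n)) = cis (- (x * (n + \<theta>)))" for x
   by (simp add: cis_mult algebra_simps)
  then have "ext (f' \<theta>) x * cis (- (x * n)) = F x * cis (- (x * (n + \<theta>)))" for x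
   by (simp add: F_def ext_def f'_def mult.assoc)
  then show ?thesis unfolding fourier_torus FI_def by simp
 qed
 define S where "S \<theta> = sqn (freq Torus) (\<lambda>n. FI F (n + \<theta>))" for \<theta>
 have S_le: "S \<theta> <= N" for \<theta>
  using torus_bessel[OF f'L[of \<theta>]] unfolding S_def sqf' Ff'[abs_def] .
 have F1: "integrable lborel F" and F2: "F \<in> L2 lborel"
  using ext_integrable[OF f] f ext_L2_iff[of f] by (auto simp: F_def)
 have [measurable]: "F \<in> borel_measurable borel" using F1 by auto
 have int_S: "(\<integral>\<^sup>+\<theta>. indicator {0..<1} \<theta> * S \<theta> \<partial>lborel) = N"
 proof -
  have "(\<integral>\<^sup>+\<theta>. indicator {0..<1} \<theta> * S \<theta> \<partial>lborel) = sqn lborel (FI F)"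
   unfolding S_def sqn_def by (rule nn_integral_periodize) measurable
  then show ?thesis using plancherel_FI[OF F1 F2] sqn_ext[of f] by (simp add: N_def F_def)
 qed
 interpret T: sigma_finite_measure "freq Torus" by (rule sigma_finite_freq)
 have [measurable]: "snd \<in> borel_measurable (borel \<Otimes>\<^sub>M freq Torus)"
  using measurable_compose[OF measurable_snd[of borel "freq Torus"] borel_measurable_freq[of "\<lambda>x. x"]] by simp
 have [measurable]: "S \<in> borel_measurable borel"
  unfolding S_def[abs_def] sqn_def
  by (rule T.borel_measurable_nn_integral) (unfold split_beta', measurable)
 have AE_S: "AE \<theta> in lborel. indicator {0..<1} \<theta> * (N - S \<theta>) = 0"
 proof -
  have "(\<integral>\<^sup>+\<theta>. indicator {0..<1} \<theta> * N - indicator {0..<1} \<theta> * S \<theta> \<partial>lborel)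
   = (\<integral>\<^sup>+\<theta>. indicator {0..<1} (\<theta>::real) * N \<partial>lborel) - (\<integral>\<^sup>+\<theta>. indicator {0..<1} \<theta> * S \<theta> \<partial>lborel)"
   by (rule nn_integral_diff) (use S_le int_S Nfin in "auto simp: indicator_def")
  also have "(\<integral>\<^sup>+\<theta>. indicator {0..<1} (\<theta>::real) * N \<partial>lborel) = N"
   by (subst nn_integral_multc) auto
  also have "N - (\<integral>\<^sup>+\<theta>. indicator {0..<1} \<theta> * S \<theta> \<partial>lborel) = 0"
   unfolding int_S using Nfin by simp
  finally have "AE \<theta> in lborel. indicator {0..<1} \<theta> * N - indicator {0..<1} \<theta> * S \<theta> = 0"
   by (subst (asm) nn_integral_0_iff_AE) auto
  then show ?thesis by eventually_elim (auto simp: indicator_def)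
 qed
 \<comment> \<open>No interval (0, 1/(k+1)) is a null set, so the parameters with equality
   accumulate at 0.\<close>
 have "\<exists>\<theta>. 0 < \<theta> \<and> \<theta> < 1 / real (Suc k) \<and> S \<theta> = N" for k
 proof (rule ccontr)
  assume no: "\<not> (\<exists>\<theta>. 0 < \<theta> \<and> \<theta> < 1 / real (Suc k) \<and> S \<theta> = N)"
  have "AE \<theta> in lborel. \<theta> \<notin> {0<..<1 / real (Suc k)}"
   using AE_S
  proof eventually_elim
   case (elim \<theta>)
   show ?case
   proof
    assume \<theta>: "\<theta> \<in> {0<..<1 / real (Suc k)}"
    have "1 / real (Suc k) <= 1" by simp
    moreover have "0 < \<theta>" "\<theta> < 1 / real (Suc k)" using \<theta> by (simp_all only: greaterThanLessThan_iff)
    ultimately have "\<theta> \<in> {0..<1}" unfolding atLeastLessThan_iff by linarith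
    then have "N - S \<theta> = 0" using elim by simp
    then have "N <= S \<theta>" using S_le[of \<theta>] Nfin by (simp add: ennreal_minus_eq_0)
    then show False using no S_le[of \<theta>] \<theta> by auto
   qed
  qed
  then have "emeasure lborel {\<theta> \<in> space lborel. \<theta> \<in> {0<..<1 / real (Suc k)}} = 0"
   by (intro emeasure_eq_0_AE) simp
  moreover have "{\<theta> \<in> space lborel. \<theta> \<in> {0<..<1 / real (Suc k)}} = {0<..<1 / real (Suc k)}" by auto
  ultimately have "emeasure lborel {0<..<1 / real (Suc k)} = 0" by (simp only:)
  then show False by (subst (asm) emeasure_lborel_Ioo) (auto simp: ennreal_eq_0_iff)
 qed
 then obtain \<theta> where \<theta>: "\<And>k. 0 < \<theta> k" "\<And>k. \<theta> k < 1 / real (Suc k)" "\<And>k. S (\<theta> k) = N" by metis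
 have \<theta>0: "\<theta> \<longlonglongrightarrow> 0"
  by (rule tendsto_sandwich[OF always_eventually always_eventually tendsto_const LIMSEQ_Suc[OF lim_1_over_n]])
   (use \<theta> in "auto intro: less_imp_le")
 have diff0: "(\<lambda>k. sqn (phys Torus) (\<lambda>x. f' (\<theta> k) x - f x)) \<longlonglongrightarrow> 0"
 proof (rule sqn_dominated_tendsto[OF _ L2_scale[OF f, of 2]])
  show "(\<lambda>x. f' (\<theta> k) x - f x) \<in> borel_measurable (phys Torus)" for k
   using f'm fm by (rule borel_measurable_diff)
  show "cmod (f' (\<theta> k) x - f x) <= cmod (2 * f x)" for k x
   using norm_triangle_ineq4[of "f' (\<theta> k) x" "f x"] by (simp add: f'_def norm_mult)
  show "(\<lambda>k. f' (\<theta> k) x - f x) \<longlonglongrightarrow> 0" for x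
  proof -
   have "(\<lambda>k. f x * cis (- (x * \<theta> k)) - f x) \<longlonglongrightarrow> f x * cis (- (x * 0)) - f x"
    unfolding cis_conv_exp by (intro tendsto_intros \<theta>0)
   then show ?thesis by (simp add: f'_def cis_zero)
  qed
 qed
 have aL: "(\<lambda>n. FI F (n + t)) \<in> L2 (freq Torus)" for t
  using S_le[of t] Nfin by (auto simp: L2_iff S_def)
 have "(\<lambda>k. S (\<theta> k)) \<longlonglongrightarrow> sqn (freq Torus) (\<lambda>n. FI F (n + 0))"
  unfolding S_def
 proof (rule sqn_tendsto[OF aL aL])
  \<comment> \<open>Continuity of the coefficients in \<theta> is again Bessel's inequality, applied
    to the difference of the modulated function and f.\<close>
  have "sqn (freq Torus) (\<lambda>n. FI F (n + \<theta> k) - FI F (n + 0)) <= sqn (phys Torus) (\<lambda>x. f' (\<theta> k) x - f x)" for k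
  proof -
   have d: "(\<lambda>x. f' (\<theta> k) x - f x) \<in> L2 (phys Torus)" by (intro L2_diff f'L f)
   have "ext (\<lambda>x. f' (\<theta> k) x - f x) = (\<lambda>x. ext (f' (\<theta> k)) x - ext f x)"
    by (auto simp: ext_def algebra_simps)
   moreover have "f' 0 = f" by (auto simp: f'_def cis_zero)
   ultimately have "fourier Torus (\<lambda>x. f' (\<theta> k) x - f x) n = FI F (n + \<theta> k) - FI F (n + 0)" for n
    unfolding Ff'[symmetric] using FI_diff[OF ext_integrable[OF f'L[of "\<theta> k"]] ext_integrable[OF f]]
    by (simp add: fourier_torus del: fourier.simps)
   then have eq: "fourier Torus (\<lambda>x. f' (\<theta> k) x - f x) = (\<lambda>n. FI F (n + \<theta> k) - FI F (n + 0))"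
    by blast
   show ?thesis using torus_bessel[OF d] unfolding eq .
  qed
  then show "(\<lambda>k. sqn (freq Torus) (\<lambda>n. FI F (n + \<theta> k) - FI F (n + 0))) \<longlonglongrightarrow> 0"
   by (intro tendsto_sandwich[OF always_eventually always_eventually tendsto_const diff0]) auto
 qed
 then have "S 0 = N" using \<theta>(3) LIMSEQ_unique[OF _ tendsto_const] by (simp add: S_def)
 moreover have "fourier Torus f = (\<lambda>n. FI F (n + 0))" by (simp add: fourier_torus F_def fun_eq_iff del: fourier.simps)
 ultimately show ?thesis unfolding S_def N_def by (simp only:)
qed

subsection \<open>The Fourier transform as a unitary map\<close>

declare fourier.simps [simp del] freq.simps [simp del] phys.simps [simp del]

lemma fourier_sqn: "f \<in> L2 (phys M) ==> sqn (freq M) (fourier M f) = sqn (phys M) f"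
 by (cases M) (use torus_parseval fourier_line_plancherel in "auto simp: freq.simps(2) phys.simps(2)")

lemma fourier_measurable: "f \<in> L2 (phys M) ==> fourier M f \<in> fmeas M"
 by (cases M)
  (use fourier_torus_measurable L2_measurable[OF fourier_line(1)] in "auto simp: freq.simps(2) phys.simps(2)")

lemma fourier_L2: "f \<in> L2 (phys M) ==> fourier M f \<in> L2 (freq M)"
 using fourier_sqn[of f M] fourier_measurable[of f M] by (simp add: L2_iff)

lemma fourier_add_scale:
 assumes f: "f \<in> L2 (phys M)" and g: "g \<in> L2 (phys M)"
 shows "AE \<xi> in freq M. fourier M (\<lambda>x. f x + c * g x) \<xi> = fourier M f \<xi> + c * fourier M g \<xi>"
proof (cases M)
 case Torus
 have "ext (\<lambda>x. f x + c * g x) = (\<lambda>x. ext f x + c * ext g x)" by (auto simp: ext_def algebra_simps)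
 then show ?thesis using Torus FI_add_scale[OF ext_integrable ext_integrable, of f g] f g
  by (simp add: fourier_torus)
next
 case Line
 show ?thesis unfolding Line freq.simps(2)
  by (rule fourier_line_add_scale) (use f g Line in "auto simp: phys.simps")
qed

lemma fourier_scale:
 assumes f: "f \<in> L2 (phys M)"
 shows "AE \<xi> in freq M. fourier M (\<lambda>x. c * f x) \<xi> = c * fourier M f \<xi>"
proof -
 have "AE \<xi> in freq M. fourier M (\<lambda>x. 0) \<xi> = 0"
  using fourier_sqn[OF L2_zero, of M] fourier_measurable[OF L2_zero, of M]
  by (subst sqn_zero_iff[symmetric]) (auto simp: sqn_def)
 then show ?thesis using fourier_add_scale[OF L2_zero f, of c] by eventually_elim simp
qed

lemma fourier_diff:
 assumes f: "f \<in> L2 (phys M)" and g: "g \<in> L2 (phys M)"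
 shows "AE \<xi> in freq M. fourier M (\<lambda>x. f x - g x) \<xi> = fourier M f \<xi> - fourier M g \<xi>"
 using fourier_add_scale[OF assms, of "-1"] by simp

lemma sqn_fourier_diff:
 assumes f: "f \<in> L2 (phys M)" and g: "g \<in> L2 (phys M)"
 shows "sqn (freq M) (\<lambda>\<xi>. fourier M f \<xi> - fourier M g \<xi>) = sqn (phys M) (\<lambda>x. f x - g x)"
 using fourier_sqn[OF L2_diff[OF f g]] sqn_cong_AE[OF fourier_diff[OF f g]] by simp

lemma fourier_eq_iff:
 assumes f: "f \<in> L2 (phys M)" and g: "g \<in> L2 (phys M)"
 shows "(AE \<xi> in freq M. fourier M f \<xi> = fourier M g \<xi>) \<longleftrightarrow> (AE x in phys M. f x = g x)"
proof -
 have "(AE \<xi> in freq M. fourier M f \<xi> = fourier M g \<xi>) \<longleftrightarrow> sqn (freq M) (\<lambda>\<xi>. fourier M f \<xi> - fourier M g \<xi>) = 0"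
  using L2_measurable[OF L2_diff[OF fourier_L2[OF f] fourier_L2[OF g]]] by (subst sqn_zero_iff) auto
 also have "... \<longleftrightarrow> (AE x in phys M. f x = g x)"
  unfolding sqn_fourier_diff[OF assms] using L2_measurable[OF L2_diff[OF f g]] by (subst sqn_zero_iff) auto
 finally show ?thesis .
qed

lemma Ei_line: "Ei Line h x = FI h (- x)"
 by (simp add: Ei_def FI_def freq.simps mult.commute)

lemma Ei_L2: "integrable (freq M) h ==> h \<in> L2 (freq M) ==> Ei M h \<in> L2 (phys M)"
 by (cases M) (use Ei_torus_L2 fourier_line_inversion(1) in "auto simp: freq.simps(2) phys.simps(2) Ei_line[abs_def]")

lemma fourier_Ei:
 assumes "integrable (freq M) h" "h \<in> L2 (freq M)"
 shows "AE \<xi> in freq M. fourier M (Ei M h) \<xi> = h \<xi>"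
proof (cases M)
 case Torus
 have "AE \<xi> in freq Torus. \<xi> \<in> \<int>" by (intro AE_I2) (simp add: freq.simps)
 then have "AE \<xi> in freq Torus. fourier Torus (Ei Torus h) \<xi> = h \<xi>"
  by eventually_elim (use fourier_torus_Ei assms Torus in simp)
 then show ?thesis unfolding Torus .
next
 case Line
 show ?thesis unfolding Line freq.simps(2) Ei_line[abs_def]
  by (rule fourier_line_inversion) (use assms Line in "auto simp: freq.simps")
qed

text \<open>A truncated g is integrable, so \<open>Ei\<close> supplies a preimage; by Plancherel
  these preimages form a Cauchy sequence, and its limit has transform g.\<close>

lemma fourier_surj:
 assumes g: "g \<in> L2 (freq M)" obtains f where "f \<in> L2 (phys M)" "AE \<xi> in freq M. fourier M f \<xi> = g \<xi>"
proof -
 define E where "E n = Ei M (tr n g)" for n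
 have E: "E n \<in> L2 (phys M)" for n unfolding E_def by (intro Ei_L2 tr_integrable tr_L2 g)
 have FE: "AE \<xi> in freq M. fourier M (E n) \<xi> = tr n g \<xi>" for n
  unfolding E_def by (intro fourier_Ei tr_integrable tr_L2 g)
 have [measurable]: "g \<in> fmeas M" by (rule L2_measurable[OF g])
 have FEm [measurable]: "fourier M (E n) \<in> fmeas M" for n by (rule fourier_measurable[OF E])
 have Eg: "sqn (freq M) (\<lambda>\<xi>. fourier M (E n) \<xi> - g \<xi>) = sqn (freq M) (\<lambda>\<xi>. tr n g \<xi> - g \<xi>)" for n
  by (rule sqn_cong_AE) (use FE[of n] in eventually_elim, simp)
 have lim: "(\<lambda>n. sqn (freq M) (\<lambda>\<xi>. fourier M (E n) \<xi> - g \<xi>)) \<longlonglongrightarrow> 0"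
  unfolding Eg by (rule tr_tendsto[OF g])
 obtain f where f: "f \<in> L2 (phys M)" "(\<lambda>n. sqn (phys M) (\<lambda>x. E n x - f x)) \<longlonglongrightarrow> 0"
 proof (rule L2_complete[OF E])
  fix e :: real assume e: "e > 0"
  obtain n0 where n0: "\<And>n. n >= n0 ==> sqn (freq M) (\<lambda>\<xi>. fourier M (E n) \<xi> - g \<xi>) < ennreal (e/4)"
   using ennreal_tendsto_zero_D[OF lim, of "ennreal (e/4)"] e by auto
  show "\<exists>n0. \<forall>m\<ge>n0. \<forall>n\<ge>n0. sqn (phys M) (\<lambda>x. E m x - E n x) <= ennreal e"
  proof (intro exI[of _ n0] allI impI)
   fix m n assume mn: "n0 <= m" "n0 <= n"
   have "sqn (phys M) (\<lambda>x. E m x - E n x) = sqn (freq M) (\<lambda>\<xi>. (fourier M (E m) \<xi> - g \<xi>) + (g \<xi> - fourier M (E n) \<xi>))"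
    using sqn_fourier_diff[OF E E] by simp
   also have "... <= 2 * (sqn (freq M) (\<lambda>\<xi>. fourier M (E m) \<xi> - g \<xi>) + sqn (freq M) (\<lambda>\<xi>. g \<xi> - fourier M (E n) \<xi>))"
    by (rule sqn_add_le) measurable
   also have "... <= 2 * (ennreal (e/4) + ennreal (e/4))"
    using n0[OF mn(1)] n0[OF mn(2)]
    by (intro mult_left_mono add_mono less_imp_le) (auto simp: sqn_diff_commute[of _ g])
   also have "... = ennreal e"
    using e by (simp add: ennreal_plus[symmetric] ennreal_mult[symmetric] del: ennreal_plus flip: ennreal_numeral)
   finally show "sqn (phys M) (\<lambda>x. E m x - E n x) <= ennreal e" .
  qed
 qed auto
 have "AE \<xi> in freq M. fourier M f \<xi> = g \<xi>"
 proof (rule sqn_limit_unique[OF FEm _ _ _ lim])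
  show "(\<lambda>n. sqn (freq M) (\<lambda>\<xi>. fourier M (E n) \<xi> - fourier M f \<xi>)) \<longlonglongrightarrow> 0"
   unfolding sqn_fourier_diff[OF E f(1)] by (rule f(2))
 qed (use fourier_measurable[OF f(1)] in auto)
 then show ?thesis using f(1) that by blast
qed

lemma fourier_mult:
 assumes f: "f \<in> L2 (phys M)" and m: "m \<in> fmeas M" "\<And>\<xi>. cmod (m \<xi>) <= B"
 shows "fourier_mult M m f \<in> L2 (phys M)"
  and "AE \<xi> in freq M. fourier M (fourier_mult M m f) \<xi> = m \<xi> * fourier M f \<xi>"
proof -
 have "(\<lambda>\<xi>. m \<xi> * fourier M f \<xi>) \<in> L2 (freq M)"
  using m by (intro L2_mult_bounded[OF fourier_L2[OF f]])
 then have "\<exists>g. g \<in> L2 (phys M) \<and> (AE \<xi> in freq M. fourier M g \<xi> = m \<xi> * fourier M f \<xi>)"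
  using fourier_surj by metis
 from someI_ex[OF this]
 show "fourier_mult M m f \<in> L2 (phys M)"
  and "AE \<xi> in freq M. fourier M (fourier_mult M m f) \<xi> = m \<xi> * fourier M f \<xi>"
  unfolding fourier_mult_def by auto
qed

subsection \<open>Sobolev spaces on the Fourier side\<close>

definition japw :: "real => real => real" where "japw \<alpha> \<xi> = jap \<xi> powr \<alpha>"

lemma jap_ge_1: "jap \<xi> >= 1"
 by (simp add: jap_def)

lemma japw_ge_1: "\<alpha> >= 0 ==> japw \<alpha> \<xi> >= 1"
 unfolding japw_def using jap_ge_1[of \<xi>] by (rule ge_one_powr_ge_zero)

lemma japw_pos: "japw \<alpha> \<xi> > 0"
 unfolding japw_def using jap_ge_1[of \<xi>] by simp

lemma japw_measurable [measurable]: "japw \<alpha> \<in> borel_measurable borel"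
 unfolding japw_def[abs_def] jap_def[abs_def] by measurable

text \<open>The isometry from H^\<alpha> onto L^2 of the frequencies. The whole solution theory
  takes place in its range, and the statements about functions are recovered through it at the
  end.\<close>

definition toV :: "real => (real => complex) => 'm::l2dom l2" where
 "toV \<alpha> f = toL2 (\<lambda>\<xi>. of_real (japw \<alpha> \<xi>) * fourier (dom_of TYPE('m)) f \<xi>)"

abbreviation sob :: "'m::l2dom itself => real => (real => complex) set" where
 "sob a \<alpha> \<equiv> sobolev (dom_of a) \<alpha>"

abbreviation sobn :: "'m::l2dom itself => real => (real => complex) => real" where
 "sobn a \<alpha> \<equiv> sobolev_norm (dom_of a) \<alpha>"

lemma sobolev_L2: "f \<in> sobolev M \<alpha> ==> f \<in> L2 (phys M)"
 by (simp add: sobolev_def)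

lemma sobolev_weighted: "f \<in> sobolev M \<alpha> ==> (\<lambda>\<xi>. of_real (japw \<alpha> \<xi>) * fourier M f \<xi>) \<in> L2 (freq M)"
 by (simp add: sobolev_def japw_def)

lemma sobolevI:
 assumes "f \<in> L2 (phys M)" "g \<in> L2 (freq M)" "AE \<xi> in freq M. of_real (japw \<alpha> \<xi>) * fourier M f \<xi> = g \<xi>"
 shows "f \<in> sobolev M \<alpha>"
proof -
 have [measurable]: "fourier M f \<in> fmeas M" "(\<lambda>\<xi>. complex_of_real (japw \<alpha> \<xi>)) \<in> fmeas M"
  using fourier_measurable[OF assms(1)] by (auto intro: borel_measurable_freq)
 have "(\<lambda>\<xi>. of_real (japw \<alpha> \<xi>) * fourier M f \<xi>) \<in> L2 (freq M)"
 proof (rule L2_cong_AE[OF assms(2)])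
  show "(\<lambda>\<xi>. of_real (japw \<alpha> \<xi>) * fourier M f \<xi>) \<in> fmeas M" by measurable
  show "AE \<xi> in freq M. g \<xi> = of_real (japw \<alpha> \<xi>) * fourier M f \<xi>" using assms(3) by eventually_elim simp
 qed
 then show ?thesis using assms(1) by (simp add: sobolev_def japw_def)
qed

lemma norm_toV:
 assumes "f \<in> sob TYPE('m::l2dom) \<alpha>" shows "norm (toV \<alpha> f :: 'm l2) = sobn TYPE('m) \<alpha> f"
proof -
 have "(norm (toV \<alpha> f :: 'm l2))^2 = (LINT \<xi>|mu TYPE('m). (jap \<xi> powr \<alpha> * cmod (fourier (dom_of TYPE('m)) f \<xi>))^2)"
  unfolding toV_def norm_toL2_sq[OF sobolev_weighted[OF assms]] by (simp add: norm_mult japw_def)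
 then show ?thesis unfolding sobolev_norm_def by (metis norm_ge_zero real_sqrt_unique)
qed

lemma toV_add_scale:
 assumes f: "f \<in> sob TYPE('m::l2dom) \<alpha>" and g: "g \<in> sob TYPE('m) \<alpha>"
 shows "(\<lambda>x. f x + of_real c * g x) \<in> sob TYPE('m) \<alpha>"
  and "(toV \<alpha> (\<lambda>x. f x + of_real c * g x) :: 'm l2) = toV \<alpha> f + c *\<^sub>R toV \<alpha> g"
proof -
 let ?M = "dom_of TYPE('m)"
 note fw = sobolev_weighted[OF f] and gw = sobolev_weighted[OF g]
 have ae: "AE \<xi> in freq ?M. of_real (japw \<alpha> \<xi>) * fourier ?M (\<lambda>x. f x + of_real c * g x) \<xi>
  = of_real (japw \<alpha> \<xi>) * fourier ?M f \<xi> + of_real c * (of_real (japw \<alpha> \<xi>) * fourier ?M g \<xi>)"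
  using fourier_add_scale[OF sobolev_L2[OF f] sobolev_L2[OF g], of "of_real c"]
  by eventually_elim (simp add: algebra_simps)
 show s: "(\<lambda>x. f x + of_real c * g x) \<in> sob TYPE('m) \<alpha>"
  by (rule sobolevI[OF L2_add[OF sobolev_L2[OF f] L2_scale[OF sobolev_L2[OF g]]] L2_add[OF fw L2_scale[OF gw]] ae])
 have "(toV \<alpha> (\<lambda>x. f x + of_real c * g x) :: 'm l2)
  = toL2 (\<lambda>\<xi>. of_real (japw \<alpha> \<xi>) * fourier ?M f \<xi> + of_real c * (of_real (japw \<alpha> \<xi>) * fourier ?M g \<xi>))"
  unfolding toV_def by (rule toL2_cong[OF sobolev_weighted[OF s] _ ae]) (intro L2_add L2_scale fw gw)
 also have "... = toV \<alpha> f + c *\<^sub>R toV \<alpha> g"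
  unfolding toV_def by (simp add: toL2_add[OF fw L2_scale[OF gw]] toL2_scaleR[OF gw])
 finally show "(toV \<alpha> (\<lambda>x. f x + of_real c * g x) :: 'm l2) = toV \<alpha> f + c *\<^sub>R toV \<alpha> g" .
qed

lemma toV_diff:
 assumes f: "f \<in> sob TYPE('m::l2dom) \<alpha>" and g: "g \<in> sob TYPE('m) \<alpha>"
 shows "(\<lambda>x. f x - g x) \<in> sob TYPE('m) \<alpha>"
  and "(toV \<alpha> (\<lambda>x. f x - g x) :: 'm l2) = toV \<alpha> f - toV \<alpha> g"
 using toV_add_scale[OF assms, of "-1"] by auto

lemma toV_eq_iff:
 assumes f: "f \<in> sob TYPE('m::l2dom) \<alpha>" and g: "g \<in> sob TYPE('m) \<alpha>"
 shows "(toV \<alpha> f :: 'm l2) = toV \<alpha> g \<longleftrightarrow> (AE x in phys (dom_of TYPE('m)). f x = g x)"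
 unfolding toV_def toL2_eq_iff[OF sobolev_weighted[OF f] sobolev_weighted[OF g]]
  fourier_eq_iff[OF sobolev_L2[OF f] sobolev_L2[OF g], symmetric]
 using japw_pos[of \<alpha>] by (simp add: less_imp_neq[THEN not_sym])

lemma toV_surj:
 fixes u :: "'m::l2dom l2"
 assumes \<alpha>: "\<alpha> >= 0" obtains f where "f \<in> sob TYPE('m) \<alpha>" "toV \<alpha> f = u"
proof -
 let ?M = "dom_of TYPE('m)"
 have "(\<lambda>\<xi>. of_real (1 / japw \<alpha> \<xi>) * fn u \<xi>) \<in> L2 (freq ?M)"
 proof (rule L2_mult_bounded[OF fn_L2])
  show "(\<lambda>\<xi>. complex_of_real (1 / japw \<alpha> \<xi>)) \<in> fmeas ?M" by (rule borel_measurable_freq) measurable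
  show "cmod (complex_of_real (1 / japw \<alpha> \<xi>)) <= 1" for \<xi>
   using japw_ge_1[OF \<alpha>, of \<xi>] unfolding norm_of_real by simp
 qed
 then obtain f where f: "f \<in> L2 (phys ?M)" "AE \<xi> in freq ?M. fourier ?M f \<xi> = of_real (1 / japw \<alpha> \<xi>) * fn u \<xi>"
  using fourier_surj by blast
 have ae: "AE \<xi> in freq ?M. of_real (japw \<alpha> \<xi>) * fourier ?M f \<xi> = fn u \<xi>"
  using f(2)
 proof eventually_elim
  case (elim \<xi>)
  then show ?case using japw_pos[of \<alpha> \<xi>] by (simp add: mult.assoc[symmetric] flip: of_real_mult)
 qed
 have s: "f \<in> sob TYPE('m) \<alpha>" by (rule sobolevI[OF f(1) fn_L2 ae])
 have "toV \<alpha> f = (toL2 (fn u) :: 'm l2)"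
  unfolding toV_def by (rule toL2_cong[OF sobolev_weighted[OF s] fn_L2 ae])
 then show ?thesis using s that by (simp add: toL2_fn)
qed

definition fromV :: "real => 'm::l2dom l2 => real => complex" where
 "fromV \<alpha> u = (SOME f. f \<in> sob TYPE('m) \<alpha> \<and> toV \<alpha> f = u)"

lemma fromV:
 fixes u :: "'m::l2dom l2"
 assumes \<alpha>: "\<alpha> >= 0" shows "fromV \<alpha> u \<in> sob TYPE('m) \<alpha>" "toV \<alpha> (fromV \<alpha> u) = u"
proof -
 have "\<exists>f. f \<in> sob TYPE('m) \<alpha> \<and> toV \<alpha> f = u" using toV_surj[OF \<alpha>] by metis
 from someI_ex[OF this] show "fromV \<alpha> u \<in> sob TYPE('m) \<alpha>" "toV \<alpha> (fromV \<alpha> u) = u"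
  unfolding fromV_def by auto
qed

lemma toV_fourier_mult:
 assumes f: "f \<in> sob TYPE('m::l2dom) \<alpha>" and m: "bmult TYPE('m) B m"
 shows "fourier_mult (dom_of TYPE('m)) m f \<in> sob TYPE('m) \<alpha>"
  and "(toV \<alpha> (fourier_mult (dom_of TYPE('m)) m f) :: 'm l2) = mult m (toV \<alpha> f)"
proof -
 let ?M = "dom_of TYPE('m)"
 have mm: "m \<in> fmeas ?M" "\<And>\<xi>. cmod (m \<xi>) <= B" using m by (auto simp: bmult_def)
 note fm = fourier_mult[OF sobolev_L2[OF f] mm]
 have ae: "AE \<xi> in freq ?M. of_real (japw \<alpha> \<xi>) * fourier ?M (fourier_mult ?M m f) \<xi> = m \<xi> * (of_real (japw \<alpha> \<xi>) * fourier ?M f \<xi>)"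
  using fm(2) by eventually_elim simp
 note w = bmult_L2[OF m sobolev_weighted[OF f]]
 show s: "fourier_mult ?M m f \<in> sob TYPE('m) \<alpha>" by (rule sobolevI[OF fm(1) w ae])
 show "(toV \<alpha> (fourier_mult ?M m f) :: 'm l2) = mult m (toV \<alpha> f)"
  unfolding toV_def mult_toL2[OF m sobolev_weighted[OF f]]
  by (rule toL2_cong[OF sobolev_weighted[OF s] w ae])
qed

lemma toV_sum:
 assumes "finite I" "\<And>i. i \<in> I ==> f i \<in> sob TYPE('m::l2dom) \<alpha>"
 shows "(\<lambda>x. \<Sum>i\<in>I. c i *\<^sub>R f i x) \<in> sob TYPE('m) \<alpha> \<and>
  (toV \<alpha> (\<lambda>x. \<Sum>i\<in>I. c i *\<^sub>R f i x) :: 'm l2) = (\<Sum>i\<in>I. c i *\<^sub>R toV \<alpha> (f i))"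
 using assms
proof (induction I rule: finite_induct)
 case empty
 let ?M = "dom_of TYPE('m)"
 have "AE \<xi> in freq ?M. fourier ?M (\<lambda>x. 0) \<xi> = 0" using fourier_scale[OF L2_zero, of ?M 0] by simp
 then have ae: "AE \<xi> in freq ?M. of_real (japw \<alpha> \<xi>) * fourier ?M (\<lambda>x. 0) \<xi> = 0" by eventually_elim simp
 have s: "(\<lambda>x. 0) \<in> sob TYPE('m) \<alpha>" by (rule sobolevI[OF L2_zero L2_zero ae])
 have "(toV \<alpha> (\<lambda>x. 0) :: 'm l2) = 0"
  unfolding toV_def zero_l2_def by (rule toL2_cong[OF sobolev_weighted[OF s] L2_zero ae])
 then show ?case using s by simp
next
 case (insert i I)
 have I: "(\<lambda>x. \<Sum>i\<in>I. c i *\<^sub>R f i x) \<in> sob TYPE('m) \<alpha>"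
  "(toV \<alpha> (\<lambda>x. \<Sum>i\<in>I. c i *\<^sub>R f i x) :: 'm l2) = (\<Sum>i\<in>I. c i *\<^sub>R toV \<alpha> (f i))"
  and i: "f i \<in> sob TYPE('m) \<alpha>" using insert by auto
 show ?case using toV_add_scale[OF I(1) i, of "c i"] I(2) insert(1,2)
  by (simp add: add.commute scaleR_conv_of_real)
qed

lemma continuous_path_iff:
 "continuous_path (dom_of TYPE('m::l2dom)) \<alpha> I \<phi> \<longleftrightarrow>
  (\<forall>t\<in>I. \<phi> t \<in> sob TYPE('m) \<alpha>) \<and> continuous_on I (\<lambda>t. toV \<alpha> (\<phi> t) :: 'm l2)"
proof (cases "\<forall>t\<in>I. \<phi> t \<in> sob TYPE('m) \<alpha>")
 case True
 have "((\<lambda>s. sobn TYPE('m) \<alpha> (\<lambda>x. \<phi> s x - \<phi> t x)) \<longlongrightarrow> 0) (at t within I)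
   \<longleftrightarrow> ((\<lambda>t. toV \<alpha> (\<phi> t) :: 'm l2) \<longlongrightarrow> toV \<alpha> (\<phi> t)) (at t within I)" if t: "t \<in> I" for t
 proof -
  have "\<forall>\<^sub>F s in at t within I. sobn TYPE('m) \<alpha> (\<lambda>x. \<phi> s x - \<phi> t x) = dist (toV \<alpha> (\<phi> s) :: 'm l2) (toV \<alpha> (\<phi> t))"
   unfolding eventually_at_filter
  proof (rule always_eventually, intro allI impI)
   fix s assume s: "s \<in> I"
   show "sobn TYPE('m) \<alpha> (\<lambda>x. \<phi> s x - \<phi> t x) = dist (toV \<alpha> (\<phi> s) :: 'm l2) (toV \<alpha> (\<phi> t))"
    using norm_toV[where 'm = 'm, OF toV_diff(1), of "\<phi> s" \<alpha> "\<phi> t"] toV_diff(2)[where 'm = 'm, of "\<phi> s" \<alpha> "\<phi> t"] True s t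
    by (simp add: dist_norm)
  qed
  from tendsto_cong[OF this] show ?thesis by (simp add: tendsto_dist_iff[symmetric])
 qed
 then show ?thesis unfolding continuous_path_def continuous_on_def using True by auto
qed (auto simp: continuous_path_def)

text \<open>The Sobolev integral is the gauge integral with another norm. As \<open>toV\<close> is
  additive on Riemann sums and isometric, the two definitions correspond division by
  division.\<close>

lemma has_sobolev_integral_iff:
 assumes g: "\<And>s. 0 <= s ==> s <= t ==> g s \<in> sob TYPE('m::l2dom) \<alpha>"
 shows "has_sobolev_integral (dom_of TYPE('m)) \<alpha> g y t \<longleftrightarrow>
  y \<in> sob TYPE('m) \<alpha> \<and> ((\<lambda>s. toV \<alpha> (g s) :: 'm l2) has_integral toV \<alpha> y) {0..t}"
proof (cases "y \<in> sob TYPE('m) \<alpha>")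
 case y: True
 have eq: "sobn TYPE('m) \<alpha> (\<lambda>x. (\<Sum>(s, K)\<in>D. measure lborel K *\<^sub>R g s x) - y x)
   = norm ((\<Sum>(s, K)\<in>D. measure lborel K *\<^sub>R (toV \<alpha> (g s) :: 'm l2)) - toV \<alpha> y)"
  if D: "D tagged_division_of {0..t}" for D
 proof -
  have fin: "finite D" using D by auto
  have gD: "g (fst p) \<in> sob TYPE('m) \<alpha>" if "p \<in> D" for p
   using tag_in_interval[OF D, of "fst p" "snd p"] that by (intro g) auto
  note S = toV_sum[where 'm = 'm, OF fin gD, of "\<lambda>p. p" "\<lambda>p. measure lborel (snd p)"]
  have S1: "(\<lambda>x. \<Sum>p\<in>D. measure lborel (snd p) *\<^sub>R g (fst p) x) \<in> sob TYPE('m) \<alpha>"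
   and S2: "(toV \<alpha> (\<lambda>x. \<Sum>p\<in>D. measure lborel (snd p) *\<^sub>R g (fst p) x) :: 'm l2) = (\<Sum>p\<in>D. measure lborel (snd p) *\<^sub>R toV \<alpha> (g (fst p)))"
   using S by auto
  show ?thesis
   using norm_toV[OF toV_diff(1)[OF S1 y]] toV_diff(2)[OF S1 y] S2 by (simp add: split_beta')
 qed
 have "((\<lambda>s. toV \<alpha> (g s) :: 'm l2) has_integral toV \<alpha> y) {0..t} \<longleftrightarrow>
  (\<forall>e>0. \<exists>d. gauge d \<and> (\<forall>D. D tagged_division_of {0..t} \<and> d fine D -->
   norm ((\<Sum>(s, K)\<in>D. measure lborel K *\<^sub>R (toV \<alpha> (g s) :: 'm l2)) - toV \<alpha> y) < e))"
  using has_integral[of "\<lambda>s. toV \<alpha> (g s) :: 'm l2" "toV \<alpha> y" 0 t] by (simp add: cbox_interval)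
 then show ?thesis unfolding has_sobolev_integral_def using y eq by (smt (verit, best))
qed (simp add: has_sobolev_integral_def)

section \<open>The trilinear estimate\<close>

subsection \<open>Translation invariance on the frequency side\<close>

declare borel_measurable_freq [measurable del] borel_measurable_phys [measurable del]

interpretation freq: sigma_finite_measure "freq M" for M by (rule sigma_finite_freq)
interpretation freq2: pair_sigma_finite "freq M" "freq M" for M ..
interpretation freqz: sigma_finite_measure "freq_sq M" for M
 by (rule sigma_finite_pair_measure) (rule sigma_finite_freq)+
interpretation freq3: pair_sigma_finite "freq M" "freq_sq M" for M ..

lemma space_freq_diff: "a \<in> space (freq M) ==> b \<in> space (freq M) ==> a - b \<in> space (freq M)"
 by (cases M) (auto simp: freq.simps)

lemma space_freq_zero: "0 \<in> space (freq M)"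
 by (cases M) (auto simp: freq.simps)

lemma space_freq_uminus: "a \<in> space (freq M) ==> - a \<in> space (freq M)"
 using space_freq_diff[OF space_freq_zero, of a] by simp

text \<open>On the torus the target carries the discrete sigma-algebra of the integers, and the
  source is arbitrary; as the integers are countable, it suffices to fix the value of f and subtract
  g from it.\<close>

lemma measurable_freq_diff [measurable (raw)]:
 assumes f: "f \<in> measurable N (freq M)" and g: "g \<in> measurable N (freq M)"
 shows "(\<lambda>x. f x - g x) \<in> measurable N (freq M)"
proof (cases M)
 case Torus
 have f': "f \<in> measurable N (count_space \<int>)" and g': "g \<in> measurable N (count_space \<int>)"
  using f g Torus by (auto simp: freq.simps)
 have "(\<lambda>x. f x - g x) \<in> measurable N (count_space \<int>)"
 proof (rule measurable_compose_countable'[OF _ f'])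
  fix i :: real assume i: "i \<in> \<int>"
  have "(\<lambda>y. i - y) \<in> measurable (count_space \<int>) (count_space \<int>)"
   using i by (simp add: measurable_count_space_eq1)
  from measurable_compose[OF g' this] show "(\<lambda>x. i - g x) \<in> measurable N (count_space \<int>)" .
 qed (simp add: Ints_def)
 then show ?thesis using Torus by (simp add: freq.simps)
next
 case Line
 then show ?thesis using f g by (simp add: freq.simps)
qed

lemma measurable_freq_const [measurable (raw)]: "a \<in> space (freq M) ==> (\<lambda>x. a) \<in> measurable N (freq M)"
 by simp

lemma distr_freq_translate:
 assumes "a \<in> space (freq M)" shows "distr (freq M) (freq M) (\<lambda>x. x - a) = freq M"
proof (cases M)
 case Torus
 have "bij_betw (\<lambda>x. x - a) \<int> \<int>"
  by (rule bij_betw_byWitness[where f' = "\<lambda>x. x + a"]) (use assms Torus in "auto simp: freq.simps")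
 then show ?thesis using Torus by (simp add: freq.simps distr_bij_count_space)
next
 case Line
 have "distr lborel lborel (\<lambda>x. x - a) = distr lborel borel ((+) (- a))"
  by (rule distr_cong) auto
 then show ?thesis using Line by (simp add: freq.simps lborel_distr_plus)
qed

lemma distr_freq_reflect:
 assumes "a \<in> space (freq M)" shows "distr (freq M) (freq M) (\<lambda>x. a - x) = freq M"
proof (cases M)
 case Torus
 have "bij_betw (\<lambda>x. a - x) \<int> \<int>"
  by (rule bij_betw_byWitness[where f' = "\<lambda>x. a - x"]) (use assms Torus in "auto simp: freq.simps")
 then show ?thesis using Torus by (simp add: freq.simps distr_bij_count_space)
next
 case Line
 have "distr lborel lborel (\<lambda>x. a - x) = distr (distr lborel borel uminus) borel ((+) a)"
  by (subst distr_distr) (auto intro!: distr_cong simp: o_def)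
 then show ?thesis using Line by (simp add: freq.simps lborel_distr_plus lborel_distr_uminus)
qed

lemma nn_integral_translate:
 assumes [measurable]: "f \<in> fmeas M" and a: "a \<in> space (freq M)"
 shows "(\<integral>\<^sup>+x. f (x - a) \<partial>freq M) = (\<integral>\<^sup>+x. f x \<partial>freq M)"
proof -
 note [measurable] = measurable_freq_const[OF a]
 have "(\<integral>\<^sup>+x. f x \<partial>distr (freq M) (freq M) (\<lambda>x. x - a)) = (\<integral>\<^sup>+x. f (x - a) \<partial>freq M)"
  by (rule nn_integral_distr) measurable
 then show ?thesis unfolding distr_freq_translate[OF a] by simp
qed

lemma nn_integral_reflect:
 assumes [measurable]: "f \<in> fmeas M" and a: "a \<in> space (freq M)"
 shows "(\<integral>\<^sup>+x. f (a - x) \<partial>freq M) = (\<integral>\<^sup>+x. f x \<partial>freq M)"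
proof -
 note [measurable] = measurable_freq_const[OF a]
 have "(\<integral>\<^sup>+x. f x \<partial>distr (freq M) (freq M) (\<lambda>x. a - x)) = (\<integral>\<^sup>+x. f (a - x) \<partial>freq M)"
  by (rule nn_integral_distr) measurable
 then show ?thesis unfolding distr_freq_reflect[OF a] by simp
qed

lemma integral_translate:
 fixes f :: "real => complex"
 assumes [measurable]: "f \<in> fmeas M" and a: "a \<in> space (freq M)"
 shows "(LINT x|freq M. f (x - a)) = (LINT x|freq M. f x)"
proof -
 note [measurable] = measurable_freq_const[OF a]
 have "(LINT x|distr (freq M) (freq M) (\<lambda>x. x - a). f x) = (LINT x|freq M. f (x - a))"
  by (rule integral_distr) measurable
 then show ?thesis unfolding distr_freq_translate[OF a] by simp
qed

lemma integral_reflect_freq: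
 fixes f :: "real => complex"
 assumes [measurable]: "f \<in> fmeas M" and a: "a \<in> space (freq M)"
 shows "(LINT x|freq M. f (a - x)) = (LINT x|freq M. f x)"
proof -
 note [measurable] = measurable_freq_const[OF a]
 have "(LINT x|distr (freq M) (freq M) (\<lambda>x. a - x). f x) = (LINT x|freq M. f (a - x))"
  by (rule integral_distr) measurable
 then show ?thesis unfolding distr_freq_reflect[OF a] by simp
qed

subsection \<open>The resonance weight\<close>

abbreviation near :: "real => 'a::zero_neq_one" where
 "near \<equiv> indicator {-1<..<1}"

abbreviation prod3 :: "(real => ennreal) => (real => ennreal) => (real => ennreal) => real => real => real => ennreal" where
 "prod3 F G H \<xi> p q \<equiv> F (\<xi> - p) * G (\<xi> - p - q) * H (\<xi> - q)"

abbreviation dint :: "domain => (real => real => ennreal) => ennreal" where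
 "dint M f \<equiv> \<integral>\<^sup>+p. \<integral>\<^sup>+q. f p q \<partial>freq M \<partial>freq M"

abbreviation nsq :: "domain => (real => ennreal) => ennreal" where
 "nsq M F \<equiv> \<integral>\<^sup>+x. (F x)^2 \<partial>freq M"

text \<open>The decay that irregularity provides at the value 2 p q of the resonance
  function.\<close>

definition kap :: "real => real => real => real" where
 "kap \<rho> p q = (1 + 2 * \<bar>p * q\<bar>) powr (- \<rho>)"

definition wt :: "real => real => real" where
 "wt \<rho> p = (1 + \<bar>p\<bar>) powr (- \<rho>)"

lemma kap_measurable [measurable (raw)]:
 "f \<in> borel_measurable N ==> g \<in> borel_measurable N ==> (\<lambda>x. kap \<rho> (f x) (g x)) \<in> borel_measurable N"
 unfolding kap_def by measurable

lemma wt_measurable [measurable (raw)]: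
 "f \<in> borel_measurable N ==> (\<lambda>x. wt \<rho> (f x)) \<in> borel_measurable N"
 unfolding wt_def by measurable

lemma kap_pos: "kap \<rho> p q > 0"
 unfolding kap_def by (simp add: add_pos_nonneg)

text \<open>For |p|, |q| \<ge> 1 both |p| and |q| are at most |p q|, so (1 + |p|)(1 + |q|) \<le> 2
  (1 + 2 |p q|) and the decay factorises. If |p| < 1 or |q| < 1 there may be no decay at all, and
  the indicators take over.\<close>

lemma kap_le:
 assumes \<rho>: "\<rho> > 0"
 shows "kap \<rho> p q <= near p + near q + 2 powr \<rho> * (wt \<rho> p * wt \<rho> q)"
proof (cases "\<bar>p\<bar> < 1 \<or> \<bar>q\<bar> < 1")
 case True
 have "kap \<rho> p q <= 1 powr (- \<rho>)" unfolding kap_def using \<rho> by (intro powr_mono2') auto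
 also have "... <= near p + near q" using True by (auto simp: indicator_def)
 also have "... <= near p + near q + 2 powr \<rho> * (wt \<rho> p * wt \<rho> q)"
  by (simp add: wt_def)
 finally show ?thesis .
next
 case False
 have "1 <= \<bar>p\<bar> * \<bar>q\<bar>" "\<bar>p\<bar> <= \<bar>p\<bar> * \<bar>q\<bar>" "\<bar>q\<bar> <= \<bar>p\<bar> * \<bar>q\<bar>"
  using False mult_mono[of 1 "\<bar>p\<bar>" 1 "\<bar>q\<bar>"] mult_left_mono[of 1 "\<bar>q\<bar>" "\<bar>p\<bar>"] mult_right_mono[of 1 "\<bar>p\<bar>" "\<bar>q\<bar>"] by auto
 then have "(1 + \<bar>p\<bar>) * (1 + \<bar>q\<bar>) <= 2 * (1 + 2 * \<bar>p * q\<bar>)"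
  by (simp add: algebra_simps abs_mult)
 then have "kap \<rho> p q <= ((1 + \<bar>p\<bar>) * (1 + \<bar>q\<bar>) / 2) powr (- \<rho>)"
  unfolding kap_def using \<rho> by (intro powr_mono2') (auto simp: add_pos_nonneg)
 also have "... = 2 powr \<rho> * (wt \<rho> p * wt \<rho> q)"
 proof -
  have "((1 + \<bar>p\<bar>) * (1 + \<bar>q\<bar>) / 2) powr (- \<rho>) = (1 + \<bar>p\<bar>) powr (- \<rho>) * (1 + \<bar>q\<bar>) powr (- \<rho>) / 2 powr (- \<rho>)"
   by (subst powr_divide; subst powr_mult) auto
  then show ?thesis unfolding wt_def by (simp add: powr_minus_divide[of 2 \<rho>])
 qed
 also have "... <= near p + near q + 2 powr \<rho> * (wt \<rho> p * wt \<rho> q)"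
  by (simp add: indicator_def)
 finally show ?thesis .
qed

lemma wt_sq: "(wt \<rho> p)^2 = wt (2 * \<rho>) p"
 unfolding wt_def power2_eq_square by (simp add: powr_add[symmetric])

lemma wt_line_finite:
 assumes "s > 1" shows "(\<integral>\<^sup>+p. ennreal (wt s p) \<partial>lborel) < \<infinity>"
proof -
 have half: "(\<integral>\<^sup>+p. ennreal (wt s p) * indicator {0..} p \<partial>lborel) = ennreal (0 - - (1 / (s - 1)))"
 proof -
  have "(\<integral>\<^sup>+p. ennreal ((1 + p) powr (- s)) * indicator {0..} p \<partial>lborel)
    = ennreal (0 - (\<lambda>x. - ((1 + x) powr (1 - s) / (s - 1))) 0)"
  proof (rule nn_integral_FTC_atLeast)
   fix x :: real assume "0 <= x"
   then have "((\<lambda>z. z powr (1 - s)) has_real_derivative (1 - s) * (1 + x) powr (1 - s - 1)) (at (1 + x))"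
    by (intro has_real_derivative_powr) auto
   then have "((\<lambda>x. (1 + x) powr (1 - s)) has_real_derivative (1 - s) * (1 + x) powr (- s)) (at x)"
    using DERIV_shift[of "\<lambda>z. z powr (1 - s)" "(1 - s) * (1 + x) powr (- s)" x 1] by (simp add: add.commute)
   from DERIV_minus[OF DERIV_cdivide[OF this, of "s - 1"]]
   have "((\<lambda>x. - ((1 + x) powr (1 - s) / (s - 1))) has_real_derivative - ((1 - s) * (1 + x) powr (- s) / (s - 1))) (at x)" .
   moreover have "- ((1 - s) * y / (s - 1)) = y" for y
   proof -
    have "(1 - s) * y = - y * (s - 1)" by (simp add: algebra_simps)
    then show ?thesis using assms by simp
   qed
   ultimately show "((\<lambda>x. - ((1 + x) powr (1 - s) / (s - 1))) has_real_derivative (1 + x) powr (- s)) (at x)"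
    by simp
  next
   have "filterlim (\<lambda>x::real. 1 + x) at_top at_top" by (rule filterlim_tendsto_add_at_top[OF tendsto_const filterlim_ident])
   then have "((\<lambda>x::real. (1 + x) powr (1 - s)) \<longlongrightarrow> 0) at_top"
    using assms by (intro tendsto_neg_powr) auto
   then have "((\<lambda>x. - ((1 + x) powr (1 - s) / (s - 1))) \<longlongrightarrow> - (0 / (s - 1))) at_top"
    by (intro tendsto_intros) (use assms in auto)
   then show "((\<lambda>x. - ((1 + x) powr (1 - s) / (s - 1))) \<longlongrightarrow> 0) at_top" by simp
  qed auto
  moreover have "(\<integral>\<^sup>+p. ennreal (wt s p) * indicator {0..} p \<partial>lborel) = (\<integral>\<^sup>+p. ennreal ((1 + p) powr (- s)) * indicator {0..} p \<partial>lborel)"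
   by (intro nn_integral_cong) (auto simp: wt_def indicator_def)
  ultimately show ?thesis by simp
 qed
 have refl: "(\<integral>\<^sup>+p. ennreal (wt s p) * indicator {..0} p \<partial>lborel) = (\<integral>\<^sup>+p. ennreal (wt s p) * indicator {0..} p \<partial>lborel)"
  using nn_integral_real_affine[of "\<lambda>p. ennreal (wt s p) * indicator {..0} p" "-1" 0]
  by (simp add: wt_def indicator_def)
 have "(\<integral>\<^sup>+p. ennreal (wt s p) \<partial>lborel)
   <= (\<integral>\<^sup>+p. ennreal (wt s p) * indicator {0..} p + ennreal (wt s p) * indicator {..0} p \<partial>lborel)"
  by (intro nn_integral_mono) (auto simp: indicator_def)
 also have "... = (\<integral>\<^sup>+p. ennreal (wt s p) * indicator {0..} p \<partial>lborel) + (\<integral>\<^sup>+p. ennreal (wt s p) * indicator {..0} p \<partial>lborel)"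
  by (rule nn_integral_add) auto
 also have "... < \<infinity>" unfolding refl half by simp
 finally show ?thesis .
qed

text \<open>On the torus the sum is compared with the integral by averaging over translates.\<close>

lemma wt_finite:
 assumes s: "s > 1" shows "(\<integral>\<^sup>+p. ennreal (wt s p) \<partial>freq M) < \<infinity>"
proof (cases M)
 case Line
 then show ?thesis using wt_line_finite[OF s] by (simp add: freq.simps)
next
 case Torus
 define S where "S = (\<integral>\<^sup>+p. ennreal (wt s p) \<partial>freq Torus)"
 have le: "ennreal (wt s n) <= ennreal (2 powr s) * ennreal (wt s (n + \<theta>))" if "0 <= \<theta>" "\<theta> < 1" for n \<theta>
 proof -
  have "((1 + \<bar>n + \<theta>\<bar>) / 2) powr s <= (1 + \<bar>n\<bar>) powr s" using that s by (intro powr_mono2) auto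
  then have "wt s n <= 2 powr s * wt s (n + \<theta>)"
   unfolding wt_def by (simp add: powr_divide powr_minus field_simps add_pos_nonneg)
  then show ?thesis by (simp add: ennreal_mult[symmetric] wt_def)
 qed
 have "S = (\<integral>\<^sup>+\<theta>. indicator {0..<1::real} \<theta> * S \<partial>lborel)" by (subst nn_integral_multc) auto
 also have "... <= (\<integral>\<^sup>+\<theta>. indicator {0..<1} \<theta> * (\<integral>\<^sup>+n. ennreal (2 powr s) * ennreal (wt s (n + \<theta>)) \<partial>freq Torus) \<partial>lborel)"
  unfolding S_def by (intro nn_integral_mono) (auto simp: indicator_def intro!: nn_integral_mono le)
 also have "... = (\<integral>\<^sup>+y. ennreal (2 powr s) * ennreal (wt s y) \<partial>lborel)"
  by (rule nn_integral_periodize) measurable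
 also have "... < \<infinity>"
  using wt_line_finite[OF s] by (subst nn_integral_cmult) (auto simp: ennreal_mult_less_top)
 finally show ?thesis using Torus by (simp add: S_def)
qed

subsection \<open>The estimate for nonnegative functions\<close>

lemma ennreal_square_add_le: "(a + b)^2 <= 2 * (a\<^sup>2 + b\<^sup>2 :: ennreal)"
proof (cases a; cases b)
 fix r s assume rs: "a = ennreal r" "0 <= r" "b = ennreal s" "0 <= s"
 have "(r + s)^2 <= 2 * (r\<^sup>2 + s\<^sup>2)" using sum_squares_bound[of r s] by (simp add: power2_sum)
 then show ?thesis using rs
  by (simp add: ennreal_plus[symmetric] ennreal_power ennreal_mult[symmetric] del: ennreal_plus flip: ennreal_numeral)
qed (auto simp: ennreal_mult_top power2_eq_square ennreal_top_mult)

text \<open>For |p| < 1, Cauchy-Schwarz in q bounds the inner integral by the norms of G and H.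
  Cauchy-Schwarz in p over the bounded set costs its measure once, and integrating the remaining
  square of F over \<xi> and then over p costs it a second time.\<close>

lemma trilinear_B1:
 assumes [measurable]: "F \<in> fmeas M" "G \<in> fmeas M" "H \<in> fmeas M"
 shows "(\<integral>\<^sup>+\<xi>. (dint M (\<lambda>p q. near p * prod3 F G H \<xi> p q))^2 \<partial>freq M)
  <= (emeasure (freq M) ({-1<..<1} \<inter> space (freq M)))^2
   * ((nsq M F) * (nsq M G) * (nsq M H))"
proof -
 define A f g h where "A = emeasure (freq M) ({-1<..<1} \<inter> space (freq M))"
  and "f = (nsq M F)" and "g = (nsq M G)" and "h = (nsq M H)"
 have [measurable]: "(near :: real => ennreal) \<in> fmeas M"
  by (rule borel_measurable_freq) measurable
 have A: "(\<integral>\<^sup>+p. near p \<partial>freq M) = A"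
 proof -
  have "(\<integral>\<^sup>+p. near p \<partial>freq M) = (\<integral>\<^sup>+p. indicator ({-1<..<1} \<inter> space (freq M)) p \<partial>freq M)"
   by (intro nn_integral_cong) (auto simp: indicator_def)
  also have "... = A" unfolding A_def
   by (rule nn_integral_indicator) (cases M, auto simp: freq.simps)
  finally show ?thesis .
 qed
 have ind2: "(near p :: ennreal)^2 = near p" for p :: real
  by (simp add: indicator_def)
 have "(\<integral>\<^sup>+\<xi>. (dint M (\<lambda>p q. near p * prod3 F G H \<xi> p q))^2 \<partial>freq M)
   <= (\<integral>\<^sup>+\<xi>. A * (g * h * (\<integral>\<^sup>+p. near p * (F (\<xi> - p))^2 \<partial>freq M)) \<partial>freq M)"
 proof (rule nn_integral_mono)
  fix \<xi> assume \<xi> [measurable]: "\<xi> \<in> space (freq M)"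
  note [measurable] = measurable_freq_const[OF \<xi>]
  define I where "I p = (\<integral>\<^sup>+q. G (\<xi> - p - q) * H (\<xi> - q) \<partial>freq M)" for p
  have [measurable]: "I \<in> fmeas M" 
   unfolding I_def[abs_def] by (rule freq.borel_measurable_nn_integral) (unfold split_beta', measurable)
  have I: "(I p)^2 <= g * h" if p: "p \<in> space (freq M)" for p
  proof -
   note [measurable] = measurable_freq_const[OF p] measurable_freq_const[OF space_freq_diff[OF \<xi> p]]
   have "(I p)^2 <= (\<integral>\<^sup>+q. (G (\<xi> - p - q))^2 \<partial>freq M) * (\<integral>\<^sup>+q. (H (\<xi> - q))^2 \<partial>freq M)"
    unfolding I_def by (rule Cauchy_Schwarz_nn_integral) measurable
   also have "... = g * h"
    unfolding g_def h_def
    using nn_integral_reflect[of "\<lambda>x. (G x)^2" M "\<xi> - p"] nn_integral_reflect[of "\<lambda>x. (H x)^2" M "\<xi>"] space_freq_diff[OF \<xi> p] \<xi>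
    by simp
   finally show ?thesis .
  qed
  have eq: "(dint M (\<lambda>p q. near p * prod3 F G H \<xi> p q))
    = (\<integral>\<^sup>+p. near p * (near p * F (\<xi> - p) * I p) \<partial>freq M)"
  proof (rule nn_integral_cong)
   fix p assume p: "p \<in> space (freq M)"
   note [measurable] = measurable_freq_const[OF p]
   have "(\<integral>\<^sup>+q. near p * prod3 F G H \<xi> p q \<partial>freq M)
    = (\<integral>\<^sup>+q. (near p * F (\<xi> - p)) * (G (\<xi> - p - q) * H (\<xi> - q)) \<partial>freq M)"
    by (simp add: mult_ac)
   also have "... = (near p * F (\<xi> - p)) * I p"
    unfolding I_def by (rule nn_integral_cmult) measurable
   also have "... = near p * (near p * F (\<xi> - p) * I p)" by (simp add: indicator_def)
   finally show "(\<integral>\<^sup>+q. near p * prod3 F G H \<xi> p q \<partial>freq M)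
    = near p * (near p * F (\<xi> - p) * I p)" .
  qed
  have "(\<integral>\<^sup>+p. near p * (near p * F (\<xi> - p) * I p) \<partial>freq M)^2 <= (\<integral>\<^sup>+p. (near p)^2 \<partial>freq M) * (\<integral>\<^sup>+p. (near p * F (\<xi> - p) * I p)^2 \<partial>freq M)"
   by (rule Cauchy_Schwarz_nn_integral) measurable
  also have "... = A * (\<integral>\<^sup>+p. near p * (F (\<xi> - p))^2 * (I p)^2 \<partial>freq M)"
   unfolding power_mult_distrib ind2 A ..
  also have "... <= A * (\<integral>\<^sup>+p. (g * h) * (near p * (F (\<xi> - p))^2) \<partial>freq M)"
   by (intro mult_left_mono nn_integral_mono) (auto simp: mult.commute intro!: mult_right_mono I)
  also have "... = A * (g * h * (\<integral>\<^sup>+p. near p * (F (\<xi> - p))^2 \<partial>freq M))"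
   by (subst nn_integral_cmult) measurable
  finally show "(dint M (\<lambda>p q. near p * prod3 F G H \<xi> p q))^2
    <= A * (g * h * (\<integral>\<^sup>+p. near p * (F (\<xi> - p))^2 \<partial>freq M))" unfolding eq .
 qed
 also have "... = A * (g * h * (dint M (\<lambda>\<xi> p. near p * (F (\<xi> - p))^2)))"
  by (simp add: nn_integral_cmult)
 also have "(dint M (\<lambda>\<xi> p. near p * (F (\<xi> - p))^2))
   = (dint M (\<lambda>p \<xi>. near p * (F (\<xi> - p))^2))"
  by (rule freq2.Fubini') (unfold split_beta', measurable)
 also have "... = (\<integral>\<^sup>+p. near p * f \<partial>freq M)"
 proof (rule nn_integral_cong)
  fix p assume p: "p \<in> space (freq M)"
  note [measurable] = measurable_freq_const[OF p]
  show "(\<integral>\<^sup>+\<xi>. near p * (F (\<xi> - p))^2 \<partial>freq M) = near p * f"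
   unfolding f_def using nn_integral_translate[of "\<lambda>x. (F x)^2" M p] p by (subst nn_integral_cmult) auto
 qed
 also have "... = A * f" by (subst nn_integral_multc) (auto simp: A)
 finally show ?thesis unfolding A_def[symmetric] f_def[symmetric] g_def[symmetric] h_def[symmetric]
  by (simp add: power2_eq_square mult_ac)
qed

text \<open>Cauchy-Schwarz in q and in p against the weights leaves the square of the weight
  integral, which is finite as soon as 2 \<rho> > 1, times the triple integral of |F|^2 |G|^2 |H|^2.
  The latter factorises after a change of variables.\<close>

lemma trilinear_B3:
 assumes [measurable]: "F \<in> fmeas M" "G \<in> fmeas M" "H \<in> fmeas M"
 shows "(\<integral>\<^sup>+\<xi>. (dint M (\<lambda>p q. (ennreal (wt \<rho> p) * ennreal (wt \<rho> q)) * prod3 F G H \<xi> p q))^2 \<partial>freq M)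
  <= (\<integral>\<^sup>+p. ennreal (wt (2 * \<rho>) p) \<partial>freq M)^2
   * ((nsq M F) * (nsq M G) * (nsq M H))"
proof -
 define A f g h where "A = (\<integral>\<^sup>+p. ennreal (wt (2 * \<rho>) p) \<partial>freq M)"
  and "f = (nsq M F)" and "g = (nsq M G)" and "h = (nsq M H)"
 have [measurable]: "(\<lambda>p. ennreal (wt \<rho> p)) \<in> fmeas M"
  by (rule borel_measurable_freq) measurable
 have A: "(\<integral>\<^sup>+p. (ennreal (wt \<rho> p))^2 \<partial>freq M) = A"
  unfolding A_def wt_sq[symmetric] by (simp add: ennreal_power wt_def)
 have "(\<integral>\<^sup>+\<xi>. (dint M (\<lambda>p q. (ennreal (wt \<rho> p) * ennreal (wt \<rho> q)) * prod3 F G H \<xi> p q))^2 \<partial>freq M)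
   <= (\<integral>\<^sup>+\<xi>. A * (A * (dint M (\<lambda>p q. (F (\<xi> - p))^2 * (G (\<xi> - p - q))^2 * (H (\<xi> - q))^2))) \<partial>freq M)"
 proof (rule nn_integral_mono)
  fix \<xi> assume \<xi>: "\<xi> \<in> space (freq M)"
  note [measurable] = measurable_freq_const[OF \<xi>]
  define I where "I p = (\<integral>\<^sup>+q. ennreal (wt \<rho> q) * (G (\<xi> - p - q) * H (\<xi> - q)) \<partial>freq M)" for p
  have [measurable]: "I \<in> fmeas M" 
   unfolding I_def[abs_def] by (rule freq.borel_measurable_nn_integral) (unfold split_beta', measurable)
  have I: "(I p)^2 <= A * (\<integral>\<^sup>+q. (G (\<xi> - p - q) * H (\<xi> - q))^2 \<partial>freq M)" if p: "p \<in> space (freq M)" for p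
  proof -
   note [measurable] = measurable_freq_const[OF p]
   have "(I p)^2 <= (\<integral>\<^sup>+q. (ennreal (wt \<rho> q))^2 \<partial>freq M) * (\<integral>\<^sup>+q. (G (\<xi> - p - q) * H (\<xi> - q))^2 \<partial>freq M)"
    unfolding I_def by (rule Cauchy_Schwarz_nn_integral) measurable
   then show ?thesis unfolding A .
  qed
  have eq: "(dint M (\<lambda>p q. (ennreal (wt \<rho> p) * ennreal (wt \<rho> q)) * prod3 F G H \<xi> p q))
    = (\<integral>\<^sup>+p. ennreal (wt \<rho> p) * (F (\<xi> - p) * I p) \<partial>freq M)"
  proof (rule nn_integral_cong)
   fix p assume p: "p \<in> space (freq M)"
   note [measurable] = measurable_freq_const[OF p]
   have "(\<integral>\<^sup>+q. (ennreal (wt \<rho> p) * ennreal (wt \<rho> q)) * prod3 F G H \<xi> p q \<partial>freq M)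
    = (\<integral>\<^sup>+q. (ennreal (wt \<rho> p) * F (\<xi> - p)) * (ennreal (wt \<rho> q) * (G (\<xi> - p - q) * H (\<xi> - q))) \<partial>freq M)"
    by (simp add: mult_ac)
   also have "... = (ennreal (wt \<rho> p) * F (\<xi> - p)) * I p"
    unfolding I_def by (rule nn_integral_cmult) measurable
   finally show "(\<integral>\<^sup>+q. (ennreal (wt \<rho> p) * ennreal (wt \<rho> q)) * prod3 F G H \<xi> p q \<partial>freq M)
    = ennreal (wt \<rho> p) * (F (\<xi> - p) * I p)" by (simp add: mult.assoc)
  qed
  have "(\<integral>\<^sup>+p. ennreal (wt \<rho> p) * (F (\<xi> - p) * I p) \<partial>freq M)^2 <= (\<integral>\<^sup>+p. (ennreal (wt \<rho> p))^2 \<partial>freq M) * (\<integral>\<^sup>+p. (F (\<xi> - p) * I p)^2 \<partial>freq M)"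
   by (rule Cauchy_Schwarz_nn_integral) measurable
  also have "... = A * (\<integral>\<^sup>+p. (F (\<xi> - p))^2 * (I p)^2 \<partial>freq M)"
   unfolding power_mult_distrib A ..
  also have "... <= A * (\<integral>\<^sup>+p. (F (\<xi> - p))^2 * (A * (\<integral>\<^sup>+q. (G (\<xi> - p - q) * H (\<xi> - q))^2 \<partial>freq M)) \<partial>freq M)"
   by (intro mult_left_mono nn_integral_mono I) auto
  also have "(\<integral>\<^sup>+p. (F (\<xi> - p))^2 * (A * (\<integral>\<^sup>+q. (G (\<xi> - p - q) * H (\<xi> - q))^2 \<partial>freq M)) \<partial>freq M)
    = (\<integral>\<^sup>+p. A * (\<integral>\<^sup>+q. (F (\<xi> - p))^2 * (G (\<xi> - p - q))^2 * (H (\<xi> - q))^2 \<partial>freq M) \<partial>freq M)"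
  proof (rule nn_integral_cong)
   fix p assume p: "p \<in> space (freq M)"
   note [measurable] = measurable_freq_const[OF p]
   have "(\<integral>\<^sup>+q. (F (\<xi> - p))^2 * (G (\<xi> - p - q))^2 * (H (\<xi> - q))^2 \<partial>freq M)
     = (F (\<xi> - p))^2 * (\<integral>\<^sup>+q. (G (\<xi> - p - q) * H (\<xi> - q))^2 \<partial>freq M)"
    unfolding mult.assoc power_mult_distrib by (rule nn_integral_cmult) measurable
   then show "(F (\<xi> - p))^2 * (A * (\<integral>\<^sup>+q. (G (\<xi> - p - q) * H (\<xi> - q))^2 \<partial>freq M))
     = A * (\<integral>\<^sup>+q. (F (\<xi> - p))^2 * (G (\<xi> - p - q))^2 * (H (\<xi> - q))^2 \<partial>freq M)"
    by (simp add: mult_ac)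
  qed
  also have "... = A * (dint M (\<lambda>p q. (F (\<xi> - p))^2 * (G (\<xi> - p - q))^2 * (H (\<xi> - q))^2))"
   by (rule nn_integral_cmult) measurable
  finally show "(dint M (\<lambda>p q. (ennreal (wt \<rho> p) * ennreal (wt \<rho> q)) * prod3 F G H \<xi> p q))^2
   <= A * (A * (dint M (\<lambda>p q. (F (\<xi> - p))^2 * (G (\<xi> - p - q))^2 * (H (\<xi> - q))^2)))" unfolding eq .
 qed
 also have "... = A * (A * (\<integral>\<^sup>+\<xi>. dint M (\<lambda>p q. (F (\<xi> - p))^2 * (G (\<xi> - p - q))^2 * (H (\<xi> - q))^2) \<partial>freq M))"
  by (simp add: nn_integral_cmult)
 also have "(\<integral>\<^sup>+\<xi>. dint M (\<lambda>p q. (F (\<xi> - p))^2 * (G (\<xi> - p - q))^2 * (H (\<xi> - q))^2) \<partial>freq M)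
   = (\<integral>\<^sup>+p. dint M (\<lambda>\<xi> q. (F (\<xi> - p))^2 * (G (\<xi> - p - q))^2 * (H (\<xi> - q))^2) \<partial>freq M)"
  by (rule freq2.Fubini') (unfold split_beta', measurable)
 \<comment> \<open>Replacing \<xi> by \<xi> + p decouples the factors: F depends on \<xi>, G on
   \<xi> - q and H on \<xi> + p - q, to be integrated in p, then q, then \<xi>. The term
   \<open>0 - p\<close> expresses the sum by differences, for which measurability on the frequency
   space is available.\<close>
 also have "... = (\<integral>\<^sup>+p. dint M (\<lambda>\<xi> q. (F \<xi>)^2 * (G (\<xi> - q))^2 * (H (\<xi> - (0 - p) - q))^2) \<partial>freq M)"
 proof (rule nn_integral_cong)
  fix p assume p: "p \<in> space (freq M)"
  note [measurable] = measurable_freq_const[OF p] measurable_freq_const[OF space_freq_zero]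
  show "(dint M (\<lambda>\<xi> q. (F (\<xi> - p))^2 * (G (\<xi> - p - q))^2 * (H (\<xi> - q))^2))
   = (dint M (\<lambda>\<xi> q. (F \<xi>)^2 * (G (\<xi> - q))^2 * (H (\<xi> - (0 - p) - q))^2))"
  proof -
   have "(\<lambda>\<xi>. \<integral>\<^sup>+q. (F \<xi>)^2 * (G (\<xi> - q))^2 * (H (\<xi> - (0 - p) - q))^2 \<partial>freq M) \<in> fmeas M"
    by (rule freq.borel_measurable_nn_integral) (unfold split_beta', measurable)
   from nn_integral_translate[OF this p] show ?thesis by simp
  qed
 qed
 also have "... = (\<integral>\<^sup>+\<xi>. dint M (\<lambda>p q. (F \<xi>)^2 * (G (\<xi> - q))^2 * (H (\<xi> - (0 - p) - q))^2) \<partial>freq M)"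
  by (rule freq2.Fubini') (use measurable_freq_const[OF space_freq_zero[of M], measurable] in "unfold split_beta', measurable")
 also have "... = (\<integral>\<^sup>+\<xi>. (F \<xi>)^2 * (g * h) \<partial>freq M)"
 proof (rule nn_integral_cong)
  fix \<xi> assume \<xi>: "\<xi> \<in> space (freq M)"
  note [measurable] = measurable_freq_const[OF \<xi>] measurable_freq_const[OF space_freq_zero]
  have "(dint M (\<lambda>p q. (F \<xi>)^2 * (G (\<xi> - q))^2 * (H (\<xi> - (0 - p) - q))^2))
   = (dint M (\<lambda>q p. (F \<xi>)^2 * (G (\<xi> - q))^2 * (H (\<xi> - (0 - p) - q))^2))"
   by (rule freq2.Fubini') (unfold split_beta', measurable)
  also have "... = (\<integral>\<^sup>+q. (F \<xi>)^2 * ((G (\<xi> - q))^2 * h) \<partial>freq M)"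
  proof (rule nn_integral_cong)
   fix q assume q: "q \<in> space (freq M)"
   note [measurable] = measurable_freq_const[OF q]
   have "(\<integral>\<^sup>+p. (H (\<xi> - (0 - p) - q))^2 \<partial>freq M) = h"
    unfolding h_def using nn_integral_translate[of "\<lambda>x. (H x)^2" M "q - \<xi>"] space_freq_diff[OF q \<xi>]
    by (simp add: algebra_simps)
   then show "(\<integral>\<^sup>+p. (F \<xi>)^2 * (G (\<xi> - q))^2 * (H (\<xi> - (0 - p) - q))^2 \<partial>freq M) = (F \<xi>)^2 * ((G (\<xi> - q))^2 * h)"
    by (subst nn_integral_cmult) (measurable, simp add: mult.assoc)
  qed
  also have "... = (F \<xi>)^2 * ((\<integral>\<^sup>+q. (G (\<xi> - q))^2 \<partial>freq M) * h)"
   by (simp add: nn_integral_cmult nn_integral_multc)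
  also have "(\<integral>\<^sup>+q. (G (\<xi> - q))^2 \<partial>freq M) = g"
   unfolding g_def using nn_integral_reflect[of "\<lambda>x. (G x)^2" M \<xi>] \<xi> by simp
  finally show "(dint M (\<lambda>p q. (F \<xi>)^2 * (G (\<xi> - q))^2 * (H (\<xi> - (0 - p) - q))^2)) = (F \<xi>)^2 * (g * h)" .
 qed
 also have "... = f * (g * h)" unfolding f_def by (rule nn_integral_multc) measurable
 finally show ?thesis unfolding A_def[symmetric] f_def[symmetric] g_def[symmetric] h_def[symmetric]
  by (simp add: power2_eq_square mult_ac)
qed

lemma nn_integral_add_add_cmult:
 assumes "a \<in> borel_measurable N" "b \<in> borel_measurable N" "d \<in> borel_measurable N"
 shows "(\<integral>\<^sup>+x. a x + (b x + c * d x) \<partial>N) = (\<integral>\<^sup>+x. a x \<partial>N) + ((\<integral>\<^sup>+x. b x \<partial>N) + c * (\<integral>\<^sup>+x. d x \<partial>N))"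
 using assms by (simp add: nn_integral_cmult nn_integral_add)

lemma trilinear_nn:
 assumes \<rho>: "\<rho> > 1/2"
 shows "\<exists>C\<ge>0. \<forall>(F :: real => ennreal) G H. F \<in> fmeas M --> G \<in> fmeas M --> H \<in> fmeas M -->
  (\<integral>\<^sup>+\<xi>. (dint M (\<lambda>p q. ennreal (kap \<rho> p q) * prod3 F G H \<xi> p q))^2 \<partial>freq M)
  <= ennreal C * ((nsq M F) * (nsq M G) * (nsq M H))"
proof -
 define A1 where "A1 = (emeasure (freq M) ({-1<..<1} \<inter> space (freq M)))^2"
 define A2 where "A2 = (\<integral>\<^sup>+p. ennreal (wt (2 * \<rho>) p) \<partial>freq M)^2"
 define c where "c = 2 powr \<rho>"
 have "emeasure (freq M) ({-1<..<1} \<inter> space (freq M)) <= emeasure (freq M) ({\<xi>. \<bar>\<xi>\<bar> <= real 1} \<inter> space (freq M))"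
 proof (rule emeasure_mono)
  show "{\<xi>. \<bar>\<xi>\<bar> <= real 1} \<inter> space (freq M) \<in> sets (freq M)" by (cases M) (auto simp: freq.simps)
 qed auto
 also have "... < \<infinity>" by (rule emeasure_freq_ball)
 finally have A1: "A1 < \<infinity>" unfolding A1_def by (simp add: power2_eq_square ennreal_mult_less_top)
 have "(\<integral>\<^sup>+p. ennreal (wt (2 * \<rho>) p) \<partial>freq M) < \<infinity>" using \<rho> by (intro wt_finite) simp
 then have A2: "A2 < \<infinity>" unfolding A2_def by (simp add: power2_eq_square ennreal_mult_less_top)
 define D where "D = 2 * (A1 + 2 * (A1 + (ennreal c)^2 * A2))"
 have D: "D < \<infinity>" unfolding D_def using A1 A2 by (simp add: ennreal_mult_less_top power2_eq_square)
 show ?thesis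
 proof (intro exI[of _ "enn2real D"] conjI allI impI)
  fix F G H :: "real => ennreal"
  assume [measurable]: "F \<in> fmeas M" "G \<in> fmeas M" "H \<in> fmeas M"
  define N where "N = (nsq M F) * (nsq M G) * (nsq M H)"
  define B1 where "B1 \<xi> = (dint M (\<lambda>p q. near p * prod3 F G H \<xi> p q))" for \<xi>
  \<comment> \<open>The region |q| < 1 becomes the region |p| < 1 when p is exchanged with q and F
    with H.\<close>
  define B2 where "B2 \<xi> = (dint M (\<lambda>p q. near p * prod3 H G F \<xi> p q))" for \<xi>
  define B3 where "B3 \<xi> = (dint M (\<lambda>p q. (ennreal (wt \<rho> p) * ennreal (wt \<rho> q)) * prod3 F G H \<xi> p q))" for \<xi>
  have [measurable]: "(near :: real => ennreal) \<in> fmeas M"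
   "(\<lambda>p. ennreal (wt \<rho> p)) \<in> fmeas M"
   by (rule borel_measurable_freq, measurable)+
  have [measurable]: "B1 \<in> fmeas M" "B2 \<in> fmeas M" "B3 \<in> fmeas M"
   unfolding B1_def[abs_def] B2_def[abs_def] B3_def[abs_def]
   by (rule freq.borel_measurable_nn_integral, unfold split_beta', rule freq.borel_measurable_nn_integral, unfold split_beta', measurable)+
  have le: "(dint M (\<lambda>p q. ennreal (kap \<rho> p q) * prod3 F G H \<xi> p q))
    <= B1 \<xi> + (B2 \<xi> + ennreal c * B3 \<xi>)" if \<xi>: "\<xi> \<in> space (freq M)" for \<xi>
  proof -
   note [measurable] = measurable_freq_const[OF \<xi>]
   have k: "ennreal (kap \<rho> p q) <= near p + (near q + ennreal c * (ennreal (wt \<rho> p) * ennreal (wt \<rho> q)))" for p q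
   proof -
    have "ennreal (kap \<rho> p q) <= ennreal (near p + (near q + c * (wt \<rho> p * wt \<rho> q)))"
     using kap_le[of \<rho> p q] \<rho> by (intro ennreal_leI) (simp add: c_def)
    also have "... = near p + (near q + ennreal c * (ennreal (wt \<rho> p) * ennreal (wt \<rho> q)))"
     by (simp add: ennreal_plus ennreal_mult c_def wt_def ennreal_indicator)
    finally show ?thesis .
   qed
   have "(dint M (\<lambda>p q. ennreal (kap \<rho> p q) * prod3 F G H \<xi> p q))
    <= (dint M (\<lambda>p q. near p * prod3 F G H \<xi> p q
     + (near q * prod3 F G H \<xi> p q
     + ennreal c * ((ennreal (wt \<rho> p) * ennreal (wt \<rho> q)) * prod3 F G H \<xi> p q))))"
   proof (intro nn_integral_mono)
    fix p q
    have "ennreal (kap \<rho> p q) * prod3 F G H \<xi> p q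
     <= (near p + (near q + ennreal c * (ennreal (wt \<rho> p) * ennreal (wt \<rho> q)))) * prod3 F G H \<xi> p q"
     by (rule mult_right_mono[OF k]) simp
    then show "ennreal (kap \<rho> p q) * prod3 F G H \<xi> p q
     <= near p * prod3 F G H \<xi> p q
     + (near q * prod3 F G H \<xi> p q
     + ennreal c * ((ennreal (wt \<rho> p) * ennreal (wt \<rho> q)) * prod3 F G H \<xi> p q))"
     by (simp only: distrib_right mult.assoc)
   qed
   also have "... = (\<integral>\<^sup>+p. (\<integral>\<^sup>+q. near p * prod3 F G H \<xi> p q \<partial>freq M)
     + ((\<integral>\<^sup>+q. near q * prod3 F G H \<xi> p q \<partial>freq M)
     + ennreal c * (\<integral>\<^sup>+q. (ennreal (wt \<rho> p) * ennreal (wt \<rho> q)) * prod3 F G H \<xi> p q \<partial>freq M)) \<partial>freq M)"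
   proof (rule nn_integral_cong)
    fix p assume p: "p \<in> space (freq M)"
    note [measurable] = measurable_freq_const[OF p]
    show "(\<integral>\<^sup>+q. near p * prod3 F G H \<xi> p q
     + (near q * prod3 F G H \<xi> p q
     + ennreal c * ((ennreal (wt \<rho> p) * ennreal (wt \<rho> q)) * prod3 F G H \<xi> p q)) \<partial>freq M)
     = (\<integral>\<^sup>+q. near p * prod3 F G H \<xi> p q \<partial>freq M)
     + ((\<integral>\<^sup>+q. near q * prod3 F G H \<xi> p q \<partial>freq M)
     + ennreal c * (\<integral>\<^sup>+q. (ennreal (wt \<rho> p) * ennreal (wt \<rho> q)) * prod3 F G H \<xi> p q \<partial>freq M))"
     by (rule nn_integral_add_add_cmult) measurable
   qed
   also have "... = B1 \<xi> + ((dint M (\<lambda>p q. near q * prod3 F G H \<xi> p q))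
     + ennreal c * B3 \<xi>)"
   proof -
    have [measurable]: "(\<lambda>p. \<integral>\<^sup>+q. near p * prod3 F G H \<xi> p q \<partial>freq M) \<in> fmeas M"
     "(\<lambda>p. \<integral>\<^sup>+q. near q * prod3 F G H \<xi> p q \<partial>freq M) \<in> fmeas M"
     "(\<lambda>p. \<integral>\<^sup>+q. (ennreal (wt \<rho> p) * ennreal (wt \<rho> q)) * prod3 F G H \<xi> p q \<partial>freq M) \<in> fmeas M"
     by (rule freq.borel_measurable_nn_integral, unfold split_beta', measurable)+
    show ?thesis unfolding B1_def B3_def
     by (rule nn_integral_add_add_cmult) measurable
   qed
   also have "(dint M (\<lambda>p q. near q * prod3 F G H \<xi> p q))
    = (dint M (\<lambda>q p. near q * prod3 F G H \<xi> p q))"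
    by (rule freq2.Fubini') (unfold split_beta', measurable)
   also have "... = B2 \<xi>"
   proof -
    have "near q * prod3 F G H \<xi> p q
     = near q * (H (\<xi> - q) * G (\<xi> - q - p) * F (\<xi> - p))" for p q
    proof -
     have eq: "\<xi> - p - q = \<xi> - q - p" by simp
     show ?thesis unfolding eq by (simp only: mult_ac)
    qed
    then show ?thesis unfolding B2_def by (simp only:)
   qed
   finally show ?thesis .
  qed
  have "(\<integral>\<^sup>+\<xi>. (dint M (\<lambda>p q. ennreal (kap \<rho> p q) * prod3 F G H \<xi> p q))^2 \<partial>freq M)
   <= (\<integral>\<^sup>+\<xi>. 2 * ((B1 \<xi>)^2 + 2 * ((B2 \<xi>)^2 + (ennreal c)^2 * (B3 \<xi>)^2)) \<partial>freq M)"
  proof (rule nn_integral_mono)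
   fix \<xi> assume \<xi>: "\<xi> \<in> space (freq M)"
   have "(dint M (\<lambda>p q. ennreal (kap \<rho> p q) * prod3 F G H \<xi> p q))^2
    <= (B1 \<xi> + (B2 \<xi> + ennreal c * B3 \<xi>))^2" by (rule power_mono[OF le[OF \<xi>]]) simp
   also have "... <= 2 * ((B1 \<xi>)^2 + (B2 \<xi> + ennreal c * B3 \<xi>)^2)" by (rule ennreal_square_add_le)
   also have "... <= 2 * ((B1 \<xi>)^2 + 2 * ((B2 \<xi>)^2 + (ennreal c * B3 \<xi>)^2))"
    by (intro mult_left_mono add_left_mono ennreal_square_add_le) simp
   finally show "(dint M (\<lambda>p q. ennreal (kap \<rho> p q) * prod3 F G H \<xi> p q))^2
    <= 2 * ((B1 \<xi>)^2 + 2 * ((B2 \<xi>)^2 + (ennreal c)^2 * (B3 \<xi>)^2))" by (simp add: power_mult_distrib)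
  qed
  also have "... = 2 * ((\<integral>\<^sup>+\<xi>. (B1 \<xi>)^2 \<partial>freq M) + 2 * ((\<integral>\<^sup>+\<xi>. (B2 \<xi>)^2 \<partial>freq M) + (ennreal c)^2 * (\<integral>\<^sup>+\<xi>. (B3 \<xi>)^2 \<partial>freq M)))"
   by (simp add: nn_integral_cmult nn_integral_add)
  also have "... <= 2 * (A1 * N + 2 * (A1 * N + (ennreal c)^2 * (A2 * N)))"
  proof (intro mult_left_mono add_mono)
   show "(\<integral>\<^sup>+\<xi>. (B1 \<xi>)^2 \<partial>freq M) <= A1 * N" unfolding B1_def A1_def N_def by (rule trilinear_B1) measurable
   have "(\<integral>\<^sup>+\<xi>. (B2 \<xi>)^2 \<partial>freq M) <= A1 * ((nsq M H) * (nsq M G) * (nsq M F))"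
    unfolding B2_def A1_def by (rule trilinear_B1) measurable
   then show "(\<integral>\<^sup>+\<xi>. (B2 \<xi>)^2 \<partial>freq M) <= A1 * N" by (simp add: N_def mult_ac)
   show "(\<integral>\<^sup>+\<xi>. (B3 \<xi>)^2 \<partial>freq M) <= A2 * N" unfolding B3_def A2_def N_def by (rule trilinear_B3) measurable
  qed auto
  also have "... = D * N" unfolding D_def by (simp add: algebra_simps)
  also have "D = ennreal (enn2real D)" using D by simp
  finally show "(\<integral>\<^sup>+\<xi>. (dint M (\<lambda>p q. ennreal (kap \<rho> p q) * prod3 F G H \<xi> p q))^2 \<partial>freq M)
   <= ennreal (enn2real D) * ((nsq M F) * (nsq M G) * (nsq M H))"
   by (simp only: N_def)
 qed simp
qed

definition trC :: "domain => real => real" where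
 "trC M \<rho> = (SOME C. C >= 0 \<and> (\<forall>(F :: real => ennreal) G H. F \<in> fmeas M --> G \<in> fmeas M --> H \<in> fmeas M -->
  (\<integral>\<^sup>+\<xi>. (dint M (\<lambda>p q. ennreal (kap \<rho> p q) * prod3 F G H \<xi> p q))^2 \<partial>freq M)
  <= ennreal C * ((nsq M F) * (nsq M G) * (nsq M H))))"

lemma trC:
 assumes "\<rho> > 1/2"
 shows "trC M \<rho> >= 0"
  and "F \<in> fmeas M ==> G \<in> fmeas M ==> H \<in> fmeas M ==>
  (\<integral>\<^sup>+\<xi>. (dint M (\<lambda>p q. ennreal (kap \<rho> p q) * prod3 F G H \<xi> p q))^2 \<partial>freq M)
  <= ennreal (trC M \<rho>) * ((nsq M F) * (nsq M G) * (nsq M H))"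
 using someI_ex[OF trilinear_nn[OF assms, of M]] unfolding trC_def[symmetric] by auto

subsection \<open>Trilinear operators with resonant kernels\<close>

type_synonym kernel = "real => real => real => complex"

text \<open>With \<open>p = \<xi> - \<xi>\<^sub>1\<close>, \<open>q = \<xi> - \<xi>\<^sub>3\<close> the convolution constraint \<open>\<xi> = \<xi>\<^sub>1 - \<xi>\<^sub>2 + \<xi>\<^sub>3\<close> becomes
  \<open>\<xi>\<^sub>2 = \<xi> - p - q\<close>, and the resonance function is \<open>\<xi>\<^sup>2 - \<xi>\<^sub>1\<^sup>2 + \<xi>\<^sub>2\<^sup>2 - \<xi>\<^sub>3\<^sup>2 = 2 p q\<close>.\<close>

definition tri3 :: "(real => complex) => (real => complex) => (real => complex) => real => real \<times> real => complex" where
 "tri3 f g h \<xi> z = f (\<xi> - fst z) * cnj (g (\<xi> - fst z - snd z)) * h (\<xi> - snd z)"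

definition OpF :: "domain => kernel => (real => complex) => (real => complex) => (real => complex) => real => complex" where
 "OpF M k f g h \<xi> = (LINT z|(freq_sq M). k \<xi> (fst z) (snd z) * tri3 f g h \<xi> z)"

text \<open>Measurability refers to the Borel sets of the line even when the frequencies are
  integers, so that one kernel serves both domains.\<close>

definition kern :: "real => real => kernel => bool" where
 "kern \<rho> A k \<longleftrightarrow> (\<lambda>w. k (fst w) (fst (snd w)) (snd (snd w))) \<in> borel_measurable (borel \<Otimes>\<^sub>M (borel \<Otimes>\<^sub>M borel)) \<and>
  0 <= A \<and> (\<forall>\<xi> p q. cmod (k \<xi> p q) <= A * kap \<rho> p q)"

lemma measurable_freq3 [measurable]:
 "fst \<in> borel_measurable (freq M \<Otimes>\<^sub>M N)"
 "(\<lambda>w. fst (snd w)) \<in> borel_measurable (N \<Otimes>\<^sub>M (freq M \<Otimes>\<^sub>M N'))"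
 "(\<lambda>w. snd (snd w)) \<in> borel_measurable (N \<Otimes>\<^sub>M (N' \<Otimes>\<^sub>M freq M))"
proof -
 have id: "(\<lambda>x. x) \<in> fmeas M" by (rule borel_measurable_freq) simp
 show "fst \<in> borel_measurable (freq M \<Otimes>\<^sub>M N)"
  by (rule measurable_compose[OF measurable_fst id])
 show "(\<lambda>w. fst (snd w)) \<in> borel_measurable (N \<Otimes>\<^sub>M (freq M \<Otimes>\<^sub>M N'))"
  by (rule measurable_compose[OF measurable_snd measurable_compose[OF measurable_fst id]])
 show "(\<lambda>w. snd (snd w)) \<in> borel_measurable (N \<Otimes>\<^sub>M (N' \<Otimes>\<^sub>M freq M))"
  by (rule measurable_compose[OF measurable_snd measurable_compose[OF measurable_snd id]])
qed

lemma tri3_measurable: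
 assumes [measurable]: "f \<in> fmeas M" "g \<in> fmeas M" "h \<in> fmeas M"
 shows "(\<lambda>w. tri3 f g h (fst w) (snd w)) \<in> borel_measurable (freq M \<Otimes>\<^sub>M (freq_sq M))"
 unfolding tri3_def by measurable

lemma kern_measurable:
 assumes "kern \<rho> A k"
 shows "(\<lambda>w. k (fst w) (fst (snd w)) (snd (snd w))) \<in> borel_measurable (freq M \<Otimes>\<^sub>M (freq_sq M))"
proof -
 have "(\<lambda>w. (fst w, fst (snd w), snd (snd w))) \<in> measurable (freq M \<Otimes>\<^sub>M (freq_sq M)) (borel \<Otimes>\<^sub>M (borel \<Otimes>\<^sub>M borel))"
  by measurable
 from measurable_compose[OF this, of "\<lambda>w. k (fst w) (fst (snd w)) (snd (snd w))" borel] assms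
 show ?thesis unfolding kern_def by simp
qed

lemma kern_tri3_measurable:
 assumes "kern \<rho> A k" "f \<in> fmeas M" "g \<in> fmeas M" "h \<in> fmeas M"
 shows "(\<lambda>w. k (fst w) (fst (snd w)) (snd (snd w)) * tri3 f g h (fst w) (snd w)) \<in> borel_measurable (freq M \<Otimes>\<^sub>M (freq_sq M))"
 by (intro borel_measurable_times kern_measurable[OF assms(1)] tri3_measurable assms)

text \<open>Absolute values stand inside the integral, because the estimate has to give more than
  the operator bound: integrability in z for almost every \<xi>, and the use of Fubini for the
  quartic form.\<close>

lemma kern_sq_bound:
 assumes \<rho>: "\<rho> > 1/2" and k: "kern \<rho> A k" and f: "f \<in> L2 (freq M)" and g: "g \<in> L2 (freq M)" and h: "h \<in> L2 (freq M)"
 shows "(\<integral>\<^sup>+\<xi>. (\<integral>\<^sup>+z. ennreal (cmod (k \<xi> (fst z) (snd z) * tri3 f g h \<xi> z)) \<partial>(freq_sq M))^2 \<partial>freq M)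
  <= ennreal (trC M \<rho> * A\<^sup>2) * (sqn (freq M) f * sqn (freq M) g * sqn (freq M) h)"
proof -
 have [measurable]: "f \<in> fmeas M" "g \<in> fmeas M" "h \<in> fmeas M"
  using f g h by (auto dest: L2_measurable)
 have A: "0 <= A" using k by (simp add: kern_def)
 have [measurable]: "(\<lambda>z. ennreal (kap \<rho> (fst z) (snd z))) \<in> borel_measurable (freq_sq M)"
 proof -
  have [measurable]: "snd \<in> borel_measurable (freq_sq M)"
   using measurable_compose[OF measurable_snd[of "freq M" "freq M"] borel_measurable_freq[of "\<lambda>x. x" M]] by simp
  show ?thesis by measurable
 qed
 define T where "T \<xi> = (dint M (\<lambda>p q. ennreal (kap \<rho> p q) * (ennreal (cmod (f (\<xi> - p))) * ennreal (cmod (g (\<xi> - p - q))) * ennreal (cmod (h (\<xi> - q))))))" for \<xi>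
 have le: "(\<integral>\<^sup>+z. ennreal (cmod (k \<xi> (fst z) (snd z) * tri3 f g h \<xi> z)) \<partial>(freq_sq M)) <= ennreal A * T \<xi>"
  if \<xi>: "\<xi> \<in> space (freq M)" for \<xi>
 proof -
  note [measurable] = measurable_freq_const[OF \<xi>]
  have "(\<integral>\<^sup>+z. ennreal (cmod (k \<xi> (fst z) (snd z) * tri3 f g h \<xi> z)) \<partial>(freq_sq M))
   <= (\<integral>\<^sup>+z. ennreal A * (ennreal (kap \<rho> (fst z) (snd z)) * (ennreal (cmod (f (\<xi> - fst z))) * ennreal (cmod (g (\<xi> - fst z - snd z))) * ennreal (cmod (h (\<xi> - snd z))))) \<partial>(freq_sq M))"
  proof (rule nn_integral_mono)
   fix z
   have "cmod (k \<xi> (fst z) (snd z) * tri3 f g h \<xi> z)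
    <= (A * kap \<rho> (fst z) (snd z)) * (cmod (f (\<xi> - fst z)) * cmod (g (\<xi> - fst z - snd z)) * cmod (h (\<xi> - snd z)))"
    using k unfolding kern_def tri3_def norm_mult complex_mod_cnj by (intro mult_right_mono) auto
   then show "ennreal (cmod (k \<xi> (fst z) (snd z) * tri3 f g h \<xi> z))
    <= ennreal A * (ennreal (kap \<rho> (fst z) (snd z)) * (ennreal (cmod (f (\<xi> - fst z))) * ennreal (cmod (g (\<xi> - fst z - snd z))) * ennreal (cmod (h (\<xi> - snd z)))))"
    using A kap_pos[of \<rho> "fst z" "snd z"] by (simp add: ennreal_mult[symmetric] mult.assoc)
  qed
  also have "... = ennreal A * (\<integral>\<^sup>+z. ennreal (kap \<rho> (fst z) (snd z)) * (ennreal (cmod (f (\<xi> - fst z))) * ennreal (cmod (g (\<xi> - fst z - snd z))) * ennreal (cmod (h (\<xi> - snd z)))) \<partial>(freq_sq M))"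
   by (rule nn_integral_cmult) measurable
  also have "(\<integral>\<^sup>+z. ennreal (kap \<rho> (fst z) (snd z)) * (ennreal (cmod (f (\<xi> - fst z))) * ennreal (cmod (g (\<xi> - fst z - snd z))) * ennreal (cmod (h (\<xi> - snd z)))) \<partial>(freq_sq M)) = T \<xi>"
  proof -
   have m: "(\<lambda>z. ennreal (kap \<rho> (fst z) (snd z)) * (ennreal (cmod (f (\<xi> - fst z))) * ennreal (cmod (g (\<xi> - fst z - snd z))) * ennreal (cmod (h (\<xi> - snd z))))) \<in> borel_measurable (freq_sq M)"
    by measurable
   show ?thesis unfolding T_def using freq.nn_integral_fst[OF m, symmetric] by (simp only: fst_conv snd_conv)
  qed
  finally show ?thesis .
 qed
 have Tm [measurable]: "T \<in> fmeas M"
 proof -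
  have [measurable]: "(\<lambda>w. ennreal (kap \<rho> (snd (fst w)) (snd w))) \<in> borel_measurable ((freq_sq M) \<Otimes>\<^sub>M freq M)"
  proof -
   have id: "(\<lambda>x. x) \<in> fmeas M" by (rule borel_measurable_freq) simp
   have [measurable]: "(\<lambda>w. snd (fst w)) \<in> borel_measurable ((freq_sq M) \<Otimes>\<^sub>M freq M)"
    "snd \<in> borel_measurable ((freq_sq M) \<Otimes>\<^sub>M freq M)"
    by (rule measurable_compose[OF measurable_compose[OF measurable_fst measurable_snd] id]
     measurable_compose[OF measurable_snd id])+
   show ?thesis by measurable
  qed
  show ?thesis unfolding T_def[abs_def]
   by (rule freq.borel_measurable_nn_integral, unfold split_beta', rule freq.borel_measurable_nn_integral, unfold split_beta', measurable)
 qed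
 have "(\<integral>\<^sup>+\<xi>. (\<integral>\<^sup>+z. ennreal (cmod (k \<xi> (fst z) (snd z) * tri3 f g h \<xi> z)) \<partial>(freq_sq M))^2 \<partial>freq M)
  <= (\<integral>\<^sup>+\<xi>. (ennreal A)^2 * (T \<xi>)^2 \<partial>freq M)"
  unfolding power_mult_distrib[symmetric] by (intro nn_integral_mono power_mono le) auto
 also have "... = (ennreal A)^2 * (nsq M T)" by (rule nn_integral_cmult) measurable
 also have "... <= (ennreal A)^2 * (ennreal (trC M \<rho>) * (sqn (freq M) f * sqn (freq M) g * sqn (freq M) h))"
 proof (rule mult_left_mono)
  show "(nsq M T) <= ennreal (trC M \<rho>) * (sqn (freq M) f * sqn (freq M) g * sqn (freq M) h)"
  using trC(2)[OF \<rho>, of "\<lambda>x. ennreal (cmod (f x))" M "\<lambda>x. ennreal (cmod (g x))" "\<lambda>x. ennreal (cmod (h x))"]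
  unfolding T_def sqn_def by (simp add: ennreal_power)
 qed simp
 finally show ?thesis using A trC(1)[OF \<rho>, of M]
  by (simp add: ennreal_mult ennreal_power mult_ac)
qed

lemma kern_integrable:
 assumes \<rho>: "\<rho> > 1/2" and k: "kern \<rho> A k" and f: "f \<in> L2 (freq M)" and g: "g \<in> L2 (freq M)" and h: "h \<in> L2 (freq M)"
 shows "AE \<xi> in freq M. integrable (freq_sq M) (\<lambda>z. k \<xi> (fst z) (snd z) * tri3 f g h \<xi> z)"
proof -
 have fm: "f \<in> fmeas M" "g \<in> fmeas M" "h \<in> fmeas M"
  using f g h by (auto dest: L2_measurable)
 note m = kern_tri3_measurable[OF k fm]
 define S where "S \<xi> = (\<integral>\<^sup>+z. ennreal (cmod (k \<xi> (fst z) (snd z) * tri3 f g h \<xi> z)) \<partial>(freq_sq M))" for \<xi>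
 have Sm: "S \<in> fmeas M"
  unfolding S_def[abs_def]
  by (rule freq2.P.borel_measurable_nn_integral) (use m in "simp add: split_beta'")
 have "(nsq M S) < \<infinity>"
  using kern_sq_bound[OF \<rho> k f g h] L2_sqn_finite[OF f] L2_sqn_finite[OF g] L2_sqn_finite[OF h]
  unfolding S_def by (auto intro: le_less_trans simp: ennreal_mult_less_top)
 then have "AE \<xi> in freq M. (S \<xi>)^2 \<noteq> \<infinity>"
  using Sm by (intro nn_integral_PInf_AE) auto
 then show ?thesis
  using AE_space
 proof eventually_elim
  case (elim \<xi>)
  have "(\<lambda>z. k \<xi> (fst z) (snd z) * tri3 f g h \<xi> z) \<in> borel_measurable (freq_sq M)"
   using measurable_compose[OF measurable_Pair1'[OF elim(2)] m] by simp
  moreover have "S \<xi> < \<infinity>" using elim(1)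
   by (cases "S \<xi> = \<top>") (simp_all add: power2_eq_square ennreal_top_mult less_top)
  ultimately show ?case unfolding S_def by (intro integrableI_bounded)
 qed
qed

lemma OpF_measurable:
 assumes "kern \<rho> A k" "f \<in> fmeas M" "g \<in> fmeas M" "h \<in> fmeas M"
 shows "OpF M k f g h \<in> fmeas M"
 unfolding OpF_def[abs_def]
 by (rule freq2.P.borel_measurable_lebesgue_integral) (use kern_tri3_measurable[OF assms] in "simp add: split_beta'")

lemma OpF_sqn:
 assumes \<rho>: "\<rho> > 1/2" and k: "kern \<rho> A k" and f: "f \<in> L2 (freq M)" and g: "g \<in> L2 (freq M)" and h: "h \<in> L2 (freq M)"
 shows "sqn (freq M) (OpF M k f g h) <= ennreal (trC M \<rho> * A\<^sup>2) * (sqn (freq M) f * sqn (freq M) g * sqn (freq M) h)"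
proof -
 have "sqn (freq M) (OpF M k f g h)
  <= (\<integral>\<^sup>+\<xi>. (\<integral>\<^sup>+z. ennreal (cmod (k \<xi> (fst z) (snd z) * tri3 f g h \<xi> z)) \<partial>(freq_sq M))^2 \<partial>freq M)"
  unfolding sqn_def ennreal_power[OF norm_ge_zero, symmetric]
 proof (rule nn_integral_mono_AE, use kern_integrable[OF assms] in eventually_elim)
  case (elim \<xi>)
  show ?case unfolding OpF_def by (intro power_mono integral_norm_bound_ennreal[OF elim]) simp
 qed
 also note kern_sq_bound[OF assms]
 finally show ?thesis .
qed

lemma OpF_L2:
 assumes \<rho>: "\<rho> > 1/2" and k: "kern \<rho> A k" and f: "f \<in> L2 (freq M)" and g: "g \<in> L2 (freq M)" and h: "h \<in> L2 (freq M)"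
 shows "OpF M k f g h \<in> L2 (freq M)"
proof -
 have "sqn (freq M) (OpF M k f g h) < \<infinity>"
  by (rule le_less_trans[OF OpF_sqn[OF assms]])
   (use L2_sqn_finite[OF f] L2_sqn_finite[OF g] L2_sqn_finite[OF h] in "simp add: ennreal_mult_less_top")
 then show ?thesis using OpF_measurable[OF k] f g h by (auto simp: L2_iff)
qed

lemma OpF_add:
 assumes \<rho>: "\<rho> > 1/2" and k: "kern \<rho> A k"
  and f: "f \<in> L2 (freq M)" "f' \<in> L2 (freq M)" and g: "g \<in> L2 (freq M)" "g' \<in> L2 (freq M)"
  and h: "h \<in> L2 (freq M)" "h' \<in> L2 (freq M)"
 shows "AE \<xi> in freq M. OpF M k (\<lambda>x. f x + f' x) g h \<xi> = OpF M k f g h \<xi> + OpF M k f' g h \<xi>"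
  and "AE \<xi> in freq M. OpF M k f (\<lambda>x. g x + g' x) h \<xi> = OpF M k f g h \<xi> + OpF M k f g' h \<xi>"
  and "AE \<xi> in freq M. OpF M k f g (\<lambda>x. h x + h' x) \<xi> = OpF M k f g h \<xi> + OpF M k f g h' \<xi>"
proof -
 show "AE \<xi> in freq M. OpF M k (\<lambda>x. f x + f' x) g h \<xi> = OpF M k f g h \<xi> + OpF M k f' g h \<xi>"
  using kern_integrable[OF \<rho> k f(1) g(1) h(1)] kern_integrable[OF \<rho> k f(2) g(1) h(1)]
  by eventually_elim (simp add: OpF_def tri3_def algebra_simps flip: Bochner_Integration.integral_add)
 show "AE \<xi> in freq M. OpF M k f (\<lambda>x. g x + g' x) h \<xi> = OpF M k f g h \<xi> + OpF M k f g' h \<xi>"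
  using kern_integrable[OF \<rho> k f(1) g(1) h(1)] kern_integrable[OF \<rho> k f(1) g(2) h(1)]
  by eventually_elim (simp add: OpF_def tri3_def algebra_simps flip: Bochner_Integration.integral_add)
 show "AE \<xi> in freq M. OpF M k f g (\<lambda>x. h x + h' x) \<xi> = OpF M k f g h \<xi> + OpF M k f g h' \<xi>"
  using kern_integrable[OF \<rho> k f(1) g(1) h(1)] kern_integrable[OF \<rho> k f(1) g(1) h(2)]
  by eventually_elim (simp add: OpF_def tri3_def algebra_simps flip: Bochner_Integration.integral_add)
qed

lemma OpF_null:
 assumes \<rho>: "\<rho> > 1/2" and k: "kern \<rho> A k" and f: "f \<in> L2 (freq M)" and g: "g \<in> L2 (freq M)" and h: "h \<in> L2 (freq M)"
  and 0: "sqn (freq M) f = 0 \<or> sqn (freq M) g = 0 \<or> sqn (freq M) h = 0"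
 shows "AE \<xi> in freq M. OpF M k f g h \<xi> = 0"
proof -
 have "sqn (freq M) (OpF M k f g h) = 0" using OpF_sqn[OF \<rho> k f g h] 0 by auto
 then show ?thesis using L2_measurable[OF OpF_L2[OF \<rho> k f g h]] by (subst (asm) sqn_zero_iff)
qed

text \<open>Additivity turns a change of one slot on a null set into the operator applied to a
  function of norm zero, and the L^2 bound makes its value vanish almost everywhere.\<close>

lemma OpF_cong:
 assumes \<rho>: "\<rho> > 1/2" and k: "kern \<rho> A k"
  and f: "f \<in> L2 (freq M)" "f' \<in> L2 (freq M)" and g: "g \<in> L2 (freq M)" "g' \<in> L2 (freq M)"
  and h: "h \<in> L2 (freq M)" "h' \<in> L2 (freq M)"
  and eq: "AE x in freq M. f x = f' x" "AE x in freq M. g x = g' x" "AE x in freq M. h x = h' x"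
 shows "AE \<xi> in freq M. OpF M k f g h \<xi> = OpF M k f' g' h' \<xi>"
proof -
 have z: "sqn (freq M) (\<lambda>x. u x - v x) = 0" if "u \<in> L2 (freq M)" "v \<in> L2 (freq M)" "AE x in freq M. u x = v x" for u v
  using that L2_measurable[OF L2_diff[OF that(1,2)]] by (subst sqn_zero_iff) auto
 note df = L2_diff[OF f] and dg = L2_diff[OF g] and dh = L2_diff[OF h]
 have "AE \<xi> in freq M. OpF M k f g h \<xi> = OpF M k f' g h \<xi>"
  using OpF_add(1)[OF \<rho> k df f(2) g(1) g(1) h(1) h(1)] OpF_null[OF \<rho> k df g(1) h(1)] z[OF f eq(1)] by auto
 moreover have "AE \<xi> in freq M. OpF M k f' g h \<xi> = OpF M k f' g' h \<xi>"
  using OpF_add(2)[OF \<rho> k f(2) f(2) dg g(2) h(1) h(1)] OpF_null[OF \<rho> k f(2) dg h(1)] z[OF g eq(2)] by auto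
 moreover have "AE \<xi> in freq M. OpF M k f' g' h \<xi> = OpF M k f' g' h' \<xi>"
  using OpF_add(3)[OF \<rho> k f(2) f(2) g(2) g(2) dh h(2)] OpF_null[OF \<rho> k f(2) g(2) dh] z[OF h eq(3)] by auto
 ultimately show ?thesis by eventually_elim simp
qed

definition Op :: "kernel => 'm::l2dom l2 => 'm l2 => 'm l2 => 'm l2" where
 "Op k u v w = toL2 (OpF (dom_of TYPE('m)) k (fn u) (fn v) (fn w))"

lemma fn_Op:
 fixes u v w :: "'m::l2dom l2"
 assumes "\<rho> > 1/2" "kern \<rho> A k"
 shows "AE \<xi> in mu TYPE('m). fn (Op k u v w) \<xi> = OpF (dom_of TYPE('m)) k (fn u) (fn v) (fn w) \<xi>"
 unfolding Op_def by (rule fn_toL2) (rule OpF_L2[OF assms fn_L2 fn_L2 fn_L2])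

lemma Op_toL2:
 assumes \<rho>: "\<rho> > 1/2" and k: "kern \<rho> A k"
  and f: "f \<in> L2 (mu TYPE('m::l2dom))" and g: "g \<in> L2 (mu TYPE('m))" and h: "h \<in> L2 (mu TYPE('m))"
 shows "Op k (toL2 f) (toL2 g) (toL2 h) = (toL2 (OpF (dom_of TYPE('m)) k f g h) :: 'm l2)"
 unfolding Op_def
 by (rule toL2_cong[OF OpF_L2[OF \<rho> k fn_L2 fn_L2 fn_L2] OpF_L2[OF \<rho> k f g h]
   OpF_cong[OF \<rho> k fn_L2 f fn_L2 g fn_L2 h fn_toL2[OF f] fn_toL2[OF g] fn_toL2[OF h]]])

lemma Op_add:
 fixes u v w :: "'m::l2dom l2"
 assumes \<rho>: "\<rho> > 1/2" and k: "kern \<rho> A k"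
 shows "Op k (u + u') v w = Op k u v w + Op k u' v w"
  and "Op k u (v + v') w = Op k u v w + Op k u v' w"
  and "Op k u v (w + w') = Op k u v w + Op k u v w'"
proof -
 note L = OpF_L2[OF \<rho> k fn_L2 fn_L2 fn_L2]
 show "Op k (u + u') v w = Op k u v w + Op k u' v w"
 proof -
  have "Op k (u + u') v w = Op k (toL2 (\<lambda>x. fn u x + fn u' x)) (toL2 (fn v)) (toL2 (fn w))"
   by (simp add: plus_l2_def toL2_fn)
  also have "... = toL2 (OpF (dom_of TYPE('m)) k (\<lambda>x. fn u x + fn u' x) (fn v) (fn w))"
   by (rule Op_toL2[OF \<rho> k L2_add fn_L2 fn_L2]) (rule fn_L2)+
  also have "... = toL2 (\<lambda>\<xi>. OpF (dom_of TYPE('m)) k (fn u) (fn v) (fn w) \<xi> + OpF (dom_of TYPE('m)) k (fn u') (fn v) (fn w) \<xi>)"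
   by (rule toL2_cong[OF OpF_L2[OF \<rho> k L2_add fn_L2 fn_L2] L2_add[OF L L] OpF_add(1)[OF \<rho> k]]) (rule fn_L2)+
  also have "... = Op k u v w + Op k u' v w" unfolding Op_def by (rule toL2_add[OF L L])
  finally show ?thesis .
 qed
 show "Op k u (v + v') w = Op k u v w + Op k u v' w"
 proof -
  have "Op k u (v + v') w = Op k (toL2 (fn u)) (toL2 (\<lambda>x. fn v x + fn v' x)) (toL2 (fn w))"
   by (simp add: plus_l2_def toL2_fn)
  also have "... = toL2 (OpF (dom_of TYPE('m)) k (fn u) (\<lambda>x. fn v x + fn v' x) (fn w))"
   by (rule Op_toL2[OF \<rho> k fn_L2 L2_add fn_L2]) (rule fn_L2)+
  also have "... = toL2 (\<lambda>\<xi>. OpF (dom_of TYPE('m)) k (fn u) (fn v) (fn w) \<xi> + OpF (dom_of TYPE('m)) k (fn u) (fn v') (fn w) \<xi>)"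
   by (rule toL2_cong[OF OpF_L2[OF \<rho> k fn_L2 L2_add fn_L2] L2_add[OF L L] OpF_add(2)[OF \<rho> k]]) (rule fn_L2)+
  also have "... = Op k u v w + Op k u v' w" unfolding Op_def by (rule toL2_add[OF L L])
  finally show ?thesis .
 qed
 show "Op k u v (w + w') = Op k u v w + Op k u v w'"
 proof -
  have "Op k u v (w + w') = Op k (toL2 (fn u)) (toL2 (fn v)) (toL2 (\<lambda>x. fn w x + fn w' x))"
   by (simp add: plus_l2_def toL2_fn)
  also have "... = toL2 (OpF (dom_of TYPE('m)) k (fn u) (fn v) (\<lambda>x. fn w x + fn w' x))"
   by (rule Op_toL2[OF \<rho> k fn_L2 fn_L2 L2_add]) (rule fn_L2)+
  also have "... = toL2 (\<lambda>\<xi>. OpF (dom_of TYPE('m)) k (fn u) (fn v) (fn w) \<xi> + OpF (dom_of TYPE('m)) k (fn u) (fn v) (fn w') \<xi>)"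
   by (rule toL2_cong[OF OpF_L2[OF \<rho> k fn_L2 fn_L2 L2_add] L2_add[OF L L] OpF_add(3)[OF \<rho> k]]) (rule fn_L2)+
  also have "... = Op k u v w + Op k u v w'" unfolding Op_def by (rule toL2_add[OF L L])
  finally show ?thesis .
 qed
qed

definition opC :: "'m::l2dom itself => real => real" where "opC a \<rho> = sqrt (trC (dom_of a) \<rho>)"

lemma opC_nonneg: "\<rho> > 1/2 ==> opC a \<rho> >= 0"
 unfolding opC_def using trC(1) by simp

lemma norm_Op:
 fixes u v w :: "'m::l2dom l2"
 assumes \<rho>: "\<rho> > 1/2" and k: "kern \<rho> A k"
 shows "norm (Op k u v w) <= opC TYPE('m) \<rho> * A * (norm u * norm v * norm w)"
proof -
 let ?M = "dom_of TYPE('m)"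
 have A: "0 <= A" using k by (simp add: kern_def)
 have "ennreal ((norm (Op k u v w))^2) = sqn (freq ?M) (OpF ?M k (fn u) (fn v) (fn w))"
  unfolding Op_def by (rule sqn_toL2[OF OpF_L2[OF \<rho> k fn_L2 fn_L2 fn_L2]])
 also have "... <= ennreal (trC ?M \<rho> * A\<^sup>2) * (sqn (freq ?M) (fn u) * sqn (freq ?M) (fn v) * sqn (freq ?M) (fn w))"
  by (rule OpF_sqn[OF \<rho> k fn_L2 fn_L2 fn_L2])
 also have "... = ennreal (trC ?M \<rho> * A\<^sup>2 * ((norm u)^2 * (norm v)^2 * (norm w)^2))"
  unfolding sqn_fn using trC(1)[OF \<rho>, of ?M] by (simp add: ennreal_mult)
 also have "trC ?M \<rho> * A\<^sup>2 * ((norm u)^2 * (norm v)^2 * (norm w)^2) = (opC TYPE('m) \<rho> * A * (norm u * norm v * norm w))^2"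
  unfolding opC_def power_mult_distrib using trC(1)[OF \<rho>, of ?M] by simp
 finally have "(norm (Op k u v w))^2 <= (opC TYPE('m) \<rho> * A * (norm u * norm v * norm w))^2"
  by (simp only: ennreal_le_iff zero_le_power2)
 then show ?thesis
  by (rule power2_le_imp_le) (use A opC_nonneg[OF \<rho>, of "TYPE('m)"] in simp)
qed

lemma kern_add_scale:
 assumes k: "kern \<rho> A k" and k': "kern \<rho> A' k'"
 shows "kern \<rho> (A + \<bar>c\<bar> * A') (\<lambda>\<xi> p q. k \<xi> p q + of_real c * k' \<xi> p q)"
proof -
 have "cmod (k \<xi> p q + of_real c * k' \<xi> p q) <= (A + \<bar>c\<bar> * A') * kap \<rho> p q" for \<xi> p q
 proof -
  have "cmod (k \<xi> p q + of_real c * k' \<xi> p q) <= cmod (k \<xi> p q) + \<bar>c\<bar> * cmod (k' \<xi> p q)"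
   using norm_triangle_ineq[of "k \<xi> p q" "of_real c * k' \<xi> p q"] by (simp add: norm_mult)
  also have "... <= A * kap \<rho> p q + \<bar>c\<bar> * (A' * kap \<rho> p q)"
   using k k' unfolding kern_def by (intro add_mono mult_left_mono) auto
  finally show ?thesis by (simp add: algebra_simps)
 qed
 then show ?thesis using k k' unfolding kern_def by auto
qed

lemma Op_kernel_add_scale:
 fixes u v w :: "'m::l2dom l2"
 assumes \<rho>: "\<rho> > 1/2" and k: "kern \<rho> A k" and k': "kern \<rho> A' k'"
 shows "Op (\<lambda>\<xi> p q. k \<xi> p q + of_real c * k' \<xi> p q) u v w = Op k u v w + c *\<^sub>R Op k' u v w"
proof -
 let ?M = "dom_of TYPE('m)"
 note k'' = kern_add_scale[OF k k', of c]
 note L = OpF_L2[OF \<rho> k fn_L2 fn_L2 fn_L2] and L' = OpF_L2[OF \<rho> k' fn_L2 fn_L2 fn_L2]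
 have "AE \<xi> in mu TYPE('m). OpF ?M (\<lambda>\<xi> p q. k \<xi> p q + of_real c * k' \<xi> p q) (fn u) (fn v) (fn w) \<xi>
  = OpF ?M k (fn u) (fn v) (fn w) \<xi> + of_real c * OpF ?M k' (fn u) (fn v) (fn w) \<xi>"
  using kern_integrable[OF \<rho> k fn_L2[of u] fn_L2[of v] fn_L2[of w]] kern_integrable[OF \<rho> k' fn_L2[of u] fn_L2[of v] fn_L2[of w]]
 proof eventually_elim
  case (elim \<xi>)
  show ?case unfolding OpF_def distrib_right mult.assoc[of "of_real c"]
   by (subst Bochner_Integration.integral_add[OF elim(1) integrable_cmult[OF elim(2)]])
    (simp only: LINT_cmult)
 qed
 from toL2_cong[OF OpF_L2[OF \<rho> k'' fn_L2 fn_L2 fn_L2] L2_add[OF L L2_scale[OF L']] this]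
 show ?thesis unfolding Op_def by (simp add: toL2_add[OF L L2_scale[OF L']] toL2_scaleR[OF L'])
qed

text \<open>Multipliers in the slots and in front are absorbed by the kernel, the one in the middle
  slot with a conjugation. Cutoffs, propagator phases and changes of weight are all handled in this
  way.\<close>

lemma Op_mult:
 fixes u v w :: "'m::l2dom l2"
 assumes \<rho>: "\<rho> > 1/2" and k: "kern \<rho> A k" and k': "kern \<rho> A' k'"
  and b: "bmult TYPE('m) B b" and b1: "bmult TYPE('m) B1 b1" and b2: "bmult TYPE('m) B2 b2" and b3: "bmult TYPE('m) B3 b3"
  and eq: "\<And>\<xi> p q. \<xi> \<in> space (mu TYPE('m)) ==> p \<in> space (mu TYPE('m)) ==> q \<in> space (mu TYPE('m)) ==>
   b \<xi> * k \<xi> p q * (b1 (\<xi> - p) * cnj (b2 (\<xi> - p - q)) * b3 (\<xi> - q)) = k' \<xi> p q"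
 shows "mult b (Op k (mult b1 u) (mult b2 v) (mult b3 w)) = Op k' u v w"
proof -
 let ?M = "dom_of TYPE('m)"
 note m1 = bmult_L2[OF b1 fn_L2[of u]] and m2 = bmult_L2[OF b2 fn_L2[of v]] and m3 = bmult_L2[OF b3 fn_L2[of w]]
 have "Op k (mult b1 u) (mult b2 v) (mult b3 w)
  = toL2 (OpF ?M k (\<lambda>x. b1 x * fn u x) (\<lambda>x. b2 x * fn v x) (\<lambda>x. b3 x * fn w x))"
  unfolding mult_def by (rule Op_toL2[OF \<rho> k m1 m2 m3])
 then have "mult b (Op k (mult b1 u) (mult b2 v) (mult b3 w))
  = toL2 (\<lambda>\<xi>. b \<xi> * OpF ?M k (\<lambda>x. b1 x * fn u x) (\<lambda>x. b2 x * fn v x) (\<lambda>x. b3 x * fn w x) \<xi>)"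
  using mult_toL2[OF b OpF_L2[OF \<rho> k m1 m2 m3]] by simp
 also have "... = Op k' u v w" unfolding Op_def
 proof (rule toL2_cong[OF bmult_L2[OF b OpF_L2[OF \<rho> k m1 m2 m3]] OpF_L2[OF \<rho> k' fn_L2 fn_L2 fn_L2]], rule AE_I2)
  fix \<xi> assume \<xi>: "\<xi> \<in> space (mu TYPE('m))"
  have "b \<xi> * OpF ?M k (\<lambda>x. b1 x * fn u x) (\<lambda>x. b2 x * fn v x) (\<lambda>x. b3 x * fn w x) \<xi>
   = (LINT z|(freq_sq ?M). b \<xi> * (k \<xi> (fst z) (snd z) * tri3 (\<lambda>x. b1 x * fn u x) (\<lambda>x. b2 x * fn v x) (\<lambda>x. b3 x * fn w x) \<xi> z))"
   unfolding OpF_def by (rule LINT_cmult[symmetric])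
  also have "... = OpF ?M k' (fn u) (fn v) (fn w) \<xi>"
   unfolding OpF_def
  proof (rule LINT_cong)
   fix z assume "z \<in> space (freq_sq ?M)"
   then have "fst z \<in> space (freq ?M)" "snd z \<in> space (freq ?M)" by (auto simp: space_pair_measure)
   note e = eq[OF \<xi> this, symmetric]
   show "b \<xi> * (k \<xi> (fst z) (snd z) * tri3 (\<lambda>x. b1 x * fn u x) (\<lambda>x. b2 x * fn v x) (\<lambda>x. b3 x * fn w x) \<xi> z)
    = k' \<xi> (fst z) (snd z) * tri3 (fn u) (fn v) (fn w) \<xi> z"
    unfolding tri3_def e by (simp only: mult_ac complex_cnj_mult)
  qed
  finally show "b \<xi> * OpF ?M k (\<lambda>x. b1 x * fn u x) (\<lambda>x. b2 x * fn v x) (\<lambda>x. b3 x * fn w x) \<xi> = OpF ?M k' (fn u) (fn v) (fn w) \<xi>" .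
 qed
 finally show ?thesis .
qed

section \<open>The modulated equation\<close>

subsection \<open>Reality of the quartic form\<close>

lemma kern_i:
 assumes "kern \<rho> A k" shows "kern \<rho> A (\<lambda>\<xi> p q. \<i> * k \<xi> p q)"
 using assms unfolding kern_def by (auto simp: norm_mult)

text \<open>Conjugation is undone by the substitution \<open>\<xi> \<mapsto> \<xi> + p\<close>, \<open>p \<mapsto> - p\<close>.\<close>

lemma Op_conserve:
 fixes u :: "'m::l2dom l2"
 assumes \<rho>: "\<rho> > 1/2" and k: "kern \<rho> A (\<lambda>\<xi> p q. \<kappa> p q)" and sym: "\<And>p q. cnj (\<kappa> p q) = \<kappa> (- p) q"
 shows "inner (Op (\<lambda>\<xi> p q. \<i> * \<kappa> p q) u u u) u = 0"
proof -
 let ?M = "dom_of TYPE('m)"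
 define f where "f = fn u"
 have fL: "f \<in> L2 (freq ?M)" unfolding f_def by simp
 have [measurable]: "f \<in> fmeas ?M" by (rule L2_measurable[OF fL])
 define S where "S \<xi> = (\<integral>\<^sup>+z. ennreal (cmod (\<kappa> (fst z) (snd z) * tri3 f f f \<xi> z)) \<partial>(freq_sq ?M))" for \<xi>
 note m = kern_tri3_measurable[OF k L2_measurable[OF fL] L2_measurable[OF fL] L2_measurable[OF fL]]
 have Sm [measurable]: "S \<in> fmeas ?M"
  unfolding S_def[abs_def]
  by (rule freq2.P.borel_measurable_nn_integral) (use m in "simp add: split_beta'")
 define P where "P \<xi> z = \<kappa> (fst z) (snd z) * tri3 f f f \<xi> z * cnj (f \<xi>)" for \<xi> z
 have Pm: "(\<lambda>w. P (fst w) (snd w)) \<in> borel_measurable (freq ?M \<Otimes>\<^sub>M (freq_sq ?M))"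
  unfolding P_def by (rule borel_measurable_times[OF m]) measurable
 \<comment> \<open>Absolute convergence of the quartic form, by Cauchy-Schwarz between the absolute
   trilinear operator and f; it permits integrating over \<xi> first.\<close>
 have P_int: "integrable (freq ?M \<Otimes>\<^sub>M (freq_sq ?M)) (\<lambda>(\<xi>, z). P \<xi> z)"
 proof (rule integrableI_bounded)
  show "(\<lambda>(\<xi>, z). P \<xi> z) \<in> borel_measurable (freq ?M \<Otimes>\<^sub>M (freq_sq ?M))" using Pm by (simp add: split_beta')
  have "(\<lambda>w. ennreal (norm (P (fst w) (snd w)))) \<in> borel_measurable (freq ?M \<Otimes>\<^sub>M (freq_sq ?M))" using Pm by measurable
  from freq2.P.nn_integral_fst[OF this]
  have "(\<integral>\<^sup>+w. ennreal (norm (case w of (\<xi>, z) => P \<xi> z)) \<partial>(freq ?M \<Otimes>\<^sub>M (freq_sq ?M)))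
   = (\<integral>\<^sup>+\<xi>. \<integral>\<^sup>+z. ennreal (norm (P \<xi> z)) \<partial>(freq_sq ?M) \<partial>freq ?M)"
   by (simp add: split_beta')
  also have "... = (\<integral>\<^sup>+\<xi>. S \<xi> * ennreal (cmod (f \<xi>)) \<partial>freq ?M)"
  proof (rule nn_integral_cong)
   fix \<xi> assume \<xi>: "\<xi> \<in> space (freq ?M)"
   have [measurable]: "(\<lambda>z. \<kappa> (fst z) (snd z) * tri3 f f f \<xi> z) \<in> borel_measurable (freq_sq ?M)"
    using measurable_compose[OF measurable_Pair1'[OF \<xi>] m] by simp
   have "(\<integral>\<^sup>+z. ennreal (norm (P \<xi> z)) \<partial>(freq_sq ?M))
    = (\<integral>\<^sup>+z. ennreal (cmod (\<kappa> (fst z) (snd z) * tri3 f f f \<xi> z)) * ennreal (cmod (f \<xi>)) \<partial>(freq_sq ?M))"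
    unfolding P_def by (simp add: norm_mult ennreal_mult)
   also have "... = S \<xi> * ennreal (cmod (f \<xi>))" unfolding S_def by (rule nn_integral_multc) measurable
   finally show "(\<integral>\<^sup>+z. ennreal (norm (P \<xi> z)) \<partial>(freq_sq ?M)) = S \<xi> * ennreal (cmod (f \<xi>))" .
  qed
  finally have eq: "(\<integral>\<^sup>+w. ennreal (norm (case w of (\<xi>, z) => P \<xi> z)) \<partial>(freq ?M \<Otimes>\<^sub>M (freq_sq ?M)))
   = (\<integral>\<^sup>+\<xi>. S \<xi> * ennreal (cmod (f \<xi>)) \<partial>freq ?M)" .
  have "(\<integral>\<^sup>+\<xi>. S \<xi> * ennreal (cmod (f \<xi>)) \<partial>freq ?M)^2 <= (\<integral>\<^sup>+\<xi>. (S \<xi>)^2 \<partial>freq ?M) * (\<integral>\<^sup>+\<xi>. (ennreal (cmod (f \<xi>)))^2 \<partial>freq ?M)"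
   by (rule Cauchy_Schwarz_nn_integral) measurable
  also have "... = (\<integral>\<^sup>+\<xi>. (S \<xi>)^2 \<partial>freq ?M) * sqn (freq ?M) f" by (simp add: sqn_def ennreal_power)
  also have "... < \<infinity>"
  proof -
   have "(\<integral>\<^sup>+\<xi>. (S \<xi>)^2 \<partial>freq ?M) < \<infinity>"
    using kern_sq_bound[OF \<rho> k fL fL fL] L2_sqn_finite[OF fL]
    unfolding S_def by (auto intro: le_less_trans simp: ennreal_mult_less_top)
   then show ?thesis using L2_sqn_finite[OF fL] by (simp add: ennreal_mult_less_top)
  qed
  finally have "(\<integral>\<^sup>+\<xi>. S \<xi> * ennreal (cmod (f \<xi>)) \<partial>freq ?M) < \<infinity>"
   by (cases "(\<integral>\<^sup>+\<xi>. S \<xi> * ennreal (cmod (f \<xi>)) \<partial>freq ?M) = \<top>")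
    (simp_all add: power2_eq_square ennreal_top_mult less_top)
  then show "(\<integral>\<^sup>+w. ennreal (norm (case w of (\<xi>, z) => P \<xi> z)) \<partial>(freq ?M \<Otimes>\<^sub>M (freq_sq ?M))) < \<infinity>"
   unfolding eq .
 qed
 define R where "R z = (LINT \<xi>|freq ?M. tri3 f f f \<xi> z * cnj (f \<xi>))" for z
 define Q where "Q = (LINT \<xi>|freq ?M. OpF ?M (\<lambda>\<xi> p q. \<kappa> p q) f f f \<xi> * cnj (f \<xi>))"
 have PR: "(LINT \<xi>|freq ?M. P \<xi> z) = \<kappa> (fst z) (snd z) * R z" for z
  unfolding P_def R_def mult.assoc by (rule LINT_cmult)
 have "Q = (LINT \<xi>|freq ?M. LINT z|(freq_sq ?M). P \<xi> z)"
  unfolding Q_def OpF_def P_def LINT_multc ..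
 also have "... = (LINT z|(freq_sq ?M). LINT \<xi>|freq ?M. P \<xi> z)"
  by (rule freq3.Fubini_integral[OF P_int, symmetric])
 also have "... = (LINT z|(freq_sq ?M). \<kappa> (fst z) (snd z) * R z)" unfolding PR ..
 finally have Q: "Q = (LINT z|(freq_sq ?M). \<kappa> (fst z) (snd z) * R z)" .
 have R_int: "integrable (freq_sq ?M) (\<lambda>z. \<kappa> (fst z) (snd z) * R z)"
  using freq3.integrable_snd[OF P_int] unfolding PR .
 define H where "H p = (LINT q|freq ?M. \<kappa> p q * R (p, q))" for p
 have QH: "Q = (LINT p|freq ?M. H p)"
 proof -
  have "integrable (freq_sq ?M) (\<lambda>(p, q). \<kappa> p q * R (p, q))" using R_int by (simp add: split_beta')
  from freq2.integral_fst[OF this] show ?thesis unfolding Q H_def by (simp add: split_beta')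
 qed
 have Hm: "H \<in> fmeas ?M"
  unfolding H_def[abs_def]
  by (rule freq.borel_measurable_lebesgue_integral) (use R_int in "auto simp: split_beta' dest: borel_measurable_integrable")
 have R_sym: "R (- p, q) = cnj (R (p, q))" if p: "p \<in> space (freq ?M)" and q: "q \<in> space (freq ?M)" for p q
 proof -
  note [measurable] = measurable_freq_const[OF p] measurable_freq_const[OF q] measurable_freq_const[OF space_freq_uminus[OF p]]
  define G where "G \<eta> = tri3 f f f \<eta> (- p, q) * cnj (f \<eta>)" for \<eta>
  have [measurable]: "G \<in> fmeas ?M" unfolding G_def[abs_def] tri3_def fst_conv snd_conv by measurable
  have "cnj (R (p, q)) = (LINT \<xi>|freq ?M. G (\<xi> - p))"
   unfolding R_def G_def tri3_def LINT_cnj[symmetric]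
   by (simp add: mult_ac diff_right_commute)
  also have "... = (LINT \<xi>|freq ?M. G \<xi>)" by (rule integral_translate[OF _ p]) measurable
  finally show ?thesis unfolding R_def G_def by simp
 qed
 have H_sym: "H (0 - p) = cnj (H p)" if p: "p \<in> space (freq ?M)" for p
  unfolding H_def LINT_cnj[symmetric]
  by (rule LINT_cong) (simp add: R_sym[OF p] sym)
 have "Q = (LINT p|freq ?M. H (0 - p))" unfolding QH by (rule integral_reflect_freq[OF Hm space_freq_zero, symmetric])
 also have "... = (LINT p|freq ?M. cnj (H p))" by (rule LINT_cong) (rule H_sym)
 also have "... = cnj Q" unfolding QH by simp
 finally have "Im Q = 0" by (simp add: complex_eq_iff)
 moreover have "inner (Op (\<lambda>\<xi> p q. \<i> * \<kappa> p q) u u u) u = Re (\<i> * Q)"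
 proof -
  have OpFi: "OpF ?M (\<lambda>\<xi> p q. \<i> * \<kappa> p q) f f f \<xi> = \<i> * OpF ?M (\<lambda>\<xi> p q. \<kappa> p q) f f f \<xi>" for \<xi>
   unfolding OpF_def mult.assoc by (rule LINT_cmult)
  have Om: "OpF ?M (\<lambda>\<xi> p q. \<kappa> p q) f f f \<in> fmeas ?M"
   by (rule OpF_measurable[OF k]) measurable
  have "(LINT \<xi>|freq ?M. fn (Op (\<lambda>\<xi> p q. \<i> * \<kappa> p q) u u u) \<xi> * cnj (fn u \<xi>))
   = (LINT \<xi>|freq ?M. \<i> * (OpF ?M (\<lambda>\<xi> p q. \<kappa> p q) f f f \<xi> * cnj (f \<xi>)))"
  proof (rule integral_cong_AE)
   show "AE \<xi> in freq ?M. fn (Op (\<lambda>\<xi> p q. \<i> * \<kappa> p q) u u u) \<xi> * cnj (fn u \<xi>) = \<i> * (OpF ?M (\<lambda>\<xi> p q. \<kappa> p q) f f f \<xi> * cnj (f \<xi>))"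
    using fn_Op[OF \<rho> kern_i[OF k], of u u u] unfolding f_def[symmetric]
    by eventually_elim (simp add: OpFi)
   show "(\<lambda>\<xi>. fn (Op (\<lambda>\<xi> p q. \<i> * \<kappa> p q) u u u) \<xi> * cnj (fn u \<xi>)) \<in> fmeas ?M" by measurable
   show "(\<lambda>\<xi>. \<i> * (OpF ?M (\<lambda>\<xi> p q. \<kappa> p q) f f f \<xi> * cnj (f \<xi>))) \<in> fmeas ?M" using Om by measurable
  qed
  then show ?thesis unfolding inner_l2_def Q_def by simp
 qed
 ultimately show ?thesis by simp
qed

subsection \<open>The cubic nonlinearity on the Fourier side\<close>

lemma integrable_translate:
 fixes f :: "real => complex"
 assumes f: "integrable (freq M) f" and a: "a \<in> space (freq M)"
 shows "integrable (freq M) (\<lambda>x. f (x - a))" "integrable (freq M) (\<lambda>x. f (a - x))"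
proof -
 note [measurable] = measurable_freq_const[OF a] borel_measurable_integrable[OF f]
 show "integrable (freq M) (\<lambda>x. f (x - a))"
  using integrable_distr_eq[of "\<lambda>x. x - a" "freq M" "freq M" f] f distr_freq_translate[OF a] by simp
 show "integrable (freq M) (\<lambda>x. f (a - x))"
  using integrable_distr_eq[of "\<lambda>x. a - x" "freq M" "freq M" f] f distr_freq_reflect[OF a] by simp
qed

text \<open>The inverse transform without normalisation, for which a convolution becomes a product
  with no constant.\<close>

definition EV :: "domain => (real => complex) => real => complex" where
 "EV M v x = (LINT \<xi>|freq M. v \<xi> * cis (x * \<xi>))"

lemma cis_freq_measurable: "(\<lambda>\<xi>. cis (x * \<xi>)) \<in> fmeas M"
 by (rule borel_measurable_freq) measurable

lemma cis_mult_measurable: "(\<lambda>\<xi>. x * \<xi>) \<in> fmeas M"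
 by (rule borel_measurable_freq) measurable

lemma conv_theorem:
 assumes v: "integrable (freq M) v" and u: "integrable (freq M) u"
 shows "EV M (\<lambda>\<xi>. LINT p|freq M. v (\<xi> - p) * u p) x = EV M v x * EV M u x"
  and "integrable (freq M) (\<lambda>\<xi>. LINT p|freq M. v (\<xi> - p) * u p)"
proof -
 have [measurable]: "v \<in> fmeas M" "u \<in> fmeas M" using v u by auto
 have [measurable]: "snd \<in> borel_measurable (freq_sq M)"
  using measurable_compose[OF measurable_snd[of "freq M" "freq M"] borel_measurable_freq[of "\<lambda>x. x" M]] by simp
 have int: "integrable (freq_sq M) (\<lambda>(p, \<xi>). v (\<xi> - p) * u p * cis (y * \<xi>))" for y
 proof (rule freq2.Fubini_integrable)
  show "(\<lambda>(p, \<xi>). v (\<xi> - p) * u p * cis (y * \<xi>)) \<in> borel_measurable (freq_sq M)" unfolding split_beta' by measurable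
  have "(LINT \<xi>|freq M. norm (case (p, \<xi>) of (p, \<xi>) => v (\<xi> - p) * u p * cis (y * \<xi>))) = (LINT \<xi>|freq M. cmod (v \<xi>)) * cmod (u p)"
   if p: "p \<in> space (freq M)" for p
  proof -
   have "(LINT \<xi>|freq M. complex_of_real (cmod (v (\<xi> - p)))) = (LINT \<xi>|freq M. complex_of_real (cmod (v \<xi>)))"
    by (rule integral_translate[OF _ p]) measurable
   then have "(LINT \<xi>|freq M. cmod (v (\<xi> - p))) = (LINT \<xi>|freq M. cmod (v \<xi>))" by simp
   then show ?thesis by (simp add: norm_mult)
  qed
  then have "integrable (freq M) (\<lambda>p. LINT \<xi>|freq M. norm (case (p, \<xi>) of (p, \<xi>) => v (\<xi> - p) * u p * cis (y * \<xi>)))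
   \<longleftrightarrow> integrable (freq M) (\<lambda>p. (LINT \<xi>|freq M. cmod (v \<xi>)) * cmod (u p))"
   by (intro Bochner_Integration.integrable_cong refl)
  then show "integrable (freq M) (\<lambda>p. LINT \<xi>|freq M. norm (case (p, \<xi>) of (p, \<xi>) => v (\<xi> - p) * u p * cis (y * \<xi>)))"
   using u by simp
  show "AE p in freq M. integrable (freq M) (\<lambda>\<xi>. case (p, \<xi>) of (p, \<xi>) => v (\<xi> - p) * u p * cis (y * \<xi>))"
  proof (rule AE_I2)
   fix p assume p: "p \<in> space (freq M)"
   show "integrable (freq M) (\<lambda>\<xi>. case (p, \<xi>) of (p, \<xi>) => v (\<xi> - p) * u p * cis (y * \<xi>))"
    unfolding prod.case
    by (intro integrable_cis integrable_multc integrable_translate(1)[OF v p] cis_mult_measurable)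
  qed
 qed
 have "EV M (\<lambda>\<xi>. LINT p|freq M. v (\<xi> - p) * u p) x = (LINT \<xi>|freq M. LINT p|freq M. v (\<xi> - p) * u p * cis (x * \<xi>))"
  unfolding EV_def by simp
 also have "... = (LINT p|freq M. LINT \<xi>|freq M. v (\<xi> - p) * u p * cis (x * \<xi>))"
  by (rule freq2.Fubini_integral[OF int])
 also have "... = (LINT p|freq M. EV M v x * (u p * cis (x * p)))"
 proof (rule LINT_cong)
  fix p assume p: "p \<in> space (freq M)"
  have [measurable]: "(\<lambda>\<eta>. v \<eta> * cis (x * \<eta>)) \<in> fmeas M"
   using cis_freq_measurable by measurable
  have "(LINT \<xi>|freq M. v (\<xi> - p) * u p * cis (x * \<xi>)) = (LINT \<xi>|freq M. (v (\<xi> - p) * cis (x * (\<xi> - p))) * (u p * cis (x * p)))"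
  proof (rule LINT_cong)
   fix \<xi>
   have "cis (x * \<xi>) = cis (x * (\<xi> - p)) * cis (x * p)" by (simp add: cis_mult algebra_simps)
   then show "v (\<xi> - p) * u p * cis (x * \<xi>) = (v (\<xi> - p) * cis (x * (\<xi> - p))) * (u p * cis (x * p))" by simp
  qed
  also have "... = (LINT \<xi>|freq M. v (\<xi> - p) * cis (x * (\<xi> - p))) * (u p * cis (x * p))"
   by (rule LINT_multc)
  also have "(LINT \<xi>|freq M. v (\<xi> - p) * cis (x * (\<xi> - p))) = EV M v x"
   unfolding EV_def by (rule integral_translate[OF _ p]) measurable
  finally show "(LINT \<xi>|freq M. v (\<xi> - p) * u p * cis (x * \<xi>)) = EV M v x * (u p * cis (x * p))" .
 qed
 also have "... = EV M v x * EV M u x" unfolding EV_def by simp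
 finally show "EV M (\<lambda>\<xi>. LINT p|freq M. v (\<xi> - p) * u p) x = EV M v x * EV M u x" .
 show "integrable (freq M) (\<lambda>\<xi>. LINT p|freq M. v (\<xi> - p) * u p)"
  using freq2.integrable_snd[OF int[of 0]] by (simp add: cis_zero)
qed

text \<open>The convolution theorem with the reflected conjugate as second factor. It writes the
  squared modulus, hence the factor |\<phi>|^2 of the cubic term, on the frequency side.\<close>

lemma corr_theorem:
 assumes v: "integrable (freq M) v"
 shows "EV M (\<lambda>p. LINT q|freq M. v q * cnj (v (q - p))) x = EV M v x * cnj (EV M v x)"
  and "integrable (freq M) (\<lambda>p. LINT q|freq M. v q * cnj (v (q - p)))"
proof -
 have v': "integrable (freq M) (\<lambda>p. cnj (v (0 - p)))"
  using integrable_translate(2)[OF v space_freq_zero] by (intro integrable_cnj)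
 have [measurable]: "v \<in> fmeas M" using v by auto
 have eq: "(LINT q|freq M. v (p - q) * cnj (v (0 - q))) = (LINT q|freq M. v q * cnj (v (q - p)))" if p: "p \<in> space (freq M)" for p
 proof -
  note [measurable] = measurable_freq_const[OF p]
  have "(LINT q|freq M. v (p - q) * cnj (v ((p - q) - p))) = (LINT q|freq M. v q * cnj (v (q - p)))"
   by (rule integral_reflect_freq[OF _ p]) measurable
  then show ?thesis by simp
 qed
 have "EV M (\<lambda>p. LINT q|freq M. v q * cnj (v (q - p))) x = EV M (\<lambda>p. LINT q|freq M. v (p - q) * cnj (v (0 - q))) x"
  unfolding EV_def by (rule LINT_cong) (simp add: eq[simplified])
 also have "... = EV M v x * EV M (\<lambda>q. cnj (v (0 - q))) x" by (rule conv_theorem(1)[OF v v'])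
 also have "EV M (\<lambda>q. cnj (v (0 - q))) x = cnj (EV M v x)"
 proof -
  have [measurable]: "(\<lambda>\<eta>. cnj (v \<eta> * cis (x * \<eta>))) \<in> fmeas M"
   using cis_freq_measurable by measurable
  have "EV M (\<lambda>q. cnj (v (0 - q))) x = (LINT q|freq M. cnj (v (0 - q) * cis (x * (0 - q))))"
   unfolding EV_def by (simp add: cis_cnj)
  also have "... = (LINT q|freq M. cnj (v q * cis (x * q)))"
   by (rule integral_reflect_freq[OF _ space_freq_zero]) measurable
  finally show ?thesis by (simp only: EV_def LINT_cnj)
 qed
 finally show "EV M (\<lambda>p. LINT q|freq M. v q * cnj (v (q - p))) x = EV M v x * cnj (EV M v x)" .
 have "integrable (freq M) (\<lambda>p. LINT q|freq M. v (p - q) * cnj (v (0 - q)))"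
  by (rule conv_theorem(2)[OF v v'])
 then show "integrable (freq M) (\<lambda>p. LINT q|freq M. v q * cnj (v (q - p)))"
  by (subst (asm) Bochner_Integration.integrable_cong[OF refl eq]) auto
qed

subsection \<open>Kernels of the modulated nonlinearity\<close>

definition weight :: "real => (real => real) => bool" where
 "weight C W \<longleftrightarrow> W \<in> borel_measurable borel \<and> (\<forall>\<xi>. 1 <= W \<xi>) \<and>
  (\<forall>\<xi> p q. W \<xi> <= C * (W (\<xi> - p) * W (\<xi> - p - q) * W (\<xi> - q)))"

text \<open>The factor 1/(2 \<pi>) is what two convolutions cost in the unitary normalisation. The
  quotient of the weights comes from representing functions by their weighted transforms, and I cuts
  off the three arguments as well as the result. The function \<phi> of the resonance value is a
  phase for the nonlinearity at one time and an increment of \<open>Phi\<close> for its integral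
  over an interval.\<close>

definition ker :: "(real => real) => (real => real) => (real => complex) => kernel" where
 "ker W I \<phi> \<xi> p q = \<i> * of_real (1 / (2 * pi) * (W \<xi> / (W (\<xi> - p) * W (\<xi> - p - q) * W (\<xi> - q)))
  * (I \<xi> * I (\<xi> - p) * I (\<xi> - p - q) * I (\<xi> - q))) * \<phi> (2 * (p * q))"

definition cut :: "nat => real => real" where "cut N = indicator {\<xi>. \<bar>\<xi>\<bar> <= real N}"

lemma cut_measurable [measurable]: "cut N \<in> borel_measurable borel"
 unfolding cut_def by measurable

lemma weight_C_nonneg: "weight C W ==> 0 <= C"
proof -
 assume W: "weight C W"
 then have "1 <= W 0" "W 0 <= C * (W (0 - 0) * W (0 - 0 - 0) * W (0 - 0))" unfolding weight_def by blast+
 moreover have "0 < W (0 - 0) * W (0 - 0 - 0) * W (0 - 0)" using \<open>1 <= W 0\<close> by simp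
 ultimately show ?thesis by (smt (verit) mult_less_0_iff)
qed

text \<open>The decay in p q may come from \<phi>, through irregularity, or from the cutoff, which
  confines p and q. The hypothesis on the product of both covers the two cases.\<close>

lemma kern_ker:
 assumes W: "weight C W" and I: "I \<in> borel_measurable borel" "\<And>\<xi>. 0 <= I \<xi>" "\<And>\<xi>. I \<xi> <= 1"
  and \<phi>: "\<phi> \<in> borel_measurable borel" and A: "0 <= A"
  and bound: "\<And>\<xi> p q. I (\<xi> - p) * I (\<xi> - p - q) * I (\<xi> - q) * cmod (\<phi> (2 * (p * q))) <= A * kap \<rho> p q"
 shows "kern \<rho> (C * A) (ker W I \<phi>)"
 unfolding kern_def
proof (intro conjI allI)
 have [measurable]: "W \<in> borel_measurable borel" using W by (simp add: weight_def)
 note [measurable] = I(1) \<phi>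
 show "(\<lambda>w. ker W I \<phi> (fst w) (fst (snd w)) (snd (snd w))) \<in> borel_measurable (borel \<Otimes>\<^sub>M (borel \<Otimes>\<^sub>M borel))"
  unfolding ker_def by measurable
 have C: "0 <= C" by (rule weight_C_nonneg[OF W])
 show "0 <= C * A" using A C by simp
 fix \<xi> p q
 have W1: "1 <= W x" for x using W by (simp add: weight_def)
 have W0: "0 < W x" for x using W1[of x] by linarith
 have r: "W \<xi> / (W (\<xi> - p) * W (\<xi> - p - q) * W (\<xi> - q)) <= C"
  using W W0 unfolding weight_def by (subst pos_divide_le_eq) auto
 have "1 * 1 <= 2 * pi" using pi_gt3 by (intro mult_mono) auto
 then have pi1: "1 / (2 * pi) <= 1" by simp
 have "cmod (ker W I \<phi> \<xi> p q) = (1 / (2 * pi) * (W \<xi> / (W (\<xi> - p) * W (\<xi> - p - q) * W (\<xi> - q)))) * I \<xi>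
   * (I (\<xi> - p) * I (\<xi> - p - q) * I (\<xi> - q) * cmod (\<phi> (2 * (p * q))))"
  unfolding ker_def norm_mult norm_of_real
  using I(2) W0 by (simp add: abs_mult abs_of_pos less_imp_le)
 also have "... <= (1 * C) * 1 * (A * kap \<rho> p q)"
 proof (rule mult_mono[OF mult_mono[OF mult_mono[OF pi1 r] I(3)] bound])
  show q0: "0 <= W \<xi> / (W (\<xi> - p) * W (\<xi> - p - q) * W (\<xi> - q))" using W0 by (simp add: less_imp_le)
  show "0 <= I (\<xi> - p) * I (\<xi> - p - q) * I (\<xi> - q) * cmod (\<phi> (2 * (p * q)))" using I(2) by simp
 qed (use C I(2) in auto)
 finally show "cmod (ker W I \<phi> \<xi> p q) <= C * A * kap \<rho> p q" by simp
qed

lemma kern_ker_decay: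
 assumes W: "weight C W" and I: "I \<in> borel_measurable borel" "\<And>\<xi>. 0 <= I \<xi>" "\<And>\<xi>. I \<xi> <= 1"
  and \<phi>: "\<phi> \<in> borel_measurable borel" and A: "0 <= A"
  and bound: "\<And>a. cmod (\<phi> a) <= A * (1 + \<bar>a\<bar>) powr (- \<rho>)"
 shows "kern \<rho> (C * A) (ker W I \<phi>)"
proof (rule kern_ker[OF W I \<phi> A])
 fix \<xi> p q
 have "I (\<xi> - p) * I (\<xi> - p - q) * I (\<xi> - q) * cmod (\<phi> (2 * (p * q))) <= (1 * 1 * 1) * cmod (\<phi> (2 * (p * q)))"
  using I(2,3) by (intro mult_right_mono mult_mono) auto
 also have "... <= A * (1 + \<bar>2 * (p * q)\<bar>) powr (- \<rho>)" using bound by simp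
 finally show "I (\<xi> - p) * I (\<xi> - p - q) * I (\<xi> - q) * cmod (\<phi> (2 * (p * q))) <= A * kap \<rho> p q"
  by (simp add: kap_def abs_mult)
qed

text \<open>Bounds |2 p q| under the cutoff: p and q are differences of two frequencies among \<xi>
  - p, \<xi> - p - q and \<xi> - q, so both are at most 2 N in modulus.\<close>

definition res :: "nat => real" where "res N = 8 * (real N)^2"

lemma cut_product_le:
 assumes \<rho>: "\<rho> > 0"
 shows "cut N (\<xi> - p) * cut N (\<xi> - p - q) * cut N (\<xi> - q) <= (1 + res N) powr \<rho> * kap \<rho> p q"
  and "cut N (\<xi> - p) * cut N (\<xi> - p - q) * cut N (\<xi> - q) \<noteq> 0 ==> \<bar>2 * (p * q)\<bar> <= res N"
proof -
 show pq: "\<bar>2 * (p * q)\<bar> <= res N" if "cut N (\<xi> - p) * cut N (\<xi> - p - q) * cut N (\<xi> - q) \<noteq> 0"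
 proof -
  have "\<bar>\<xi> - p\<bar> <= real N" "\<bar>\<xi> - p - q\<bar> <= real N" "\<bar>\<xi> - q\<bar> <= real N"
   using that by (auto simp: cut_def indicator_def split: if_splits)
  then have "\<bar>p\<bar> <= 2 * real N" "\<bar>q\<bar> <= 2 * real N" by linarith+
  then have "\<bar>p\<bar> * \<bar>q\<bar> <= (2 * real N) * (2 * real N)" by (intro mult_mono) auto
  then show ?thesis by (simp add: res_def abs_mult power2_eq_square)
 qed
 show "cut N (\<xi> - p) * cut N (\<xi> - p - q) * cut N (\<xi> - q) <= (1 + res N) powr \<rho> * kap \<rho> p q"
 proof (cases "cut N (\<xi> - p) * cut N (\<xi> - p - q) * cut N (\<xi> - q) = 0")
  case True
  then show ?thesis using kap_pos[of \<rho> p q] by (simp only:) (simp add: less_imp_le)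
 next
  case False
  have "(1 + res N) powr (- \<rho>) <= kap \<rho> p q"
   unfolding kap_def using pq[OF False] \<rho> by (intro powr_mono2') (auto simp: abs_mult add_pos_nonneg)
  moreover have "0 < 1 + res N" by (simp add: res_def add_pos_nonneg)
  ultimately have "1 <= (1 + res N) powr \<rho> * kap \<rho> p q"
   by (simp add: powr_minus field_simps)
  then show ?thesis using False by (auto simp: cut_def indicator_def split: if_splits)
 qed
qed

lemma kern_ker_cut:
 assumes W: "weight C W" and \<rho>: "\<rho> > 0" and \<phi>: "\<phi> \<in> borel_measurable borel" and A: "0 <= A"
  and bound: "\<And>a. \<bar>a\<bar> <= res N ==> cmod (\<phi> a) <= A"
 shows "kern \<rho> (C * (A * (1 + res N) powr \<rho>)) (ker W (cut N) \<phi>)"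
proof (rule kern_ker[OF W cut_measurable _ _ \<phi>])
 fix \<xi> p q
 let ?c = "cut N (\<xi> - p) * cut N (\<xi> - p - q) * cut N (\<xi> - q)"
 have c0: "0 <= ?c" by (simp add: cut_def)
 have "?c * cmod (\<phi> (2 * (p * q))) <= ?c * A"
 proof (cases "?c = 0")
  case False
  show ?thesis by (rule mult_left_mono[OF bound[OF cut_product_le(2)[OF \<rho> False]] c0])
 qed (simp only: mult_zero_left order_refl)
 also have "... <= ((1 + res N) powr \<rho> * kap \<rho> p q) * A"
  by (rule mult_right_mono[OF cut_product_le(1)[OF \<rho>] A])
 finally show "?c * cmod (\<phi> (2 * (p * q))) <= A * (1 + res N) powr \<rho> * kap \<rho> p q" by (simp add: mult_ac)
qed (use A in "auto simp: cut_def indicator_def")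

lemma ker_add_scale: "ker W I (\<lambda>a. \<phi> a + of_real c * \<psi> a) \<xi> p q = ker W I \<phi> \<xi> p q + of_real c * ker W I \<psi> \<xi> p q"
 unfolding ker_def by (simp only: distrib_left mult.left_commute)

lemma weight_1: "weight 1 (\<lambda>\<xi>. 1)"
 by (simp add: weight_def)

lemma EV_Ei: "Ei M v x = c2pi * EV M v x"
 by (simp add: Ei_def EV_def)

lemma c2pi_sq: "c2pi * c2pi = of_real (1 / (2 * pi))"
 using complex_norm_square[of c2pi] norm_c2pi by (metis cnj_c2pi of_real_power)

text \<open>The projected function is \<open>Ei M v\<close> with v integrable, so its cube can be
  computed pointwise by the convolution theorems. The result is again of the form
  \<open>Ei M h\<close> with h integrable and square integrable, which also shows that the cube lies
  in L^2 before the outer projection is applied.\<close>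

lemma cubic_trunc_fourier:
 fixes \<rho> :: real
 assumes f: "f \<in> L2 (phys M)" and \<rho>: "\<rho> > 1/2"
 shows "cubic_trunc M N f \<in> L2 (phys M)"
  and "AE \<xi> in freq M. fourier M (cubic_trunc M N f) \<xi> = OpF M (ker (\<lambda>\<xi>. 1) (cut N) (\<lambda>a. 1)) (fourier M f) (fourier M f) (fourier M f) \<xi>"
proof -
 define F where "F = fourier M f"
 have F: "F \<in> L2 (freq M)" unfolding F_def by (rule fourier_L2[OF f])
 define v where "v = tr N F"
 have v1: "integrable (freq M) v" unfolding v_def by (rule tr_integrable[OF F])
 have v2: "v \<in> L2 (freq M)" unfolding v_def by (rule tr_L2[OF F])
 have [measurable]: "v \<in> fmeas M" using v1 by auto
 define k where "k = ker (\<lambda>\<xi>. 1) (cut N) (\<lambda>a. 1)"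
 \<comment> \<open>The kernel without the cutoff of the result; the outer projection restores it at
   the end.\<close>
 define k1 where "k1 \<xi> p q = \<i> * of_real (1 / (2 * pi) * (cut N (\<xi> - p) * cut N (\<xi> - p - q) * cut N (\<xi> - q)))" for \<xi> p q
 have k: "kern \<rho> (1 * (1 * (1 + res N) powr \<rho>)) k"
  unfolding k_def by (rule kern_ker_cut[OF weight_1]) (use \<rho> in auto)
 have k1: "kern \<rho> (1 * (1 * (1 + res N) powr \<rho>)) k1"
 proof -
  have [measurable]: "(\<lambda>w. k1 (fst w) (fst (snd w)) (snd (snd w))) \<in> borel_measurable (borel \<Otimes>\<^sub>M (borel \<Otimes>\<^sub>M borel))"
   unfolding k1_def by measurable
  have "cmod (k1 \<xi> p q) <= 1 * (1 * (1 + res N) powr \<rho>) * kap \<rho> p q" for \<xi> p q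
  proof -
   have "1 / (2 * pi) <= 1" using pi_gt3 by simp
   then have "cmod (k1 \<xi> p q) <= 1 * (cut N (\<xi> - p) * cut N (\<xi> - p - q) * cut N (\<xi> - q))"
    unfolding k1_def norm_mult norm_of_real by (simp add: abs_mult cut_def indicator_def)
   also have "... <= (1 + res N) powr \<rho> * kap \<rho> p q"
    unfolding mult_1 using \<rho> by (intro cut_product_le(1)) simp
   finally show ?thesis by simp
  qed
  then show ?thesis unfolding kern_def by simp
 qed
 define u where "u p = (LINT q|freq M. v q * cnj (v (q - p)))" for p
 have u1: "integrable (freq M) u" unfolding u_def by (rule corr_theorem(2)[OF v1])
 define w where "w \<xi> = (LINT p|freq M. v (\<xi> - p) * u p)" for \<xi>
 have w1: "integrable (freq M) w" unfolding w_def by (rule conv_theorem(2)[OF v1 u1])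
 define h where "h = OpF M k1 F F F"
 have h2: "h \<in> L2 (freq M)" unfolding h_def by (rule OpF_L2[OF \<rho> k1 F F F])
 have hw: "AE \<xi> in freq M. h \<xi> = \<i> * (c2pi * c2pi) * w \<xi>"
  using kern_integrable[OF \<rho> k1 F F F] AE_space
 proof eventually_elim
  case (elim \<xi>)
  note \<xi> = elim(2)
  note [measurable] = measurable_freq_const[OF \<xi>]
  have eq: "k1 \<xi> p q * tri3 F F F \<xi> (p, q) = \<i> * (c2pi * c2pi) * (v (\<xi> - p) * (v (\<xi> - q) * cnj (v (\<xi> - q - p))))" for p q
  proof -
   have "\<xi> - p - q = \<xi> - q - p" by simp
   note e = this
   show ?thesis unfolding k1_def tri3_def v_def tr_def c2pi_sq cut_def fst_conv snd_conv e
    by (auto simp: indicator_def)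
  qed
  have "integrable (freq_sq M) (\<lambda>(p, q). k1 \<xi> p q * tri3 F F F \<xi> (p, q))"
   using elim(1) by (simp add: split_beta')
  from freq2.integral_fst[OF this]
  have "h \<xi> = (LINT p|freq M. LINT q|freq M. k1 \<xi> p q * tri3 F F F \<xi> (p, q))"
   unfolding h_def OpF_def by (simp add: split_beta')
  also have "... = (LINT p|freq M. \<i> * (c2pi * c2pi) * (v (\<xi> - p) * u p))"
  proof (rule LINT_cong)
   fix p assume p: "p \<in> space (freq M)"
   note [measurable] = measurable_freq_const[OF p]
   have "(LINT q|freq M. v (\<xi> - q) * cnj (v (\<xi> - q - p))) = u p"
    unfolding u_def by (rule integral_reflect_freq[OF _ \<xi>]) measurable
   then show "(LINT q|freq M. k1 \<xi> p q * tri3 F F F \<xi> (p, q)) = \<i> * (c2pi * c2pi) * (v (\<xi> - p) * u p)"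
    unfolding eq by simp
  qed
  also have "... = \<i> * (c2pi * c2pi) * w \<xi>" unfolding w_def by (rule LINT_cmult)
  finally show ?case .
 qed
 have h1: "integrable (freq M) h"
 proof -
  have "integrable (freq M) (\<lambda>\<xi>. \<i> * (c2pi * c2pi) * w \<xi>)" using w1 by simp
  then show ?thesis using hw L2_measurable[OF h2] by (subst integrable_cong_AE[of h _ "\<lambda>\<xi>. \<i> * (c2pi * c2pi) * w \<xi>"]) auto
 qed
 have EVh: "EV M h x = \<i> * (c2pi * c2pi) * EV M w x" for x
 proof -
  have [measurable]: "h \<in> fmeas M" "w \<in> fmeas M" using h1 w1 by auto
  have "EV M h x = (LINT \<xi>|freq M. \<i> * (c2pi * c2pi) * (w \<xi> * cis (x * \<xi>)))"
   unfolding EV_def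
  proof (rule integral_cong_AE)
   show "AE \<xi> in freq M. h \<xi> * cis (x * \<xi>) = \<i> * (c2pi * c2pi) * (w \<xi> * cis (x * \<xi>))" using hw by eventually_elim simp
  qed (use cis_freq_measurable[of x M] in measurable)
  then show ?thesis unfolding EV_def by simp
 qed
 have cub: "cubic (Ei M v) x = Ei M h x" for x
 proof -
  have "EV M w x = EV M v x * (EV M v x * cnj (EV M v x))"
   unfolding w_def conv_theorem(1)[OF v1 u1] unfolding u_def corr_theorem(1)[OF v1] ..
  then show ?thesis unfolding cubic_def EV_Ei EVh complex_norm_square by (simp add: mult_ac)
 qed
 define g where "g = Pi_proj M N f"
 have ind: "(indicator {\<xi>. \<bar>\<xi>\<bar> <= real N} :: real => complex) \<in> fmeas M"
  "cmod (indicator {\<xi>. \<bar>\<xi>\<bar> <= real N} \<xi>) <= 1" for \<xi>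
  by (rule borel_measurable_freq, measurable) (simp add: indicator_def)
 note g' = fourier_mult[OF f ind, folded Pi_proj_def, folded g_def]
 have Ev: "Ei M v \<in> L2 (phys M)" "AE \<xi> in freq M. fourier M (Ei M v) \<xi> = v \<xi>"
  by (rule Ei_L2[OF v1 v2], rule fourier_Ei[OF v1 v2])
 have "AE \<xi> in freq M. fourier M g \<xi> = fourier M (Ei M v) \<xi>"
  using g'(2) Ev(2) by eventually_elim (simp add: v_def tr_def F_def)
 then have gE: "AE x in phys M. g x = Ei M v x" using fourier_eq_iff[OF g'(1) Ev(1)] by simp
 have Eh: "Ei M h \<in> L2 (phys M)" "AE \<xi> in freq M. fourier M (Ei M h) \<xi> = h \<xi>"
  by (rule Ei_L2[OF h1 h2], rule fourier_Ei[OF h1 h2])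
 have cg: "AE x in phys M. Ei M h x = cubic g x"
  using gE by eventually_elim (simp add: cub[symmetric] cubic_def)
 have "cubic g \<in> borel_measurable (phys M)"
  unfolding cubic_def using L2_measurable[OF g'(1)] by measurable
 then have cgL: "cubic g \<in> L2 (phys M)" by (rule L2_cong_AE[OF Eh(1) _ cg])
 have Fcg: "AE \<xi> in freq M. fourier M (cubic g) \<xi> = h \<xi>"
  using fourier_eq_iff[OF Eh(1) cgL] cg Eh(2) by auto
 have ct: "cubic_trunc M N f = fourier_mult M (indicator {\<xi>. \<bar>\<xi>\<bar> <= real N}) (cubic g)"
  unfolding cubic_trunc_def g_def Pi_proj_def ..
 show "cubic_trunc M N f \<in> L2 (phys M)" unfolding ct by (rule fourier_mult(1)[OF cgL ind])
 have "AE \<xi> in freq M. fourier M (cubic_trunc M N f) \<xi> = indicator {\<xi>. \<bar>\<xi>\<bar> <= real N} \<xi> * h \<xi>"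
  unfolding ct using fourier_mult(2)[OF cgL ind] Fcg by eventually_elim simp
 moreover have "indicator {\<xi>. \<bar>\<xi>\<bar> <= real N} \<xi> * h \<xi> = OpF M k F F F \<xi>" for \<xi>
  unfolding h_def OpF_def LINT_cmult[symmetric]
  by (rule LINT_cong) (simp add: k_def ker_def k1_def cut_def indicator_def)
 ultimately show "AE \<xi> in freq M. fourier M (cubic_trunc M N f) \<xi> = OpF M (ker (\<lambda>\<xi>. 1) (cut N) (\<lambda>a. 1)) (fourier M f) (fourier M f) (fourier M f) \<xi>"
  unfolding k_def F_def by simp
qed

subsection \<open>Modulated phases\<close>

lemma cis_lipschitz: "cmod (cis x - cis y) <= \<bar>x - y\<bar>"
proof -
 have "cis x - cis y = cis y * (cis (x - y) - 1)" by (simp add: cis_mult algebra_simps)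
 then have "cmod (cis x - cis y) = cmod (iexp (x - y) - 1)" by (simp add: norm_mult cis_conv_exp)
 also have "... <= \<bar>x - y\<bar>" using iexp_approx1[of "x - y" 0] by simp
 finally show ?thesis .
qed

lemma Phi_cis: "Phi w t a = integral {0..t} (\<lambda>r. cis (a * w r))"
 by (simp add: Phi_def cis_conv_exp)

lemma phase_continuous:
 assumes "continuous_on S w" shows "continuous_on S (\<lambda>r. cis (a * w r))"
 using assms by (intro continuous_intros)

text \<open>Irregularity on [0,T] in the form in which it is used: any admissible constant K stands
  for the norm, the decay in a is on the right-hand side, and s = t is included.\<close>

locale modulation =
 fixes \<rho> \<gamma> T K :: real and w :: "real => real"
 assumes \<rho>: "\<rho> > 1/2" and \<gamma>: "\<gamma> > 1/2" and T: "T >= 0" and K: "K >= 0"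
  and w: "continuous_on {0..T} w"
  and decay: "\<And>a s t. 0 <= s ==> s <= t ==> t <= T ==>
   cmod (Phi w t a - Phi w s a) <= K * (t - s) powr \<gamma> * (1 + \<bar>a\<bar>) powr (- \<rho>)"
begin

lemma phase_integrable: "0 <= s ==> t <= T ==> (\<lambda>r. cis (a * w r)) integrable_on {s..t}"
 by (intro integrable_continuous_interval phase_continuous continuous_on_subset[OF w]) auto

lemma Phi_diff:
 assumes "0 <= s" "s <= t" "t <= T"
 shows "Phi w t a - Phi w s a = integral {s..t} (\<lambda>r. cis (a * w r))"
 unfolding Phi_cis
 using Henstock_Kurzweil_Integration.integral_combine[of 0 s t "\<lambda>r. cis (a * w r)"] assms phase_integrable[of 0 t a]
 by (simp add: algebra_simps)

lemma Phi_measurable: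
 assumes t: "0 <= t" "t <= T" shows "Phi w t \<in> borel_measurable borel"
proof -
 have "compact (w ` {0..t})" using t w by (intro compact_continuous_image continuous_on_subset[OF w]) auto
 then obtain B where B: "\<And>r. r \<in> {0..t} ==> \<bar>w r\<bar> <= B"
  using compact_imp_bounded bounded_iff by (metis imageI real_norm_def)
 have B0: "0 <= B" using B[of 0] t by (simp add: order_trans[OF abs_ge_zero])
 have L: "cmod (Phi w t a - Phi w t b) <= B * t * \<bar>a - b\<bar>" for a b
 proof -
  have "Phi w t a - Phi w t b = integral {0..t} (\<lambda>r. cis (a * w r) - cis (b * w r))"
   unfolding Phi_cis using t phase_integrable by (simp add: Henstock_Kurzweil_Integration.integral_diff)
  also have "cmod ... <= (\<bar>a - b\<bar> * B) * (t - 0)"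
  proof (rule integral_bound)
   show "continuous_on {0..t} (\<lambda>r. cis (a * w r) - cis (b * w r))"
    using t by (intro continuous_on_diff phase_continuous continuous_on_subset[OF w]) auto
   fix r assume "r \<in> {0..t}"
   then have "\<bar>a - b\<bar> * \<bar>w r\<bar> <= \<bar>a - b\<bar> * B" using B by (intro mult_left_mono) auto
   moreover have "cmod (cis (a * w r) - cis (b * w r)) <= \<bar>a - b\<bar> * \<bar>w r\<bar>"
    using cis_lipschitz[of "a * w r" "b * w r"] by (simp add: abs_mult left_diff_distrib[symmetric])
   ultimately show "cmod (cis (a * w r) - cis (b * w r)) <= \<bar>a - b\<bar> * B" by linarith
  qed (use t in auto)
  finally show ?thesis by (simp add: mult_ac)
 qed
 have "(B * t)-lipschitz_on UNIV (Phi w t)"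
  using L B0 t by (intro lipschitz_onI) (auto simp: dist_norm)
 then show ?thesis by (intro borel_measurable_continuous_onI lipschitz_on_continuous_on)
qed

text \<open>Uniform continuity of w gives a d that serves all a, at the price of the factor |a|.
  Under the cutoff |a| is at most \<open>res N\<close>, and this becomes the first-order
  approximation required by \<open>X_F\<close>.\<close>

lemma Phi_approx:
 assumes e: "e > 0"
 shows "\<exists>d>0. \<forall>s t a. 0 <= s --> s <= t --> t <= T --> t - s < d -->
  cmod (Phi w t a - Phi w s a - of_real (t - s) * cis (a * w s)) <= (t - s) * (\<bar>a\<bar> * e)"
proof -
 have "uniformly_continuous_on {0..T} w" using w by (intro compact_uniformly_continuous) auto
 then obtain d where d: "d > 0" "\<And>r s. r \<in> {0..T} ==> s \<in> {0..T} ==> dist s r < d ==> dist (w s) (w r) < e"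
  unfolding uniformly_continuous_on_def using e by metis
 show ?thesis
 proof (intro exI[of _ d] conjI allI impI d)
  fix s t a assume st: "0 <= s" "s <= t" "t <= T" "t - s < d"
  have "Phi w t a - Phi w s a - of_real (t - s) * cis (a * w s) = integral {s..t} (\<lambda>r. cis (a * w r) - cis (a * w s))"
   by (subst Henstock_Kurzweil_Integration.integral_diff)
    (use st phase_integrable in "auto simp: Phi_diff scaleR_conv_of_real")
  also have "cmod ... <= (\<bar>a\<bar> * e) * (t - s)"
  proof (rule integral_bound)
   show "continuous_on {s..t} (\<lambda>r. cis (a * w r) - cis (a * w s))"
    using st by (intro continuous_on_diff continuous_on_const phase_continuous continuous_on_subset[OF w]) auto
   fix r assume r: "r \<in> {s..t}"
   have "\<bar>a\<bar> * \<bar>w r - w s\<bar> <= \<bar>a\<bar> * e"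
    using d(2)[of s r] r st by (intro mult_left_mono) (auto simp: dist_real_def)
   moreover have "cmod (cis (a * w r) - cis (a * w s)) <= \<bar>a\<bar> * \<bar>w r - w s\<bar>"
    using cis_lipschitz[of "a * w r" "a * w s"] by (simp add: abs_mult right_diff_distrib[symmetric])
   ultimately show "cmod (cis (a * w r) - cis (a * w s)) <= \<bar>a\<bar> * e" by linarith
  qed (use st in auto)
  finally show "cmod (Phi w t a - Phi w s a - of_real (t - s) * cis (a * w s)) <= (t - s) * (\<bar>a\<bar> * e)"
   by (simp only: mult.commute)
 qed
qed

end

lemma Phi_minus: "Phi w t (- a) = cnj (Phi w t a)"
 unfolding Phi_cis by (simp add: integral_cnj cis_cnj)

lemma irregular_decay:
 assumes "irregular \<rho> \<gamma> T w"
 obtains K where "K >= 0" "\<And>a s t. 0 <= s ==> s <= t ==> t <= T ==>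
   cmod (Phi w t a - Phi w s a) <= K * (t - s) powr \<gamma> * (1 + \<bar>a\<bar>) powr (- \<rho>)"
proof -
 define K where "K = enn2real (irregularity_norm \<rho> \<gamma> T w)"
 have K: "irregularity_norm \<rho> \<gamma> T w = ennreal K" "0 <= K"
  using assms unfolding irregular_def K_def by (simp_all add: less_top)
 show ?thesis
 proof (rule that[OF K(2)])
  fix a s t :: real assume st: "0 <= s" "s <= t" "t <= T"
  show "cmod (Phi w t a - Phi w s a) <= K * (t - s) powr \<gamma> * (1 + \<bar>a\<bar>) powr (- \<rho>)"
  proof (cases "s = t")
   case False
   then have d: "0 < (t - s) powr \<gamma>" using st by simp
   have p: "0 < (1 + \<bar>a\<bar>) powr \<rho>" by (simp add: add_pos_nonneg)
   have "ennreal ((1 + \<bar>a\<bar>) powr \<rho> * (cmod (Phi w t a - Phi w s a) / \<bar>t - s\<bar> powr \<gamma>)) <= irregularity_norm \<rho> \<gamma> T w"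
    unfolding irregularity_norm_def
    by (rule SUP_upper2[of a], simp, rule SUP_upper2[of "(s, t)"]) (use st False in auto)
   then have "(1 + \<bar>a\<bar>) powr \<rho> * (cmod (Phi w t a - Phi w s a) / (t - s) powr \<gamma>) <= K"
    unfolding K(1) using K(2) st by simp
   then show ?thesis using d p by (simp add: powr_minus field_simps)
  qed (use K in simp)
 qed
qed

subsection \<open>The modulated nonlinearity as a Young integrand\<close>

definition Fk :: "(real => real) => (real => real) => nat => real => 'm::l2dom l2 => 'm l2 => 'm l2 => 'm l2" where
 "Fk w W N r = Op (ker W (cut N) (\<lambda>a. cis (a * w r)))"

text \<open>The decay of the phases is known on \<open>[0,T]\<close> only, but trilinearity is required for all times; hence the value \<open>0\<close> elsewhere.\<close>

definition Xk :: "real => (real => real) => (real => real) => nat => real => real => 'm::l2dom l2 => 'm l2 => 'm l2 => 'm l2" where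
 "Xk T w W N s t u v x =
  (if 0 <= s \<and> s <= t \<and> t <= T then Op (ker W (cut N) (\<lambda>a. Phi w t a - Phi w s a)) u v x else 0)"

definition XXk :: "(real => real) => (real => real) => real => real => 'm::l2dom l2 => 'm l2 => 'm l2 => 'm l2" where
 "XXk w W s t = Op (ker W (\<lambda>\<xi>. 1) (\<lambda>a. Phi w t a - Phi w s a))"

lemma Op_ker_add_scale:
 fixes u v x :: "'m::l2dom l2"
 assumes "\<rho> > 1/2" "kern \<rho> A (ker W I \<phi>)" "kern \<rho> A' (ker W I \<psi>)"
 shows "Op (ker W I (\<lambda>a. \<phi> a + of_real c * \<psi> a)) u v x = Op (ker W I \<phi>) u v x + c *\<^sub>R Op (ker W I \<psi>) u v x"
proof -
 have "ker W I (\<lambda>a. \<phi> a + of_real c * \<psi> a) = (\<lambda>\<xi> p q. ker W I \<phi> \<xi> p q + of_real c * ker W I \<psi> \<xi> p q)"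
  by (intro ext) (rule ker_add_scale)
 then show ?thesis using Op_kernel_add_scale[OF assms] by simp
qed

lemma trilinear_bounded_tendsto:
 fixes B :: "'v::real_normed_vector => 'v => 'v => 'v"
 assumes add: "\<And>f f' g h. B (f + f') g h = B f g h + B f' g h"
  "\<And>f g g' h. B f (g + g') h = B f g h + B f g' h"
  "\<And>f g h h'. B f g (h + h') = B f g h + B f g h'"
  and bound: "\<And>f g h. norm (B f g h) <= A * (norm f * norm g * norm h)"
  and lim: "f \<longlonglongrightarrow> f'" "g \<longlonglongrightarrow> g'" "h \<longlonglongrightarrow> h'"
 shows "(\<lambda>n. B (f n) (g n) (h n)) \<longlonglongrightarrow> B f' g' h'"
proof -
 define D where "D n = A * (norm (f n - f') * norm (g n) * norm (h n)) + A * (norm f' * norm (g n - g') * norm (h n))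
  + A * (norm f' * norm g' * norm (h n - h'))" for n
 have "norm (B (f n) (g n) (h n) - B f' g' h') <= D n" for n
  unfolding trilinear_diff[of B, OF add] D_def
  by (intro order_trans[OF norm_triangle_ineq] add_mono bound)
 moreover from lim have "D \<longlonglongrightarrow> A * (norm (f' - f') * norm g' * norm h') + A * (norm f' * norm (g' - g') * norm h')
  + A * (norm f' * norm g' * norm (h' - h'))"
  unfolding D_def by (intro tendsto_intros lim)
 then have "D \<longlonglongrightarrow> 0" by simp
 ultimately have "(\<lambda>n. B (f n) (g n) (h n) - B f' g' h') \<longlonglongrightarrow> 0" by (rule LIMSEQ_0_le)
 then show ?thesis by (simp add: LIM_zero_iff)
qed

lemma bmult_of_real:
 assumes [measurable]: "b \<in> borel_measurable borel" and "\<And>\<xi>. \<bar>b \<xi>\<bar> <= B"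
 shows "bmult TYPE('m::l2dom) B (\<lambda>\<xi>. of_real (b \<xi>))"
 unfolding bmult_def using assms(2) by (auto intro!: borel_measurable_freq)

abbreviation ccut :: "nat => real => complex" where
 "ccut N \<xi> \<equiv> of_real (cut N \<xi>)"

lemma cut_tendsto:
 fixes u :: "'m::l2dom l2"
 shows "(\<lambda>N. mult (ccut N) u) \<longlonglongrightarrow> u"
proof -
 have 1: "bmult TYPE('m) 1 (\<lambda>\<xi>. of_real (1 :: real))" by (rule bmult_of_real) auto
 have "(\<lambda>N. mult (ccut N) u) \<longlonglongrightarrow> mult (\<lambda>\<xi>. of_real (1 :: real)) u"
 proof (rule mult_tendsto[OF _ 1])
  show "bmult TYPE('m) 1 (ccut N)" for N
   by (rule bmult_of_real) (auto simp: cut_def indicator_def)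
  fix \<xi> :: real
  have "eventually (\<lambda>N. cut N \<xi> = 1) sequentially"
   using eventually_ge_at_top[of "nat \<lceil>\<bar>\<xi>\<bar>\<rceil>"] by eventually_elim (auto simp: cut_def nat_ceiling_le_eq)
  then show "(\<lambda>N. complex_of_real (cut N \<xi>)) \<longlonglongrightarrow> of_real 1"
   by (intro tendsto_eventually) (auto elim: eventually_mono)
 qed
 then show ?thesis using mult_one[OF 1, of u] by simp
qed

context modulation
begin

lemma increment_measurable: "0 <= s ==> s <= t ==> t <= T ==> (\<lambda>a. Phi w t a - Phi w s a) \<in> borel_measurable borel"
 using Phi_measurable[of s] Phi_measurable[of t] by measurable

lemma phase_measurable: "(\<lambda>a. cis (a * x)) \<in> borel_measurable borel"
 by measurable

lemma kern_Xk:
 assumes W: "weight C W" and st: "0 <= s" "s <= t" "t <= T"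
 shows "kern \<rho> (C * (K * (t - s) powr \<gamma>)) (ker W (cut N) (\<lambda>a. Phi w t a - Phi w s a))"
  and "kern \<rho> (C * (K * (t - s) powr \<gamma>)) (ker W (\<lambda>\<xi>. 1) (\<lambda>a. Phi w t a - Phi w s a))"
 by (rule kern_ker_decay[OF W _ _ _ increment_measurable[OF st]];
   use K decay[OF st] in "auto simp: cut_def indicator_def")+

lemma kern_cut:
 assumes W: "weight C W" and "\<phi> \<in> borel_measurable borel" "0 <= A" "\<And>a. \<bar>a\<bar> <= res N ==> cmod (\<phi> a) <= A"
 shows "kern \<rho> (C * (A * (1 + res N) powr \<rho>)) (ker W (cut N) \<phi>)"
 by (rule kern_ker_cut[OF W]) (use \<rho> assms in auto)

lemma kern_Fk:
 assumes W: "weight C W" shows "kern \<rho> (C * (1 * (1 + res N) powr \<rho>)) (ker W (cut N) (\<lambda>a. cis (a * x)))"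
 by (rule kern_cut[OF W phase_measurable]) auto

text \<open>Time enters through the phases only, and under the cutoff these vary by at most
  \<open>res N\<close> times the variation of w. Continuity of w thus gives continuity of the
  truncated nonlinearity in time.\<close>

lemma Fk_diff_bound:
 fixes u v x :: "'m::l2dom l2"
 assumes W: "weight C W"
 shows "norm (Fk w W N r u v x - Fk w W N r' u v x)
  <= opC TYPE('m) \<rho> * (C * ((res N * \<bar>w r - w r'\<bar>) * (1 + res N) powr \<rho>)) * (norm u * norm v * norm x)"
proof -
 have "Fk w W N r u v x - Fk w W N r' u v x = Op (ker W (cut N) (\<lambda>a. cis (a * w r) + of_real (- 1) * cis (a * w r'))) u v x"
  unfolding Fk_def by (subst Op_ker_add_scale[OF \<rho> kern_Fk[OF W] kern_Fk[OF W]]) simp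
 also have "norm ... <= opC TYPE('m) \<rho> * (C * ((res N * \<bar>w r - w r'\<bar>) * (1 + res N) powr \<rho>)) * (norm u * norm v * norm x)"
 proof (rule norm_Op[OF \<rho> kern_cut[OF W]])
  show "0 <= res N * \<bar>w r - w r'\<bar>" by (simp add: res_def)
  fix a :: real assume a: "\<bar>a\<bar> <= res N"
  have "cmod (cis (a * w r) - cis (a * w r')) <= \<bar>a\<bar> * \<bar>w r - w r'\<bar>"
   using cis_lipschitz[of "a * w r" "a * w r'"] by (simp add: abs_mult right_diff_distrib[symmetric])
  also have "... <= res N * \<bar>w r - w r'\<bar>" using a by (intro mult_right_mono) auto
  finally show "cmod (cis (a * w r) + of_real (- 1) * cis (a * w r')) <= res N * \<bar>w r - w r'\<bar>" by simp
 qed measurable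
 finally show ?thesis .
qed

text \<open>The bound common to all N is the product of the norm of the trilinear estimate, the
  constant C of the weight and the constant K of irregularity; the weight enters through C only. The
  bounds of the nonlinearity at one time come from the cutoff and grow with N.\<close>

lemma young_ker:
 assumes W: "weight C W"
 shows "young (Xk T w W :: nat => real => real => 'm::l2dom l2 => 'm l2 => 'm l2 => 'm l2) (XXk w W) (Fk w W)
  (\<lambda>N. opC TYPE('m) \<rho> * (C * (1 * (1 + res N) powr \<rho>))) (opC TYPE('m) \<rho> * (C * K)) \<gamma> T"
proof -
 note C = weight_C_nonneg[OF W] and o = opC_nonneg[OF \<rho>, of "TYPE('m)"]
 \<comment> \<open>The truncated operator is the full one between cutoffs in all slots and in front,
   so convergence as N grows follows from strong convergence of the cutoffs to the identity.\<close>
 have tr: "Xk T w W N s t u v x = mult (ccut N) (XXk w W s t (mult (ccut N) u)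
   (mult (ccut N) v) (mult (ccut N) x))"
  if st: "0 <= s" "s <= t" "t <= T" for N s t and u v x :: "'m l2"
 proof -
  have b: "bmult TYPE('m) 1 (ccut N)"
   by (rule bmult_of_real) (auto simp: cut_def indicator_def)
  have "Op (ker W (cut N) (\<lambda>a. Phi w t a - Phi w s a)) u v x = mult (ccut N) (XXk w W s t (mult (ccut N) u)
   (mult (ccut N) v) (mult (ccut N) x))"
   unfolding XXk_def
   by (rule Op_mult[OF \<rho> kern_Xk(2)[OF W st] kern_Xk(1)[OF W st] b b b b, symmetric])
    (simp add: ker_def mult_ac)
  then show ?thesis unfolding Xk_def using st by simp
 qed
 show ?thesis
 proof (unfold_locales)
  show "0 <= opC TYPE('m) \<rho> * (C * K)" using C K o by simp
  show "1 / 2 < \<gamma>" "0 <= T" by (rule \<gamma>, rule T)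
  fix N :: nat and s t r :: real and u u' v x :: "'m l2"
  show "Fk w W N r (u + u') v x = Fk w W N r u v x + Fk w W N r u' v x"
   "Fk w W N r v (u + u') x = Fk w W N r v u x + Fk w W N r v u' x"
   "Fk w W N r v x (u + u') = Fk w W N r v x u + Fk w W N r v x u'"
   unfolding Fk_def by (rule Op_add[OF \<rho> kern_Fk[OF W]])+
  show "norm (Fk w W N r u v x) <= opC TYPE('m) \<rho> * (C * (1 * (1 + res N) powr \<rho>)) * (norm u * norm v * norm x)"
   unfolding Fk_def by (rule norm_Op[OF \<rho> kern_Fk[OF W]])
  show "continuous_on {0..T} (\<lambda>r. Fk w W N r u v x)"
  proof (rule continuous_onI_LIMSEQ)
   fix y z assume y: "\<forall>n. y n \<in> {0..T}" and z: "z \<in> {0..T}" and lim: "y \<longlonglongrightarrow> z"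
   have lw: "(\<lambda>n. w (y n)) \<longlonglongrightarrow> w z"
    using w y z lim by (auto simp: continuous_on_sequentially o_def)
   have "(\<lambda>n. opC TYPE('m) \<rho> * (C * ((res N * \<bar>w (y n) - w z\<bar>) * (1 + res N) powr \<rho>)) * (norm u * norm v * norm x))
    \<longlonglongrightarrow> opC TYPE('m) \<rho> * (C * ((res N * \<bar>w z - w z\<bar>) * (1 + res N) powr \<rho>)) * (norm u * norm v * norm x)"
    by (intro tendsto_intros lw)
   then have "(\<lambda>n. Fk w W N (y n) u v x - Fk w W N z u v x) \<longlonglongrightarrow> 0"
    by (intro LIMSEQ_0_le[OF Fk_diff_bound[OF W]]) simp
   then show "(\<lambda>n. Fk w W N (y n) u v x) \<longlonglongrightarrow> Fk w W N z u v x" by (simp add: LIM_zero_iff)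
  qed
 next
  fix N :: nat and s t :: real and u u' v x :: "'m l2"
  assume st: "0 <= s" "s <= t" "t <= T"
  show "norm (Xk T w W N s t u v x) <= opC TYPE('m) \<rho> * (C * K) * (t - s) powr \<gamma> * (norm u * norm v * norm x)"
   unfolding Xk_def using st norm_Op[OF \<rho> kern_Xk(1)[OF W st, of N], of u v x] by (simp add: mult_ac)
  have "(\<lambda>N. XXk w W s t (mult (ccut N) u) (mult (ccut N) v) (mult (ccut N) x))
   \<longlonglongrightarrow> XXk w W s t u v x"
   unfolding XXk_def
   by (rule trilinear_bounded_tendsto[OF Op_add[OF \<rho> kern_Xk(2)[OF W st]] norm_Op[OF \<rho> kern_Xk(2)[OF W st]]])
    (rule cut_tendsto)+
  then have d: "(\<lambda>N. XXk w W s t (mult (ccut N) u) (mult (ccut N) v) (mult (ccut N) x)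
    - XXk w W s t u v x) \<longlonglongrightarrow> 0" (is "?d \<longlonglongrightarrow> 0") by (simp add: LIM_zero_iff)
  have b: "bmult TYPE('m) 1 (ccut N)" for N
   by (rule bmult_of_real) (auto simp: cut_def indicator_def)
  have "(\<lambda>N. mult (ccut N) (?d N)) \<longlonglongrightarrow> 0"
   by (rule LIMSEQ_0_le[where D = "\<lambda>N. norm (?d N)"]) (use norm_mult_le[OF b] d in "auto simp: tendsto_norm_zero")
  from tendsto_add[OF this cut_tendsto[of "XXk w W s t u v x"]]
  show "(\<lambda>N. Xk T w W N s t u v x) \<longlonglongrightarrow> XXk w W s t u v x"
   by (simp add: tr[OF st] mult_diff[OF b])
 next
  fix N :: nat and s t t' :: real and u v x :: "'m l2"
  assume st: "0 <= s" "s <= t" "t <= t'" "t' <= T"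
  have st': "t <= T" "0 <= t" "s <= t'" using st by auto
  have eq: "(\<lambda>a. Phi w t' a - Phi w s a) = (\<lambda>a. (Phi w t a - Phi w s a) + of_real 1 * (Phi w t' a - Phi w t a))" by auto
  show "Xk T w W N s t' u v x = Xk T w W N s t u v x + Xk T w W N t t' u v x"
   using Op_ker_add_scale[OF \<rho> kern_Xk(1)[OF W st(1,2) st'(1), of N] kern_Xk(1)[OF W st'(2) st(3,4), of N], where c = 1 and u = u and v = v and x = x]
   unfolding eq[symmetric] Xk_def using st st' by simp
 next
  fix N :: nat and e :: real assume e: "e > 0"
  \<comment> \<open>B grows with N, which is harmless since the required d may depend on N; dividing
    e by B + 1 absorbs it, also when B = 0.\<close>
  define B where "B = opC TYPE('m) \<rho> * (C * (res N * (1 + res N) powr \<rho>))"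
  have B: "B >= 0" unfolding B_def using C o by (simp add: res_def)
  have e': "e / (B + 1) > 0" using e B by simp
  obtain d where d: "d > 0" "\<And>s t a. 0 <= s ==> s <= t ==> t <= T ==> t - s < d ==>
   cmod (Phi w t a - Phi w s a - of_real (t - s) * cis (a * w s)) <= (t - s) * (\<bar>a\<bar> * (e / (B + 1)))"
   using Phi_approx[OF e'] by metis
  show "\<exists>d>0. \<forall>s t u v x. 0 <= s --> s <= t --> t <= T --> t - s < d -->
   norm (Xk T w W N s t u v x - (t - s) *\<^sub>R Fk w W N s u v (x :: 'm l2)) <= e * (t - s) * (norm u * norm v * norm x)"
  proof (intro exI[of _ d] conjI allI impI d(1))
   fix s t and u v x :: "'m l2" assume st: "0 <= s" "s <= t" "t <= T" "t - s < d"
   note [measurable] = increment_measurable[OF st(1-3)]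
   have "Xk T w W N s t u v x - (t - s) *\<^sub>R Fk w W N s u v x
    = Op (ker W (cut N) (\<lambda>a. (Phi w t a - Phi w s a) + of_real (- (t - s)) * cis (a * w s))) u v x"
    unfolding Fk_def Xk_def using st by (subst Op_ker_add_scale[OF \<rho> kern_Xk(1)[OF W st(1-3)] kern_Fk[OF W]]) (simp add: scaleR_diff_left)
   also have "norm ... <= opC TYPE('m) \<rho> * (C * (((t - s) * (res N * (e / (B + 1)))) * (1 + res N) powr \<rho>)) * (norm u * norm v * norm x)"
   proof (rule norm_Op[OF \<rho> kern_cut[OF W]])
    show "0 <= (t - s) * (res N * (e / (B + 1)))" unfolding res_def using st by (intro mult_nonneg_nonneg less_imp_le[OF e']) auto
    fix a :: real assume a: "\<bar>a\<bar> <= res N"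
    have "cmod ((Phi w t a - Phi w s a) + of_real (- (t - s)) * cis (a * w s)) <= (t - s) * (\<bar>a\<bar> * (e / (B + 1)))"
     using d(2)[OF st, of a] by (simp only: of_real_minus mult_minus_left add_uminus_conv_diff)
    also have "... <= (t - s) * (res N * (e / (B + 1)))"
     using a e' st by (intro mult_left_mono mult_right_mono) auto
    finally show "cmod ((Phi w t a - Phi w s a) + of_real (- (t - s)) * cis (a * w s)) <= (t - s) * (res N * (e / (B + 1)))" .
   qed measurable
   also have "opC TYPE('m) \<rho> * (C * (((t - s) * (res N * (e / (B + 1)))) * (1 + res N) powr \<rho>)) = (B * (e / (B + 1))) * (t - s)"
    unfolding B_def by (simp only: mult_ac)
   also have "(B * (e / (B + 1))) * (t - s) * (norm u * norm v * norm x) <= e * (t - s) * (norm u * norm v * norm x)"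
    using B e st by (intro mult_right_mono) (auto simp: field_simps)
   finally show "norm (Xk T w W N s t u v x - (t - s) *\<^sub>R Fk w W N s u v x) <= e * (t - s) * (norm u * norm v * norm x)" .
  qed
 next
  fix N :: nat and s t :: real and u u' v x :: "'m l2"
  note A = Op_add[OF \<rho> kern_Xk(1)[OF W, of s t]]
  show "Xk T w W N s t (u + u') v x = Xk T w W N s t u v x + Xk T w W N s t u' v x"
   "Xk T w W N s t v (u + u') x = Xk T w W N s t v u x + Xk T w W N s t v u' x"
   "Xk T w W N s t v x (u + u') = Xk T w W N s t v x u + Xk T w W N s t v x u'"
   unfolding Xk_def using A by auto
 qed
qed

end

subsection \<open>Weights\<close>

text \<open>The bracket of x is the Euclidean norm of (1, x), and (1, \<xi>) = (1, \<xi> - p) - (1,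
  \<xi> - p - q) + (1, \<xi> - q).\<close>

lemma jap_triangle: "jap \<xi> <= jap (\<xi> - p) + jap (\<xi> - p - q) + jap (\<xi> - q)"
proof -
 have n: "jap x = norm (1::real, x)" for x by (simp add: jap_def norm_prod_def)
 have "norm (1::real, \<xi>) = norm ((1, \<xi> - p) - (1, \<xi> - p - q) + (1::real, \<xi> - q))" by simp
 also have "... <= norm (1::real, \<xi> - p) + norm (1::real, \<xi> - p - q) + norm (1::real, \<xi> - q)"
  by (intro order_trans[OF norm_triangle_ineq] add_right_mono norm_triangle_ineq4)
 finally show ?thesis by (simp only: n)
qed

text \<open>Stated with a maximum because a maximum commutes with x \<mapsto> c + \<delta> x for
  \<delta> \<ge> 0; this is what later keeps the constant free of \<delta>.\<close>

lemma japw_max: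
 assumes \<alpha>: "\<alpha> >= 0"
 shows "japw \<alpha> \<xi> <= 3 powr \<alpha> * max (max (japw \<alpha> (\<xi> - p)) (japw \<alpha> (\<xi> - p - q))) (japw \<alpha> (\<xi> - q))"
proof -
 define m where "m = max (max (jap (\<xi> - p)) (jap (\<xi> - p - q))) (jap (\<xi> - q))"
 have m1: "1 <= m" using jap_ge_1[of "\<xi> - q"] unfolding m_def by linarith
 have "jap \<xi> <= 3 * m" using jap_triangle[of \<xi> p q] unfolding m_def by linarith
 then have "japw \<alpha> \<xi> <= (3 * m) powr \<alpha>"
  unfolding japw_def using jap_ge_1[of \<xi>] \<alpha> by (intro powr_mono2) auto
 also have "... = 3 powr \<alpha> * m powr \<alpha>" using m1 by (simp add: powr_mult)
 also have "m powr \<alpha> <= max (max (japw \<alpha> (\<xi> - p)) (japw \<alpha> (\<xi> - p - q))) (japw \<alpha> (\<xi> - q))"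
  unfolding m_def japw_def by (auto simp: max_def)
 finally show ?thesis by simp
qed

lemma max3_le_prod:
 fixes a b c :: real assumes "1 <= a" "1 <= b" "1 <= c" shows "max (max a b) c <= a * b * c"
proof -
 have ab: "1 <= a * b" "a <= a * b" "b <= a * b"
  using assms mult_mono[of 1 a 1 b] mult_left_mono[of 1 b a] mult_right_mono[of 1 a b] by auto
 have "a * b <= a * b * c" "c <= a * b * c"
  using assms ab(1) mult_left_mono[of 1 c "a * b"] mult_right_mono[of 1 "a * b" c] by auto
 then show ?thesis using ab by simp
qed

text \<open>Covers the Sobolev weight (c = 0, \<delta> = 1) and its regularisation (c = 1) together.
  The maximum passes through the affine map, and as all values are at least 1 it is bounded by the
  product, so the constant is \<open>3 powr \<alpha>\<close> whatever \<delta> is.\<close>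

lemma weight_affine:
 assumes \<alpha>: "\<alpha> >= 0" and \<delta>: "\<delta> >= 0" and c: "c = 1 \<or> (c = 0 \<and> \<delta> = 1)"
 shows "weight (3 powr \<alpha>) (\<lambda>\<xi>. c + \<delta> * japw \<alpha> \<xi>)"
 unfolding weight_def
proof (intro conjI allI)
 show "(\<lambda>\<xi>. c + \<delta> * japw \<alpha> \<xi>) \<in> borel_measurable borel" by measurable
 have W1: "1 <= c + \<delta> * japw \<alpha> \<xi>" for \<xi> using c japw_ge_1[OF \<alpha>, of \<xi>] \<delta> by auto
 show "1 <= c + \<delta> * japw \<alpha> \<xi>" for \<xi> by (rule W1)
 fix \<xi> p q
 define m where "m = max (max (japw \<alpha> (\<xi> - p)) (japw \<alpha> (\<xi> - p - q))) (japw \<alpha> (\<xi> - q))"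
 have p3: "1 <= 3 powr \<alpha>" using \<alpha> by (simp add: ge_one_powr_ge_zero)
 have c0: "0 <= c" using c by auto
 have "c + \<delta> * japw \<alpha> \<xi> <= 3 powr \<alpha> * c + \<delta> * (3 powr \<alpha> * m)"
  using japw_max[OF \<alpha>, of \<xi> p q] \<delta> p3 c0 mult_right_mono[OF p3 c0] unfolding m_def
  by (intro add_mono mult_left_mono) auto
 also have "... = 3 powr \<alpha> * (c + \<delta> * m)" by (simp add: algebra_simps)
 also have "c + \<delta> * m = max (max (c + \<delta> * japw \<alpha> (\<xi> - p)) (c + \<delta> * japw \<alpha> (\<xi> - p - q))) (c + \<delta> * japw \<alpha> (\<xi> - q))"
  unfolding m_def using \<delta> by (simp add: max_add_distrib_right max_mult_distrib_left)
 also have "3 powr \<alpha> * ... <= 3 powr \<alpha> * ((c + \<delta> * japw \<alpha> (\<xi> - p)) * (c + \<delta> * japw \<alpha> (\<xi> - p - q)) * (c + \<delta> * japw \<alpha> (\<xi> - q)))"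
  by (intro mult_left_mono max3_le_prod W1) simp
 finally show "c + \<delta> * japw \<alpha> \<xi> <= 3 powr \<alpha> * ((c + \<delta> * japw \<alpha> (\<xi> - p)) * (c + \<delta> * japw \<alpha> (\<xi> - p - q)) * (c + \<delta> * japw \<alpha> (\<xi> - q)))" .
qed

lemma weight_japw: "\<alpha> >= 0 ==> weight (3 powr \<alpha>) (japw \<alpha>)"
 using weight_affine[of \<alpha> 1 0] by simp

abbreviation aff :: "real => real => real => real" where
 "aff \<alpha> \<delta> \<xi> \<equiv> 1 + \<delta> * japw \<alpha> \<xi>"

lemma weight_japw_affine: "\<alpha> >= 0 ==> \<delta> >= 0 ==> weight (3 powr \<alpha>) (aff \<alpha> \<delta>)"
 using weight_affine[of \<alpha> \<delta> 1] by simp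

subsection \<open>Change of weight\<close>

abbreviation nsol :: "(real => real) => (real => real) => real => real => (real => 'm::l2dom l2) => bool" where
 "nsol w W \<equiv> young.sol (Fk w W)"

text \<open>Both sides are the operator with kernel \<open>b \<xi> * k \<xi> p q\<close>. With b a
  quotient of weights this compares two weighted equations; with b a propagator phase it yields the
  interaction representation.\<close>

lemma Op_intertwine:
 fixes u v x :: "'m::l2dom l2"
 assumes \<rho>: "\<rho> > 1/2" and k: "kern \<rho> A k" and k': "kern \<rho> A' k'"
  and b [measurable]: "b \<in> borel_measurable borel" and B: "\<And>\<xi>. cmod (b \<xi>) <= B"
  and eq: "\<And>\<xi> p q. b \<xi> * k \<xi> p q = k' \<xi> p q * (b (\<xi> - p) * cnj (b (\<xi> - p - q)) * b (\<xi> - q))"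
 shows "mult b (Op k u v x) = Op k' (mult b u) (mult b v) (mult b x)"
proof -
 have one: "bmult TYPE('m) 1 (\<lambda>\<xi>. 1)" by (simp add: bmult_def)
 have m1: "mult (\<lambda>\<xi>. 1) y = y" for y :: "'m l2" by (rule mult_one[OF one]) simp
 have b': "bmult TYPE('m) B b" using borel_measurable_freq[OF b] B by (simp add: bmult_def)
 have B0: "0 <= B" using order_trans[OF norm_ge_zero B[of 0]] .
 have k'': "kern \<rho> (B * A) (\<lambda>\<xi> p q. b \<xi> * k \<xi> p q)"
  unfolding kern_def
 proof (intro conjI allI)
  have [measurable]: "(\<lambda>w. k (fst w) (fst (snd w)) (snd (snd w))) \<in> borel_measurable (borel \<Otimes>\<^sub>M (borel \<Otimes>\<^sub>M borel))"
   using k by (simp add: kern_def)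
  show "(\<lambda>w. b (fst w) * k (fst w) (fst (snd w)) (snd (snd w))) \<in> borel_measurable (borel \<Otimes>\<^sub>M (borel \<Otimes>\<^sub>M borel))"
   by measurable
  show "0 <= B * A" using k B0 by (simp add: kern_def)
  fix \<xi> p q
  have "cmod (b \<xi>) * cmod (k \<xi> p q) <= B * (A * kap \<rho> p q)"
   by (rule mult_mono[OF B]) (use k B0 in "auto simp: kern_def")
  then show "cmod (b \<xi> * k \<xi> p q) <= B * A * kap \<rho> p q" by (simp add: norm_mult mult.assoc)
 qed
 have "mult b (Op k (mult (\<lambda>\<xi>. 1) u) (mult (\<lambda>\<xi>. 1) v) (mult (\<lambda>\<xi>. 1) x)) = Op (\<lambda>\<xi> p q. b \<xi> * k \<xi> p q) u v x"
  by (rule Op_mult[OF \<rho> k k'' b' one one one]) simp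
 moreover have "mult (\<lambda>\<xi>. 1) (Op k' (mult b u) (mult b v) (mult b x)) = Op (\<lambda>\<xi> p q. b \<xi> * k \<xi> p q) u v x"
  by (rule Op_mult[OF \<rho> k' k'' one b' b' b']) (simp add: eq)
 ultimately show ?thesis unfolding m1 by simp
qed

context modulation
begin

text \<open>The solutions for two weights are one path in two coordinates. Multiplication by W'/W
  intertwines the truncated nonlinearities; the hypothesis on B makes it a bounded operator, so that
  it passes through the time integral and the limit in N.\<close>

lemma nsol_transport:
 fixes v :: "real => 'm::l2dom l2"
 assumes W: "weight C W" and W': "weight C' W'" and B: "\<And>\<xi>. W' \<xi> <= B * W \<xi>"
  and v: "nsol w W a b v" and ab: "0 <= a" "a <= b" "b <= T"
 shows "nsol w W' a b (\<lambda>t. mult (\<lambda>\<xi>. of_real (W' \<xi> / W \<xi>)) (v t))"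
proof -
 interpret Y: young "Xk T w W :: _ => _ => _ => 'm l2 => _" "XXk w W" "Fk w W"
  "\<lambda>N. opC TYPE('m) \<rho> * (C * (1 * (1 + res N) powr \<rho>))" "opC TYPE('m) \<rho> * (C * K)" \<gamma> T
  by (rule young_ker[OF W])
 interpret Y': young "Xk T w W' :: _ => _ => _ => 'm l2 => _" "XXk w W'" "Fk w W'"
  "\<lambda>N. opC TYPE('m) \<rho> * (C' * (1 * (1 + res N) powr \<rho>))" "opC TYPE('m) \<rho> * (C' * K)" \<gamma> T
  by (rule young_ker[OF W'])
 define \<beta> where "\<beta> \<xi> = complex_of_real (W' \<xi> / W \<xi>)" for \<xi>
 have W1: "0 < W \<xi>" "0 < W' \<xi>" for \<xi>
  using W W' unfolding weight_def by (meson less_le_trans zero_less_one)+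
 have [measurable]: "W \<in> borel_measurable borel" "W' \<in> borel_measurable borel" using W W' by (auto simp: weight_def)
 have \<beta>m: "\<beta> \<in> borel_measurable borel" unfolding \<beta>_def by measurable
 have \<beta>B: "cmod (\<beta> \<xi>) <= B" for \<xi>
  unfolding \<beta>_def norm_of_real using W1[of \<xi>] B[of \<xi>] by (simp add: pos_divide_le_eq)
 have b: "bmult TYPE('m) B \<beta>" using borel_measurable_freq[OF \<beta>m] \<beta>B by (simp add: bmult_def)
 have inter: "Fk w W' N r (mult \<beta> x) (mult \<beta> y) (mult \<beta> z) = mult \<beta> (Fk w W N r x y z)" for N r and x y z :: "'m l2"
  unfolding Fk_def
 proof (rule Op_intertwine[OF \<rho> kern_Fk[OF W] kern_Fk[OF W'] \<beta>m \<beta>B, symmetric])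
  fix \<xi> p q
  show "\<beta> \<xi> * ker W (cut N) (\<lambda>a. cis (a * w r)) \<xi> p q
   = ker W' (cut N) (\<lambda>a. cis (a * w r)) \<xi> p q * (\<beta> (\<xi> - p) * cnj (\<beta> (\<xi> - p - q)) * \<beta> (\<xi> - q))"
   unfolding ker_def \<beta>_def using W1[of "\<xi> - p"] W1[of "\<xi> - p - q"] W1[of "\<xi> - q"] W1[of \<xi>]
   by (simp add: divide_simps)
 qed
 obtain M where M: "ctrl a b M v" "1 <= M" using Y.sol_ctrl[OF v] ab by blast
 have vc: "continuous_on {a..t} v" if "t <= b" for t
  by (rule continuous_on_subset[OF holder_continuous[OF ctrl_holder[OF M(1)]]]) (use that in auto)
 have J: "Y'.J N a t (\<lambda>t. mult \<beta> (v t)) (\<lambda>t. mult \<beta> (v t)) (\<lambda>t. mult \<beta> (v t)) = mult \<beta> (Y.J N a t v v v)" if "t <= b" for N t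
 proof -
  have "(\<lambda>r. Fk w W N r (v r) (v r) (v r)) integrable_on {a..t}"
   using vc[OF that] ab that by (intro Y.F_path_integrable) auto
  from integral_linear[OF this bounded_linear_mult[OF b]] show ?thesis
   unfolding Y.J_def Y'.J_def inter by (simp add: o_def)
 qed
 have "Y'.sol a b (\<lambda>t. mult \<beta> (v t))"
  unfolding Y'.sol_def
 proof (intro conjI ballI exI)
  have B0: "0 <= B" using order_trans[OF norm_ge_zero \<beta>B[of 0]] .
  show "holder a b (B * M) (\<lambda>t. mult \<beta> (v t))"
  proof (rule holderI)
   fix s t assume st: "a <= s" "s <= t" "t <= b"
   have "norm (mult \<beta> (v t - v s)) <= B * (M * sqrt (t - s))"
    by (rule order_trans[OF norm_mult_le[OF b] mult_left_mono[OF holderD[OF ctrl_holder[OF M(1)] st] B0]])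
   then show "norm (mult \<beta> (v t) - mult \<beta> (v s)) <= B * M * sqrt (t - s)" by (simp add: mult_diff[OF b] mult.assoc)
  qed
  fix t assume t: "t \<in> {a..b}"
  have "(\<lambda>N. Y.J N a t v v v) \<longlonglongrightarrow> v t - v a" using v t unfolding Y.sol_def by blast
  from bounded_linear.tendsto[OF bounded_linear_mult[OF b] this]
  show "(\<lambda>N. Y'.J N a t (\<lambda>t. mult \<beta> (v t)) (\<lambda>t. mult \<beta> (v t)) (\<lambda>t. mult \<beta> (v t))) \<longlonglongrightarrow> mult \<beta> (v t) - mult \<beta> (v a)"
   using t by (simp add: J mult_diff[OF b])
 qed
 then show ?thesis unfolding \<beta>_def .
qed

subsection \<open>Conservation of the \<open>L\<^sup>2\<close> norm and a priori bounds\<close>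

text \<open>For weight 1 the kernel is \<i> times a \<kappa> that depends on p q only through an
  increment of \<open>Phi\<close>. As w is real, \<open>Phi\<close> at -a is the conjugate of
  \<open>Phi\<close> at a, which is the symmetry under p \<mapsto> -p that makes the quartic form
  real.\<close>

lemma XXk_orthogonal:
 fixes u :: "'m::l2dom l2"
 assumes st: "0 <= s" "s <= t" "t <= T"
 shows "inner u (XXk w (\<lambda>\<xi>. 1) s t u u u) = 0"
proof -
 define \<kappa> where "\<kappa> p q = of_real (1 / (2 * pi)) * (Phi w t (2 * (p * q)) - Phi w s (2 * (p * q)))" for p q
 have eq: "ker (\<lambda>\<xi>. 1) (\<lambda>\<xi>. 1) (\<lambda>a. Phi w t a - Phi w s a) = (\<lambda>\<xi> p q. \<i> * \<kappa> p q)"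
  by (intro ext) (simp add: ker_def \<kappa>_def)
 have "kern \<rho> (1 * (K * (t - s) powr \<gamma>)) (\<lambda>\<xi> p q. - (\<i> * (\<i> * \<kappa> p q)))"
  using kern_i[OF kern_Xk(2)[OF weight_1 st]] unfolding eq by (auto simp: kern_def)
 moreover have "- (\<i> * (\<i> * \<kappa> p q)) = \<kappa> p q" for p q by (simp add: mult.assoc[symmetric])
 ultimately have k: "kern \<rho> (1 * (K * (t - s) powr \<gamma>)) (\<lambda>\<xi> p q. \<kappa> p q)" by simp
 have "cnj (\<kappa> p q) = \<kappa> (- p) q" for p q
  unfolding \<kappa>_def by (simp add: Phi_minus)
 from Op_conserve[OF \<rho> k this, of u] show ?thesis
  unfolding XXk_def eq by (simp add: inner_commute)
qed

text \<open>The full operator, without cutoff, is orthogonal to v s, so the inner product of v s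
  with the increment is only the sewing error of order \<gamma> + 1/2.\<close>

lemma nsol_conserved:
 fixes v :: "real => 'm::l2dom l2"
 assumes v: "nsol w (\<lambda>\<xi>. 1) 0 b v" and b: "b <= T" and t: "0 <= t" "t <= b"
 shows "norm (v t) = norm (v 0)"
proof -
 interpret Y: young "Xk T w (\<lambda>\<xi>. 1) :: _ => _ => _ => 'm l2 => _" "XXk w (\<lambda>\<xi>. 1)" "Fk w (\<lambda>\<xi>. 1)"
  "\<lambda>N. opC TYPE('m) \<rho> * (1 * (1 * (1 + res N) powr \<rho>))" "opC TYPE('m) \<rho> * (1 * K)" \<gamma> T
  by (rule young_ker[OF weight_1])
 have b0: "0 <= b" using t by simp
 obtain M where M: "ctrl 0 b M v" "1 <= M" using Y.sol_ctrl[OF v b0] by blast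
 obtain A where A: "A >= 0"
  "\<And>s t. 0 <= s ==> s <= t ==> t <= b ==> norm (v t - v s) <= A * (t - s) powr \<gamma>"
  "\<And>s t. 0 <= s ==> s <= t ==> t <= b ==> norm (v t - v s - XXk w (\<lambda>\<xi>. 1) s t (v s) (v s) (v s)) <= A * (t - s) powr (\<gamma> + 1/2)"
  using Y.sol_increments[OF v order_refl b b0] by blast
 \<comment> \<open>The first entry bounds the squared increment, since 2 \<gamma> = (\<gamma> - 1/2)
   + (\<gamma> + 1/2); the second bounds the inner product with v s.\<close>
 define B where "B = max (A\<^sup>2 * b powr (\<gamma> - 1/2)) (M * A)"
 show ?thesis
 proof (rule norm_conserved[of "\<gamma> + 1/2" B 0 b])
  show "\<gamma> + 1/2 > 1" using \<gamma> by simp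
  show "B >= 0" unfolding B_def using A(1) by (simp add: le_max_iff_disj)
  fix s t assume st: "0 <= s" "s <= t" "t <= b"
  have "(norm (v t - v s))^2 <= (A * (t - s) powr \<gamma>)^2" using A(2)[OF st] by (intro power_mono) auto
  also have "... = A\<^sup>2 * ((t - s) powr (\<gamma> - 1/2) * (t - s) powr (\<gamma> + 1/2))"
   by (simp add: power_mult_distrib power2_eq_square powr_add[symmetric])
  also have "... <= A\<^sup>2 * (b powr (\<gamma> - 1/2) * (t - s) powr (\<gamma> + 1/2))"
   using st \<gamma> by (intro mult_left_mono mult_right_mono powr_mono2) auto
  also have "... = A\<^sup>2 * b powr (\<gamma> - 1/2) * (t - s) powr (\<gamma> + 1/2)" by simp
  also have "... <= B * (t - s) powr (\<gamma> + 1/2)" by (intro mult_right_mono) (auto simp: B_def)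
  finally show "(norm (v t - v s))^2 <= B * (t - s) powr (\<gamma> + 1/2)" .
  have st': "t <= T" using st b by simp
  have "inner (v s) (v t - v s) = inner (v s) (v t - v s - XXk w (\<lambda>\<xi>. 1) s t (v s) (v s) (v s))"
   using XXk_orthogonal[OF st(1,2) st', of "v s"] by (simp add: inner_diff_right)
  then have "\<bar>inner (v s) (v t - v s)\<bar> <= norm (v s) * norm (v t - v s - XXk w (\<lambda>\<xi>. 1) s t (v s) (v s) (v s))"
   by (simp only: Cauchy_Schwarz_ineq2)
  also have "... <= M * (A * (t - s) powr (\<gamma> + 1/2))"
   using ctrl_norm[OF M(1)] A(3)[OF st] st M(2) by (intro mult_mono) auto
  also have "... = M * A * (t - s) powr (\<gamma> + 1/2)" by simp
  also have "... <= B * (t - s) powr (\<gamma> + 1/2)" by (intro mult_right_mono) (auto simp: B_def)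
  finally show "\<bar>inner (v s) (v t - v s)\<bar> <= B * (t - s) powr (\<gamma> + 1/2)" .
 qed (use t in auto)
qed

end

text \<open>Changes of coordinates from the weight of H^\<alpha>: \<open>low\<close> passes to
  weight 1, so its norm is the L^2 norm of the function; \<open>rescale\<close> passes to the
  regularised weight with parameter \<delta>, and \<open>unscale\<close> goes back.\<close>

definition low :: "real => 'm::l2dom l2 => 'm l2" where
 "low \<alpha> u = mult (\<lambda>\<xi>. of_real (1 / japw \<alpha> \<xi>)) u"

definition rescale :: "real => real => 'm::l2dom l2 => 'm l2" where
 "rescale \<alpha> \<delta> u = mult (\<lambda>\<xi>. of_real ((1 + \<delta> * japw \<alpha> \<xi>) / japw \<alpha> \<xi>)) u"

definition unscale :: "real => real => 'm::l2dom l2 => 'm l2" where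
 "unscale \<alpha> \<delta> u = mult (\<lambda>\<xi>. of_real (japw \<alpha> \<xi> / (1 + \<delta> * japw \<alpha> \<xi>))) u"

context
 fixes \<alpha> \<delta> :: real assumes \<alpha>: "\<alpha> >= 0" and \<delta>: "0 < \<delta>" "\<delta> <= 1"
begin

lemma affine_japw: "1 <= japw \<alpha> \<xi>" "0 < 1 + \<delta> * japw \<alpha> \<xi>" "1 + \<delta> * japw \<alpha> \<xi> <= 2 * japw \<alpha> \<xi>"
 "japw \<alpha> \<xi> <= 1 / \<delta> * (1 + \<delta> * japw \<alpha> \<xi>)"
proof -
 show j: "1 <= japw \<alpha> \<xi>" by (rule japw_ge_1[OF \<alpha>])
 then show "0 < 1 + \<delta> * japw \<alpha> \<xi>" using \<delta> by (intro add_pos_nonneg) auto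
 have "\<delta> * japw \<alpha> \<xi> <= 1 * japw \<alpha> \<xi>" using j \<delta> by (intro mult_right_mono) auto
 then show "1 + \<delta> * japw \<alpha> \<xi> <= 2 * japw \<alpha> \<xi>" using j by linarith
 show "japw \<alpha> \<xi> <= 1 / \<delta> * (1 + \<delta> * japw \<alpha> \<xi>)" using \<delta> by (simp add: field_simps)
qed

lemma bmult_scale:
 "bmult TYPE('m::l2dom) 1 (\<lambda>\<xi>. of_real (1 / japw \<alpha> \<xi>))"
 "bmult TYPE('m::l2dom) 2 (\<lambda>\<xi>. of_real ((1 + \<delta> * japw \<alpha> \<xi>) / japw \<alpha> \<xi>))"
 "bmult TYPE('m::l2dom) (1 / \<delta>) (\<lambda>\<xi>. of_real (japw \<alpha> \<xi> / (1 + \<delta> * japw \<alpha> \<xi>)))"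
proof -
 have j: "0 < japw \<alpha> \<xi>" for \<xi> using affine_japw(1)[of \<xi>] by linarith
 show "bmult TYPE('m::l2dom) 1 (\<lambda>\<xi>. of_real (1 / japw \<alpha> \<xi>))"
  by (rule bmult_of_real) (use j affine_japw(1) in "auto simp: abs_of_pos")
 show "bmult TYPE('m::l2dom) 2 (\<lambda>\<xi>. of_real ((1 + \<delta> * japw \<alpha> \<xi>) / japw \<alpha> \<xi>))"
  by (rule bmult_of_real, measurable) (use j affine_japw in "simp add: abs_of_pos pos_divide_le_eq")
 show "bmult TYPE('m::l2dom) (1 / \<delta>) (\<lambda>\<xi>. of_real (japw \<alpha> \<xi> / (1 + \<delta> * japw \<alpha> \<xi>)))"
 proof (rule bmult_of_real, measurable)
  fix \<xi>
  show "\<bar>japw \<alpha> \<xi> / (1 + \<delta> * japw \<alpha> \<xi>)\<bar> <= 1 / \<delta>"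
   unfolding abs_of_pos[OF divide_pos_pos[OF j affine_japw(2)]] pos_divide_le_eq[OF affine_japw(2)] by (rule affine_japw(4))
 qed
qed

lemma unscale_rescale: "unscale \<alpha> \<delta> (rescale \<alpha> \<delta> u) = (u :: 'm::l2dom l2)"
 "rescale \<alpha> \<delta> (unscale \<alpha> \<delta> u) = u"
proof -
 have j: "japw \<alpha> \<xi> \<noteq> 0" "1 + \<delta> * japw \<alpha> \<xi> \<noteq> 0" for \<xi> using affine_japw(1,2)[of \<xi>] by auto
 have 1: "bmult TYPE('m) 1 (\<lambda>\<xi>. 1)" by (simp add: bmult_def)
 have c: "complex_of_real (japw \<alpha> \<xi> / (1 + \<delta> * japw \<alpha> \<xi>)) * of_real ((1 + \<delta> * japw \<alpha> \<xi>) / japw \<alpha> \<xi>) = 1" for \<xi>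
  unfolding of_real_mult[symmetric] using j[of \<xi>] by simp
 show "unscale \<alpha> \<delta> (rescale \<alpha> \<delta> u) = u"
  unfolding unscale_def rescale_def mult_mult[OF bmult_scale(3) bmult_scale(2)] c by (rule mult_one[OF 1]) simp
 show "rescale \<alpha> \<delta> (unscale \<alpha> \<delta> u) = u"
  unfolding unscale_def rescale_def mult_mult[OF bmult_scale(2) bmult_scale(3)] mult.commute[of "complex_of_real ((1 + \<delta> * japw \<alpha> _) / _)"] c
  by (rule mult_one[OF 1]) simp
qed

text \<open>Dividing 1 + \<delta> W by W splits the rescaled element into its L^2 part and \<delta>
  times its H^\<alpha> part: the first is conserved, the second is kept below 1 by the choice of
  \<delta>.\<close>

lemma norm_rescale_le: "norm (rescale \<alpha> \<delta> u) <= norm (low \<alpha> u) + \<delta> * norm (u :: 'm::l2dom l2)"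
proof -
 have "rescale \<alpha> \<delta> u = low \<alpha> u + \<delta> *\<^sub>R u"
  unfolding l2_eq_iff rescale_def low_def
  using fn_mult[OF bmult_scale(2), of u] fn_mult[OF bmult_scale(1), of u]
   fn_add[of "mult (\<lambda>\<xi>. of_real (1 / japw \<alpha> \<xi>)) u" "\<delta> *\<^sub>R u"] fn_scaleR[of \<delta> u]
 proof eventually_elim
  case (elim \<xi>)
  have "japw \<alpha> \<xi> \<noteq> 0" using affine_japw(1)[of \<xi>] by auto
  then have c: "complex_of_real ((1 + \<delta> * japw \<alpha> \<xi>) / japw \<alpha> \<xi>) = of_real (1 / japw \<alpha> \<xi>) + of_real \<delta>"
   unfolding of_real_add[symmetric] by (simp add: add_divide_distrib)
  show ?case unfolding elim(1) elim(3) elim(2) elim(4) c by (rule distrib_right)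
 qed
 then show ?thesis using norm_triangle_ineq[of "low \<alpha> u" "\<delta> *\<^sub>R u"] \<delta> by simp
qed

lemma norm_unscale_le: "norm (unscale \<alpha> \<delta> u) <= 1 / \<delta> * norm (u :: 'm::l2dom l2)"
 unfolding unscale_def by (rule norm_mult_le[OF bmult_scale(3)])

lemma unscale_diff: "unscale \<alpha> \<delta> (u - v) = unscale \<alpha> \<delta> u - unscale \<alpha> \<delta> (v :: 'm::l2dom l2)"
 unfolding unscale_def by (rule mult_diff[OF bmult_scale(3)])

end

definition solC :: "'m::l2dom itself => real => real => real => real" where
 "solC m \<rho> \<alpha> K = opC m \<rho> * (3 powr \<alpha> * K)"

context modulation
begin

lemma solC_nonneg: "0 <= solC TYPE('m::l2dom) \<rho> \<alpha> K"
 unfolding solC_def using opC_nonneg[OF \<rho>, of "TYPE('m)"] K by simp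

lemma young_japw:
 assumes "\<alpha> >= 0"
 shows "young (Xk T w (japw \<alpha>) :: _ => _ => _ => 'm::l2dom l2 => _) (XXk w (japw \<alpha>)) (Fk w (japw \<alpha>))
  (\<lambda>N. opC TYPE('m) \<rho> * (3 powr \<alpha> * (1 * (1 + res N) powr \<rho>))) (solC TYPE('m) \<rho> \<alpha> K) \<gamma> T"
 unfolding solC_def by (rule young_ker[OF weight_japw[OF assms]])

lemma young_affine:
 assumes "\<alpha> >= 0" "0 < \<delta>"
 shows "young (Xk T w (aff \<alpha> \<delta>) :: _ => _ => _ => 'm::l2dom l2 => _) (XXk w (aff \<alpha> \<delta>)) (Fk w (aff \<alpha> \<delta>))
  (\<lambda>N. opC TYPE('m) \<rho> * (3 powr \<alpha> * (1 * (1 + res N) powr \<rho>))) (solC TYPE('m) \<rho> \<alpha> K) \<gamma> T"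
 unfolding solC_def by (rule young_ker[OF weight_japw_affine]) (use assms in auto)

lemma nsol_rescale:
 fixes v :: "real => 'm::l2dom l2"
 assumes \<alpha>: "\<alpha> >= 0" and \<delta>: "0 < \<delta>" "\<delta> <= 1" and ab: "0 <= a" "a <= b" "b <= T"
 shows "nsol w (japw \<alpha>) a b v ==> nsol w (aff \<alpha> \<delta>) a b (\<lambda>t. rescale \<alpha> \<delta> (v t))"
  and "nsol w (aff \<alpha> \<delta>) a b v ==> nsol w (japw \<alpha>) a b (\<lambda>t. unscale \<alpha> \<delta> (v t))"
 using nsol_transport[OF weight_japw[OF \<alpha>] weight_japw_affine[OF \<alpha> less_imp_le[OF \<delta>(1)]] affine_japw(3)[OF \<alpha> \<delta>] _ ab]
  nsol_transport[OF weight_japw_affine[OF \<alpha> less_imp_le[OF \<delta>(1)]] weight_japw[OF \<alpha>] affine_japw(4)[OF \<alpha> \<delta>] _ ab]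
 unfolding rescale_def unscale_def by auto

lemma low_conserved:
 fixes v :: "real => 'm::l2dom l2"
 assumes \<alpha>: "\<alpha> >= 0" and v: "nsol w (japw \<alpha>) 0 b v" and b: "b <= T" and t: "0 <= t" "t <= b"
 shows "norm (low \<alpha> (v t)) = norm (low \<alpha> (v 0))"
proof (rule nsol_conserved[OF _ b t])
 have "1 <= 1 * japw \<alpha> \<xi>" for \<xi> using japw_ge_1[OF \<alpha>] by simp
 from nsol_transport[OF weight_japw[OF \<alpha>] weight_1 this v order_refl _ b] t
 show "nsol w (\<lambda>\<xi>. 1) 0 b (\<lambda>t. low \<alpha> (v t))" unfolding low_def by simp
qed

text \<open>If \<open>\<parallel>v\<parallel> \<le> A\<close> in \<open>H\<^sup>\<alpha>\<close>, then the rescaled datum with \<open>\<delta> = 1/A\<close> is controlled by the conserved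
  \<open>L\<^sup>2\<close> norm. Hence the length of the time step does not depend on \<open>A\<close>.\<close>

lemma apriori_step:
 fixes v :: "real => 'm::l2dom l2"
 assumes \<alpha>: "\<alpha> >= 0" and v: "nsol w (japw \<alpha>) a b v" and ab: "0 <= a" "a <= b" "b <= T"
  and short: "short_time (solC TYPE('m) \<rho> \<alpha> K) \<gamma> T (R + 2) (b - a)"
  and R: "norm (low \<alpha> (v a)) <= R" and A: "norm (v a) <= A" "1 <= A"
 shows "holder a b A v" and "\<And>t. a <= t ==> t <= b ==> norm (v t) <= 2 * A"
proof -
 define \<delta> where "\<delta> = 1 / A"
 have \<delta>: "0 < \<delta>" "\<delta> <= 1" using A(2) by (auto simp: \<delta>_def)
 interpret Y: young "Xk T w (aff \<alpha> \<delta>) :: _ => _ => _ => 'm l2 => _" "XXk w (aff \<alpha> \<delta>)"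
  "Fk w (aff \<alpha> \<delta>)" "\<lambda>N. opC TYPE('m) \<rho> * (3 powr \<alpha> * (1 * (1 + res N) powr \<rho>))" "solC TYPE('m) \<rho> \<alpha> K" \<gamma> T
  by (rule young_affine[OF \<alpha> \<delta>(1)])
 have "\<delta> * norm (v a) <= 1" using A by (simp add: \<delta>_def)
 then have r: "norm (rescale \<alpha> \<delta> (v a)) <= R + 1" using norm_rescale_le[OF \<alpha> \<delta>, of "v a"] R by linarith
 \<comment> \<open>The 2 in \<open>R + 2\<close> is made of 1 for the part \<delta> * norm (v a) of
   the rescaled datum and 1 for the growth of the solution during the step.\<close>
 have short': "short_time (solC TYPE('m) \<rho> \<alpha> K) \<gamma> T ((R + 1) + 1) (b - a)" using short by (simp add: add.commute)
 note h = Y.sol_short_bound(1)[OF nsol_rescale(1)[OF \<alpha> \<delta> ab v] ab r short']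
 show hv: "holder a b A v"
 proof (rule holderI)
  fix s t assume st: "a <= s" "s <= t" "t <= b"
  have "v t - v s = unscale \<alpha> \<delta> (rescale \<alpha> \<delta> (v t) - rescale \<alpha> \<delta> (v s))"
   by (simp add: unscale_diff[OF \<alpha> \<delta>] unscale_rescale[OF \<alpha> \<delta>])
  also have "norm ... <= 1 / \<delta> * norm (rescale \<alpha> \<delta> (v t) - rescale \<alpha> \<delta> (v s))" by (rule norm_unscale_le[OF \<alpha> \<delta>])
  also have "... <= 1 / \<delta> * (1 * sqrt (t - s))" using \<delta> by (intro mult_left_mono holderD[OF h st]) auto
  finally show "norm (v t - v s) <= A * sqrt (t - s)" by (simp add: \<delta>_def)
 qed
 fix t assume t: "a <= t" "t <= b"
 have "t - a <= 1" using short t by (simp add: short_time_def)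
 then have "A * sqrt (t - a) <= A * 1" using A(2) by (intro mult_left_mono) auto
 then have "norm (v t - v a) <= A" using holderD[OF hv order_refl t] by simp
 then show "norm (v t) <= 2 * A" using A(1) norm_triangle_ineq[of "v a" "v t - v a"] by simp
qed

text \<open>Every step of length \<tau> at most doubles the bound in H^\<alpha>. The next step
  starts with the same L^2 bound R, by conservation, hence with the same \<tau>; so after k steps
  the bound is \<open>2 ^ k * A\<close>.\<close>

lemma apriori_bound:
 fixes v :: "real => 'm::l2dom l2"
 assumes \<alpha>: "\<alpha> >= 0" and \<tau>: "0 < \<tau>" "short_time (solC TYPE('m) \<rho> \<alpha> K) \<gamma> T (R + 2) \<tau>"
  and v: "nsol w (japw \<alpha>) 0 b v" and b: "0 <= b" "b <= T" "b <= real k * \<tau>"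
  and R: "norm (low \<alpha> (v 0)) <= R" and A: "norm (v 0) <= A" "1 <= A"
 shows "ctrl 0 b (2 ^ k * A) v"
 using v b
proof (induction k arbitrary: b)
 case 0
 then show ?case using A by (auto simp: ctrl_def holder_def)
next
 case (Suc k)
 interpret Y: young "Xk T w (japw \<alpha>) :: _ => _ => _ => 'm l2 => _" "XXk w (japw \<alpha>)"
  "Fk w (japw \<alpha>)" "\<lambda>N. opC TYPE('m) \<rho> * (3 powr \<alpha> * (1 * (1 + res N) powr \<rho>))" "solC TYPE('m) \<rho> \<alpha> K" \<gamma> T
  by (rule young_japw[OF \<alpha>])
 define m where "m = min b (real k * \<tau>)"
 have m: "0 <= m" "m <= b" "m <= T" "m <= real k * \<tau>" "b - m <= \<tau>"
  using Suc.prems \<tau> by (auto simp: m_def algebra_simps)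
 define A' where "A' = 2 ^ k * A"
 have A': "1 <= A'" using A(2) mult_mono[of 1 "2 ^ k :: real" 1 A] by (simp add: A'_def)
 have c1: "ctrl 0 m A' v" unfolding A'_def
  by (rule Suc.IH[OF Y.sol_subinterval[OF Suc.prems(1)]]) (use Suc.prems m in auto)
 have R': "norm (low \<alpha> (v m)) <= R"
  using low_conserved[OF \<alpha> Suc.prems(1,3) m(1,2)] R by simp
 have R0: "0 <= R" using R order_trans[OF norm_ge_zero] by blast
 have short: "short_time (solC TYPE('m) \<rho> \<alpha> K) \<gamma> T (R + 2) (b - m)"
  by (rule short_time_mono[OF \<tau>(2) \<gamma> solC_nonneg T]) (use R0 m in auto)
 note st = apriori_step[OF \<alpha> Y.sol_subinterval[OF Suc.prems(1) order_refl Suc.prems(3) m(1,2) order_refl] m(1,2) Suc.prems(3) short R'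
   ctrl_norm[OF c1 m(1) order_refl] A']
 have h: "holder 0 b (A' + A') v"
  by (rule holder_join[OF ctrl_holder[OF c1] st(1)]) (use m A' in auto)
 have n: "norm (v t) <= A' + A'" if "0 <= t" "t <= b" for t
  using st(2)[of t] ctrl_norm[OF c1, of t] that A' by (cases "t <= m") auto
 have e: "2 ^ Suc k * A = A' + A'" by (simp add: A'_def)
 show ?case unfolding ctrl_def e using h n by auto
qed

section \<open>Global existence, uniqueness and Lipschitz dependence in the interaction
  representation\<close>

text \<open>The length \<tau> is fixed once by the L^2 norm of the datum. At each restart \<delta>
  is adapted to the current H^\<alpha> norm, the equation is solved locally with the regularised
  weight, and the solution is brought back by \<open>unscale\<close> and glued.\<close>

lemma nsol_exists:
 fixes u0 :: "'m::l2dom l2"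
 assumes \<alpha>: "\<alpha> >= 0"
 shows "\<exists>v. v 0 = u0 \<and> nsol w (japw \<alpha>) 0 T v"
proof -
 define R where "R = norm (low \<alpha> u0)"
 have R0: "0 <= R" unfolding R_def by simp
 obtain \<tau> where \<tau>: "0 < \<tau>" "short_time (solC TYPE('m) \<rho> \<alpha> K) \<gamma> T (R + 2) \<tau>"
  using ex_short_time[OF \<gamma> solC_nonneg T, of "R + 2"] R0 by auto
 interpret Y: young "Xk T w (japw \<alpha>) :: _ => _ => _ => 'm l2 => _" "XXk w (japw \<alpha>)"
  "Fk w (japw \<alpha>)" "\<lambda>N. opC TYPE('m) \<rho> * (3 powr \<alpha> * (1 * (1 + res N) powr \<rho>))" "solC TYPE('m) \<rho> \<alpha> K" \<gamma> T
  by (rule young_japw[OF \<alpha>])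
 have "\<exists>v. v 0 = u0 \<and> Y.sol 0 (min T (real k * \<tau>)) v" for k
 proof (induction k)
  case 0
  have "Y.sol 0 0 (\<lambda>_. u0)" unfolding Y.sol_def Y.J_def holder_def by auto
  then show ?case using T by (auto simp: min_absorb2)
 next
  case (Suc k)
  define m where "m = min T (real k * \<tau>)"
  define b where "b = min T (real (Suc k) * \<tau>)"
  have mb: "0 <= m" "m <= b" "b <= T" "b - m <= \<tau>" "m <= T"
   using T \<tau> by (auto simp: m_def b_def algebra_simps min_def)
  obtain v where v: "v 0 = u0" "Y.sol 0 m v" using Suc.IH unfolding m_def by blast
  have R': "norm (low \<alpha> (v m)) = R"
   using low_conserved[OF \<alpha> v(2) mb(5,1) order_refl] v(1) by (simp add: R_def)
  \<comment> \<open>The summand 1 gives \<delta> \<le> 1 and covers v m = 0; \<delta> times the norm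
    of v m stays at most 1.\<close>
  define \<delta> where "\<delta> = 1 / (norm (v m) + 1)"
  have \<delta>: "0 < \<delta>" "\<delta> <= 1" by (auto simp: \<delta>_def add_nonneg_pos)
  interpret Z: young "Xk T w (aff \<alpha> \<delta>) :: _ => _ => _ => 'm l2 => _" "XXk w (aff \<alpha> \<delta>)"
   "Fk w (aff \<alpha> \<delta>)" "\<lambda>N. opC TYPE('m) \<rho> * (3 powr \<alpha> * (1 * (1 + res N) powr \<rho>))" "solC TYPE('m) \<rho> \<alpha> K" \<gamma> T
   by (rule young_affine[OF \<alpha> \<delta>(1)])
  have "\<delta> * norm (v m) <= 1" by (simp add: \<delta>_def divide_le_eq_1 add_nonneg_pos)
  then have r: "norm (rescale \<alpha> \<delta> (v m)) <= R + 1" using norm_rescale_le[OF \<alpha> \<delta>, of "v m"] R' by linarith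
  have short: "short_time (solC TYPE('m) \<rho> \<alpha> K) \<gamma> T ((R + 1) + 1) (b - m)"
   by (rule short_time_mono[OF \<tau>(2) \<gamma> solC_nonneg T]) (use R0 mb in auto)
  obtain z where z: "z m = rescale \<alpha> \<delta> (v m)" "Z.sol m b z"
   using Z.local_solution[OF mb(1-3) r short] by blast
  define v' where "v' t = (if t <= m then v t else unscale \<alpha> \<delta> (z t))" for t
  have "Y.sol 0 m v'" by (rule Y.sol_cong[OF v(2)]) (simp add: v'_def)
  moreover have "Y.sol m b v'"
   by (rule Y.sol_cong[OF nsol_rescale(2)[OF \<alpha> \<delta> mb(1-3) z(2)]])
    (auto simp: v'_def z(1) unscale_rescale[OF \<alpha> \<delta>])
  ultimately have "Y.sol 0 b v'" by (rule Y.sol_join) (use mb in auto)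
  moreover have "v' 0 = u0" using v(1) mb(1) by (simp add: v'_def)
  ultimately show ?case unfolding b_def by blast
 qed
 moreover obtain k where "T <= real k * \<tau>" using reals_Archimedean3[OF \<tau>(1)] by (meson less_imp_le)
 ultimately show ?thesis by (metis min_absorb1)
qed

lemma nsol_unique:
 fixes u v :: "real => 'm::l2dom l2"
 assumes \<alpha>: "\<alpha> >= 0" and u: "nsol w (japw \<alpha>) 0 T u" and v: "nsol w (japw \<alpha>) 0 T v" and "u 0 = v 0"
  and t: "0 <= t" "t <= T"
 shows "u t = v t"
 by (rule young.sol_unique[OF young_japw[OF \<alpha>] u v assms(4) order_refl order_refl t])

text \<open>The a priori bound gives all solutions with data in a ball of radius A one common
  control on [0,T], and stability of bounded solutions then yields a single L.\<close>

lemma nsol_lipschitz: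
 assumes \<alpha>: "\<alpha> >= 0"
 shows "\<exists>L\<ge>0. \<forall>u v :: real => 'm::l2dom l2. nsol w (japw \<alpha>) 0 T u --> nsol w (japw \<alpha>) 0 T v -->
  norm (u 0) <= A --> norm (v 0) <= A --> ctrl 0 T (L * norm (u 0 - v 0)) (\<lambda>t. u t - v t)"
proof -
 define A' where "A' = max A 1"
 obtain \<tau> where \<tau>: "0 < \<tau>" "short_time (solC TYPE('m) \<rho> \<alpha> K) \<gamma> T (A' + 2) \<tau>"
  using ex_short_time[OF \<gamma> solC_nonneg T, of "A' + 2"] by (auto simp: A'_def)
 obtain k where k: "T <= real k * \<tau>" using reals_Archimedean3[OF \<tau>(1)] by (meson less_imp_le)
 have low: "norm (low \<alpha> x) <= A'" if "norm x <= A" for x :: "'m l2"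
  using norm_mult_le[OF bmult_scale(1)[OF \<alpha>, of 1], of x] that unfolding low_def by (simp add: A'_def)
 have c: "ctrl 0 T (2 ^ k * A') u" if "nsol w (japw \<alpha>) 0 T u" "norm (u 0) <= A" for u :: "real => 'm l2"
  by (rule apriori_bound[OF \<alpha> \<tau> that(1) T order_refl k low[OF that(2)]]) (use that(2) in "auto simp: A'_def")
 have "1 <= 2 ^ k * A'" using mult_mono[of 1 "2 ^ k :: real" 1 A'] by (simp add: A'_def)
 from young.sol_lipschitz[OF young_japw[OF \<alpha>] this]
 show ?thesis using c T by blast
qed

end

text \<open>Solutions on [0,n] agree on common times by uniqueness, so the value at t may be taken
  from the one on [0,n] with n the least integer above t.\<close>

lemma global_nsol:
 fixes u0 :: "'m::l2dom l2"
 assumes m: "\<And>T. T >= 0 ==> \<exists>K. modulation \<rho> \<gamma> T K w" and \<alpha>: "\<alpha> >= 0"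
 shows "\<exists>v. v 0 = u0 \<and> (\<forall>T\<ge>0. nsol w (japw \<alpha>) 0 T v)"
proof -
 have "\<exists>v. v 0 = u0 \<and> nsol w (japw \<alpha>) 0 (real n) v" for n
  using m[of "real n"] modulation.nsol_exists[OF _ \<alpha>] by force
 then obtain V where V: "\<And>n. V n 0 = u0" "\<And>n. nsol w (japw \<alpha>) 0 (real n) (V n)" by metis
 define v where "v t = V (nat \<lceil>t\<rceil>) t" for t
 have sub: "nsol w (japw \<alpha>) 0 T (V n)" if T: "0 <= T" "T <= real n" for T n
 proof -
  obtain K where "modulation \<rho> \<gamma> (real n) K w" using m[of "real n"] by auto
  from young.sol_subinterval[OF modulation.young_japw[OF this \<alpha>] V(2)] show ?thesis using T by auto
 qed
 have eq: "V n t = v t" if t: "0 <= t" "t <= real n" for n t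
 proof -
  obtain K where "modulation \<rho> \<gamma> t K w" using m[OF t(1)] by auto
  from modulation.nsol_unique[OF this \<alpha> sub[OF t] sub[OF t(1), of "nat \<lceil>t\<rceil>"] _ t(1) order_refl]
  show ?thesis using V(1) t by (simp add: v_def real_nat_ceiling_ge)
 qed
 have "nsol w (japw \<alpha>) 0 T v" if T: "0 <= T" for T
 proof -
  obtain K where K: "modulation \<rho> \<gamma> T K w" using m[OF T] by auto
  have n: "T <= real (nat \<lceil>T\<rceil>)" by (rule real_nat_ceiling_ge)
  show ?thesis
   by (rule young.sol_cong[OF modulation.young_japw[OF K \<alpha>] sub[OF T n]]) (rule eq, assumption, rule order_trans[OF _ n])
 qed
 moreover have "v 0 = u0" using V(1) by (simp add: v_def)
 ultimately show ?thesis by blast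
qed

subsection \<open>Interaction representation of the equation\<close>

text \<open>The symbol of the propagators: \<open>ph (w t)\<close> belongs to the inverse propagator
  \<open>U_inv\<close> and \<open>ph (- w t)\<close> to \<open>U\<close>.\<close>

definition ph :: "real => real => complex" where "ph \<sigma> \<xi> = cis (\<sigma> * \<xi>\<^sup>2)"

lemma ph_measurable [measurable]: "ph \<sigma> \<in> borel_measurable borel"
 unfolding ph_def[abs_def] by measurable

lemma bmult_ph: "bmult TYPE('m::l2dom) 1 (ph \<sigma>)"
 using borel_measurable_freq[OF ph_measurable] by (simp add: bmult_def ph_def)

lemma ph_inverse: "mult (ph \<sigma>) (mult (ph (- \<sigma>)) u) = (u :: 'm::l2dom l2)" "mult (ph (- \<sigma>)) (mult (ph \<sigma>) u) = u"
proof -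
 have 1: "bmult TYPE('m) 1 (\<lambda>\<xi>. 1)" by (simp add: bmult_def)
 have e: "ph \<sigma> \<xi> * ph (- \<sigma>) \<xi> = 1" "ph (- \<sigma>) \<xi> * ph \<sigma> \<xi> = 1" for \<xi> by (simp_all add: ph_def cis_mult)
 show "mult (ph \<sigma>) (mult (ph (- \<sigma>)) u) = u" "mult (ph (- \<sigma>)) (mult (ph \<sigma>) u) = u"
  unfolding mult_mult[OF bmult_ph bmult_ph] e by (rule mult_one[OF 1], simp)+
qed

lemma schroedinger_ph: "schroedinger M \<tau> = fourier_mult M (ph (- \<tau>))"
 by (simp add: schroedinger_def ph_def[abs_def] cis_conv_exp)

lemma toV_U:
 assumes "f \<in> sob TYPE('m::l2dom) \<alpha>"
 shows "U (dom_of TYPE('m)) w t f \<in> sob TYPE('m) \<alpha>"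
  and "(toV \<alpha> (U (dom_of TYPE('m)) w t f) :: 'm l2) = mult (ph (- w t)) (toV \<alpha> f)"
 unfolding U_def schroedinger_ph using toV_fourier_mult[OF assms bmult_ph] by auto

lemma toV_U_inv:
 assumes "f \<in> sob TYPE('m::l2dom) \<alpha>"
 shows "U_inv (dom_of TYPE('m)) w t f \<in> sob TYPE('m) \<alpha>"
  and "(toV \<alpha> (U_inv (dom_of TYPE('m)) w t f) :: 'm l2) = mult (ph (w t)) (toV \<alpha> f)"
 unfolding U_inv_def schroedinger_ph minus_minus using toV_fourier_mult[OF assms bmult_ph] by auto

lemma toV_cubic_trunc:
 assumes \<alpha>: "\<alpha> >= 0" and f: "f \<in> sob TYPE('m::l2dom) \<alpha>"
 shows "cubic_trunc (dom_of TYPE('m)) N f \<in> sob TYPE('m) \<alpha>"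
  and "(toV \<alpha> (cubic_trunc (dom_of TYPE('m)) N f) :: 'm l2)
   = Op (ker (japw \<alpha>) (cut N) (\<lambda>a. 1)) (toV \<alpha> f) (toV \<alpha> f) (toV \<alpha> f)"
proof -
 let ?M = "dom_of TYPE('m)"
 define k where "k = ker (japw \<alpha>) (cut N) (\<lambda>a. 1)"
 define F where "F = fourier ?M f"
 define G where "G \<xi> = of_real (japw \<alpha> \<xi>) * F \<xi>" for \<xi>
 \<comment> \<open>The cutoff kernel decays with any exponent, so 1 is chosen here; no irregularity
   enters at a fixed time.\<close>
 have one: "(1::real) > 1/2" by simp
 have k: "kern 1 (3 powr \<alpha> * (1 * (1 + res N) powr 1)) k"
  unfolding k_def by (rule kern_ker_cut[OF weight_japw[OF \<alpha>]]) auto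
 have G: "G \<in> L2 (freq ?M)" using sobolev_weighted[OF f] unfolding G_def[abs_def] F_def .
 have O: "OpF ?M k G G G \<in> L2 (freq ?M)" by (rule OpF_L2[OF one k G G G])
 note ct = cubic_trunc_fourier[OF sobolev_L2[OF f] one, of N]
 have eq: "OpF ?M k G G G \<xi> = of_real (japw \<alpha> \<xi>) * OpF ?M (ker (\<lambda>\<xi>. 1) (cut N) (\<lambda>a. 1)) F F F \<xi>" for \<xi>
  unfolding OpF_def LINT_cmult[symmetric]
 proof (rule LINT_cong)
  fix z :: "real \<times> real"
  have j: "complex_of_real (japw \<alpha> x) \<noteq> 0" for x using japw_pos[of \<alpha> x] by simp
  show "k \<xi> (fst z) (snd z) * tri3 G G G \<xi> z
   = of_real (japw \<alpha> \<xi>) * (ker (\<lambda>\<xi>. 1) (cut N) (\<lambda>a. 1) \<xi> (fst z) (snd z) * tri3 F F F \<xi> z)"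
   unfolding k_def ker_def tri3_def G_def using j by (simp add: divide_simps)
 qed
 have ae: "AE \<xi> in freq ?M. of_real (japw \<alpha> \<xi>) * fourier ?M (cubic_trunc ?M N f) \<xi> = OpF ?M k G G G \<xi>"
  using ct(2) unfolding F_def[symmetric] by eventually_elim (simp add: eq)
 show s: "cubic_trunc ?M N f \<in> sob TYPE('m) \<alpha>" by (rule sobolevI[OF ct(1) O ae])
 have "(toV \<alpha> (cubic_trunc ?M N f) :: 'm l2) = toL2 (OpF ?M k G G G)"
  unfolding toV_def by (rule toL2_cong[OF sobolev_weighted[OF s] O ae])
 also have "... = Op k (toL2 G) (toL2 G) (toL2 G)" by (rule Op_toL2[OF one k G G G, symmetric])
 finally show "(toV \<alpha> (cubic_trunc ?M N f) :: 'm l2) = Op (ker (japw \<alpha>) (cut N) (\<lambda>a. 1)) (toV \<alpha> f) (toV \<alpha> f) (toV \<alpha> f)"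
  unfolding k_def toV_def G_def[abs_def] F_def .
qed

text \<open>Conjugating the cubic term by the propagator multiplies its kernel by the phase of the
  resonance function: the squares of the four frequencies combine to 2 p q, with a minus sign in the
  conjugated slot.\<close>

lemma toV_integrand:
 fixes f :: "real => complex" and w :: "real => real" and s :: real
 assumes \<alpha>: "\<alpha> >= 0" and f: "f \<in> sob TYPE('m::l2dom) \<alpha>"
 defines "v \<equiv> (toV \<alpha> (U_inv (dom_of TYPE('m)) w s f) :: 'm l2)"
 shows "U_inv (dom_of TYPE('m)) w s (cubic_trunc (dom_of TYPE('m)) N f) \<in> sob TYPE('m) \<alpha>"
  and "(toV \<alpha> (U_inv (dom_of TYPE('m)) w s (cubic_trunc (dom_of TYPE('m)) N f)) :: 'm l2) = Fk w (japw \<alpha>) N s v v v"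
proof -
 show "U_inv (dom_of TYPE('m)) w s (cubic_trunc (dom_of TYPE('m)) N f) \<in> sob TYPE('m) \<alpha>"
  by (rule toV_U_inv(1)[OF toV_cubic_trunc(1)[OF \<alpha> f]])
 have one: "(1::real) > 1/2" by simp
 have k: "kern 1 (3 powr \<alpha> * (1 * (1 + res N) powr 1)) (ker (japw \<alpha>) (cut N) (\<lambda>a. 1))"
  "kern 1 (3 powr \<alpha> * (1 * (1 + res N) powr 1)) (ker (japw \<alpha>) (cut N) (\<lambda>a. cis (a * w s)))"
  by (rule kern_ker_cut[OF weight_japw[OF \<alpha>]]; simp)+
 show "(toV \<alpha> (U_inv (dom_of TYPE('m)) w s (cubic_trunc (dom_of TYPE('m)) N f)) :: 'm l2) = Fk w (japw \<alpha>) N s v v v"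
  unfolding v_def toV_U_inv(2)[OF toV_cubic_trunc(1)[OF \<alpha> f]] toV_U_inv(2)[OF f] toV_cubic_trunc(2)[OF \<alpha> f] Fk_def
 proof (rule Op_intertwine[OF one k ph_measurable])
  show "cmod (ph (w s) \<xi>) <= 1" for \<xi> by (simp add: ph_def)
  fix \<xi> p q
  have "w s * \<xi>\<^sup>2 = 2 * (p * q) * w s + (w s * (\<xi> - p)^2 + - (w s * (\<xi> - p - q)^2) + w s * (\<xi> - q)^2)"
   by (simp add: power2_eq_square algebra_simps)
  then have "ph (w s) \<xi> = cis (2 * (p * q) * w s) * (ph (w s) (\<xi> - p) * cnj (ph (w s) (\<xi> - p - q)) * ph (w s) (\<xi> - q))"
   unfolding ph_def cis_cnj cis_mult by (simp only:)
  then show "ph (w s) \<xi> * ker (japw \<alpha>) (cut N) (\<lambda>a. 1) \<xi> p q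
   = ker (japw \<alpha>) (cut N) (\<lambda>a. cis (a * w s)) \<xi> p q * (ph (w s) (\<xi> - p) * cnj (ph (w s) (\<xi> - p - q)) * ph (w s) (\<xi> - q))"
   unfolding ker_def by (simp only: mult_ac mult_1_left)
 qed
qed

definition profile :: "real => (real => real) => (real => real => complex) => real => 'm::l2dom l2" where
 "profile \<alpha> w \<phi> t = toV \<alpha> (U_inv (dom_of TYPE('m)) w t (\<phi> t))"

lemma time_halfline: "{t. 0 <= t \<and> ereal t < \<infinity>} = {0..}"
 by auto

lemma continuous_on_halfline:
 fixes f :: "real => 'b::topological_space"
 assumes "\<And>T. T >= 0 ==> continuous_on {0..T} f" shows "continuous_on {0..} f"
 unfolding continuous_on_eq_continuous_within
proof
 fix x :: real assume x: "x \<in> {0..}"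
 have "at x within {0..} = at x within {0..x+1}"
  by (rule at_within_nhd[of x "{..<x+1}"]) auto
 moreover have "continuous (at x within {0..x+1}) f"
  using assms[of "x + 1"] x by (auto simp: continuous_on_eq_continuous_within)
 ultimately show "continuous (at x within {0..}) f" by simp
qed

text \<open>The propagator is only strongly continuous in time. The variation of the phase is
  therefore applied to the fixed vector v y, and the variation of v is handled by the contraction
  property.\<close>

lemma mult_ph_continuous:
 fixes v :: "real => 'm::l2dom l2"
 assumes w: "continuous_on S w" and v: "continuous_on S v"
 shows "continuous_on S (\<lambda>t. mult (ph (w t)) (v t))"
proof (rule continuous_onI_LIMSEQ)
 fix x y assume x: "\<forall>n. x n \<in> S" and y: "y \<in> S" and lim: "x \<longlonglongrightarrow> y"
 have lw: "(\<lambda>n. w (x n)) \<longlonglongrightarrow> w y" and lv: "(\<lambda>n. v (x n)) \<longlonglongrightarrow> v y"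
  using w v x y lim by (auto simp: continuous_on_sequentially o_def)
 have 1: "(\<lambda>n. mult (ph (w (x n))) (v y)) \<longlonglongrightarrow> mult (ph (w y)) (v y)"
  by (rule mult_tendsto[OF bmult_ph bmult_ph]) (unfold ph_def, intro tendsto_intros lw)
 have n: "norm (mult (ph \<sigma>) u) <= norm u" for \<sigma> and u :: "'m l2"
  using norm_mult_le[OF bmult_ph, of \<sigma> u] by simp
 have "(\<lambda>n. v (x n) - v y) \<longlonglongrightarrow> 0" using lv by (simp add: LIM_zero_iff)
 then have 2: "(\<lambda>n. mult (ph (w (x n))) (v (x n) - v y)) \<longlonglongrightarrow> 0"
  by (rule LIMSEQ_0_le[OF n tendsto_norm_zero])
 show "(\<lambda>n. mult (ph (w (x n))) (v (x n))) \<longlonglongrightarrow> mult (ph (w y)) (v y)"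
  using tendsto_add[OF 2 1] by (simp add: mult_diff[OF bmult_ph])
qed

lemma sobn_diff:
 assumes "f \<in> sob TYPE('m::l2dom) \<alpha>" "g \<in> sob TYPE('m) \<alpha>"
 shows "sobn TYPE('m) \<alpha> (\<lambda>x. f x - g x) = norm (toV \<alpha> f - toV \<alpha> g :: 'm l2)"
 using norm_toV[OF toV_diff(1)[OF assms]] toV_diff(2)[OF assms] by simp

context
 fixes \<rho> \<gamma> \<alpha> :: real and w :: "real => real"
 assumes mod: "\<And>T. T >= 0 ==> \<exists>K. modulation \<rho> \<gamma> T K w" and \<alpha>: "\<alpha> >= 0"
begin

text \<open>In coordinates the truncated Duhamel integrals are the \<open>J N\<close> of the Young
  theory and the profile is the path v. Membership in the controlled space supplies exactly the
  Hoelder continuity, and the convergence of the Duhamel integrals the remaining clause.\<close>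

lemma solution_nsol:
 fixes \<phi> :: "real => real => complex"
 assumes \<phi>0: "\<phi>0 \<in> sob TYPE('m::l2dom) \<alpha>"
  and sol: "is_global_solution (dom_of TYPE('m)) \<alpha> w \<phi>0 \<phi>" and con: "\<phi> \<in> controlled (dom_of TYPE('m)) \<alpha> w"
 defines "v \<equiv> (profile \<alpha> w \<phi> :: real => 'm l2)"
 shows "v 0 = toV \<alpha> \<phi>0" and "T >= 0 ==> nsol w (japw \<alpha>) 0 T v"
proof -
 let ?M = "dom_of TYPE('m)"
 obtain J JN where \<phi>c: "continuous_path ?M \<alpha> {0..} \<phi>" and Jc: "continuous_path ?M \<alpha> {0..} J"
  and JNc: "\<And>N. continuous_path ?M \<alpha> {0..} (JN N)"
  and JNi: "\<And>N t. 0 <= t ==> has_sobolev_integral ?M \<alpha> (\<lambda>s. U_inv ?M w s (cubic_trunc ?M N (\<phi> s))) (JN N t) t"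
  and lim: "\<And>S. 0 <= S ==> uniform_limit {0..S} (\<lambda>N t. sobolev_norm ?M \<alpha> (\<lambda>x. JN N t x - J t x)) (\<lambda>_. 0) sequentially"
  and eq: "\<And>t. 0 <= t ==> AE x in phys ?M. \<phi> t x = U ?M w t \<phi>0 x + U ?M w t (J t) x"
  using sol unfolding is_solution_def is_duhamel_integral_def time_halfline by auto
 have s\<phi>: "\<phi> t \<in> sob TYPE('m) \<alpha>" and sJ: "J t \<in> sob TYPE('m) \<alpha>" and sJN: "JN N t \<in> sob TYPE('m) \<alpha>" if "0 <= t" for t N
  using \<phi>c Jc JNc[of N] that unfolding continuous_path_def by auto
 have vt: "v t = toV \<alpha> \<phi>0 + toV \<alpha> (J t)" if t: "0 <= t" for t
 proof -
  note s = toV_add_scale[OF toV_U(1)[OF \<phi>0, of w t] toV_U(1)[OF sJ[OF t], of w t], where c = 1]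
  have "AE x in phys ?M. \<phi> t x = U ?M w t \<phi>0 x + of_real 1 * U ?M w t (J t) x" using eq[OF t] by simp
  then have "(toV \<alpha> (\<phi> t) :: 'm l2) = toV \<alpha> (\<lambda>x. U ?M w t \<phi>0 x + of_real 1 * U ?M w t (J t) x)"
   using toV_eq_iff[OF s\<phi>[OF t] s(1)] by blast
  also have "... = mult (ph (- w t)) (toV \<alpha> \<phi>0 + toV \<alpha> (J t))"
   unfolding s(2) toV_U(2)[OF \<phi>0] toV_U(2)[OF sJ[OF t]] by (simp add: mult_add[OF bmult_ph])
  finally show ?thesis unfolding v_def profile_def toV_U_inv(2)[OF s\<phi>[OF t]] by (simp add: ph_inverse)
 qed
 have int: "((\<lambda>s. Fk w (japw \<alpha>) N s (v s) (v s) (v s)) has_integral toV \<alpha> (JN N t)) {0..t}" if t: "0 <= t" for N t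
 proof -
  have "((\<lambda>s. toV \<alpha> (U_inv ?M w s (cubic_trunc ?M N (\<phi> s))) :: 'm l2) has_integral toV \<alpha> (JN N t)) {0..t}"
   using JNi[OF t, of N] has_sobolev_integral_iff[of t "\<lambda>s. U_inv ?M w s (cubic_trunc ?M N (\<phi> s))" \<alpha>, where 'm = 'm]
    toV_integrand(1)[OF \<alpha> s\<phi>] by blast
  moreover have "toV \<alpha> (U_inv ?M w s (cubic_trunc ?M N (\<phi> s))) = Fk w (japw \<alpha>) N s (v s) (v s) (v s)" if "s \<in> {0..t}" for s
   using toV_integrand(2)[OF \<alpha> s\<phi>] that unfolding v_def profile_def by auto
  ultimately show ?thesis by (rule has_integral_eq[rotated])
 qed
 have limt: "(\<lambda>N. toV \<alpha> (JN N t) :: 'm l2) \<longlonglongrightarrow> toV \<alpha> (J t)" if t: "0 <= t" for t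
 proof -
  have "(\<lambda>N. sobolev_norm ?M \<alpha> (\<lambda>x. JN N t x - J t x)) \<longlonglongrightarrow> 0"
   using tendsto_uniform_limitI[OF lim[OF t], of t] t by simp
  then have "(\<lambda>N. norm (toV \<alpha> (JN N t) - toV \<alpha> (J t) :: 'm l2)) \<longlonglongrightarrow> 0"
   by (simp add: sobn_diff[OF sJN[OF t] sJ[OF t]])
  then show ?thesis by (simp add: tendsto_norm_zero_iff LIM_zero_iff)
 qed
 have "(toV \<alpha> (JN N 0) :: 'm l2) = 0" for N
  using integral_unique[OF int[of 0 N]] by simp
 then have J0: "(toV \<alpha> (J 0) :: 'm l2) = 0" using limt[of 0] by (simp add: LIMSEQ_const_iff)
 then show v0: "v 0 = toV \<alpha> \<phi>0" using vt[of 0] by simp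
 assume T: "T >= 0"
 obtain K where K: "modulation \<rho> \<gamma> T K w" using mod[OF T] by auto
 interpret Y: young "Xk T w (japw \<alpha>) :: _ => _ => _ => 'm l2 => _" "XXk w (japw \<alpha>)"
  "Fk w (japw \<alpha>)" "\<lambda>N. opC TYPE('m) \<rho> * (3 powr \<alpha> * (1 * (1 + res N) powr \<rho>))" "solC TYPE('m) \<rho> \<alpha> K" \<gamma> T
  by (rule modulation.young_japw[OF K \<alpha>])
 \<comment> \<open>Control is assumed for positive horizons, while T = 0 is allowed here.\<close>
 have "\<phi> \<in> controlled_upto ?M \<alpha> w (T + 1)" using con T by (simp add: controlled_def)
 then obtain C where C: "\<And>s t. 0 <= s ==> s < t ==> t <= T + 1 ==>
   sobolev_norm ?M \<alpha> (\<lambda>x. U_inv ?M w t (\<phi> t) x - U_inv ?M w s (\<phi> s) x) <= C * \<bar>t - s\<bar> powr (1/2)"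
  unfolding controlled_upto_def by blast
 have h: "holder 0 T C v"
 proof (rule holderI)
  fix s t assume st: "0 <= s" "s <= t" "t <= T"
  show "norm (v t - v s) <= C * sqrt (t - s)"
  proof (cases "s = t")
   case False
   have t0: "0 <= t" using st by simp
   show ?thesis using C[of s t] st False
     sobn_diff[OF toV_U_inv(1)[OF s\<phi>[OF t0], of w t] toV_U_inv(1)[OF s\<phi>[OF st(1)], of w s]]
    unfolding v_def profile_def by (simp add: powr_half_sqrt)
  qed simp
 qed
 show "nsol w (japw \<alpha>) 0 T v"
  unfolding Y.sol_def
 proof (intro conjI ballI exI[of _ C] h)
  fix t assume t: "t \<in> {0..T}"
  have "Y.J N 0 t v v v = toV \<alpha> (JN N t)" for N
   unfolding Y.J_def using int[of t N] t by (intro integral_unique) auto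
  then show "(\<lambda>N. Y.J N 0 t v v v) \<longlonglongrightarrow> v t - v 0" using limt[of t] vt[of t] v0 t by simp
 qed
qed

text \<open>A solution in coordinates has pointwise convergence of the truncated integrals; the
  uniform convergence on compact intervals demanded of a solution comes from
  \<open>J_uniform_limit\<close>.\<close>

lemma nsol_solution:
 fixes v :: "real => 'm::l2dom l2"
 assumes w: "continuous_on {0..} w" and \<phi>0: "\<phi>0 \<in> sob TYPE('m::l2dom) \<alpha>"
  and v: "\<And>T. T >= 0 ==> nsol w (japw \<alpha>) 0 T v" and v0: "v 0 = toV \<alpha> \<phi>0"
 shows "\<exists>\<phi>. is_global_solution (dom_of TYPE('m)) \<alpha> w \<phi>0 \<phi> \<and> \<phi> \<in> controlled (dom_of TYPE('m)) \<alpha> w"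
proof -
 let ?M = "dom_of TYPE('m)"
 define \<phi> where "\<phi> t = fromV \<alpha> (mult (ph (- w t)) (v t))" for t
 define G where "G N s = Fk w (japw \<alpha>) N s (v s) (v s) (v s)" for N s
 define J where "J t = fromV \<alpha> (v t - v 0)" for t
 define JN where "JN N t = fromV \<alpha> (integral {0..t} (G N))" for N t
 note F = fromV[OF \<alpha>]
 have s\<phi>: "\<phi> t \<in> sob TYPE('m) \<alpha>" and sJ: "J t \<in> sob TYPE('m) \<alpha>" and sJN: "JN N t \<in> sob TYPE('m) \<alpha>" for t N
  unfolding \<phi>_def J_def JN_def by (rule F)+
 have t\<phi>: "toV \<alpha> (\<phi> t) = mult (ph (- w t)) (v t)" and tJ: "toV \<alpha> (J t) = v t - v 0" and tJN: "toV \<alpha> (JN N t) = integral {0..t} (G N)" for t N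
  unfolding \<phi>_def J_def JN_def by (rule F)+
 have U\<phi>: "toV \<alpha> (U_inv ?M w t (\<phi> t)) = v t" for t
  unfolding toV_U_inv(2)[OF s\<phi>] t\<phi> by (rule ph_inverse)
 have Y: "\<exists>K. young (Xk T w (japw \<alpha>) :: _ => _ => _ => 'm l2 => _) (XXk w (japw \<alpha>)) (Fk w (japw \<alpha>))
   (\<lambda>N. opC TYPE('m) \<rho> * (3 powr \<alpha> * (1 * (1 + res N) powr \<rho>))) (solC TYPE('m) \<rho> \<alpha> K) \<gamma> T" if "T >= 0" for T
  using mod[OF that] modulation.young_japw[OF _ \<alpha>] by blast
 have ctl: "\<exists>M. ctrl 0 T M v" if T: "T >= 0" for T
 proof -
  obtain K where "young (Xk T w (japw \<alpha>) :: _ => _ => _ => 'm l2 => _) (XXk w (japw \<alpha>)) (Fk w (japw \<alpha>))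
   (\<lambda>N. opC TYPE('m) \<rho> * (3 powr \<alpha> * (1 * (1 + res N) powr \<rho>))) (solC TYPE('m) \<rho> \<alpha> K) \<gamma> T" using Y[OF T] by blast
  from young.sol_ctrl[OF this v[OF T] T] show ?thesis by blast
 qed
 have vcT: "continuous_on {0..T} v" if "T >= 0" for T
  using ctl[OF that] holder_continuous ctrl_holder by blast
 have vc: "continuous_on {0..} v" by (rule continuous_on_halfline) (rule vcT)
 have Gc: "continuous_on {0..T} (G N)" if T: "T >= 0" for T N
 proof -
  obtain K where "young (Xk T w (japw \<alpha>) :: _ => _ => _ => 'm l2 => _) (XXk w (japw \<alpha>)) (Fk w (japw \<alpha>))
   (\<lambda>N. opC TYPE('m) \<rho> * (3 powr \<alpha> * (1 * (1 + res N) powr \<rho>))) (solC TYPE('m) \<rho> \<alpha> K) \<gamma> T" using Y[OF T] by blast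
  from young.F_path_continuous[OF this vcT[OF T] vcT[OF T] vcT[OF T]] show ?thesis unfolding G_def[abs_def] by simp
 qed
 have \<phi>c: "continuous_path ?M \<alpha> {0..} \<phi>"
  unfolding continuous_path_iff t\<phi> using s\<phi> w vc by (auto intro!: mult_ph_continuous continuous_on_minus)
 have sol: "is_global_solution ?M \<alpha> w \<phi>0 \<phi>"
  unfolding is_solution_def time_halfline
 proof (intro conjI \<phi>c exI[of _ J] allI impI)
  show "is_duhamel_integral ?M \<alpha> w \<infinity> \<phi> J"
   unfolding is_duhamel_integral_def time_halfline
  proof (intro conjI exI[of _ JN] allI impI)
   show "continuous_path ?M \<alpha> {0..} J"
    unfolding continuous_path_iff tJ using sJ vc by (auto intro!: continuous_intros)
   show "continuous_path ?M \<alpha> {0..} (JN N)" for N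
    unfolding continuous_path_iff tJN using sJN
    by (auto intro!: continuous_on_halfline indefinite_integral_continuous_1 integrable_continuous_interval Gc)
  next
   fix N :: nat and t :: real assume t: "0 <= t"
   have "(G N has_integral integral {0..t} (G N)) {0..t}"
    by (intro integrable_integral integrable_continuous_interval Gc t)
   moreover have "toV \<alpha> (U_inv ?M w s (cubic_trunc ?M N (\<phi> s))) = G N s" for s
    unfolding toV_integrand(2)[OF \<alpha> s\<phi>] U\<phi> G_def ..
   ultimately show "has_sobolev_integral ?M \<alpha> (\<lambda>s. U_inv ?M w s (cubic_trunc ?M N (\<phi> s))) (JN N t) t"
    using has_sobolev_integral_iff[of t "\<lambda>s. U_inv ?M w s (cubic_trunc ?M N (\<phi> s))" \<alpha> "JN N t", where 'm = 'm]
     toV_integrand(1)[OF \<alpha> s\<phi>] sJN[of N t] by (simp add: tJN)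
  next
   fix S :: real assume S: "0 <= S"
   obtain K where K: "young (Xk S w (japw \<alpha>) :: _ => _ => _ => 'm l2 => _) (XXk w (japw \<alpha>)) (Fk w (japw \<alpha>))
    (\<lambda>N. opC TYPE('m) \<rho> * (3 powr \<alpha> * (1 * (1 + res N) powr \<rho>))) (solC TYPE('m) \<rho> \<alpha> K) \<gamma> S" using Y[OF S] by blast
   interpret Y: young "Xk S w (japw \<alpha>) :: _ => _ => _ => 'm l2 => _" "XXk w (japw \<alpha>)" "Fk w (japw \<alpha>)"
    "\<lambda>N. opC TYPE('m) \<rho> * (3 powr \<alpha> * (1 * (1 + res N) powr \<rho>))" "solC TYPE('m) \<rho> \<alpha> K" \<gamma> S by (rule K)
   obtain M where M: "ctrl 0 S M v" using ctl[OF S] by blast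
   have "uniform_limit {0..S} (\<lambda>N t. Y.J N 0 t v v v) (\<lambda>t. Y.JJ 0 t v v v) sequentially"
    using Y.J_uniform_limit[OF M M M] by simp
   moreover have "Y.JJ 0 t v v v = v t - v 0" if "t \<in> {0..S}" for t
    using Y.sol_JJ[OF v[OF S] order_refl order_refl order_refl, of t] that by simp
   ultimately have "uniform_limit {0..S} (\<lambda>N t. Y.J N 0 t v v v) (\<lambda>t. v t - v 0) sequentially"
    by (rule iffD1[OF uniform_limit_cong'[OF refl], rotated])
   then show "uniform_limit {0..S} (\<lambda>N t. sobolev_norm ?M \<alpha> (\<lambda>x. JN N t x - J t x)) (\<lambda>_. 0) sequentially"
    unfolding uniform_limit_iff sobn_diff[OF sJN sJ] tJN tJ Y.J_def G_def[abs_def] by (simp add: dist_norm)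
  qed
  fix t :: real assume t: "0 <= t"
  note s = toV_add_scale[OF toV_U(1)[OF \<phi>0, of w t] toV_U(1)[OF sJ[of t], of w t], where c = 1]
  have "(toV \<alpha> (\<phi> t) :: 'm l2) = toV \<alpha> (\<lambda>x. U ?M w t \<phi>0 x + of_real 1 * U ?M w t (J t) x)"
   unfolding s(2) toV_U(2)[OF \<phi>0] toV_U(2)[OF sJ] t\<phi> tJ v0 by (simp add: mult_diff[OF bmult_ph])
  then show "AE x in phys ?M. \<phi> t x = U ?M w t \<phi>0 x + U ?M w t (J t) x"
   using toV_eq_iff[OF s\<phi> s(1)] by simp
 qed
 have "\<phi> \<in> controlled_upto ?M \<alpha> w T" if T: "T > 0" for T
 proof -
  obtain C where C: "ctrl 0 T C v" using ctl[of T] T by auto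
  have "continuous_path ?M \<alpha> {0..T} \<phi>"
   using \<phi>c unfolding continuous_path_iff by (auto intro: continuous_on_subset)
  moreover have "sobolev_norm ?M \<alpha> (\<lambda>x. U_inv ?M w t (\<phi> t) x - U_inv ?M w s (\<phi> s) x) <= C * \<bar>t - s\<bar> powr (1/2)"
   if "0 <= s" "s < t" "t <= T" for s t
   unfolding sobn_diff[OF toV_U_inv(1)[OF s\<phi>] toV_U_inv(1)[OF s\<phi>]] U\<phi>
   using holderD[OF ctrl_holder[OF C], of s t] that by (simp add: powr_half_sqrt)
  ultimately show ?thesis unfolding controlled_upto_def by blast
 qed
 then show ?thesis using sol \<phi>c unfolding controlled_def by blast
qed

lemma nsol_controlled_norm:
 fixes u1 u2 :: "real => real => complex"
 assumes T: "T >= 0" and s: "\<And>t. 0 <= t ==> u1 t \<in> sob TYPE('m::l2dom) \<alpha>" "\<And>t. 0 <= t ==> u2 t \<in> sob TYPE('m) \<alpha>"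
  and D: "ctrl 0 T D (\<lambda>t. profile \<alpha> w u1 t - profile \<alpha> w u2 t :: 'm l2)"
 shows "controlled_norm (dom_of TYPE('m)) \<alpha> w T (\<lambda>t x. u1 t x - u2 t x) <= ennreal (2 * D)"
proof -
 let ?M = "dom_of TYPE('m)"
 define z where "z t = (profile \<alpha> w u1 t - profile \<alpha> w u2 t :: 'm l2)" for t
 have D0: "0 <= D" by (rule ctrl_nonneg[OF D T])
 have sz: "U_inv ?M w t (\<lambda>x. u1 t x - u2 t x) \<in> sob TYPE('m) \<alpha>" and tz: "toV \<alpha> (U_inv ?M w t (\<lambda>x. u1 t x - u2 t x)) = z t"
  if t: "0 <= t" for t
 proof -
  note d = toV_diff[OF s(1)[OF t] s(2)[OF t]]
  show "U_inv ?M w t (\<lambda>x. u1 t x - u2 t x) \<in> sob TYPE('m) \<alpha>" by (rule toV_U_inv(1)[OF d(1)])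
  show "toV \<alpha> (U_inv ?M w t (\<lambda>x. u1 t x - u2 t x)) = z t"
   unfolding z_def profile_def toV_U_inv(2)[OF d(1)] toV_U_inv(2)[OF s(1)[OF t]] toV_U_inv(2)[OF s(2)[OF t]] d(2)
   by (rule mult_diff[OF bmult_ph])
 qed
 have 1: "(SUP t\<in>{0..T}. ennreal (sobolev_norm ?M \<alpha> (U_inv ?M w t (\<lambda>x. u1 t x - u2 t x)))) <= ennreal D"
 proof (rule SUP_least)
  fix t assume t: "t \<in> {0..T}"
  have "sobolev_norm ?M \<alpha> (U_inv ?M w t (\<lambda>x. u1 t x - u2 t x)) <= D"
   using norm_toV[OF sz[of t]] tz[of t] ctrl_norm[OF D, of t] t unfolding z_def by simp
  then show "ennreal (sobolev_norm ?M \<alpha> (U_inv ?M w t (\<lambda>x. u1 t x - u2 t x))) <= ennreal D" by (rule ennreal_leI)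
 qed
 have 2: "(SUP (s, t)\<in>{(s, t). 0 <= s \<and> s < t \<and> t <= T}.
    ennreal (sobolev_norm ?M \<alpha> (\<lambda>x. U_inv ?M w t (\<lambda>x. u1 t x - u2 t x) x - U_inv ?M w s (\<lambda>x. u1 s x - u2 s x) x)
         / \<bar>t - s\<bar> powr (1/2))) <= ennreal D"
 proof (rule SUP_least, clarify)
  fix s t assume st: "0 <= s" "s < t" "t <= T"
  have "sobolev_norm ?M \<alpha> (\<lambda>x. U_inv ?M w t (\<lambda>x. u1 t x - u2 t x) x - U_inv ?M w s (\<lambda>x. u1 s x - u2 s x) x) <= D * sqrt (t - s)"
   using sobn_diff[OF sz[of t] sz[of s]] tz[of t] tz[of s] holderD[OF ctrl_holder[OF D], of s t] st unfolding z_def by simp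
  then show "ennreal (sobolev_norm ?M \<alpha> (\<lambda>x. U_inv ?M w t (\<lambda>x. u1 t x - u2 t x) x - U_inv ?M w s (\<lambda>x. u1 s x - u2 s x) x)
         / \<bar>t - s\<bar> powr (1/2)) <= ennreal D"
   using st by (intro ennreal_leI) (simp add: powr_half_sqrt pos_divide_le_eq)
 qed
 have "controlled_norm ?M \<alpha> w T (\<lambda>t x. u1 t x - u2 t x) <= ennreal D + ennreal D"
  unfolding controlled_norm_def by (rule add_mono[OF 1 2])
 also have "... = ennreal (2 * D)" using D0 by (simp add: ennreal_plus[symmetric] del: ennreal_plus)
 finally show ?thesis .
qed

theorem modulated_NLS:
 fixes M :: domain
 assumes w: "continuous_on {0..} w" and M: "M = dom_of TYPE('m::l2dom)"
 shows "(\<forall>\<phi>0 \<in> sobolev M \<alpha>. \<exists>\<phi>. is_global_solution M \<alpha> w \<phi>0 \<phi> \<and> \<phi> \<in> controlled M \<alpha> w) \<and>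
  (\<forall>\<phi>0 \<in> sobolev M \<alpha>. \<forall>\<phi> \<in> controlled M \<alpha> w. \<forall>\<psi> \<in> controlled M \<alpha> w.
   is_global_solution M \<alpha> w \<phi>0 \<phi> --> is_global_solution M \<alpha> w \<phi>0 \<psi> -->
   (\<forall>t\<ge>0. AE x in phys M. \<phi> t x = \<psi> t x)) \<and>
  (\<forall>T>0. \<forall>\<phi>0 \<in> sobolev M \<alpha>. \<exists>r>0. \<exists>L\<ge>0. \<forall>\<phi>1 \<in> sobolev M \<alpha>. \<forall>\<phi>2 \<in> sobolev M \<alpha>.
   sobolev_norm M \<alpha> (\<lambda>x. \<phi>1 x - \<phi>0 x) < r -->
   sobolev_norm M \<alpha> (\<lambda>x. \<phi>2 x - \<phi>0 x) < r -->
   (\<forall>u1 \<in> controlled M \<alpha> w. \<forall>u2 \<in> controlled M \<alpha> w.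
     is_global_solution M \<alpha> w \<phi>1 u1 --> is_global_solution M \<alpha> w \<phi>2 u2 -->
     controlled_norm M \<alpha> w T (\<lambda>t x. u1 t x - u2 t x)
      <= ennreal (L * sobolev_norm M \<alpha> (\<lambda>x. \<phi>1 x - \<phi>2 x))))"
 unfolding M
proof (intro conjI ballI allI impI)
 let ?M = "dom_of TYPE('m)"
 fix \<phi>0 assume \<phi>0: "\<phi>0 \<in> sobolev ?M \<alpha>"
 obtain v where "v 0 = (toV \<alpha> \<phi>0 :: 'm l2)" "\<And>T. T >= 0 ==> nsol w (japw \<alpha>) 0 T v"
  using global_nsol[OF mod \<alpha>] by blast
 then show "\<exists>\<phi>. is_global_solution ?M \<alpha> w \<phi>0 \<phi> \<and> \<phi> \<in> controlled ?M \<alpha> w"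
  by (intro nsol_solution[OF w \<phi>0])
next
 let ?M = "dom_of TYPE('m)"
 fix \<phi>0 \<phi> \<psi> and t :: real
 assume \<phi>0: "\<phi>0 \<in> sobolev ?M \<alpha>" and c: "\<phi> \<in> controlled ?M \<alpha> w" "\<psi> \<in> controlled ?M \<alpha> w"
  and s: "is_global_solution ?M \<alpha> w \<phi>0 \<phi>" "is_global_solution ?M \<alpha> w \<phi>0 \<psi>" and t: "0 <= t"
 have S: "\<phi> t \<in> sobolev ?M \<alpha>" "\<psi> t \<in> sobolev ?M \<alpha>"
  using c t unfolding controlled_def continuous_path_def by auto
 note a = solution_nsol[OF \<phi>0 s(1) c(1)] and b = solution_nsol[OF \<phi>0 s(2) c(2)]
 obtain K where K: "modulation \<rho> \<gamma> t K w" using mod[OF t] by auto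
 have "profile \<alpha> w \<phi> t = (profile \<alpha> w \<psi> t :: 'm l2)"
  by (rule modulation.nsol_unique[OF K \<alpha> a(2)[OF t] b(2)[OF t] _ t order_refl]) (simp add: a(1) b(1))
 then have "mult (ph (w t)) (toV \<alpha> (\<phi> t)) = (mult (ph (w t)) (toV \<alpha> (\<psi> t)) :: 'm l2)"
  unfolding profile_def toV_U_inv(2)[OF S(1)] toV_U_inv(2)[OF S(2)] .
 then have "(toV \<alpha> (\<phi> t) :: 'm l2) = toV \<alpha> (\<psi> t)" by (metis ph_inverse(2))
 then show "AE x in phys ?M. \<phi> t x = \<psi> t x" using toV_eq_iff[OF S] by blast
next
 let ?M = "dom_of TYPE('m)"
 fix T :: real and \<phi>0 assume T: "T > 0" and \<phi>0: "\<phi>0 \<in> sobolev ?M \<alpha>"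
 \<comment> \<open>All data at distance less than r = 1 from \<phi>0 have norm at most A, and one L
   serves the whole ball.\<close>
 define A where "A = norm (toV \<alpha> \<phi>0 :: 'm l2) + 1"
 obtain K where K: "modulation \<rho> \<gamma> T K w" using mod[of T] T by auto
 obtain L where L: "L >= 0" "\<And>u v :: real => 'm l2. nsol w (japw \<alpha>) 0 T u ==> nsol w (japw \<alpha>) 0 T v ==>
  norm (u 0) <= A ==> norm (v 0) <= A ==> ctrl 0 T (L * norm (u 0 - v 0)) (\<lambda>t. u t - v t)"
  using modulation.nsol_lipschitz[OF K \<alpha>, where 'm = 'm, of A] by blast
 have near: "norm (toV \<alpha> f :: 'm l2) <= A" if f: "f \<in> sobolev ?M \<alpha>" "sobolev_norm ?M \<alpha> (\<lambda>x. f x - \<phi>0 x) < 1" for f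
  using f(2) sobn_diff[OF f(1) \<phi>0] norm_triangle_ineq2[of "toV \<alpha> f :: 'm l2" "toV \<alpha> \<phi>0"] unfolding A_def by simp
 show "\<exists>r>0. \<exists>L\<ge>0. \<forall>\<phi>1 \<in> sobolev ?M \<alpha>. \<forall>\<phi>2 \<in> sobolev ?M \<alpha>.
   sobolev_norm ?M \<alpha> (\<lambda>x. \<phi>1 x - \<phi>0 x) < r -->
   sobolev_norm ?M \<alpha> (\<lambda>x. \<phi>2 x - \<phi>0 x) < r -->
   (\<forall>u1 \<in> controlled ?M \<alpha> w. \<forall>u2 \<in> controlled ?M \<alpha> w.
     is_global_solution ?M \<alpha> w \<phi>1 u1 --> is_global_solution ?M \<alpha> w \<phi>2 u2 -->
     controlled_norm ?M \<alpha> w T (\<lambda>t x. u1 t x - u2 t x)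
      <= ennreal (L * sobolev_norm ?M \<alpha> (\<lambda>x. \<phi>1 x - \<phi>2 x)))"
 proof (rule exI[of _ 1], rule conjI, simp, rule exI[of _ "2 * L"], intro conjI ballI impI)
  show "0 <= 2 * L" using L(1) by simp
  fix \<phi>1 \<phi>2 u1 u2
  assume f: "\<phi>1 \<in> sobolev ?M \<alpha>" "\<phi>2 \<in> sobolev ?M \<alpha>"
   and n: "sobolev_norm ?M \<alpha> (\<lambda>x. \<phi>1 x - \<phi>0 x) < 1" "sobolev_norm ?M \<alpha> (\<lambda>x. \<phi>2 x - \<phi>0 x) < 1"
   and c: "u1 \<in> controlled ?M \<alpha> w" "u2 \<in> controlled ?M \<alpha> w"
   and s: "is_global_solution ?M \<alpha> w \<phi>1 u1" "is_global_solution ?M \<alpha> w \<phi>2 u2"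
  have T0: "T >= 0" using T by simp
  note a = solution_nsol[OF f(1) s(1) c(1)] and b = solution_nsol[OF f(2) s(2) c(2)]
  have "ctrl 0 T (L * norm (toV \<alpha> \<phi>1 - toV \<alpha> \<phi>2 :: 'm l2)) (\<lambda>t. profile \<alpha> w u1 t - profile \<alpha> w u2 t :: 'm l2)"
   using L(2)[OF a(2)[OF T0] b(2)[OF T0]] near[OF f(1) n(1)] near[OF f(2) n(2)] unfolding a(1) b(1) by blast
  from nsol_controlled_norm[OF T0 _ _ this] c
  have "controlled_norm ?M \<alpha> w T (\<lambda>t x. u1 t x - u2 t x) <= ennreal (2 * (L * norm (toV \<alpha> \<phi>1 - toV \<alpha> \<phi>2 :: 'm l2)))"
   unfolding controlled_def continuous_path_def by auto
  then show "controlled_norm ?M \<alpha> w T (\<lambda>t x. u1 t x - u2 t x) <= ennreal (2 * L * sobolev_norm ?M \<alpha> (\<lambda>x. \<phi>1 x - \<phi>2 x))"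
   unfolding sobn_diff[OF f] by (simp only: mult.assoc)
 qed
qed

end

section \<open>The two domains\<close>

text \<open>The element of such a type is immaterial; the type itself names the domain in the class
  \<open>l2dom\<close>.\<close>

datatype torus = torus
datatype line = line

instantiation torus :: l2dom
begin
definition "dom_of (_ :: torus itself) = Torus"
instance ..
end

instantiation line :: l2dom
begin
definition "dom_of (_ :: line itself) = Line"
instance ..
end

theorem theorem1p8:
  fixes M :: domain and \<rho> \<gamma> \<alpha> :: real and w :: "real \<Rightarrow> real"
  assumes "\<rho> > 1/2" and "\<gamma> > 1/2"
    and "continuous_on {0..} w"
    and "\<forall>T>0. irregular \<rho> \<gamma> T w"
    and "\<alpha> \<ge> 0"
  shows "(\<forall>\<phi>0 \<in> sobolev M \<alpha>. \<exists>\<phi>. is_global_solution M \<alpha> w \<phi>0 \<phi> \<and> \<phi> \<in> controlled M \<alpha> w) \<and>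
    (\<forall>\<phi>0 \<in> sobolev M \<alpha>. \<forall>\<phi> \<in> controlled M \<alpha> w. \<forall>\<psi> \<in> controlled M \<alpha> w.
       is_global_solution M \<alpha> w \<phi>0 \<phi> \<longrightarrow> is_global_solution M \<alpha> w \<phi>0 \<psi> \<longrightarrow>
       (\<forall>t\<ge>0. AE x in phys M. \<phi> t x = \<psi> t x)) \<and>
    (\<forall>T>0. \<forall>\<phi>0 \<in> sobolev M \<alpha>. \<exists>r>0. \<exists>L\<ge>0. \<forall>\<phi>1 \<in> sobolev M \<alpha>. \<forall>\<phi>2 \<in> sobolev M \<alpha>.
       sobolev_norm M \<alpha> (\<lambda>x. \<phi>1 x - \<phi>0 x) < r \<longrightarrow>
       sobolev_norm M \<alpha> (\<lambda>x. \<phi>2 x - \<phi>0 x) < r \<longrightarrow>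
       (\<forall>u1 \<in> controlled M \<alpha> w. \<forall>u2 \<in> controlled M \<alpha> w.
          is_global_solution M \<alpha> w \<phi>1 u1 \<longrightarrow> is_global_solution M \<alpha> w \<phi>2 u2 \<longrightarrow>
          controlled_norm M \<alpha> w T (\<lambda>t x. u1 t x - u2 t x)
            \<le> ennreal (L * sobolev_norm M \<alpha> (\<lambda>x. \<phi>1 x - \<phi>2 x))))"
proof -
 have mod: "\<exists>K. modulation \<rho> \<gamma> T K w" if T: "T >= 0" for T
 proof -
  \<comment> \<open>Irregularity is assumed for positive horizons, while T = 0 is allowed
    here.\<close>
  have "irregular \<rho> \<gamma> (T + 1) w" using assms(4) T by simp
  then obtain K where K: "K >= 0" "\<And>a s t. 0 <= s ==> s <= t ==> t <= T + 1 ==>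
    cmod (Phi w t a - Phi w s a) <= K * (t - s) powr \<gamma> * (1 + \<bar>a\<bar>) powr (- \<rho>)"
   using irregular_decay by blast
  have "modulation \<rho> \<gamma> T K w"
  proof
   show "continuous_on {0..T} w" using assms(3) by (rule continuous_on_subset) auto
  qed (use K assms T in auto)
  then show ?thesis ..
 qed
 show ?thesis
 proof (cases M)
  case Torus
  then show ?thesis
   using modulated_NLS[OF mod assms(5,3), where M = M and 'm = torus] by (simp add: dom_of_torus_def)
 next
  case Line
  then show ?thesis
   using modulated_NLS[OF mod assms(5,3), where M = M and 'm = line] by (simp add: dom_of_line_def)
 qed
qed

end
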